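(* Let $\Sigma$ be a WPLS on $(U,H,Y)$, $J=J^*\in\mathrm{BL}(Y)$, and let $\mathcal U_*$ be as in the context. Assume that $\vartheta=0$ and that $\mathcal S_{PT}\gg0$, i.e., there is $\varepsilon>0$ such that $\langle \mathcal D u,J\mathcal D u\rangle_{L^2}\ge\varepsilon\|u\|_{\mathcal U_*}^2$ for all $u\in\mathcal U_*(0)$. Then $\mathcal U_*(x_0)\neq\emptyset$ for all $x_0\in H$ (the FCC holds) if and only if there is a $J$-optimal state-feedback pair for $\Sigma$ over $\mathcal U_*$.
   Context: Spaces are complex Hilbert spaces of arbitrary dimension; $\mathrm{BL}$ = bounded linear operators. $\mathbb R_+=[0,\infty)$, $\mathbb R_-=(-\infty,0)$, $L^2_\omega(I;X)=\{f:e^{-\omega\cdot}f\in L^2(I;X)\}$; functions on a subinterval are extended by zero to $\mathbb R$. $(\tau^tu)(s)=u(t+s)$; $\pi_\pm$ = multiplication by the characteristic function of $\mathbb R_\pm$. TIC. $\mathrm{TIC}_\omega(U,Y)$ = all $\mathcal D\in\mathrm{BL}(L^2_\omega(\mathbb R;U),L^2_\omega(\mathbb R;Y))$ with $\tau^t\mathcal D=\mathcal D\tau^t$ ($t\in\mathbb R$) and $\pi_-\mathcal D\pi_+=0$; $\mathrm{TIC}_\infty=\bigcup_{\omega\in\mathbb R}\mathrm{TIC}_\omega$ (maps agreeing on common domains identified; extended by causality to $L^2_{loc}(\mathbb R_+;U)$). $\mathcal G$ denotes invertible elements: $\mathcal E\in\mathcal G\mathrm{TIC}_\infty(U)$ iff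 $\mathcal E$ has an inverse in $\mathrm{TIC}_\infty(U)$. WPLS. An $\omega$-stable well-posed linear system on $(U,H,Y)$ is a quadruple $\Sigma=\begin{bmatrix}\mathcal A&\mathcal B\\ \mathcal C&\mathcal D\end{bmatrix}$ where: (1) $\mathcal A^t$ is a strongly continuous semigroup on $H$ with $\sup_{t\ge0}\|e^{-\omega t}\mathcal A^t\|<\infty$; (2) $\mathcal B\in\mathrm{BL}(L^2_\omega(\mathbb R;U),H)$, $\mathcal A^t\mathcal Bu=\mathcal B\tau^t\pi_-u$ ($t\ge0$); (3) $\mathcal C\in\mathrm{BL}(H,L^2_\omega(\mathbb R;Y))$, $\mathcal C\mathcal A^tx=\pi_+\tau^t\mathcal Cx$ ($t\ge0$); (4) $\mathcal D\in\mathrm{TIC}_\omega(U,Y)$ and $\pi_+\mathcal D\pi_-=\mathcal C\mathcal B$. A WPLS is an $\omega$-stable one for some $\omega\in\mathbb R$. For $x_0\in H$ and $u\in L^2_{loc}(\mathbb R_+;U)$ the state and output are $x(t)=\mathcal A^tx_0+\mathcal B\tau^tu$, $y=\mathcal Cx_0+\mathcal Du$. State feedback. $[\mathcal K\,|\,\mathcal F]$ is an admissible state-feedback pair for $\Sigma$ if $\begin{bmatrix}\mathcal A&\mathcal B\\ \mathcal C&\mathcal D\\ \mathcal K&\mathcal F\end{bmatrix}$ is a WPLS on $(U,H,Y\times U)$ and $I-\mathcal F\in\mathcal G\mathrm{TIC}_\infty(U)$. The closed-loop control map is $\mathcal K_{cl}=(I-\mathcal F)^{-1}\mathcal K$, i.e.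 $u=\mathcal K_{cl}x_0$ solves $u=\mathcal Kx_0+\mathcal Fu$. Optimization domain. $\vartheta\in\mathbb R$; $\tilde Y$ is a Hilbert space and $\begin{bmatrix}\mathcal A&\mathcal B\\ \mathcal Q&\mathcal R\end{bmatrix}$ is a WPLS on $(U,H,\tilde Y)$; $Z^u$ is a topological vector space and $Z^s$ a Banach space (of functions $\mathbb R_+\to\tilde Y$), $Z^s\subset Z^u$ continuously, $\mathcal Q\in\mathrm{BL}(H,Z^u)$, $\mathcal R\in\mathrm{BL}(L^2(\mathbb R_+;U),Z^u)$, and for $z\in Z^u$, $t>0$: $\pi_+\tau^tz\in Z^s\iff z\in Z^s$. For $x_0\in H$, $$\mathcal U_*(x_0)=\{u\in L^2_\vartheta(\mathbb R_+;U):\ \mathcal Cx_0+\mathcal Du\in L^2,\ \mathcal Qx_0+\mathcal Ru\in Z^s\}.$$ $\mathcal U_*(0)$ is a Banach space with norm $\|u\|_{\mathcal U_*}=\max\{\|u\|_{L^2_\vartheta},\|\mathcal Du\|_{L^2},\|\mathcal Ru\|_{Z^s}\}$. (Examples: $\mathcal U_{exp}(x_0)=\{u\in L^2:x\in L^2\}$, $\mathcal U_{out}(x_0)=\{u\in L^2:y\in L^2\}$.) $\mathcal S_{PT}=\mathcal D^*J\mathcal D\in\mathrm{BL}(\mathcal U_*(0),\mathcal U_*(0)^* )$ is the Popov Toeplitz operator, $\langle v,\mathcal S_{PT}u\rangle=\langle\mathcal Dv,J\mathcal Du\rangle_{L^2}$. $J$-optimality. The cost is $\langle y,Jy\rangle_{L^2(\mathbb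 R_+;Y)}$. A control $u\in\mathcal U_*(x_0)$ is $J$-optimal for $x_0$ if the Fréchet derivative of the cost on $\mathcal U_*(x_0)$ vanishes at $u$, equivalently $\langle\mathcal D\eta,J(\mathcal Cx_0+\mathcal Du)\rangle_{L^2}=0$ for all $\eta\in\mathcal U_*(0)$. An admissible state-feedback pair is $J$-optimal over $\mathcal U_*$ if, for every $x_0\in H$, $\mathcal K_{cl}x_0\in\mathcal U_*(x_0)$ and $\mathcal K_{cl}x_0$ is $J$-optimal for $x_0$. *)

theory Defs
  imports "HOL-Analysis.Analysis"
begin

section \<open>Complex Hilbert spaces\<close>

class scaleC =
  fixes scaleC :: "complex \<Rightarrow> 'a \<Rightarrow> 'a"  (infixr \<open>*\<^sub>C\<close> 75)

class complex_vector = scaleC + ab_group_add +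
  assumes scaleC_add_right: "a *\<^sub>C (x + y) = a *\<^sub>C x + a *\<^sub>C y"
    and scaleC_add_left: "(a + b) *\<^sub>C x = a *\<^sub>C x + b *\<^sub>C x"
    and scaleC_scaleC: "a *\<^sub>C b *\<^sub>C x = (a * b) *\<^sub>C x"
    and scaleC_one: "1 *\<^sub>C x = x"

text \<open>
  A complex Hilbert space is a complete real inner product space (this supplies norm, metric and
  topology) with a compatible complex structure.  The complex inner product is conjugate linear in
  its first argument; its positivity is inherited from the real one.
\<close>

class chilbert_space = complex_vector + real_inner + complete_space +
  fixes cinner :: "'a \<Rightarrow> 'a \<Rightarrow> complex"
  assumes scaleR_scaleC: "r *\<^sub>R x = complex_of_real r *\<^sub>C x"
    and cinner_commute: "cinner x y = cnj (cinner y x)"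
    and cinner_add_left: "cinner (x + y) z = cinner x z + cinner y z"
    and cinner_scaleC_left: "cinner (a *\<^sub>C x) y = cnj a * cinner x y"
    and inner_eq_Re_cinner: "inner x y = Re (cinner x y)"

instantiation prod :: (complex_vector, complex_vector) complex_vector
begin

definition "scaleC a p = (a *\<^sub>C fst p, a *\<^sub>C snd p)"

instance
  by standard
    (simp_all add: scaleC_prod_def scaleC_add_right scaleC_add_left scaleC_scaleC scaleC_one
      prod_eq_iff)

end

instantiation prod :: (chilbert_space, chilbert_space) chilbert_space
begin

definition "cinner p q = cinner (fst p) (fst q) + cinner (snd p) (snd q)"

instance
proof
  fix r :: real and a :: complex and p q s :: "'a \<times> 'b"
  show "r *\<^sub>R p = complex_of_real r *\<^sub>C p"
    by (simp add: scaleC_prod_def prod_eq_iff scaleR_scaleC)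
  have "cinner (fst p) (fst q) = cnj (cinner (fst q) (fst p))"
    "cinner (snd p) (snd q) = cnj (cinner (snd q) (snd p))"
    by (rule cinner_commute)+
  then show "cinner p q = cnj (cinner q p)"
    by (simp add: cinner_prod_def)
  show "cinner (p + q) s = cinner p s + cinner q s"
    by (simp add: cinner_prod_def cinner_add_left)
  show "cinner (a *\<^sub>C p) q = cnj a * cinner p q"
    by (simp add: cinner_prod_def scaleC_prod_def cinner_scaleC_left distrib_left)
  show "inner p q = Re (cinner p q)"
    by (simp add: cinner_prod_def inner_prod_def inner_eq_Re_cinner)
qed

end


section \<open>Functions on the real line modulo equality almost everywhere\<close>

lemma AE_lebesgue_translate:
  fixes P :: "real \<Rightarrow> bool"
  assumes "AE s in lebesgue. P s"
  shows "AE s in lebesgue. P (t + s)"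
proof -
  have "AE s in lborel. P s"
    using assms by (simp add: AE_completion_iff)
  then obtain N where N: "{s \<in> space lborel. \<not> P s} \<subseteq> N" "emeasure lborel N = 0" "N \<in> sets lborel"
    by (rule AE_E)
  have "AE s in lborel. s \<notin> N"
    using N by (intro AE_not_in) (auto simp: null_sets_def)
  then have "AE s in distr lborel borel ((+) t). s \<notin> N"
    by (subst lborel_distr_plus)
  then have "AE s in lborel. t + s \<notin> N"
    using N by (subst (asm) AE_distr_iff) auto
  then have "AE s in lborel. P (t + s)"
    using N(1) by (auto elim!: eventually_mono)
  then show ?thesis
    by (rule AE_completion)
qed

lemma borel_measurable_lebesgue_cong_AE:
  fixes f g :: "real \<Rightarrow> 'a::topological_space"
  assumes "AE t in lebesgue. f t = g t" "f \<in> borel_measurable lebesgue"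
  shows "g \<in> borel_measurable lebesgue"
proof (rule measurableI)
  fix S :: "'a set" assume "S \<in> sets borel"
  then have "f -` S \<inter> space lebesgue \<in> sets lebesgue"
    using assms(2) by (rule measurable_sets[rotated])
  then show "g -` S \<inter> space lebesgue \<in> sets lebesgue"
    by (rule completion.in_sets_AE[rotated]) (use assms(1) in \<open>auto elim!: eventually_mono\<close>)
qed simp

lemma integral_lebesgue_cong_AE:
  fixes f g :: "real \<Rightarrow> complex"
  assumes "AE t in lebesgue. f t = g t"
  shows "integral\<^sup>L lebesgue f = integral\<^sup>L lebesgue g"
proof (cases "f \<in> borel_measurable lebesgue")
  case True
  with assms have "g \<in> borel_measurable lebesgue"
    by (rule borel_measurable_lebesgue_cong_AE)
  with True show ?thesis
    using assms by (rule integral_cong_AE)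
next
  case False
  have "AE t in lebesgue. g t = f t"
    using assms by (auto elim!: eventually_mono)
  with False have "g \<notin> borel_measurable lebesgue"
    by (metis borel_measurable_lebesgue_cong_AE)
  with False show ?thesis
    by (metis borel_measurable_integrable not_integrable_integral_eq)
qed

definition ae_eq :: "(real \<Rightarrow> 'a) \<Rightarrow> (real \<Rightarrow> 'a) \<Rightarrow> bool" where
  "ae_eq f g \<longleftrightarrow> (AE t in lebesgue. f t = g t)"

lemma equivp_ae_eq: "equivp ae_eq"
proof (rule equivpI)
  show "reflp ae_eq"
    by (auto intro!: reflpI simp: ae_eq_def)
  show "symp ae_eq"
    by (auto intro!: sympI simp: ae_eq_def elim!: eventually_mono)
  show "transp ae_eq"
    by (auto intro!: transpI simp: ae_eq_def elim!: eventually_elim2)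
qed

text \<open>
  No measurability is built into the type; it is imposed where it belongs, in the definition of
  the \<open>L\<^sup>2\<close> spaces.
\<close>

quotient_type 'a aefun = "real \<Rightarrow> 'a" / ae_eq
  by (rule equivp_ae_eq)

instantiation aefun :: (ab_group_add) ab_group_add
begin

lift_definition zero_aefun :: "'a aefun" is "\<lambda>t. 0" .

lift_definition plus_aefun :: "'a aefun \<Rightarrow> 'a aefun \<Rightarrow> 'a aefun" is "\<lambda>f g t. f t + g t"
  unfolding ae_eq_def by (auto elim!: eventually_elim2)

lift_definition minus_aefun :: "'a aefun \<Rightarrow> 'a aefun \<Rightarrow> 'a aefun" is "\<lambda>f g t. f t - g t"
  unfolding ae_eq_def by (auto elim!: eventually_elim2)

lift_definition uminus_aefun :: "'a aefun \<Rightarrow> 'a aefun" is "\<lambda>f t. - f t"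
  unfolding ae_eq_def by (auto elim!: eventually_mono)

instance
  by standard (transfer, simp add: ae_eq_def algebra_simps)+

end

instantiation aefun :: (complex_vector) complex_vector
begin

lift_definition scaleC_aefun :: "complex \<Rightarrow> 'a aefun \<Rightarrow> 'a aefun" is "\<lambda>a f t. a *\<^sub>C f t"
  unfolding ae_eq_def by (auto elim!: eventually_mono)

instance
  by standard
    (transfer, simp add: ae_eq_def scaleC_add_right scaleC_add_left scaleC_scaleC scaleC_one)+

end

lift_definition shift :: "real \<Rightarrow> 'a aefun \<Rightarrow> 'a aefun" is "\<lambda>t f s. f (t + s)"
  unfolding ae_eq_def by (rule AE_lebesgue_translate)

text \<open>Multiplication by the characteristic function of \<open>I\<close>.\<close>

lift_definition cut :: "real set \<Rightarrow> 'a::zero aefun \<Rightarrow> 'a aefun" is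
  "\<lambda>I f t. if t \<in> I then f t else 0"
  unfolding ae_eq_def by (auto elim!: eventually_mono)

abbreviation pi_plus :: "'a::zero aefun \<Rightarrow> 'a aefun" where
  "pi_plus \<equiv> cut {0..}"

abbreviation pi_minus :: "'a::zero aefun \<Rightarrow> 'a aefun" where
  "pi_minus \<equiv> cut {..<0}"

lift_definition pair_aefun :: "'a aefun \<Rightarrow> 'b aefun \<Rightarrow> ('a \<times> 'b) aefun" is
  "\<lambda>f g t. (f t, g t)"
  unfolding ae_eq_def by (auto elim!: eventually_elim2)

lift_definition map_aefun :: "('a \<Rightarrow> 'b) \<Rightarrow> 'a aefun \<Rightarrow> 'b aefun" is "\<lambda>T f t. T (f t)"
  unfolding ae_eq_def by (auto elim!: eventually_mono)


section \<open>Weighted \<open>L\<^sup>2\<close> spaces\<close>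

text \<open>
  Strong (Bochner) measurability.  The Hilbert spaces need not be separable, so Borel
  measurability would not be enough.
\<close>

lift_definition strongly_measurable :: "'a::real_normed_vector aefun \<Rightarrow> bool" is
  "\<lambda>f. \<exists>s. (\<forall>n. simple_function lebesgue (s n)) \<and>
        (AE t in lebesgue. (\<lambda>n::nat. s n t) \<longlonglongrightarrow> f t)"
  unfolding ae_eq_def by (intro iff_exI conj_cong refl) (auto elim!: eventually_elim2)

lift_definition weighted_integral :: "real \<Rightarrow> 'a::real_normed_vector aefun \<Rightarrow> ennreal" is
  "\<lambda>\<omega> f. \<integral>\<^sup>+ t. ennreal ((norm (exp (- \<omega> * t) *\<^sub>R f t))\<^sup>2) \<partial>lebesgue"
  unfolding ae_eq_def by (intro nn_integral_cong_AE) (auto elim!: eventually_mono)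

definition L2 :: "real \<Rightarrow> 'a::real_normed_vector aefun set" where
  "L2 \<omega> = {f. strongly_measurable f \<and> weighted_integral \<omega> f < \<infinity>}"

definition L2_norm :: "real \<Rightarrow> 'a::real_normed_vector aefun \<Rightarrow> real" where
  "L2_norm \<omega> f = sqrt (enn2real (weighted_integral \<omega> f))"

text \<open>\<open>L\<^sup>2\<^sub>\<omega>(\<real>\<^sub>+; X)\<close>, extended by zero to the whole line.\<close>

definition L2_plus :: "real \<Rightarrow> 'a::real_normed_vector aefun set" where
  "L2_plus \<omega> = {f \<in> L2 \<omega>. pi_plus f = f}"

lift_definition L2_inner :: "'a::chilbert_space aefun \<Rightarrow> 'a aefun \<Rightarrow> complex" is
  "\<lambda>f g. LINT t|lebesgue. cinner (f t) (g t)"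
  unfolding ae_eq_def by (rule integral_lebesgue_cong_AE) (auto elim!: eventually_elim2)


section \<open>Normed, Banach and topological vector spaces given by carriers\<close>

definition csubspace :: "'a::complex_vector set \<Rightarrow> bool" where
  "csubspace X \<longleftrightarrow> 0 \<in> X \<and> (\<forall>x\<in>X. \<forall>y\<in>X. x + y \<in> X) \<and> (\<forall>a. \<forall>x\<in>X. a *\<^sub>C x \<in> X)"

definition clinear_on :: "'a::complex_vector set \<Rightarrow> ('a \<Rightarrow> 'b::complex_vector) \<Rightarrow> bool" where
  "clinear_on X T \<longleftrightarrow>
     (\<forall>x\<in>X. \<forall>y\<in>X. T (x + y) = T x + T y) \<and> (\<forall>a. \<forall>x\<in>X. T (a *\<^sub>C x) = a *\<^sub>C T x)"

definition BL :: "'a::complex_vector set \<Rightarrow> ('a \<Rightarrow> real) \<Rightarrow> 'b::complex_vector set \<Rightarrow> ('b \<Rightarrow> real)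
    \<Rightarrow> ('a \<Rightarrow> 'b) set" where
  "BL X nX Y nY =
     {T. T ` X \<subseteq> Y \<and> clinear_on X T \<and> (\<exists>M. \<forall>x\<in>X. nY (T x) \<le> M * nX x)}"

definition norm_on :: "'a::complex_vector set \<Rightarrow> ('a \<Rightarrow> real) \<Rightarrow> bool" where
  "norm_on X n \<longleftrightarrow>
     (\<forall>x\<in>X. 0 \<le> n x \<and> (n x = 0 \<longleftrightarrow> x = 0)) \<and>
     (\<forall>x\<in>X. \<forall>y\<in>X. n (x + y) \<le> n x + n y) \<and>
     (\<forall>a. \<forall>x\<in>X. n (a *\<^sub>C x) = cmod a * n x)"

text \<open>Set to zero off the carrier, so that it satisfies the axioms of \<^locale>\<open>Metric_space\<close>.\<close>

definition norm_dist :: "'a::complex_vector set \<Rightarrow> ('a \<Rightarrow> real) \<Rightarrow> 'a \<Rightarrow> 'a \<Rightarrow> real" where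
  "norm_dist X n x y = (if x \<in> X \<and> y \<in> X then n (x - y) else 0)"

definition norm_topology :: "'a::complex_vector set \<Rightarrow> ('a \<Rightarrow> real) \<Rightarrow> 'a topology" where
  "norm_topology X n = Metric_space.mtopology X (norm_dist X n)"

definition banach_space_on :: "'a::complex_vector set \<Rightarrow> ('a \<Rightarrow> real) \<Rightarrow> bool" where
  "banach_space_on X n \<longleftrightarrow>
     csubspace X \<and> norm_on X n \<and> Metric_space.mcomplete X (norm_dist X n)"

text \<open>
  Topological vector spaces are Hausdorff; for the space \<open>Zu\<close> below this is what makes
  \<open>\<U>\<^sub>*(0)\<close> complete.
\<close>

definition topological_vector_space :: "'a::complex_vector topology \<Rightarrow> bool" where
  "topological_vector_space Z \<longleftrightarrow>
     csubspace (topspace Z) \<and> Hausdorff_space Z \<and>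
     continuous_map (prod_topology Z Z) Z (\<lambda>(x, y). x + y) \<and>
     continuous_map (prod_topology euclidean Z) Z (\<lambda>(a, x). a *\<^sub>C x)"


section \<open>Time-invariant causal maps\<close>

definition TIC :: "real \<Rightarrow> ('u::chilbert_space aefun \<Rightarrow> 'y::chilbert_space aefun) set" where
  "TIC \<omega> =
     {D \<in> BL (L2 \<omega>) (L2_norm \<omega>) (L2 \<omega>) (L2_norm \<omega>).
        (\<forall>t. \<forall>u\<in>L2 \<omega>. shift t (D u) = D (shift t u)) \<and>
        (\<forall>u\<in>L2 \<omega>. pi_minus (D (pi_plus u)) = 0)}"

text \<open>
  Maps on \<open>L\<^sup>2\<^sub>\<alpha>\<close> and on \<open>L\<^sup>2\<^sub>\<beta>\<close> are identified when they agree on the common domain.  A map is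
  always paired with its weight; its values off \<open>L2\<close> of that weight are irrelevant.
\<close>

definition identified :: "real \<Rightarrow> real \<Rightarrow> ('u::real_normed_vector aefun \<Rightarrow> 'b) \<Rightarrow> ('u aefun \<Rightarrow> 'b) \<Rightarrow> bool"
  where "identified \<alpha> \<beta> S T \<longleftrightarrow> (\<forall>u \<in> L2 \<alpha> \<inter> L2 \<beta>. S u = T u)"

text \<open>
  \<open>G \<in> TIC\<^sub>\<gamma>\<close> represents the inverse in \<open>TIC\<^sub>\<infinity>\<close> of the map represented by \<open>E\<close> on \<open>L\<^sup>2\<^sub>\<beta>\<close>.
\<close>

definition TIC_inverse :: "real \<Rightarrow> ('u::chilbert_space aefun \<Rightarrow> 'u aefun) \<Rightarrow> real \<Rightarrow>
    ('u aefun \<Rightarrow> 'u aefun) \<Rightarrow> bool" where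
  "TIC_inverse \<beta> E \<gamma> G \<longleftrightarrow>
     G \<in> TIC \<gamma> \<and>
     (\<exists>E'\<in>TIC \<gamma>. identified \<beta> \<gamma> E E' \<and> (\<forall>u\<in>L2 \<gamma>. E' (G u) = u \<and> G (E' u) = u))"

text \<open>
  Extension by causality to \<open>L\<^sup>2\<^sub>l\<^sub>o\<^sub>c(\<real>\<^sub>+; U)\<close>: on \<open>[0, T)\<close> the output is that of the
  input truncated to \<open>[0, T)\<close>, which lies in \<open>L\<^sup>2\<^sub>\<omega>\<close> for every \<open>\<omega>\<close>.
\<close>

definition causal_ext :: "('u::zero aefun \<Rightarrow> 'y::zero aefun) \<Rightarrow> 'u aefun \<Rightarrow> 'y aefun" where
  "causal_ext D u =
     (THE y. pi_plus y = y \<and> (\<forall>T>0. cut {0..<T} y = cut {0..<T} (D (cut {0..<T} u))))"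


section \<open>Well-posed linear systems\<close>

definition C0_semigroup :: "(real \<Rightarrow> 'h::chilbert_space \<Rightarrow> 'h) \<Rightarrow> bool" where
  "C0_semigroup A \<longleftrightarrow>
     (\<forall>t\<ge>0. A t \<in> BL UNIV norm UNIV norm) \<and>
     A 0 = id \<and> (\<forall>s\<ge>0. \<forall>t\<ge>0. A (s + t) = A s \<circ> A t) \<and>
     (\<forall>x. continuous_on {0..} (\<lambda>t. A t x))"

definition wpls :: "real \<Rightarrow> (real \<Rightarrow> 'h::chilbert_space \<Rightarrow> 'h) \<Rightarrow> ('u::chilbert_space aefun \<Rightarrow> 'h) \<Rightarrow>
    ('h \<Rightarrow> 'y::chilbert_space aefun) \<Rightarrow> ('u aefun \<Rightarrow> 'y aefun) \<Rightarrow> bool" where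
  "wpls \<omega> A B C D \<longleftrightarrow>
     C0_semigroup A \<and> bdd_above ((\<lambda>t. exp (- \<omega> * t) * onorm (A t)) ` {0..}) \<and>
     B \<in> BL (L2 \<omega>) (L2_norm \<omega>) UNIV norm \<and>
     (\<forall>t\<ge>0. \<forall>u\<in>L2 \<omega>. A t (B u) = B (shift t (pi_minus u))) \<and>
     C \<in> BL UNIV norm (L2 \<omega>) (L2_norm \<omega>) \<and>
     (\<forall>t\<ge>0. \<forall>x. C (A t x) = pi_plus (shift t (C x))) \<and>
     D \<in> TIC \<omega> \<and>
     (\<forall>u\<in>L2 \<omega>. pi_plus (D (pi_minus u)) = C (B u))"


section \<open>State feedback\<close>

text \<open>
  The system extended by the output pair \<open>K\<close>, \<open>F\<close> may need another stability weight \<open>\<beta>\<close> than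
  \<open>\<omega>\<close>; \<open>B'\<close> and \<open>D'\<close> represent \<open>B\<close> and \<open>D\<close> for that weight.
\<close>

definition admissible_feedback :: "real \<Rightarrow> (real \<Rightarrow> 'h::chilbert_space \<Rightarrow> 'h) \<Rightarrow>
    ('u::chilbert_space aefun \<Rightarrow> 'h) \<Rightarrow> ('h \<Rightarrow> 'y::chilbert_space aefun) \<Rightarrow> ('u aefun \<Rightarrow> 'y aefun) \<Rightarrow>
    real \<Rightarrow> ('h \<Rightarrow> 'u aefun) \<Rightarrow> ('u aefun \<Rightarrow> 'u aefun) \<Rightarrow> bool" where
  "admissible_feedback \<omega> A B C D \<beta> K F \<longleftrightarrow>
     (\<exists>B' D'. identified \<omega> \<beta> B B' \<and> identified \<omega> \<beta> D D' \<and>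
        wpls \<beta> A B' (\<lambda>x. pair_aefun (C x) (K x)) (\<lambda>u. pair_aefun (D' u) (F u))) \<and>
     (\<exists>\<gamma> G. TIC_inverse \<beta> (\<lambda>u. u - F u) \<gamma> G)"

text \<open>
  \<open>(I - F)\<^sup>-\<^sup>1 K\<close>; all choices of \<open>G\<close> represent the same map and have the same causal extension.
\<close>

definition closed_loop_control :: "real \<Rightarrow> ('h \<Rightarrow> 'u::chilbert_space aefun) \<Rightarrow>
    ('u aefun \<Rightarrow> 'u aefun) \<Rightarrow> 'h \<Rightarrow> 'u aefun" where
  "closed_loop_control \<beta> K F x =
     causal_ext (SOME G. \<exists>\<gamma>. TIC_inverse \<beta> (\<lambda>u. u - F u) \<gamma> G) (K x)"


section \<open>The optimization domain\<close>

text \<open>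
  \<open>Zu\<close> carries its own topology on its carrier \<^term>\<open>topspace Zu\<close>; \<open>ns\<close> is the norm of \<open>Zs\<close>.
\<close>

definition optimization_data :: "real \<Rightarrow> (real \<Rightarrow> 'h::chilbert_space \<Rightarrow> 'h) \<Rightarrow>
    ('u::chilbert_space aefun \<Rightarrow> 'h) \<Rightarrow> ('h \<Rightarrow> 'z::chilbert_space aefun) \<Rightarrow>
    ('u aefun \<Rightarrow> 'z aefun) \<Rightarrow> 'z aefun topology \<Rightarrow> 'z aefun set \<Rightarrow> ('z aefun \<Rightarrow> real) \<Rightarrow> bool" where
  "optimization_data \<omega> A B Q R Zu Zs ns \<longleftrightarrow>
     (\<exists>\<alpha> B'. identified \<omega> \<alpha> B B' \<and> wpls \<alpha> A B' Q R) \<and>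
     topological_vector_space Zu \<and> (\<forall>z\<in>topspace Zu. pi_plus z = z) \<and>
     banach_space_on Zs ns \<and> Zs \<subseteq> topspace Zu \<and>
     continuous_map (norm_topology Zs ns) Zu (\<lambda>z. z) \<and>
     continuous_map euclidean Zu Q \<and>
     continuous_map (norm_topology (L2_plus 0) (L2_norm 0)) Zu (causal_ext R) \<and>
     (\<forall>z\<in>topspace Zu. \<forall>t>0. pi_plus (shift t z) \<in> Zs \<longleftrightarrow> z \<in> Zs)"

definition U_star :: "real \<Rightarrow> ('h \<Rightarrow> 'y::chilbert_space aefun) \<Rightarrow>
    ('u::chilbert_space aefun \<Rightarrow> 'y aefun) \<Rightarrow> ('h \<Rightarrow> 'z::chilbert_space aefun) \<Rightarrow>
    ('u aefun \<Rightarrow> 'z aefun) \<Rightarrow> 'z aefun set \<Rightarrow> 'h \<Rightarrow> 'u aefun set" where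
  "U_star \<theta> C D Q R Zs x =
     {u \<in> L2_plus \<theta>. C x + causal_ext D u \<in> L2 0 \<and> Q x + causal_ext R u \<in> Zs}"

definition U_star_norm :: "real \<Rightarrow> ('u::chilbert_space aefun \<Rightarrow> 'y::chilbert_space aefun) \<Rightarrow>
    ('u aefun \<Rightarrow> 'z::chilbert_space aefun) \<Rightarrow> ('z aefun \<Rightarrow> real) \<Rightarrow> 'u aefun \<Rightarrow> real" where
  "U_star_norm \<theta> D R ns u =
     Max {L2_norm \<theta> u, L2_norm 0 (causal_ext D u), ns (causal_ext R u)}"


section \<open>\<open>J\<close>-optimality\<close>

definition popov_form :: "('u::chilbert_space aefun \<Rightarrow> 'y::chilbert_space aefun) \<Rightarrow> ('y \<Rightarrow> 'y) \<Rightarrow>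
    'u aefun \<Rightarrow> 'u aefun \<Rightarrow> complex" where
  "popov_form D J v u = L2_inner (causal_ext D v) (map_aefun J (causal_ext D u))"

text \<open>For self-adjoint \<open>J\<close> the integral is real, so taking the real part only changes its type.\<close>

definition cost :: "('h \<Rightarrow> 'y::chilbert_space aefun) \<Rightarrow> ('u::chilbert_space aefun \<Rightarrow> 'y aefun) \<Rightarrow>
    ('y \<Rightarrow> 'y) \<Rightarrow> 'h \<Rightarrow> 'u aefun \<Rightarrow> real" where
  "cost C D J x u =
     Re (L2_inner (C x + causal_ext D u) (map_aefun J (C x + causal_ext D u)))"

text \<open>
  Vanishing of the Frechet derivative at \<open>u\<close> of the cost on the affine space
  \<open>\<U>\<^sub>*(x) = u + \<U>\<^sub>*(0)\<close>, with respect to the norm of \<open>\<U>\<^sub>*(0)\<close>.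
\<close>

definition J_optimal :: "real \<Rightarrow> ('h::chilbert_space \<Rightarrow> 'y::chilbert_space aefun) \<Rightarrow>
    ('u::chilbert_space aefun \<Rightarrow> 'y aefun) \<Rightarrow> ('h \<Rightarrow> 'z::chilbert_space aefun) \<Rightarrow>
    ('u aefun \<Rightarrow> 'z aefun) \<Rightarrow> 'z aefun set \<Rightarrow> ('z aefun \<Rightarrow> real) \<Rightarrow> ('y \<Rightarrow> 'y) \<Rightarrow>
    'h \<Rightarrow> 'u aefun \<Rightarrow> bool" where
  "J_optimal \<theta> C D Q R Zs ns J x u \<longleftrightarrow>
     u \<in> U_star \<theta> C D Q R Zs x \<and>
     (\<forall>e>0. \<exists>d>0. \<forall>\<eta>\<in>U_star \<theta> C D Q R Zs 0. U_star_norm \<theta> D R ns \<eta> < d \<longrightarrow>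
        \<bar>cost C D J x (u + \<eta>) - cost C D J x u\<bar> \<le> e * U_star_norm \<theta> D R ns \<eta>)"

definition J_optimal_feedback :: "real \<Rightarrow> real \<Rightarrow> (real \<Rightarrow> 'h::chilbert_space \<Rightarrow> 'h) \<Rightarrow>
    ('u::chilbert_space aefun \<Rightarrow> 'h) \<Rightarrow> ('h \<Rightarrow> 'y::chilbert_space aefun) \<Rightarrow> ('u aefun \<Rightarrow> 'y aefun) \<Rightarrow>
    ('h \<Rightarrow> 'z::chilbert_space aefun) \<Rightarrow> ('u aefun \<Rightarrow> 'z aefun) \<Rightarrow> 'z aefun set \<Rightarrow>
    ('z aefun \<Rightarrow> real) \<Rightarrow> ('y \<Rightarrow> 'y) \<Rightarrow> real \<Rightarrow> ('h \<Rightarrow> 'u aefun) \<Rightarrow> ('u aefun \<Rightarrow> 'u aefun) \<Rightarrow> bool" where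
  "J_optimal_feedback \<theta> \<omega> A B C D Q R Zs ns J \<beta> K F \<longleftrightarrow>
     admissible_feedback \<omega> A B C D \<beta> K F \<and>
     (\<forall>x. J_optimal \<theta> C D Q R Zs ns J x (closed_loop_control \<beta> K F x))"

end

theory Submission
  imports Defs
begin

text \<open>
  After passing to a common weight \<open>\<gamma> > 0\<close>, the space \<open>V = \<U>\<^sub>*(0)\<close> with the form
  \<open>b u v = \<langle>D u, J D v\<rangle>\<close> is a Hilbert space, so every initial state \<open>x\<close> has a unique optimal control
  \<open>Ko x\<close>, which is linear in \<open>x\<close> and, by Zabreiko's lemma, bounded.  What has to be found is the pair
  that generates these controls, that is, a spectral factorization of \<open>b\<close>.

  Right shifts are isometries of \<open>V\<close> for \<open>b\<close>, and the adjoint of the right shift by \<open>a\<close> is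
  \<open>T a v = \<pi>\<^sub>+ \<tau>\<^sup>a v - Ko (B \<tau>\<^sup>a v)\<close>.  The Riesz representatives \<open>fe u\<close> in \<open>V\<close> of the functionals
  \<open>v \<mapsto> \<langle>e\<^bsup>-\<sigma>t\<^esup> u, v\<rangle>\<close> with \<open>\<sigma> = 2 \<gamma>\<close> are eigenvectors of all \<open>T a\<close>.  The Gram matrix of their shifts
  is, up to the operator \<open>\<Gamma>\<close> with \<open>\<langle>u, \<Gamma> v\<rangle> = b (fe u) (fe v)\<close>, that of the functions
  \<open>\<chi>\<^bsub>[a,\<infinity>)\<^esub> e\<^bsup>-\<sigma>t\<^esup> u\<close> in \<open>L\<^sup>2\<close>.  This gives a shift-invariant causal map \<open>M\<close> from \<open>L\<^sup>2(\<real>\<^sub>+)\<close> to \<open>V\<close>, bounded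
  above and below.  It is onto: if \<open>v\<close> is orthogonal to its range, a Laplace transform argument shows
  that the transform of \<open>v\<close> vanishes on an arithmetic progression, and \<open>v = 0\<close> by Lerch's theorem.

  If \<open>w\<close> vanishes after time \<open>h\<close>, then \<open>M w\<close> is optimal after time \<open>h\<close>.  Hence \<open>M w\<close> is controlled on
  \<open>[0, h)\<close> by its own values there, which makes \<open>M\<close> boundedly invertible on \<open>L\<^sup>2\<^sub>\<beta>\<close> for \<open>\<beta> > \<gamma>\<close>.  With \<open>E\<close>
  the inverse, the pair is \<open>K = E Ko\<close>, \<open>F = I - E\<close>.
\<close>

subsection \<open>Complex Hilbert spaces\<close>

text \<open>By Wold's theorem the isometric right shifts on \<open>V\<close> are modelled on
  square-integrable functions with values in some wandering space. The difficulty is to show that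
  this space is a copy of the input space \<open>'u\<close>. A single real exponent suffices: the
  vectors \<open>fe u\<close> are common eigenvectors of the adjoint shifts, they are indexed by
  \<open>'u\<close>, and what has to be proved is that their right shifts span a dense subspace of
  \<open>V\<close>.

  A second obstacle is that \<open>M\<close> is an isomorphism only onto \<open>V\<close>, whose
  norm also contains \<open>D u\<close> and \<open>R u\<close>, so its inverse is not bounded
  between \<open>L2\<close> spaces of weight zero. A control that is optimal after time
  \<open>h\<close>, however, has its whole output controlled by its restriction to
  \<open>[0, h)\<close>, at the price of a factor growing like \<open>exp (\<gamma> * h)\<close>.
  This growth is absorbed by a weight above \<open>\<gamma>\<close>, which is why the pair is
  constructed at the weight \<open>\<beta>\<close>.

  Since \<open>I - F = E\<close> and \<open>N\<close> inverts \<open>E\<close>, the closed-loop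
  control is \<open>N (E (Ko x)) = Ko x\<close>. The remaining axioms for \<open>K\<close> and
  \<open>F\<close> express that \<open>N\<close> produces an optimal control once its input has
  ended.\<close>

instance chilbert_space \<subseteq> banach ..

lemma scaleC_zero_right [simp]: "a *\<^sub>C (0::'a::complex_vector) = 0"
  using scaleC_add_right[of a 0 "0::'a"] by simp

lemma scaleC_zero_left [simp]: "0 *\<^sub>C (x::'a::complex_vector) = 0"
  using scaleC_add_left[of 0 0 x] by simp

lemma scaleC_minus_left: "(- a) *\<^sub>C (x::'a::complex_vector) = - (a *\<^sub>C x)"
  using scaleC_add_left[of a "- a" x] by (simp add: eq_neg_iff_add_eq_0 add.commute)

lemma scaleC_minus_right: "a *\<^sub>C (- x) = - (a *\<^sub>C (x::'a::complex_vector))"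
  using scaleC_add_right[of a x "- x"] by (simp add: eq_neg_iff_add_eq_0 add.commute)

lemma scaleC_diff_right: "a *\<^sub>C (x - y) = a *\<^sub>C x - a *\<^sub>C (y::'a::complex_vector)"
  using scaleC_add_right[of a x "- y"] by (simp add: scaleC_minus_right)

lemma scaleC_minus1: "(- 1) *\<^sub>C x = - (x::'a::complex_vector)"
  by (simp add: scaleC_minus_left scaleC_one)

lemma cinner_add_right: "cinner x (y + z) = cinner x y + cinner x z"
  by (metis cinner_add_left cinner_commute complex_cnj_add)

lemma cinner_scaleC_right: "cinner x (a *\<^sub>C y) = a * cinner x y"
  by (metis cinner_scaleC_left cinner_commute complex_cnj_cnj complex_cnj_mult)

lemma cinner_zero_left [simp]: "cinner 0 x = 0"
  using cinner_add_left[of 0 0 x] by simp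

lemma cinner_zero_right [simp]: "cinner x 0 = 0"
  using cinner_add_right[of x 0 0] by simp

lemma cinner_minus_left: "cinner (- x) y = - cinner x y"
  using cinner_add_left[of x "- x" y] by (simp add: eq_neg_iff_add_eq_0 add.commute)

lemma cinner_minus_right: "cinner x (- y) = - cinner x y"
  using cinner_add_right[of x y "- y"] by (simp add: eq_neg_iff_add_eq_0 add.commute)

lemma cinner_diff_left: "cinner (x - y) z = cinner x z - cinner y z"
  using cinner_add_left[of x "- y" z] by (simp add: cinner_minus_left)

lemma cinner_diff_right: "cinner x (y - z) = cinner x y - cinner x z"
  using cinner_add_right[of x y "- z"] by (simp add: cinner_minus_right)

lemma cinner_scaleR_left: "cinner (r *\<^sub>R x) y = of_real r * cinner x y"
  by (simp add: scaleR_scaleC cinner_scaleC_left)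

lemma cinner_scaleR_right: "cinner x (r *\<^sub>R y) = of_real r * cinner x y"
  by (simp add: scaleR_scaleC cinner_scaleC_right)

lemma cinner_self: "cinner x x = of_real ((norm x)\<^sup>2)"
proof -
  have "Im (cinner x x) = 0"
    using arg_cong[OF cinner_commute[of x x], of Im] by simp
  then show ?thesis
    by (simp add: complex_eq_iff power2_norm_eq_inner inner_eq_Re_cinner)
qed

lemma norm_scaleC: "norm (a *\<^sub>C (x::'a::chilbert_space)) = cmod a * norm x"
proof -
  have "cinner (a *\<^sub>C x) (a *\<^sub>C x) = (a * cnj a) * cinner x x"
    by (simp add: cinner_scaleC_left cinner_scaleC_right)
  then have "complex_of_real ((norm (a *\<^sub>C x))\<^sup>2) = of_real ((cmod a)\<^sup>2) * of_real ((norm x)\<^sup>2)"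
    unfolding cinner_self complex_norm_square[symmetric] .
  then have "complex_of_real ((norm (a *\<^sub>C x))\<^sup>2) = of_real ((cmod a * norm x)\<^sup>2)"
    by (simp only: of_real_mult[symmetric] power_mult_distrib)
  then show ?thesis
    by (metis of_real_eq_iff norm_ge_zero mult_nonneg_nonneg power2_eq_imp_eq)
qed

lemma norm_cinner_le: "cmod (cinner x y) \<le> norm x * norm y"
proof (cases "cinner x y = 0")
  case False
  define a where "a = cnj (cinner x y) / cmod (cinner x y)"
  have a1: "cmod a = 1" using False by (simp add: a_def norm_divide)
  have "cinner x (a *\<^sub>C y) = of_real (cmod (cinner x y))"
    using False by (simp add: cinner_scaleC_right a_def complex_norm_square[symmetric] power2_eq_square
        mult.commute[of "cnj _"])
  then have "cmod (cinner x y) = inner x (a *\<^sub>C y)" by (simp add: inner_eq_Re_cinner)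
  also have "\<dots> \<le> norm x * norm (a *\<^sub>C y)" by (rule norm_cauchy_schwarz)
  finally show ?thesis by (simp add: norm_scaleC a1)
qed simp

lemma bounded_bilinear_cinner: "bounded_bilinear (cinner :: 'a::chilbert_space \<Rightarrow> 'a \<Rightarrow> complex)"
proof
  show "\<exists>K. \<forall>(a::'a) b. cmod (cinner a b) \<le> norm a * norm b * K"
    by (rule exI[of _ 1]) (simp add: norm_cinner_le)
qed (simp_all add: cinner_add_left cinner_add_right cinner_scaleR_left cinner_scaleR_right
      scaleR_conv_of_real)

lemma bounded_linear_scaleC: "bounded_linear ((*\<^sub>C) a :: 'a::chilbert_space \<Rightarrow> 'a)"
  by (rule bounded_linear_intro[of _ "cmod a"])
     (simp_all add: scaleC_add_right scaleR_scaleC scaleC_scaleC norm_scaleC mult.commute)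

subsection \<open>Strong measurability\<close>

definition smeas :: "(real \<Rightarrow> 'a::real_normed_vector) \<Rightarrow> bool" where
  "smeas f \<longleftrightarrow> (\<exists>s. (\<forall>n. simple_function lebesgue (s n)) \<and>
        (AE t in lebesgue. (\<lambda>n::nat. s n t) \<longlonglongrightarrow> f t))"

lemma strongly_measurable_abs: "strongly_measurable (abs_aefun f) \<longleftrightarrow> smeas f"
  by (simp add: strongly_measurable.abs_eq smeas_def)

lemma smeas_cong_AE: "smeas f \<Longrightarrow> AE t in lebesgue. f t = g t \<Longrightarrow> smeas g"
proof -
  assume f: "smeas f" and e: "AE t in lebesgue. f t = g t"
  from f obtain s where s: "\<forall>n. simple_function lebesgue (s n)" 
    and l: "AE t in lebesgue. (\<lambda>n::nat. s n t) \<longlonglongrightarrow> f t"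
    unfolding smeas_def by blast
  from l e have "AE t in lebesgue. (\<lambda>n::nat. s n t) \<longlonglongrightarrow> g t"
    by eventually_elim simp
  with s show "smeas g" unfolding smeas_def by blast
qed

lemma smeas_compose2:
  assumes "smeas f" "smeas g" and h: "\<And>a b. isCont (\<lambda>p. h (fst p) (snd p)) (a, b)"
  shows "smeas (\<lambda>t. h (f t) (g t))"
proof -
  from assms obtain s s' where s: "\<And>n. simple_function lebesgue (s n)" "\<And>n. simple_function lebesgue (s' n)"
    and l: "AE t in lebesgue. (\<lambda>n::nat. s n t) \<longlonglongrightarrow> f t" "AE t in lebesgue. (\<lambda>n::nat. s' n t) \<longlonglongrightarrow> g t"
    unfolding smeas_def by auto
  show ?thesis unfolding smeas_def
  proof (intro exI conjI allI)
    show "simple_function lebesgue ((\<lambda>n t. h (s n t) (s' n t)) n)" for n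
      using s by (auto intro: simple_function_compose2)
    show "AE t in lebesgue. (\<lambda>n. h (s n t) (s' n t)) \<longlonglongrightarrow> h (f t) (g t)"
      using l
    proof eventually_elim
      case (elim t)
      show ?case
        using isCont_tendsto_compose[OF h[of "f t" "g t"] tendsto_Pair[OF elim]] by simp
    qed
  qed
qed

lemma smeas_compose1:
  assumes "smeas f" and h: "\<And>a. isCont h a"
  shows "smeas (\<lambda>t. h (f t))"
proof -
  have "isCont (\<lambda>p. h (fst p)) (a, b)" for a b
    by (rule isCont_o2[OF isCont_fst]) (auto intro: h)
  from smeas_compose2[where h = "\<lambda>a b. h a", OF assms(1) assms(1) this] show ?thesis .
qed

lemma smeas_const [simp]: "smeas (\<lambda>t. c)"
  unfolding smeas_def by (intro exI[of _ "\<lambda>n t. c"]) auto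

lemma smeas_add: "smeas f \<Longrightarrow> smeas g \<Longrightarrow> smeas (\<lambda>t. f t + g t)"
  by (rule smeas_compose2[where h = "(+)"]) (assumption | intro continuous_intros)+

lemma smeas_scaleR: "smeas f \<Longrightarrow> smeas g \<Longrightarrow> smeas (\<lambda>t. f t *\<^sub>R g t)"
  by (rule smeas_compose2[where h = "(*\<^sub>R)"]) (assumption | intro continuous_intros)+

lemma smeas_bounded_linear: "bounded_linear h \<Longrightarrow> smeas f \<Longrightarrow> smeas (\<lambda>t. h (f t))"
  by (rule smeas_compose1) (auto intro: linear_continuous_at)

lemma smeas_Pair: "smeas f \<Longrightarrow> smeas g \<Longrightarrow> smeas (\<lambda>t. (f t, g t))"
  by (rule smeas_compose2[where h = Pair]) (assumption | intro continuous_intros)+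

lemma smeas_If:
  assumes "smeas f" "smeas g" "I \<in> sets lebesgue"
  shows "smeas (\<lambda>t. if t \<in> I then f t else g t)"
proof -
  from assms obtain s s' where s: "\<And>n. simple_function lebesgue (s n)" "\<And>n. simple_function lebesgue (s' n)"
    and l: "AE t in lebesgue. (\<lambda>n::nat. s n t) \<longlonglongrightarrow> f t" "AE t in lebesgue. (\<lambda>n::nat. s' n t) \<longlonglongrightarrow> g t"
    unfolding smeas_def by auto
  show ?thesis unfolding smeas_def
  proof (intro exI conjI allI)
    show "simple_function lebesgue ((\<lambda>n t. if t \<in> I then s n t else s' n t) n)" for n
      using s assms(3) by (auto intro: simple_function_If_set)
    show "AE t in lebesgue. (\<lambda>n. if t \<in> I then s n t else s' n t) \<longlonglongrightarrow> (if t \<in> I then f t else g t)"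
      using l by eventually_elim auto
  qed
qed

lemma measurable_shift_lebesgue: "(+) t \<in> lebesgue \<rightarrow>\<^sub>M (lebesgue :: real measure)"
  using lebesgue_affine_measurable[of "\<lambda>_. 1::real" t] by simp

lemma smeas_shift:
  assumes "smeas f"
  shows "smeas (\<lambda>s. f (t + s))"
proof -
  from assms obtain s where s: "\<And>n. simple_function lebesgue (s n)"
    and l: "AE t in lebesgue. (\<lambda>n::nat. s n t) \<longlonglongrightarrow> f t"
    unfolding smeas_def by auto
  show ?thesis unfolding smeas_def
  proof (intro exI conjI allI)
    show "simple_function lebesgue ((\<lambda>n r. s n (t + r)) n)" for n
      using simple_function_comp[OF measurable_shift_lebesgue s] by simp
    show "AE r in lebesgue. (\<lambda>n. s n (t + r)) \<longlonglongrightarrow> f (t + r)"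
      using AE_lebesgue_translate[OF l] .
  qed
qed

lemma smeas_borel: 
  assumes "smeas f" shows "f \<in> borel_measurable lebesgue"
proof -
  from assms obtain s where s: "\<And>n. simple_function lebesgue (s n)"
    and l: "AE t in lebesgue. (\<lambda>n::nat. s n t) \<longlonglongrightarrow> f t"
    unfolding smeas_def by auto
  from AE_E[OF l] obtain N where N: "{t \<in> space lebesgue. \<not> (\<lambda>n::nat. s n t) \<longlonglongrightarrow> f t} \<subseteq> N"
    "emeasure lebesgue N = 0" "N \<in> sets lebesgue" by blast
  define g where "g = (\<lambda>t. if t \<in> N then 0 else f t)"
  have "g \<in> borel_measurable lebesgue"
  proof (rule borel_measurable_LIMSEQ_metric)
    show "(\<lambda>t. if t \<in> N then 0 else s n t) \<in> borel_measurable lebesgue" for n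
      by (rule borel_measurable_simple_function, rule simple_function_If_set) (use s N in auto)
    show "(\<lambda>n. if t \<in> N then 0 else s n t) \<longlonglongrightarrow> g t" for t
      using N(1) by (auto simp: g_def)
  qed
  moreover have "AE t in lebesgue. g t = f t"
    using AE_not_in[of N lebesgue] N by (auto simp: g_def null_sets_def)
  ultimately show ?thesis by (rule borel_measurable_lebesgue_cong_AE[rotated])
qed

text \<open>One half of Pettis's theorem, with \<open>smeasI\<close> as the other half. Borel
  measurability and an almost separable range are easier to carry through limits than sequences of
  simple functions.\<close>

lemma smeas_separable:
  assumes "smeas f"
  obtains D where "countable D" "AE t in lebesgue. f t \<in> closure D"
proof -
  from assms obtain s where s: "\<And>n. simple_function lebesgue (s n)"
    and l: "AE t in lebesgue. (\<lambda>n::nat. s n t) \<longlonglongrightarrow> f t"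
    unfolding smeas_def by auto
  define D where "D = (\<Union>n. range (s n))"
  have "countable D"
    unfolding D_def using simple_functionD(1)[OF s] by (intro countable_UN) (auto intro: countable_finite)
  moreover have "AE t in lebesgue. f t \<in> closure D"
    using l
  proof eventually_elim
    case (elim t)
    show ?case
      unfolding closure_sequential
      by (intro exI[of _ "\<lambda>n. s n t"] conjI elim) (auto simp: D_def)
  qed
  ultimately show ?thesis by (rule that)
qed

text \<open>The approximating simple functions pick, among the first \<open>n\<close> points of a countable dense
  set, the first one that is closest.\<close>

lemma smeasI:
  assumes f: "f \<in> borel_measurable lebesgue" and D: "countable D" "AE t in lebesgue. f t \<in> closure D"
  shows "smeas f"
proof (cases "D = {}")
  case True
  then have "AE t in lebesgue. f t = 0" using D by (auto elim: eventually_mono)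
  then have "AE t in lebesgue. 0 = f t" by eventually_elim auto
  from smeas_cong_AE[OF smeas_const this] show ?thesis .
next
  case False
  define d where "d = from_nat_into D"
  have d: "range d = D" using False D(1) by (simp add: d_def range_from_nat_into)
  define k where "k = (\<lambda>n t. LEAST i. i \<le> n \<and> (\<forall>j\<in>{..n}. dist (f t) (d i) \<le> dist (f t) (d j)))"
  have ex: "\<exists>i. i \<le> n \<and> (\<forall>j\<in>{..n}. dist (f t) (d i) \<le> dist (f t) (d j))" for n :: nat and t
    using ex_is_arg_min_if_finite[of "{..n}" "\<lambda>i. dist (f t) (d i)"]
    by (auto simp: is_arg_min_linorder)
  have kn: "k n t \<le> n \<and> (\<forall>j\<in>{..n}. dist (f t) (d (k n t)) \<le> dist (f t) (d j))" for n t
    unfolding k_def using LeastI_ex[OF ex[of n t]] .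
  have df: "(\<lambda>t. dist (f t) c) \<in> borel_measurable lebesgue" for c
  proof -
    have "(\<lambda>x. dist x c) \<in> borel_measurable borel"
      by (intro borel_measurable_continuous_onI continuous_intros)
    from measurable_comp[OF f this] show ?thesis by (simp add: comp_def)
  qed
  have km: "k n \<in> lebesgue \<rightarrow>\<^sub>M count_space UNIV" for n
  proof -
    have "Measurable.pred lebesgue (\<lambda>t. dist (f t) (d i) \<le> dist (f t) (d j))" for i j
      unfolding pred_def by (rule borel_measurable_le[OF df df])
    then have "Measurable.pred lebesgue (\<lambda>t. i \<le> n \<and> (\<forall>j\<in>{..n}. dist (f t) (d i) \<le> dist (f t) (d j)))" for i
      by (intro pred_intros_conj1' pred_intros_finite(3)) auto
    then have "(\<lambda>t. LEAST i. i \<le> n \<and> (\<forall>j\<in>{..n}. dist (f t) (d i) \<le> dist (f t) (d j)))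
        \<in> lebesgue \<rightarrow>\<^sub>M count_space UNIV"
      by (rule measurable_Least)
    then show ?thesis unfolding k_def .
  qed
  show ?thesis unfolding smeas_def
  proof (intro exI conjI allI)
    show "simple_function lebesgue ((\<lambda>n t. d (k n t)) n)" for n
    proof -
      have "simple_function lebesgue (k n)"
        unfolding simple_function_eq_measurable using km kn
        by (auto intro: finite_subset[of _ "{..n}"])
      then show ?thesis by (auto intro: simple_function_compose1)
    qed
    show "AE t in lebesgue. (\<lambda>n. d (k n t)) \<longlonglongrightarrow> f t"
      using D(2)
    proof eventually_elim
      case (elim t)
      show ?case
      proof (rule LIMSEQ_I)
        fix r :: real assume "0 < r"
        then obtain y where "y \<in> D" "dist y (f t) < r" using elim by (meson closure_approachable)
        then obtain j where j: "dist (d j) (f t) < r" using d by auto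
        show "\<exists>no. \<forall>n\<ge>no. norm (d (k n t) - f t) < r"
        proof (intro exI allI impI)
          fix n assume "j \<le> n"
          then have "dist (f t) (d (k n t)) \<le> dist (f t) (d j)" using kn by auto
          with j show "norm (d (k n t) - f t) < r" by (simp add: dist_norm norm_minus_commute)
        qed
      qed
    qed
  qed
qed

text \<open>Both conditions of Pettis's theorem survive almost everywhere limits: the union of
  countably many countable dense sets is still countable. No diagonal choice of simple functions is
  made.\<close>

lemma smeas_LIMSEQ:
  assumes f: "\<And>n::nat. smeas (f n)" and lim: "AE t in lebesgue. (\<lambda>n. f n t) \<longlonglongrightarrow> g t"
  shows "smeas g"
proof -
  from AE_E[OF lim] obtain N where N: "{t \<in> space lebesgue. \<not> (\<lambda>n::nat. f n t) \<longlonglongrightarrow> g t} \<subseteq> N"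
    "emeasure lebesgue N = 0" "N \<in> sets lebesgue" by blast
  define h where "h = (\<lambda>t. if t \<in> N then 0 else g t)"
  have gh: "AE t in lebesgue. h t = g t"
    using AE_not_in[of N lebesgue] N by (auto simp: h_def null_sets_def)
  have h: "h \<in> borel_measurable lebesgue"
  proof (rule borel_measurable_LIMSEQ_metric)
    show "(\<lambda>t. if t \<in> N then 0 else f n t) \<in> borel_measurable lebesgue" for n
      by (rule smeas_borel, rule smeas_If) (use f N in auto)
    show "(\<lambda>n. if t \<in> N then 0 else f n t) \<longlonglongrightarrow> h t" for t
      using N(1) by (auto simp: h_def)
  qed
  have "\<forall>n. \<exists>D. countable D \<and> (AE t in lebesgue. f n t \<in> closure D)"
    using smeas_separable[OF f] by metis
  then obtain D where D: "\<And>n. countable (D n)" "\<And>n. AE t in lebesgue. f n t \<in> closure (D n)"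
    by metis
  have aeD: "AE t in lebesgue. \<forall>n. f n t \<in> closure (D n)"
    using D(2) by (simp add: AE_all_countable)
  have "AE t in lebesgue. g t \<in> closure (\<Union>n. D n)"
    using lim aeD
  proof eventually_elim
    case (elim t)
    have "\<forall>n. f n t \<in> closure (\<Union>n. D n)"
      using elim(2) closure_mono[of "D _" "\<Union>n. D n"] by blast
    then show ?case
      using closed_sequentially[OF closed_closure, of "\<lambda>n. f n t"] elim(1) by simp
  qed
  then have "AE t in lebesgue. h t \<in> closure (\<Union>n. D n)"
    using gh by eventually_elim auto
  then have "smeas h" by (intro smeasI[OF h, of "\<Union>n. D n"]) (auto intro: D)
  then show ?thesis using gh by (rule smeas_cong_AE)
qed

lemma smeas_real: "f \<in> borel_measurable lebesgue \<Longrightarrow> smeas (f :: real \<Rightarrow> real)"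
  by (rule smeasI[of _ \<rat>]) (auto simp: countable_rat Rats_closure_real)

lemma smeas_cinner: "smeas f \<Longrightarrow> smeas g \<Longrightarrow> smeas (\<lambda>t. cinner (f t) (g t))"
proof (rule smeas_compose2[where h = cinner])
  show "isCont (\<lambda>p. cinner (fst p) (snd p)) (a, b)" for a b :: 'a
    by (intro bounded_bilinear.isCont[OF bounded_bilinear_cinner] continuous_intros)
qed

text \<open>The exceptional null set depends on \<open>u\<close>. The separable range leaves only
  countably many test vectors, and approximating \<open>f t\<close> itself by them gives
  \<open>cinner (f t) (f t) = 0\<close>.\<close>

lemma smeas_AE_zeroI:
  fixes f :: "real \<Rightarrow> 'a::chilbert_space"
  assumes f: "smeas f" and z: "\<And>u. AE t in lebesgue. cinner u (f t) = 0"
  shows "AE t in lebesgue. f t = 0"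
proof -
  obtain D where D: "countable D" "AE t in lebesgue. f t \<in> closure D"
    using smeas_separable[OF f] .
  have "AE t in lebesgue. \<forall>u\<in>D. cinner u (f t) = 0"
    using D(1) z by (simp add: AE_ball_countable)
  with D(2) show ?thesis
  proof eventually_elim
    case (elim t)
    then obtain x where x: "\<And>n. x n \<in> D" "x \<longlonglongrightarrow> f t" unfolding closure_sequential by blast
    have "(\<lambda>n. cinner (x n) (f t)) \<longlonglongrightarrow> cinner (f t) (f t)"
      by (intro bounded_bilinear.tendsto[OF bounded_bilinear_cinner] x tendsto_const)
    then have "cinner (f t) (f t) = 0" using elim x(1) by (simp add: LIMSEQ_const_iff)
    then show ?case by (simp add: cinner_self)
  qed
qed

subsection \<open>The spaces \<open>L\<^sup>2\<^sub>\<omega>\<close>\<close>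

lemma aefun_cases [cases type: aefun]: obtains f where "F = abs_aefun f"
  by (metis Quotient3_aefun Quotient3_abs_rep)

lemma abs_aefun_eq_iff: "abs_aefun f = abs_aefun g \<longleftrightarrow> (AE t in lebesgue. f t = g t)"
  using aefun.abs_eq_iff[of f g] by (simp add: ae_eq_def)

lemmas aefun_abs_simps = plus_aefun.abs_eq minus_aefun.abs_eq uminus_aefun.abs_eq
  scaleC_aefun.abs_eq shift.abs_eq cut.abs_eq map_aefun.abs_eq zero_aefun.abs_eq
  pair_aefun.abs_eq weighted_integral.abs_eq L2_inner.abs_eq

lemma L2_abs: "abs_aefun f \<in> L2 \<omega> \<longleftrightarrow>
   smeas f \<and> (\<integral>\<^sup>+ t. ennreal ((norm (exp (- \<omega> * t) *\<^sub>R f t))\<^sup>2) \<partial>lebesgue) < \<infinity>"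
  by (simp add: L2_def strongly_measurable_abs weighted_integral.abs_eq)

lemma L2_abs0: "abs_aefun f \<in> L2 0 \<longleftrightarrow>
   smeas f \<and> (\<integral>\<^sup>+ t. ennreal ((norm (f t))\<^sup>2) \<partial>lebesgue) < \<infinity>"
  by (simp add: L2_abs)

lemma L2_sm: "f \<in> L2 \<omega> \<Longrightarrow> strongly_measurable f"
  by (simp add: L2_def)

text \<open>Multiplication by an exponential is an isometry between weighted spaces; it reduces
  norm, inner product and completeness questions on \<open>L2 \<omega>\<close> to the weight
  zero.\<close>

lift_definition wmul :: "real \<Rightarrow> 'a::real_vector aefun \<Rightarrow> 'a aefun" is "\<lambda>a f t. exp (a * t) *\<^sub>R f t"
  unfolding ae_eq_def by (auto elim!: eventually_mono)

lemma smeas_exp: "smeas f \<Longrightarrow> smeas (\<lambda>t. exp (a * t) *\<^sub>R f t)"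
  by (intro smeas_scaleR smeas_real measurable_completion) auto

lemma smeas_wmul_iff: "smeas (\<lambda>t. exp (a * t) *\<^sub>R f t) \<longleftrightarrow> smeas f"
proof
  assume "smeas (\<lambda>t. exp (a * t) *\<^sub>R f t)"
  then have "smeas (\<lambda>t. exp (- a * t) *\<^sub>R (exp (a * t) *\<^sub>R f t))" by (rule smeas_exp)
  then show "smeas f" by (simp add: exp_minus)
qed (rule smeas_exp)

lemma L2_wmul_iff: "wmul a f \<in> L2 \<omega> \<longleftrightarrow> f \<in> L2 (\<omega> - a)"
proof (cases f)
  case (1 g)
  have "exp (- (\<omega> * t)) * exp (a * t) = exp ((a - \<omega>) * t)" for t
    by (simp add: exp_add[symmetric] algebra_simps)
  then show ?thesis
    by (simp add: 1 wmul.abs_eq L2_abs smeas_wmul_iff)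
qed

lemma L2_norm_wmul: "L2_norm \<omega> (wmul a f) = L2_norm (\<omega> - a) f"
proof (cases f)
  case (1 g)
  have "exp (- (\<omega> * t)) * exp (a * t) = exp ((a - \<omega>) * t)" for t
    by (simp add: exp_add[symmetric] algebra_simps)
  then show ?thesis
    by (simp add: 1 wmul.abs_eq L2_norm_def weighted_integral.abs_eq)
qed

lemma wmul_add: "wmul a (f + g) = wmul a f + wmul a g"
  by transfer (simp add: ae_eq_def scaleR_add_right)

lemma wmul_diff: "wmul a (f - g) = wmul a f - wmul a g"
  by transfer (simp add: ae_eq_def scaleR_diff_right)

lemma wmul_scaleC: "wmul a (c *\<^sub>C f) = c *\<^sub>C wmul a (f::'a::chilbert_space aefun)"
  by transfer (simp add: ae_eq_def scaleR_scaleC scaleC_scaleC mult.commute)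

lemma wmul_wmul [simp]: "wmul a (wmul (- a) f) = f"
  by transfer (simp add: ae_eq_def exp_minus)

lemma wmul_eq_0_iff [simp]: "wmul a f = 0 \<longleftrightarrow> f = 0"
  by transfer (simp add: ae_eq_def)

lemma smeas_norm2: "smeas f \<Longrightarrow> (\<lambda>t. ennreal ((norm (f t))\<^sup>2)) \<in> borel_measurable lebesgue"
proof -
  assume "smeas f"
  then have "smeas (\<lambda>t. norm (f t))" by (intro smeas_compose1[where h = norm]) (auto intro: continuous_intros)
  from smeas_borel[OF this] show ?thesis by measurable
qed

lemma L2_0_zero [simp]: "0 \<in> L2 \<omega>"
  by (simp add: zero_aefun.abs_eq L2_abs)

lemma L2_0_add: 
  fixes f g :: "'a::real_normed_vector aefun"
  assumes "f \<in> L2 0" "g \<in> L2 0" shows "f + g \<in> L2 0"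
proof (cases f; cases g)
  fix f' g' assume e: "f = abs_aefun f'" "g = abs_aefun g'"
  with assms have m: "smeas f'" "smeas g'"
    and fin: "(\<integral>\<^sup>+ t. ennreal ((norm (f' t))\<^sup>2) \<partial>lebesgue) < \<infinity>" "(\<integral>\<^sup>+ t. ennreal ((norm (g' t))\<^sup>2) \<partial>lebesgue) < \<infinity>"
    by (auto simp: L2_abs0)
  have pw: "(norm (f' t + g' t))\<^sup>2 \<le> 2 * (norm (f' t))\<^sup>2 + 2 * (norm (g' t))\<^sup>2" for t
  proof -
    have "(norm (f' t + g' t))\<^sup>2 \<le> (norm (f' t) + norm (g' t))\<^sup>2"
      by (intro power_mono norm_triangle_ineq) auto
    also have "\<dots> \<le> 2 * (norm (f' t))\<^sup>2 + 2 * (norm (g' t))\<^sup>2"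
      using sum_squares_ge_zero[of "norm (f' t) - norm (g' t)" 0] by (simp add: power2_eq_square algebra_simps)
    finally show ?thesis .
  qed
  have "(\<integral>\<^sup>+ t. ennreal ((norm (f' t + g' t))\<^sup>2) \<partial>lebesgue) \<le>
      (\<integral>\<^sup>+ t. 2 * ennreal ((norm (f' t))\<^sup>2) + 2 * ennreal ((norm (g' t))\<^sup>2) \<partial>lebesgue)"
    by (intro nn_integral_mono, subst (1 2) ennreal_numeral[symmetric])
       (auto simp: ennreal_mult[symmetric] ennreal_plus[symmetric] simp del: ennreal_numeral ennreal_plus intro!: ennreal_leI pw)
  also have "\<dots> = 2 * (\<integral>\<^sup>+ t. ennreal ((norm (f' t))\<^sup>2) \<partial>lebesgue) + 2 * (\<integral>\<^sup>+ t. ennreal ((norm (g' t))\<^sup>2) \<partial>lebesgue)"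
    using smeas_norm2[OF m(1)] smeas_norm2[OF m(2)]
    by (subst nn_integral_add) (auto simp: nn_integral_cmult)
  also have "\<dots> < \<infinity>" using fin by (simp add: ennreal_mult_less_top)
  finally show ?thesis
    unfolding e by (simp add: plus_aefun.abs_eq L2_abs0 smeas_add m)
qed

lemma L2_add: "f \<in> L2 \<omega> \<Longrightarrow> g \<in> L2 \<omega> \<Longrightarrow> f + g \<in> L2 \<omega>"
  using L2_0_add[of "wmul (- \<omega>) f" "wmul (- \<omega>) g"] by (simp add: wmul_add[symmetric] L2_wmul_iff)

lemma L2_0_scaleC: 
  fixes f :: "'a::chilbert_space aefun"
  assumes "f \<in> L2 0" shows "a *\<^sub>C f \<in> L2 0"
proof (cases f)
  case (1 g)
  with assms have m: "smeas g" and fin: "(\<integral>\<^sup>+ t. ennreal ((norm (g t))\<^sup>2) \<partial>lebesgue) < \<infinity>"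
    by (auto simp: L2_abs0)
  have "(\<integral>\<^sup>+ t. ennreal ((norm (a *\<^sub>C g t))\<^sup>2) \<partial>lebesgue) = ennreal ((cmod a)\<^sup>2) * (\<integral>\<^sup>+ t. ennreal ((norm (g t))\<^sup>2) \<partial>lebesgue)"
    using smeas_norm2[OF m] by (subst nn_integral_cmult[symmetric]) (auto simp: norm_scaleC power_mult_distrib ennreal_mult)
  also have "\<dots> < \<infinity>" using fin by (simp add: ennreal_mult_less_top)
  finally show ?thesis
    using m by (simp add: 1 scaleC_aefun.abs_eq L2_abs0 smeas_bounded_linear[OF bounded_linear_scaleC])
qed

lemma L2_scaleC: "f \<in> L2 \<omega> \<Longrightarrow> a *\<^sub>C f \<in> L2 \<omega>" for f :: "'a::chilbert_space aefun"
  using L2_0_scaleC[of "wmul (- \<omega>) f" a] by (simp add: wmul_scaleC[symmetric] L2_wmul_iff)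

lemma csubspace_L2: "csubspace (L2 \<omega> :: 'a::chilbert_space aefun set)"
  by (simp add: csubspace_def L2_add L2_scaleC)

lemma csubspace_uminus: "csubspace X \<Longrightarrow> x \<in> X \<Longrightarrow> - x \<in> X"
  unfolding csubspace_def by (metis scaleC_minus1)

lemma csubspace_diff: "csubspace X \<Longrightarrow> x \<in> X \<Longrightarrow> y \<in> X \<Longrightarrow> x - y \<in> X"
  using csubspace_uminus[of X y] unfolding csubspace_def by (metis uminus_add_conv_diff add.commute)

lemma L2_diff: "f \<in> L2 \<omega> \<Longrightarrow> g \<in> L2 \<omega> \<Longrightarrow> f - g \<in> L2 \<omega>" for f :: "'a::chilbert_space aefun"
  by (rule csubspace_diff[OF csubspace_L2])

lemma L2_norm_nonneg [simp]: "0 \<le> L2_norm \<omega> f"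
  by (simp add: L2_norm_def)

lemma L2_norm_sq: "f \<in> L2 \<omega> \<Longrightarrow> ennreal ((L2_norm \<omega> f)\<^sup>2) = weighted_integral \<omega> f"
  by (simp add: L2_norm_def L2_def less_top[symmetric])

lemma L2_norm_leI:
  assumes "weighted_integral \<omega> f \<le> ennreal (c\<^sup>2)" "0 \<le> c"
  shows "L2_norm \<omega> f \<le> c"
proof -
  have "enn2real (weighted_integral \<omega> f) \<le> c\<^sup>2"
    using assms by (intro enn2real_leI) auto
  then show ?thesis unfolding L2_norm_def using assms(2) by (intro real_le_lsqrt) auto
qed

subsection \<open>The inner product of \<open>L\<^sup>2\<close>\<close>

lemma L2_inner_integrable:
  fixes f g :: "real \<Rightarrow> 'a::chilbert_space"
  assumes "abs_aefun f \<in> L2 0" "abs_aefun g \<in> L2 0"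
  shows "integrable lebesgue (\<lambda>t. cinner (f t) (g t))"
proof -
  have m: "smeas f" "smeas g"
    and fin: "(\<integral>\<^sup>+ t. ennreal ((norm (f t))\<^sup>2) \<partial>lebesgue) < \<infinity>" "(\<integral>\<^sup>+ t. ennreal ((norm (g t))\<^sup>2) \<partial>lebesgue) < \<infinity>"
    using assms by (auto simp: L2_abs0)
  have pw: "cmod (cinner (f t) (g t)) \<le> (norm (f t))\<^sup>2 + (norm (g t))\<^sup>2" for t
  proof -
    have "cmod (cinner (f t) (g t)) \<le> norm (f t) * norm (g t)" by (rule norm_cinner_le)
    also have "\<dots> \<le> (norm (f t))\<^sup>2 + (norm (g t))\<^sup>2"
      using sum_squares_bound[of "norm (f t)" "norm (g t)"] mult_nonneg_nonneg[of "norm (f t)" "norm (g t)"]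
      by (simp del: mult_nonneg_nonneg) 
    finally show ?thesis .
  qed
  have "(\<integral>\<^sup>+ t. ennreal (cmod (cinner (f t) (g t))) \<partial>lebesgue) \<le>
      (\<integral>\<^sup>+ t. ennreal ((norm (f t))\<^sup>2) + ennreal ((norm (g t))\<^sup>2) \<partial>lebesgue)"
    by (intro nn_integral_mono) (auto simp: ennreal_plus[symmetric] simp del: ennreal_plus intro!: ennreal_leI pw)
  also have "\<dots> = (\<integral>\<^sup>+ t. ennreal ((norm (f t))\<^sup>2) \<partial>lebesgue) + (\<integral>\<^sup>+ t. ennreal ((norm (g t))\<^sup>2) \<partial>lebesgue)"
    using smeas_norm2[OF m(1)] smeas_norm2[OF m(2)] by (subst nn_integral_add) auto
  also have "\<dots> < \<infinity>" using fin by (simp add: less_top[symmetric])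
  finally show ?thesis
    using smeas_borel[OF smeas_cinner[OF m]] by (simp add: integrable_iff_bounded)
qed

lemma L2_inner_add_left:
  "f \<in> L2 0 \<Longrightarrow> g \<in> L2 0 \<Longrightarrow> h \<in> L2 0 \<Longrightarrow> L2_inner (f + g) h = L2_inner f h + L2_inner g h"
  by (cases f; cases g; cases h)
     (simp add: aefun_abs_simps cinner_add_left Bochner_Integration.integral_add L2_inner_integrable)

lemma L2_inner_add_right:
  "f \<in> L2 0 \<Longrightarrow> g \<in> L2 0 \<Longrightarrow> h \<in> L2 0 \<Longrightarrow> L2_inner h (f + g) = L2_inner h f + L2_inner h g"
  by (cases f; cases g; cases h)
     (simp add: aefun_abs_simps cinner_add_right Bochner_Integration.integral_add L2_inner_integrable)

lemma L2_inner_diff_left: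
  "f \<in> L2 0 \<Longrightarrow> g \<in> L2 0 \<Longrightarrow> h \<in> L2 0 \<Longrightarrow> L2_inner (f - g) h = L2_inner f h - L2_inner g h"
  by (cases f; cases g; cases h)
     (simp add: aefun_abs_simps cinner_diff_left Bochner_Integration.integral_diff L2_inner_integrable)

lemma L2_inner_diff_right:
  "f \<in> L2 0 \<Longrightarrow> g \<in> L2 0 \<Longrightarrow> h \<in> L2 0 \<Longrightarrow> L2_inner h (f - g) = L2_inner h f - L2_inner h g"
  by (cases f; cases g; cases h)
     (simp add: aefun_abs_simps cinner_diff_right Bochner_Integration.integral_diff L2_inner_integrable)

lemma L2_inner_scaleC_right: "L2_inner f (a *\<^sub>C g) = a * L2_inner f g"
  by (cases f; cases g) (simp add: aefun_abs_simps cinner_scaleC_right)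

lemma L2_inner_scaleC_left: "L2_inner (a *\<^sub>C f) g = cnj a * L2_inner f g"
  by (cases f; cases g) (simp add: aefun_abs_simps cinner_scaleC_left)

lemma L2_inner_commute: "L2_inner f g = cnj (L2_inner g f)"
proof (cases f; cases g)
  fix f' g' assume "f = abs_aefun f'" "g = abs_aefun g'"
  then show ?thesis
    using Bochner_Integration.integral_cnj[where f = "\<lambda>t. cinner (g' t) (f' t)" and M = lebesgue]
    by (simp add: aefun_abs_simps cinner_commute[symmetric] del: Bochner_Integration.integral_cnj)
qed

lemma L2_inner_zero_left [simp]: "L2_inner 0 f = 0"
  by (cases f) (simp add: aefun_abs_simps)

lemma L2_inner_zero_right [simp]: "L2_inner f 0 = 0"
  by (cases f) (simp add: aefun_abs_simps)

lemma L2_inner_self: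
  fixes f :: "'a::chilbert_space aefun"
  assumes "f \<in> L2 0"
  shows "L2_inner f f = of_real ((L2_norm 0 f)\<^sup>2)"
proof (cases f)
  case (1 g)
  with assms have m: "smeas g" and i: "integrable lebesgue (\<lambda>t. cinner (g t) (g t))"
    by (auto simp: L2_abs0 intro: L2_inner_integrable)
  have i': "integrable lebesgue (\<lambda>t. (norm (g t))\<^sup>2)"
    using integrable_Re[OF i] by (simp add: cinner_self)
  have "L2_inner f f = of_real (LINT t|lebesgue. (norm (g t))\<^sup>2)"
    by (simp add: 1 L2_inner.abs_eq cinner_self del: of_real_power)
  also have "(LINT t|lebesgue. (norm (g t))\<^sup>2) = (L2_norm 0 f)\<^sup>2"
    using smeas_norm2[OF m] i'
    by (simp add: 1 L2_norm_def weighted_integral.abs_eq integral_eq_nn_integral)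
  finally show ?thesis .
qed

lemma L2_norm_eq_0_iff:
  fixes f :: "'a::chilbert_space aefun"
  assumes "f \<in> L2 \<omega>"
  shows "L2_norm \<omega> f = 0 \<longleftrightarrow> f = 0"
proof -
  have *: "L2_norm 0 f = 0 \<longleftrightarrow> f = 0" if "f \<in> L2 0" for f :: "'a aefun"
  proof (cases f)
    case (1 g)
    with that have m: "smeas g" and fin: "(\<integral>\<^sup>+ t. ennreal ((norm (g t))\<^sup>2) \<partial>lebesgue) < \<infinity>"
      by (auto simp: L2_abs0)
    have "L2_norm 0 f = 0 \<longleftrightarrow> (\<integral>\<^sup>+ t. ennreal ((norm (g t))\<^sup>2) \<partial>lebesgue) = 0"
      using fin by (auto simp: 1 L2_norm_def weighted_integral.abs_eq enn2real_eq_0_iff)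
    also have "\<dots> \<longleftrightarrow> (AE t in lebesgue. g t = 0)"
      using smeas_norm2[OF m] by (subst nn_integral_0_iff_AE) (auto simp: ennreal_eq_0_iff)
    also have "\<dots> \<longleftrightarrow> f = 0"
      by (simp add: 1 zero_aefun.abs_eq abs_aefun_eq_iff)
    finally show ?thesis .
  qed
  have "L2_norm \<omega> f = L2_norm 0 (wmul (- \<omega>) f)" by (simp add: L2_norm_wmul)
  then show ?thesis using *[of "wmul (- \<omega>) f"] assms by (simp add: L2_wmul_iff)
qed

lemma L2_norm_scaleC:
  fixes f :: "'a::chilbert_space aefun"
  assumes "f \<in> L2 \<omega>"
  shows "L2_norm \<omega> (a *\<^sub>C f) = cmod a * L2_norm \<omega> f"
proof -
  have *: "L2_norm 0 (a *\<^sub>C f) = cmod a * L2_norm 0 f" if "f \<in> L2 0" for f :: "'a aefun"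
  proof -
    have "complex_of_real ((L2_norm 0 (a *\<^sub>C f))\<^sup>2) = (a * cnj a) * L2_inner f f"
      unfolding L2_inner_self[OF L2_0_scaleC[OF that, of a], symmetric]
      by (simp add: L2_inner_scaleC_left L2_inner_scaleC_right)
    then have "complex_of_real ((L2_norm 0 (a *\<^sub>C f))\<^sup>2) = of_real ((cmod a)\<^sup>2) * of_real ((L2_norm 0 f)\<^sup>2)"
      unfolding L2_inner_self[OF that] complex_norm_square[symmetric] .
    then have "(L2_norm 0 (a *\<^sub>C f))\<^sup>2 = (cmod a * L2_norm 0 f)\<^sup>2"
      by (simp only: of_real_mult[symmetric] power_mult_distrib of_real_eq_iff)
    then show ?thesis by (rule power2_eq_imp_eq) auto
  qed
  have "L2_norm \<omega> (a *\<^sub>C f) = L2_norm 0 (a *\<^sub>C wmul (- \<omega>) f)"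
    by (simp add: L2_norm_wmul wmul_scaleC[symmetric])
  then show ?thesis using *[of "wmul (- \<omega>) f"] assms by (simp add: L2_wmul_iff L2_norm_wmul)
qed

lemma L2_inner_Re_expand:
  fixes f g :: "'a::chilbert_space aefun"
  assumes "f \<in> L2 0" "g \<in> L2 0"
  shows "(L2_norm 0 (f + g))\<^sup>2 = (L2_norm 0 f)\<^sup>2 + 2 * Re (L2_inner f g) + (L2_norm 0 g)\<^sup>2"
proof -
  have "complex_of_real ((L2_norm 0 (f + g))\<^sup>2) = L2_inner f f + L2_inner f g + (cnj (L2_inner f g) + L2_inner g g)"
    using assms L2_inner_self[OF L2_0_add[OF assms]]
    by (simp add: L2_inner_add_left L2_inner_add_right L2_0_add L2_inner_commute[of g f] algebra_simps)
  then have "Re (complex_of_real ((L2_norm 0 (f + g))\<^sup>2)) = Re (L2_inner f f + L2_inner f g + (cnj (L2_inner f g) + L2_inner g g))"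
    by (rule arg_cong)
  then show ?thesis unfolding L2_inner_self[OF assms(1)] L2_inner_self[OF assms(2)]
    by (simp del: of_real_power)
qed

lemma L2_inner_bound:
  fixes f g :: "'a::chilbert_space aefun"
  assumes f: "f \<in> L2 0" and g: "g \<in> L2 0"
  shows "cmod (L2_inner f g) \<le> L2_norm 0 f * L2_norm 0 g"
proof -
  have re: "Re (L2_inner f g) \<le> L2_norm 0 f * L2_norm 0 g" if f: "f \<in> L2 0" and g: "g \<in> L2 0" for f g :: "'a aefun"
  proof (cases "L2_norm 0 f = 0")
    case True
    then have "f = 0" using f L2_norm_eq_0_iff by blast
    then show ?thesis by simp
  next
    case False
    define a b where "a = L2_norm 0 f" and "b = L2_norm 0 g"
    have a: "0 < a" using False by (simp add: a_def less_le)
    have "0 \<le> (L2_norm 0 (of_real (- b) *\<^sub>C f + of_real a *\<^sub>C g))\<^sup>2" by simp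
    also have "\<dots> = 2 * (a * b)\<^sup>2 - 2 * a * b * Re (L2_inner f g)"
      by (subst L2_inner_Re_expand)
         (simp_all add: f g L2_scaleC L2_norm_scaleC L2_inner_scaleC_left L2_inner_scaleC_right
           a_def[symmetric] b_def[symmetric] power2_eq_square algebra_simps)
    finally have *: "a * b * Re (L2_inner f g) \<le> (a * b) * (a * b)" by (simp add: power2_eq_square)
    show ?thesis
    proof (cases "b = 0")
      case True
      then have "g = 0" using L2_norm_eq_0_iff[OF g] b_def by simp
      then show ?thesis by simp
    next
      case False
      then have "0 < a * b" using a by (simp add: b_def less_le)
      with * have "Re (L2_inner f g) \<le> a * b" using mult_le_cancel_left_pos by blast
      then show ?thesis by (simp add: a_def b_def)
    qed
  qed
  show ?thesis
  proof (cases "L2_inner f g = 0")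
    case False
    define c where "c = cnj (L2_inner f g) / cmod (L2_inner f g)"
    have c1: "cmod c = 1" using False by (simp add: c_def norm_divide)
    have "c * L2_inner f g = of_real (cmod (L2_inner f g))"
      using False complex_norm_square[of "L2_inner f g"]
      by (simp add: c_def mult.commute[of "cnj _"] power2_eq_square divide_eq_eq)
    then have "Re (L2_inner f (c *\<^sub>C g)) = cmod (L2_inner f g)"
      by (simp add: L2_inner_scaleC_right)
    then show ?thesis using re[OF f L2_scaleC[OF g, of c]] by (simp add: L2_norm_scaleC g c1)
  qed simp
qed

lemma L2_norm_triangle:
  fixes f g :: "'a::chilbert_space aefun"
  assumes "f \<in> L2 \<omega>" "g \<in> L2 \<omega>"
  shows "L2_norm \<omega> (f + g) \<le> L2_norm \<omega> f + L2_norm \<omega> g"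
proof -
  have *: "L2_norm 0 (f + g) \<le> L2_norm 0 f + L2_norm 0 g" if "f \<in> L2 0" "g \<in> L2 0" for f g :: "'a aefun"
  proof (rule power2_le_imp_le)
    have "Re (L2_inner f g) \<le> L2_norm 0 f * L2_norm 0 g"
      using L2_inner_bound[OF that] complex_Re_le_cmod order_trans by blast
    then show "(L2_norm 0 (f + g))\<^sup>2 \<le> (L2_norm 0 f + L2_norm 0 g)\<^sup>2"
      by (simp add: L2_inner_Re_expand that power2_sum)
  qed simp
  have "L2_norm \<omega> (f + g) = L2_norm 0 (wmul (- \<omega>) f + wmul (- \<omega>) g)"
    by (simp add: L2_norm_wmul wmul_add[symmetric])
  then show ?thesis using *[of "wmul (- \<omega>) f" "wmul (- \<omega>) g"] assms by (simp add: L2_wmul_iff L2_norm_wmul)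
qed

lemma norm_on_L2: "norm_on (L2 \<omega> :: 'a::chilbert_space aefun set) (L2_norm \<omega>)"
  by (simp add: norm_on_def L2_norm_eq_0_iff L2_norm_scaleC L2_norm_triangle)

text \<open>A sequential form of completeness for a carrier and a norm on it. The spaces at issue
  (\<open>V\<close>, \<open>L2_plus\<close>, \<open>Zs\<close>) are subsets of function types, and
  limits are handled as real null sequences of norms.\<close>

definition ncomplete :: "'a::ab_group_add set \<Rightarrow> ('a \<Rightarrow> real) \<Rightarrow> bool" where
  "ncomplete X n \<longleftrightarrow> (\<forall>f. (\<forall>k::nat. f k \<in> X) \<and> (\<forall>e>0. \<exists>N. \<forall>i\<ge>N. \<forall>j\<ge>N. n (f i - f j) < e)
     \<longrightarrow> (\<exists>x\<in>X. (\<lambda>k. n (f k - x)) \<longlonglongrightarrow> 0))"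

lemma ncompleteD:
  assumes "ncomplete X n" "\<And>k::nat. f k \<in> X" "\<And>e. e > 0 \<Longrightarrow> \<exists>N. \<forall>i\<ge>N. \<forall>j\<ge>N. n (f i - f j) < e"
  obtains x where "x \<in> X" "(\<lambda>k. n (f k - x)) \<longlonglongrightarrow> 0"
  using assms unfolding ncomplete_def by blast

lemma strongly_measurable_diff:
  "smeas f \<Longrightarrow> smeas g \<Longrightarrow> smeas (\<lambda>t. f t - g t)"
  by (rule smeas_compose2[where h = "(-)"]) (assumption | intro continuous_intros)+

text \<open>Along a subsequence with increments \<open>\<le> 4\<^sup>-\<^sup>k\<close>, the series of \<open>2\<^sup>k |d\<^sub>k|\<^sup>2\<close> is integrable, hence
  almost everywhere finite, which forces pointwise convergence without Minkowski's inequality.\<close>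

lemma L2_0_complete: "ncomplete (L2 0 :: 'a::chilbert_space aefun set) (L2_norm 0)"
  unfolding ncomplete_def
proof (intro allI impI, elim conjE)
  fix F :: "nat \<Rightarrow> 'a aefun"
  assume F: "\<forall>k. F k \<in> L2 0" and cau: "\<forall>e>0. \<exists>N. \<forall>i\<ge>N. \<forall>j\<ge>N. L2_norm 0 (F i - F j) < e"
  define f where "f k = rep_aefun (F k)" for k
  have Ff: "F k = abs_aefun (f k)" for k
    by (simp add: f_def Quotient3_abs_rep[OF Quotient3_aefun])
  have m: "smeas (f k)" for k using F by (simp add: Ff L2_abs0)
  have nsq: "(\<integral>\<^sup>+ t. ennreal ((norm (f i t - f j t))\<^sup>2) \<partial>lebesgue) = ennreal ((L2_norm 0 (F i - F j))\<^sup>2)" for i j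
    using L2_norm_sq[OF L2_diff[of "F i" 0 "F j"]] F
    by (simp add: Ff minus_aefun.abs_eq weighted_integral.abs_eq)
  have "\<exists>N. \<forall>k. (\<forall>i\<ge>N k. \<forall>j\<ge>N k. L2_norm 0 (F i - F j) < (1/4) ^ k)"
    using cau by (intro choice) auto
  then obtain N where N: "\<And>k i j. i \<ge> N k \<Longrightarrow> j \<ge> N k \<Longrightarrow> L2_norm 0 (F i - F j) < (1/4) ^ k"
    by blast
  \<comment> \<open>The index \<open>r k\<close> is nondecreasing in \<open>k\<close> and dominates
    both \<open>N k\<close>, so that consecutive increments are at most \<open>(1/4) ^ k\<close>,
    and \<open>k\<close>, so that \<open>F (r k)\<close> runs through every tail.\<close>
  define r where "r k = (\<Sum>i\<le>k. N i) + k" for k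
  have rN: "N k \<le> r k" for k
    unfolding r_def by (rule trans_le_add1, rule member_le_sum) auto
  have rS: "r k \<le> r (Suc k)" for k by (simp add: r_def)
  have rk: "k \<le> r k" for k by (simp add: r_def)
  define d where "d k t = f (r (Suc k)) t - f (r k) t" for k t
  have dm: "(\<lambda>t. ennreal ((norm (d k t))\<^sup>2)) \<in> borel_measurable lebesgue" for k
    unfolding d_def by (intro smeas_norm2 strongly_measurable_diff m)
  have dn: "(\<integral>\<^sup>+ t. ennreal ((norm (d k t))\<^sup>2) \<partial>lebesgue) \<le> ennreal ((1/16) ^ k)" for k
  proof -
    have "L2_norm 0 (F (r (Suc k)) - F (r k)) \<le> (1/4) ^ k"
      using N[of k "r (Suc k)" "r k"] rN[of k] rS[of k] by force
    then have "(L2_norm 0 (F (r (Suc k)) - F (r k)))\<^sup>2 \<le> ((1/4) ^ k)\<^sup>2"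
      by (intro power_mono) auto
    also have "\<dots> = (1/16) ^ k" by (simp add: power_divide power_mult[symmetric] power2_eq_square power_mult_distrib[symmetric])
    finally show ?thesis unfolding d_def nsq by (rule ennreal_leI)
  qed
  have "(\<integral>\<^sup>+ t. (\<Sum>k. ennreal (2 ^ k) * ennreal ((norm (d k t))\<^sup>2)) \<partial>lebesgue)
      = (\<Sum>k. ennreal (2 ^ k) * (\<integral>\<^sup>+ t. ennreal ((norm (d k t))\<^sup>2) \<partial>lebesgue))"
    using dm by (subst nn_integral_suminf) (auto simp: nn_integral_cmult)
  also have "\<dots> \<le> (\<Sum>k. ennreal ((1/8) ^ k))"
  proof (intro suminf_le summableI)
    fix k
    have "ennreal (2 ^ k) * (\<integral>\<^sup>+ t. ennreal ((norm (d k t))\<^sup>2) \<partial>lebesgue) \<le> ennreal (2 ^ k) * ennreal ((1/16) ^ k)"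
      by (intro mult_left_mono dn) auto
    also have "\<dots> = ennreal ((1/8) ^ k)"
      by (subst ennreal_mult[symmetric]) (auto simp: power_mult_distrib[symmetric])
    finally show "ennreal (2 ^ k) * (\<integral>\<^sup>+ t. ennreal ((norm (d k t))\<^sup>2) \<partial>lebesgue) \<le> ennreal ((1/8) ^ k)" .
  qed
  also have "\<dots> = ennreal (\<Sum>k. (1/8) ^ k)"
    by (rule suminf_ennreal2) (auto intro: summable_geometric)
  finally have fin: "(\<integral>\<^sup>+ t. (\<Sum>k. ennreal (2 ^ k) * ennreal ((norm (d k t))\<^sup>2)) \<partial>lebesgue) \<noteq> \<infinity>"
    using ennreal_neq_top neq_top_trans by (metis infinity_ennreal_def)
  have ae: "AE t in lebesgue. (\<Sum>k. ennreal (2 ^ k) * ennreal ((norm (d k t))\<^sup>2)) \<noteq> \<infinity>"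
    by (rule nn_integral_noteq_infinite[OF _ fin]) (use dm in measurable)
  define g where "g t = lim (\<lambda>k. f (r k) t)" for t
  have lim: "AE t in lebesgue. (\<lambda>k. f (r k) t) \<longlonglongrightarrow> g t"
    using ae
  proof eventually_elim
    case (elim t)
    then obtain S where S: "(\<Sum>k. ennreal (2 ^ k) * ennreal ((norm (d k t))\<^sup>2)) = ennreal S" "0 \<le> S"
      by (cases "\<Sum>k. ennreal (2 ^ k) * ennreal ((norm (d k t))\<^sup>2)" rule: ennreal_cases) auto
    have le: "norm (d k t) \<le> sqrt S * (sqrt (1/2)) ^ k" for k
    proof -
      have "(\<Sum>k\<in>{k}. ennreal (2 ^ k) * ennreal ((norm (d k t))\<^sup>2)) \<le> ennreal S"
        unfolding S(1)[symmetric] by (rule sum_le_suminf) auto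
      then have "2 ^ k * (norm (d k t))\<^sup>2 \<le> S"
        using S(2) by (simp add: ennreal_mult[symmetric])
      then have "(norm (d k t))\<^sup>2 \<le> S * (1/2) ^ k"
        by (simp add: field_simps power_divide)
      also have "\<dots> = (sqrt S * (sqrt (1/2)) ^ k)\<^sup>2"
        using S(2) by (simp add: power_mult_distrib power_mult[symmetric] mult.commute[of _ 2] power_mult)
      finally show ?thesis by (rule power2_le_imp_le) (use S in auto)
    qed
    have "summable (\<lambda>k. sqrt S * (sqrt (1/2)) ^ k)"
      by (intro summable_mult summable_geometric) (simp add: real_sqrt_lt_1_iff)
    then have "summable (\<lambda>k. d k t)"
      by (rule summable_comparison_test'[where N = 0]) (use le in auto)
    then have "convergent (\<lambda>n. \<Sum>k<n. d k t)" by (simp add: summable_iff_convergent)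
    moreover have "(\<Sum>k<n. d k t) = f (r n) t - f (r 0) t" for n
      unfolding d_def by (rule sum_lessThan_telescope)
    ultimately have "convergent (\<lambda>n. f (r n) t - f (r 0) t)" by simp
    then have "convergent (\<lambda>n. f (r n) t)"
      using convergent_add[OF _ convergent_const[of "f (r 0) t"]] by fastforce
    then show ?case unfolding g_def by (simp add: convergent_LIMSEQ_iff)
  qed
  have gm: "smeas g" by (rule smeas_LIMSEQ[OF _ lim]) (rule m)
  \<comment> \<open>Fatou's lemma along the subsequence: the Cauchy bounds on
    \<open>F i - F (r k)\<close> pass to \<open>F i - G\<close> before the limit is known to lie in
    \<open>L2 0\<close>.\<close>
  have bound: "(\<integral>\<^sup>+ t. ennreal ((norm (f i t - g t))\<^sup>2) \<partial>lebesgue) \<le> ennreal (e\<^sup>2)"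
    if e: "0 < e" and i: "\<forall>j\<ge>i. L2_norm 0 (F i - F j) < e" for e i
  proof -
    have "(\<integral>\<^sup>+ t. ennreal ((norm (f i t - g t))\<^sup>2) \<partial>lebesgue) =
        (\<integral>\<^sup>+ t. liminf (\<lambda>k. ennreal ((norm (f i t - f (r k) t))\<^sup>2)) \<partial>lebesgue)"
    proof (rule nn_integral_cong_AE)
      show "AE t in lebesgue. ennreal ((norm (f i t - g t))\<^sup>2) = liminf (\<lambda>k. ennreal ((norm (f i t - f (r k) t))\<^sup>2))"
        using lim
      proof eventually_elim
        case (elim t)
        have "(\<lambda>k. ennreal ((norm (f i t - f (r k) t))\<^sup>2)) \<longlonglongrightarrow> ennreal ((norm (f i t - g t))\<^sup>2)"
          by (intro tendsto_ennrealI tendsto_intros elim)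
        then show ?case by (rule lim_imp_Liminf[OF sequentially_bot, symmetric])
      qed
    qed
    also have "\<dots> \<le> liminf (\<lambda>k. \<integral>\<^sup>+ t. ennreal ((norm (f i t - f (r k) t))\<^sup>2) \<partial>lebesgue)"
      by (rule nn_integral_liminf) (intro smeas_norm2 strongly_measurable_diff m)
    also have "\<dots> \<le> ennreal (e\<^sup>2)"
      unfolding nsq
    proof (rule Liminf_le)
      show "\<forall>\<^sub>F k in sequentially. ennreal ((L2_norm 0 (F i - F (r k)))\<^sup>2) \<le> ennreal (e\<^sup>2)"
        using eventually_ge_at_top[of i]
      proof eventually_elim
        case (elim k)
        then have "i \<le> r k" using rk[of k] by simp
        then have "L2_norm 0 (F i - F (r k)) < e" using i by blast
        then show ?case by (intro ennreal_leI power_mono) auto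
      qed
    qed simp
    finally show ?thesis .
  qed
  define G where "G = abs_aefun g"
  have conv: "F i - G \<in> L2 0 \<and> L2_norm 0 (F i - G) \<le> e"
    if e: "0 < e" and i: "\<forall>j\<ge>i. L2_norm 0 (F i - F j) < e" for e i
  proof -
    have "(\<integral>\<^sup>+ t. ennreal ((norm (f i t - g t))\<^sup>2) \<partial>lebesgue) < \<infinity>"
      using bound[OF that] by (rule order.strict_trans1) simp
    then have "F i - G \<in> L2 0"
      by (simp add: G_def Ff minus_aefun.abs_eq L2_abs0 strongly_measurable_diff m gm)
    moreover have "L2_norm 0 (F i - G) \<le> e"
      by (rule L2_norm_leI) (use bound[OF that] e in \<open>simp_all add: G_def Ff minus_aefun.abs_eq weighted_integral.abs_eq\<close>)
    ultimately show ?thesis by blast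
  qed
  show "\<exists>x\<in>L2 0. (\<lambda>k. L2_norm 0 (F k - x)) \<longlonglongrightarrow> 0"
  proof (rule bexI[of _ G])
    show "(\<lambda>k. L2_norm 0 (F k - G)) \<longlonglongrightarrow> 0"
    proof (rule LIMSEQ_I)
      fix e :: real assume "0 < e"
      then obtain N' where "\<forall>i\<ge>N'. \<forall>j\<ge>N'. L2_norm 0 (F i - F j) < e / 2" using cau half_gt_zero by blast
      then have "\<forall>i\<ge>N'. L2_norm 0 (F i - G) \<le> e / 2" using conv[of "e / 2"] \<open>0 < e\<close> by auto
      then show "\<exists>no. \<forall>n\<ge>no. norm (L2_norm 0 (F n - G) - 0) < e"
        using \<open>0 < e\<close> by (intro exI[of _ N']) force
    qed
    obtain N' where "\<forall>i\<ge>N'. \<forall>j\<ge>N'. L2_norm 0 (F i - F j) < 1" using cau zero_less_one by blast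
    then have "F N' - G \<in> L2 0" using conv[of 1 N'] by auto
    with F have "F N' - (F N' - G) \<in> L2 0" by (metis L2_diff)
    then show "G \<in> L2 0" by simp
  qed
qed

lemma L2_complete: "ncomplete (L2 \<omega> :: 'a::chilbert_space aefun set) (L2_norm \<omega>)"
  unfolding ncomplete_def
proof (intro allI impI, elim conjE)
  fix F :: "nat \<Rightarrow> 'a aefun"
  assume F: "\<forall>k. F k \<in> L2 \<omega>" and cau: "\<forall>e>0. \<exists>N. \<forall>i\<ge>N. \<forall>j\<ge>N. L2_norm \<omega> (F i - F j) < e"
  obtain x where x: "x \<in> L2 0" "(\<lambda>k. L2_norm 0 (wmul (-\<omega>) (F k) - x)) \<longlonglongrightarrow> 0"
  proof (rule ncompleteD[OF L2_0_complete])
    show "wmul (- \<omega>) (F k) \<in> L2 0" for k using F by (simp add: L2_wmul_iff)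
    show "\<exists>N. \<forall>i\<ge>N. \<forall>j\<ge>N. L2_norm 0 (wmul (- \<omega>) (F i) - wmul (- \<omega>) (F j)) < e" if "0 < e" for e
      using cau that by (simp add: wmul_diff[symmetric] L2_norm_wmul)
  qed auto
  have "wmul (- \<omega>) (wmul \<omega> x) = x" using wmul_wmul[of "- \<omega>" x] by simp
  then have "L2_norm 0 (wmul (-\<omega>) (F k) - x) = L2_norm \<omega> (F k - wmul \<omega> x)" for k
    using L2_norm_wmul[of 0 "- \<omega>" "F k - wmul \<omega> x"] by (simp add: wmul_diff)
  then show "\<exists>x\<in>L2 \<omega>. (\<lambda>k. L2_norm \<omega> (F k - x)) \<longlonglongrightarrow> 0"
    using x by (intro bexI[of _ "wmul \<omega> x"]) (simp_all add: L2_wmul_iff)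
qed

subsection \<open>Shifts and cuts\<close>

lemma shift_0 [simp]: "shift 0 f = f"
  by transfer (simp add: ae_eq_def)

lemma shift_shift [simp]: "shift a (shift b f) = shift (a + b) f"
  by transfer (simp add: ae_eq_def add_ac)

lemma shift_add: "shift a (f + g) = shift a f + shift a g"
  by transfer (simp add: ae_eq_def)

lemma shift_diff: "shift a (f - g) = shift a f - shift a g"
  by transfer (simp add: ae_eq_def)

lemma shift_scaleC: "shift a (c *\<^sub>C f) = c *\<^sub>C shift a f"
  by transfer (simp add: ae_eq_def)

lemma shift_zero [simp]: "shift a 0 = 0"
  by transfer (simp add: ae_eq_def)

lemma cut_add: "cut I (f + g) = cut I f + cut I (g::'a::ab_group_add aefun)"
  by transfer (simp add: ae_eq_def)

lemma cut_diff: "cut I (f - g) = cut I f - cut I (g::'a::ab_group_add aefun)"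
  by transfer (simp add: ae_eq_def)

lemma cut_scaleC: "cut I (c *\<^sub>C f) = c *\<^sub>C cut I (f::'a::complex_vector aefun)"
  by transfer (simp add: ae_eq_def)

lemma cut_zero [simp]: "cut I (0::'a::ab_group_add aefun) = 0"
  by transfer (simp add: ae_eq_def)

lemma cut_cut [simp]: "cut I (cut J f) = cut (I \<inter> J) f"
  by transfer (simp add: ae_eq_def)

lemma cut_empty [simp]: "cut {} f = (0::'a::ab_group_add aefun)"
  by transfer (simp add: ae_eq_def)

lemma cut_UNIV [simp]: "cut UNIV f = f"
  by transfer (simp add: ae_eq_def)

lemma shift_cut: "shift a (cut I f) = cut {s. a + s \<in> I} (shift a f)"
  by transfer (simp add: ae_eq_def)

lemma cut_split: "I \<inter> J = {} \<Longrightarrow> cut I f + cut J f = cut (I \<union> J) (f::'a::ab_group_add aefun)"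
  by transfer (auto simp: ae_eq_def)

lemma cut_eq_subset: "cut I f = cut I g \<Longrightarrow> J \<subseteq> I \<Longrightarrow> cut J f = cut J g"
  by (metis cut_cut inf.absorb1)

lemma cut_fix_subset: "cut I f = f \<Longrightarrow> I \<subseteq> J \<Longrightarrow> cut J f = f"
  by (metis cut_cut inf.absorb2)

lemma pi_split: "pi_minus f + pi_plus f = (f::'a::ab_group_add aefun)"
proof -
  have "{..<0} \<union> {0..} = (UNIV :: real set)" "{..<0} \<inter> {0..} = ({} :: real set)" by auto
  then show ?thesis using cut_split[of "{..<0}" "{0..}" f] by simp
qed

lemma nn_integral_lebesgue_shift:
  assumes "f \<in> borel_measurable lebesgue"
  shows "(\<integral>\<^sup>+ s. f (t + s) \<partial>lebesgue) = (\<integral>\<^sup>+ s. f s \<partial>(lebesgue :: real measure))"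
  using nn_integral_real_affine_lebesgue[OF assms, of 1 t] by simp

lemma smeas_norm2_exp: "smeas f \<Longrightarrow> (\<lambda>t. ennreal ((norm (exp (a * t) *\<^sub>R f t))\<^sup>2)) \<in> borel_measurable lebesgue"
  by (intro smeas_norm2 smeas_exp)

lemma weighted_integral_shift:
  assumes "strongly_measurable f"
  shows "weighted_integral \<omega> (shift t f) = ennreal ((exp (\<omega> * t))\<^sup>2) * weighted_integral \<omega> f"
proof (cases f)
  case (1 g)
  with assms have m: "smeas g" by (simp add: strongly_measurable_abs)
  have e: "(norm (exp (- \<omega> * s) *\<^sub>R g (t + s)))\<^sup>2 = (exp (\<omega> * t))\<^sup>2 * (norm (exp (- \<omega> * (t + s)) *\<^sub>R g (t + s)))\<^sup>2" for s
  proof -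
    have "exp (- \<omega> * s) = exp (\<omega> * t) * exp (- \<omega> * (t + s))" by (simp add: exp_add[symmetric] algebra_simps)
    then show ?thesis by (simp add: power_mult_distrib)
  qed
  have "weighted_integral \<omega> (shift t f) = (\<integral>\<^sup>+ s. ennreal ((exp (\<omega> * t))\<^sup>2) * ennreal ((norm (exp (- \<omega> * (t + s)) *\<^sub>R g (t + s)))\<^sup>2) \<partial>lebesgue)"
    unfolding 1 shift.abs_eq weighted_integral.abs_eq e by (simp add: ennreal_mult)
  also have "\<dots> = (\<integral>\<^sup>+ s. ennreal ((exp (\<omega> * t))\<^sup>2) * ennreal ((norm (exp (- \<omega> * s) *\<^sub>R g s))\<^sup>2) \<partial>lebesgue)"
    using nn_integral_lebesgue_shift[of "\<lambda>s. ennreal ((exp (\<omega> * t))\<^sup>2) * ennreal ((norm (exp (- \<omega> * s) *\<^sub>R g s))\<^sup>2)" t]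
      smeas_norm2_exp[OF m, of "- \<omega>"] by auto
  also have "\<dots> = ennreal ((exp (\<omega> * t))\<^sup>2) * weighted_integral \<omega> f"
    using smeas_norm2_exp[OF m, of "- \<omega>"] by (simp add: 1 weighted_integral.abs_eq nn_integral_cmult)
  finally show ?thesis .
qed

lemma strongly_measurable_shift: "strongly_measurable f \<Longrightarrow> strongly_measurable (shift t f)"
  by (cases f) (simp add: shift.abs_eq strongly_measurable_abs smeas_shift)

lemma strongly_measurable_cut: "strongly_measurable f \<Longrightarrow> I \<in> sets lebesgue \<Longrightarrow> strongly_measurable (cut I f)"
  by (cases f) (simp add: cut.abs_eq strongly_measurable_abs smeas_If)

lemma L2_shift: "f \<in> L2 \<omega> \<Longrightarrow> shift t f \<in> L2 \<omega>"
  by (simp add: L2_def strongly_measurable_shift weighted_integral_shift ennreal_mult_less_top)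

lemma L2_norm_shift: "f \<in> L2 \<omega> \<Longrightarrow> L2_norm \<omega> (shift t f) = exp (\<omega> * t) * L2_norm \<omega> f"
  by (simp add: L2_norm_def L2_def weighted_integral_shift enn2real_mult real_sqrt_mult)

lemma weighted_integral_cut_le: "weighted_integral \<omega> (cut I f) \<le> weighted_integral \<omega> f"
proof (cases f)
  case (1 g)
  then show ?thesis
    by (auto simp: cut.abs_eq weighted_integral.abs_eq intro!: nn_integral_mono)
qed

lemma L2_cut: "f \<in> L2 \<omega> \<Longrightarrow> I \<in> sets lebesgue \<Longrightarrow> cut I f \<in> L2 \<omega>"
  using weighted_integral_cut_le[of \<omega> I f] by (auto simp: L2_def strongly_measurable_cut)

lemma L2_norm_cut_le: "f \<in> L2 \<omega> \<Longrightarrow> L2_norm \<omega> (cut I f) \<le> L2_norm \<omega> f"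
  using weighted_integral_cut_le[of \<omega> I f] by (simp add: L2_norm_def L2_def enn2real_mono)

lemma weighted_integral_mono:
  assumes "cut I f = f" "\<And>t. t \<in> I \<Longrightarrow> exp (- \<alpha> * t) \<le> c * exp (- \<beta> * t)" "0 \<le> c" "strongly_measurable f"
  shows "weighted_integral \<alpha> f \<le> ennreal (c\<^sup>2) * weighted_integral \<beta> f"
proof (cases f)
  case (1 g)
  have m: "smeas g" using assms(4) by (simp add: 1 strongly_measurable_abs)
  have "AE t in lebesgue. g t = (if t \<in> I then g t else 0)"
    using assms(1) by (auto simp: 1 cut.abs_eq abs_aefun_eq_iff elim!: eventually_mono)
  then have "AE t in lebesgue. ennreal ((norm (exp (- \<alpha> * t) *\<^sub>R g t))\<^sup>2) \<le> ennreal (c\<^sup>2) * ennreal ((norm (exp (- \<beta> * t) *\<^sub>R g t))\<^sup>2)"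
  proof eventually_elim
    case (elim t)
    show ?case
    proof (cases "t \<in> I")
      case True
      have "norm (exp (- \<alpha> * t) *\<^sub>R g t) \<le> c * norm (exp (- \<beta> * t) *\<^sub>R g t)"
        using assms(2)[OF True] mult_right_mono[of "exp (- \<alpha> * t)" "c * exp (- \<beta> * t)" "norm (g t)"] by (simp add: mult.assoc)
      then have "(norm (exp (- \<alpha> * t) *\<^sub>R g t))\<^sup>2 \<le> (c * norm (exp (- \<beta> * t) *\<^sub>R g t))\<^sup>2"
        by (rule power_mono) auto
      then show ?thesis by (subst ennreal_mult[symmetric]) (auto simp: power_mult_distrib intro: ennreal_leI)
    next
      case False
      then have "g t = 0" using elim by simp
      then show ?thesis by simp
    qed
  qed
  then have "weighted_integral \<alpha> f \<le> (\<integral>\<^sup>+ t. ennreal (c\<^sup>2) * ennreal ((norm (exp (- \<beta> * t) *\<^sub>R g t))\<^sup>2) \<partial>lebesgue)"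
    unfolding 1 weighted_integral.abs_eq by (rule nn_integral_mono_AE)
  also have "\<dots> = ennreal (c\<^sup>2) * weighted_integral \<beta> f"
    using smeas_norm2_exp[OF m, of "- \<beta>"] by (simp add: 1 weighted_integral.abs_eq nn_integral_cmult)
  finally show ?thesis .
qed

lemma L2_weight_mono:
  assumes "cut I f = f" "\<And>t. t \<in> I \<Longrightarrow> exp (- \<alpha> * t) \<le> c * exp (- \<beta> * t)" "0 \<le> c" "f \<in> L2 \<beta>"
  shows "f \<in> L2 \<alpha>" "L2_norm \<alpha> f \<le> c * L2_norm \<beta> f"
proof -
  note * = weighted_integral_mono[OF assms(1-3) L2_sm[OF assms(4)]]
  then show "f \<in> L2 \<alpha>" using assms(4) by (auto simp: L2_def intro: order.strict_trans1 simp: ennreal_mult_less_top)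
  have "weighted_integral \<alpha> f \<le> ennreal ((c * L2_norm \<beta> f)\<^sup>2)"
    using * by (simp add: power_mult_distrib ennreal_mult L2_norm_sq assms(4))
  then show "L2_norm \<alpha> f \<le> c * L2_norm \<beta> f" by (rule L2_norm_leI) (use assms(3) in auto)
qed

lemma L2_weight_plus:
  assumes "pi_plus f = f" "\<alpha> \<le> \<beta>" "f \<in> L2 \<alpha>"
  shows "f \<in> L2 \<beta>" "L2_norm \<beta> f \<le> L2_norm \<alpha> f"
  using L2_weight_mono[of "{0..}" f \<beta> 1 \<alpha>] assms by (auto intro: mult_right_mono)

lemma L2_weight_minus:
  assumes "pi_minus f = f" "\<alpha> \<le> \<beta>" "f \<in> L2 \<beta>"
  shows "f \<in> L2 \<alpha>" "L2_norm \<alpha> f \<le> L2_norm \<beta> f"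
  using L2_weight_mono[of "{..<0}" f \<alpha> 1 \<beta>] assms by (auto intro: mult_right_mono_neg)

lemma L2_norm_cut_tendsto:
  assumes f: "f \<in> L2 \<omega>" and J: "\<And>n. J n \<in> sets lebesgue" and ev: "\<And>t. \<forall>\<^sub>F n in sequentially. t \<in> J n"
  shows "(\<lambda>n. L2_norm \<omega> (f - cut (J n) f)) \<longlonglongrightarrow> 0"
proof (cases f)
  case (1 g)
  have m: "smeas g" and fin: "(\<integral>\<^sup>+ t. ennreal ((norm (exp (- \<omega> * t) *\<^sub>R g t))\<^sup>2) \<partial>lebesgue) < \<infinity>"
    using f by (auto simp: 1 L2_abs)
  have "(\<lambda>n. \<integral>\<^sup>+ t. ennreal ((norm (exp (- \<omega> * t) *\<^sub>R (g t - (if t \<in> J n then g t else 0))))\<^sup>2) \<partial>lebesgue) \<longlonglongrightarrow> (\<integral>\<^sup>+ t. 0 \<partial>(lebesgue :: real measure))"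
  proof (rule nn_integral_dominated_convergence[where M = lebesgue and u = "\<lambda>n t. ennreal ((norm (exp (- \<omega> * t) *\<^sub>R (g t - (if t \<in> J n then g t else 0))))\<^sup>2)"
        and u' = "\<lambda>t. 0" and w = "\<lambda>t. ennreal ((norm (exp (- \<omega> * t) *\<^sub>R g t))\<^sup>2)"])
    show "(\<lambda>t. ennreal ((norm (exp (- \<omega> * t) *\<^sub>R (g t - (if t \<in> J n then g t else 0))))\<^sup>2)) \<in> borel_measurable lebesgue" for n
      by (intro smeas_norm2_exp strongly_measurable_diff smeas_If m J smeas_const)
    show "AE t in lebesgue. (\<lambda>n. ennreal ((norm (exp (- \<omega> * t) *\<^sub>R (g t - (if t \<in> J n then g t else 0))))\<^sup>2)) \<longlonglongrightarrow> 0"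
    proof (rule AE_I2)
      fix t
      show "(\<lambda>n. ennreal ((norm (exp (- \<omega> * t) *\<^sub>R (g t - (if t \<in> J n then g t else 0))))\<^sup>2)) \<longlonglongrightarrow> 0"
        by (rule tendsto_eventually, rule eventually_mono[OF ev[of t]]) simp
    qed
    show "AE t in lebesgue. ennreal ((norm (exp (- \<omega> * t) *\<^sub>R (g t - (if t \<in> J n then g t else 0))))\<^sup>2)
        \<le> ennreal ((norm (exp (- \<omega> * t) *\<^sub>R g t))\<^sup>2)" for n
      by (rule AE_I2) simp
  qed (use fin in \<open>simp_all only: smeas_norm2_exp[OF m] borel_measurable_const\<close>)
  then have "(\<lambda>n. weighted_integral \<omega> (f - cut (J n) f)) \<longlonglongrightarrow> 0"
    by (simp add: 1 cut.abs_eq minus_aefun.abs_eq weighted_integral.abs_eq)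
  then have "(\<lambda>n. sqrt (enn2real (weighted_integral \<omega> (f - cut (J n) f)))) \<longlonglongrightarrow> sqrt (enn2real 0)"
    by (intro tendsto_real_sqrt tendsto_enn2real) auto
  then show ?thesis by (simp add: L2_norm_def)
qed

subsection \<open>Coercive Hermitian forms and extension by continuity\<close>

lemma norm_onD:
  assumes "norm_on X n"
  shows "x \<in> X \<Longrightarrow> 0 \<le> n x" "x \<in> X \<Longrightarrow> n x = 0 \<longleftrightarrow> x = 0"
    "x \<in> X \<Longrightarrow> y \<in> X \<Longrightarrow> n (x + y) \<le> n x + n y" "x \<in> X \<Longrightarrow> n (a *\<^sub>C x) = cmod a * n x"
  using assms unfolding norm_on_def by auto

lemma norm_on_zero: "norm_on X n \<Longrightarrow> csubspace X \<Longrightarrow> n 0 = 0"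
  using norm_onD(2)[of X n 0] by (auto simp: csubspace_def)

lemma norm_on_minus: "norm_on X n \<Longrightarrow> x \<in> X \<Longrightarrow> n (- x) = n x"
  using norm_onD(4)[of X n x "-1"] by (simp add: scaleC_minus1)

lemma norm_on_commute: "norm_on X n \<Longrightarrow> csubspace X \<Longrightarrow> x \<in> X \<Longrightarrow> y \<in> X \<Longrightarrow> n (x - y) = n (y - x)"
  using norm_on_minus[of X n "x - y"] by (simp add: csubspace_diff)

lemma norm_on_diff_triangle:
  "norm_on X n \<Longrightarrow> csubspace X \<Longrightarrow> x \<in> X \<Longrightarrow> y \<in> X \<Longrightarrow> z \<in> X \<Longrightarrow> n (x - z) \<le> n (x - y) + n (y - z)"
  using norm_onD(3)[of X n "x - y" "y - z"] by (simp add: csubspace_diff)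

lemma csubspaceD:
  assumes "csubspace X"
  shows "0 \<in> X" "x \<in> X \<Longrightarrow> y \<in> X \<Longrightarrow> x + y \<in> X" "x \<in> X \<Longrightarrow> a *\<^sub>C x \<in> X"
    "x \<in> X \<Longrightarrow> y \<in> X \<Longrightarrow> x - y \<in> X" "x \<in> X \<Longrightarrow> - x \<in> X"
  using assms csubspace_diff[of X x y] csubspace_uminus[of X x] unfolding csubspace_def by auto

text \<open>A Hilbert space whose given norm is only equivalent to the one of its inner product. The
  norm of \<open>V\<close> is a maximum of three norms and need not satisfy the parallelogram law;
  the form \<open>s\<close> does.\<close>

locale coercive_form =
  fixes X :: "'a::complex_vector set" and n :: "'a \<Rightarrow> real" and s :: "'a \<Rightarrow> 'a \<Rightarrow> complex"
    and c C :: real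
  assumes sub: "csubspace X" and nrm: "norm_on X n" and compl: "ncomplete X n"
    and add_right: "\<And>x y z. x \<in> X \<Longrightarrow> y \<in> X \<Longrightarrow> z \<in> X \<Longrightarrow> s x (y + z) = s x y + s x z"
    and scale_right: "\<And>x y a. x \<in> X \<Longrightarrow> y \<in> X \<Longrightarrow> s x (a *\<^sub>C y) = a * s x y"
    and herm: "\<And>x y. x \<in> X \<Longrightarrow> y \<in> X \<Longrightarrow> s x y = cnj (s y x)"
    and cpos: "0 < c"
    and coercive: "\<And>x. x \<in> X \<Longrightarrow> c * (n x)\<^sup>2 \<le> Re (s x x)"
    and bound: "\<And>x y. x \<in> X \<Longrightarrow> y \<in> X \<Longrightarrow> cmod (s x y) \<le> C * n x * n y"
begin

lemmas subD = csubspaceD[OF sub]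
lemmas nrmD = norm_onD[OF nrm]

lemma add_left: "x \<in> X \<Longrightarrow> y \<in> X \<Longrightarrow> z \<in> X \<Longrightarrow> s (x + y) z = s x z + s y z"
  using add_right[of z x y] by (simp add: herm[of _ z] subD)

lemma scale_left: "x \<in> X \<Longrightarrow> y \<in> X \<Longrightarrow> s (a *\<^sub>C x) y = cnj a * s x y"
  using scale_right[of y x a] by (simp add: herm[of _ y] subD)

lemma form_expand:
  assumes "x \<in> X" "y \<in> X"
  shows "Re (s (x + y) (x + y)) = Re (s x x) + 2 * Re (s x y) + Re (s y y)"
  using assms herm[OF assms] by (simp add: add_left add_right subD)

lemma form_scale: "x \<in> X \<Longrightarrow> Re (s (of_real t *\<^sub>C x) (of_real t *\<^sub>C x)) = t\<^sup>2 * Re (s x x)"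
  by (simp add: scale_left scale_right subD power2_eq_square)

lemma form_zero:
  assumes "a \<in> X" "\<And>x. x \<in> X \<Longrightarrow> s a x = 0" shows "a = 0"
proof -
  have "c * (n a)\<^sup>2 \<le> 0" using coercive[of a] assms by simp
  then have "n a = 0" using cpos by (simp add: mult_le_0_iff)
  then show ?thesis using nrmD(2) assms by simp
qed

text \<open>The representing vector minimises the energy \<open>Re (s x x) - 2 * Re (l x)\<close>,
  and the identity \<open>s a x = l x\<close> is its first-order condition. Coercivity bounds the
  energy from below.\<close>

lemma riesz:
  assumes ladd: "\<And>x y. x \<in> X \<Longrightarrow> y \<in> X \<Longrightarrow> l (x + y) = l x + l y"
    and lscale: "\<And>x a. x \<in> X \<Longrightarrow> l (a *\<^sub>C x) = a * l x"
    and lbd: "\<And>x. x \<in> X \<Longrightarrow> cmod (l x) \<le> M * n x"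
  obtains a where "a \<in> X" "\<And>x. x \<in> X \<Longrightarrow> s a x = l x"
proof -
  define \<phi> where "\<phi> x = Re (s x x) - 2 * Re (l x)" for x
  have Rel: "Re (l x) \<le> M * n x" if "x \<in> X" for x
    using lbd[OF that] complex_Re_le_cmod order_trans by blast
  have low: "- (M\<^sup>2 / c) \<le> \<phi> x" if "x \<in> X" for x
  proof -
    have "0 \<le> (c * n x - M)\<^sup>2 / c" using cpos by simp
    also have "\<dots> = c * (n x)\<^sup>2 - 2 * M * n x + M\<^sup>2 / c"
      using cpos by (simp add: power2_eq_square field_simps)
    finally show ?thesis using coercive[OF that] Rel[OF that] by (simp add: \<phi>_def)
  qed
  define m where "m = (INF x\<in>X. \<phi> x)"
  have bdd: "bdd_below (\<phi> ` X)" using low by (auto intro!: bdd_belowI2)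
  have ne: "X \<noteq> {}" using subD(1) by auto
  have mle: "m \<le> \<phi> x" if "x \<in> X" for x unfolding m_def using bdd that by (rule cINF_lower)
  have "\<exists>x\<in>X. \<phi> x < m + 1 / real (Suc k)" for k
  proof -
    have "Inf (\<phi> ` X) < m + 1 / real (Suc k)" by (simp add: m_def)
    then show ?thesis using cInf_less_iff[of "\<phi> ` X"] ne bdd by auto
  qed
  then obtain x where x: "\<And>k. x k \<in> X" "\<And>k. \<phi> (x k) < m + 1 / real (Suc k)" by metis
  \<comment> \<open>The parallelogram law for \<open>s\<close> at the midpoint of \<open>y\<close>
    and \<open>z\<close>: two near-minimisers of the energy are close in \<open>n\<close>, so a
    minimising sequence is Cauchy.\<close>
  have par: "c / 2 * (n (y - z))\<^sup>2 \<le> \<phi> y + \<phi> z - 2 * m" if "y \<in> X" "z \<in> X" for y z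
  proof -
    let ?p = "of_real (1/2) *\<^sub>C (y + z)"
    have p: "?p \<in> X" using that by (simp add: subD)
    have l: "Re (l ?p) = (Re (l y) + Re (l z)) / 2"
      using that by (simp add: lscale ladd subD)
    have e1: "Re (s ?p ?p) = (Re (s y y) + 2 * Re (s y z) + Re (s z z)) / 4"
      using form_expand[OF that] form_scale[of "y + z" "1/2"] that by (simp add: subD power2_eq_square)
    have "Re (s (y + (-1) *\<^sub>C z) (y + (-1) *\<^sub>C z)) = Re (s y y) - 2 * Re (s y z) + Re (s z z)"
      using form_expand[of y "(-1) *\<^sub>C z"] form_scale[of z "-1"] that by (simp add: subD scale_right)
    then have e2: "Re (s (y - z) (y - z)) = Re (s y y) - 2 * Re (s y z) + Re (s z z)"
      by (simp add: scaleC_minus1)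
    have "c * (n (y - z))\<^sup>2 \<le> Re (s (y - z) (y - z))" using that by (intro coercive subD)
    also have "\<dots> = 2 * (\<phi> y + \<phi> z - 2 * \<phi> ?p)"
      unfolding e2 \<phi>_def e1 l by (simp add: field_simps)
    also have "\<dots> \<le> 2 * (\<phi> y + \<phi> z - 2 * m)" using mle[OF p] by simp
    finally show ?thesis by simp
  qed
  obtain a where a: "a \<in> X" "(\<lambda>k. n (x k - a)) \<longlonglongrightarrow> 0"
  proof (rule ncompleteD[OF compl x(1)])
    fix e :: real assume e: "0 < e"
    obtain N where N: "4 / (c * e\<^sup>2) < real N" using reals_Archimedean2 by blast
    show "\<exists>N. \<forall>i\<ge>N. \<forall>j\<ge>N. n (x i - x j) < e"
    proof (intro exI allI impI)
      fix i j assume ij: "N \<le> i" "N \<le> j"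
      have N0: "0 < real N" using N cpos e by (meson divide_pos_pos less_trans mult_pos_pos zero_less_numeral zero_less_power)
      have "1 / real (Suc i) \<le> 1 / real N" "1 / real (Suc j) \<le> 1 / real N"
        using ij N0 by (auto intro!: divide_left_mono mult_pos_pos)
      then have "c / 2 * (n (x i - x j))\<^sup>2 < 2 / real N"
        using par[OF x(1)[of i] x(1)[of j]] x(2)[of i] x(2)[of j] by linarith
      also have "2 / real N < c / 2 * e\<^sup>2"
      proof -
        have "4 < real N * (c * e\<^sup>2)" using N cpos e by (simp add: divide_less_eq)
        then show ?thesis using N0 by (simp add: divide_less_eq algebra_simps)
      qed
      finally have "(n (x i - x j))\<^sup>2 < e\<^sup>2" using cpos by (simp add: mult_less_cancel_left_pos)
      then show "n (x i - x j) < e" by (rule power_less_imp_less_base) (use e in simp)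
    qed
  qed auto
  have phia: "\<phi> a \<le> m"
  proof (rule LIMSEQ_le_const)
    have C: "\<bar>\<phi> (x k) - \<phi> a\<bar> \<le> 2 * (\<bar>C\<bar> * n a * n (x k - a)) + \<bar>C\<bar> * n (x k - a) * n (x k - a) + 2 * (M * n (x k - a))" for k
    proof -
      have d: "x k - a \<in> X" using a x by (simp add: subD)
      have "\<phi> (x k) - \<phi> a = 2 * Re (s a (x k - a)) + Re (s (x k - a) (x k - a)) - 2 * Re (l (x k - a))"
        using form_expand[OF a(1) d] ladd[OF a(1) d] by (simp add: \<phi>_def)
      moreover have "\<bar>Re (s a (x k - a))\<bar> \<le> \<bar>C\<bar> * n a * n (x k - a)"
        using bound[OF a(1) d] abs_Re_le_cmod[of "s a (x k - a)"] nrmD(1)[OF a(1)] nrmD(1)[OF d]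
          mult_right_mono[of "C * n a" "\<bar>C\<bar> * n a" "n (x k - a)"] mult_right_mono[of C "\<bar>C\<bar>" "n a"] by linarith
      moreover have "\<bar>Re (s (x k - a) (x k - a))\<bar> \<le> \<bar>C\<bar> * n (x k - a) * n (x k - a)"
        using bound[OF d d] abs_Re_le_cmod[of "s (x k - a) (x k - a)"] nrmD(1)[OF d]
          mult_right_mono[of "C * n (x k - a)" "\<bar>C\<bar> * n (x k - a)" "n (x k - a)"] mult_right_mono[of C "\<bar>C\<bar>" "n (x k - a)"] by linarith
      moreover have "\<bar>Re (l (x k - a))\<bar> \<le> M * n (x k - a)"
        using lbd[OF d] abs_Re_le_cmod[of "l (x k - a)"] by linarith
      ultimately show ?thesis by linarith
    qed
    have "(\<lambda>k. 2 * (\<bar>C\<bar> * n a * n (x k - a)) + \<bar>C\<bar> * n (x k - a) * n (x k - a) + 2 * (M * n (x k - a))) \<longlonglongrightarrow>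
        2 * (\<bar>C\<bar> * n a * 0) + \<bar>C\<bar> * 0 * 0 + 2 * (M * 0)"
      by (intro tendsto_intros a(2))
    then have "(\<lambda>k. 2 * (\<bar>C\<bar> * n a * n (x k - a)) + \<bar>C\<bar> * n (x k - a) * n (x k - a) + 2 * (M * n (x k - a))) \<longlonglongrightarrow> 0"
      by simp
    then have t0: "(\<lambda>k. \<phi> (x k) - \<phi> a) \<longlonglongrightarrow> 0"
      by (rule Lim_null_comparison[rotated]) (use C in auto)
    have "(\<lambda>k. m + 1 / real (Suc k) - (\<phi> (x k) - \<phi> a)) \<longlonglongrightarrow> m + 0 - 0"
      by (intro tendsto_intros t0 LIMSEQ_inverse_real_of_nat[unfolded inverse_eq_divide])
    then show "(\<lambda>k. m + 1 / real (Suc k) - (\<phi> (x k) - \<phi> a)) \<longlonglongrightarrow> m" by simp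
    show "\<exists>N. \<forall>k\<ge>N. \<phi> a \<le> m + 1 / real (Suc k) - (\<phi> (x k) - \<phi> a)"
      using x(2) by (intro exI[of _ 0]) (auto intro: less_imp_le simp: algebra_simps)
  qed
  have re0: "Re (s a y - l y) = 0" if y: "y \<in> X" for y
  proof (rule ccontr)
    assume ne: "Re (s a y - l y) \<noteq> 0"
    define g where "g = Re (s a y - l y)"
    define S where "S = Re (s y y)"
    have q: "0 \<le> 2 * t * g + t\<^sup>2 * S" for t :: real
    proof -
      have ty: "of_real t *\<^sub>C y \<in> X" using y by (simp add: subD)
      have "m \<le> \<phi> (a + of_real t *\<^sub>C y)" using a y by (intro mle subD)
      moreover have "\<phi> (a + of_real t *\<^sub>C y) = \<phi> a + 2 * t * g + t\<^sup>2 * S"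
        using form_expand[OF a(1) ty] form_scale[OF y, of t] ladd[OF a(1) ty]
        by (simp add: \<phi>_def g_def S_def scale_right[OF a(1) y] lscale[OF y] algebra_simps)
      ultimately show ?thesis using phia by simp
    qed
    have S0: "0 \<le> S" using coercive[OF y] cpos unfolding S_def
      by (meson mult_nonneg_nonneg less_imp_le order_trans zero_le_power2)
    \<comment> \<open>The quadratic \<open>2 * t * g + t^2 * S\<close> is nonnegative for all real
      \<open>t\<close>, which forces \<open>g = 0\<close>. The denominator is \<open>S + 1\<close>
      because \<open>S\<close> vanishes when \<open>y = 0\<close>.\<close>
    define t where "t = - g / (S + 1)"
    have tP: "t * (S + 1) = - g" using S0 by (simp add: t_def)
    have "(2 * t * g + t\<^sup>2 * S) * (S + 1)\<^sup>2 = 2 * (t * (S + 1)) * g * (S + 1) + (t * (S + 1))\<^sup>2 * S"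
      by (simp add: power2_eq_square algebra_simps)
    also have "\<dots> = - (g\<^sup>2 * (S + 2))" unfolding tP by (simp add: power2_eq_square algebra_simps)
    also have "\<dots> < 0" using S0 ne by (simp add: g_def)
    finally show False using q[of t] by (meson mult_nonneg_nonneg not_less zero_le_power2)
  qed
  have "s a y = l y" if y: "y \<in> X" for y
  proof -
    have "Re (\<i> * (s a y - l y)) = 0"
      using re0[of "\<i> *\<^sub>C y"] y a by (simp add: subD scale_right lscale)
    then show ?thesis using re0[OF y] by (simp add: complex_eq_iff)
  qed
  with a(1) show ?thesis using that by blast
qed

end

text \<open>The map is given by a linear relation \<open>G\<close> instead of a function on its
  domain. The bound on \<open>G\<close> already makes it single valued, so generators can be
  assigned values without checking that linear relations among them are respected.\<close>

lemma extension_by_continuity: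
  fixes G :: "('a::complex_vector \<times> 'b::complex_vector) set"
  assumes X: "csubspace X" "norm_on X n" and Y: "csubspace Y" "norm_on Y nY" "ncomplete Y nY"
    and G: "csubspace G" "\<And>w u. (w, u) \<in> G \<Longrightarrow> w \<in> X \<and> u \<in> Y \<and> nY u \<le> c * n w"
    and dense: "\<And>x e. x \<in> X \<Longrightarrow> 0 < e \<Longrightarrow> \<exists>(w, u)\<in>G. n (x - w) < e"
    and c: "0 \<le> c"
  obtains T where "T ` X \<subseteq> Y" "clinear_on X T" "\<And>x. x \<in> X \<Longrightarrow> nY (T x) \<le> c * n x"
    "\<And>w u. (w, u) \<in> G \<Longrightarrow> T w = u"
proof -
  note XD = csubspaceD[OF X(1)] and YD = csubspaceD[OF Y(1)]
  note nD = norm_onD[OF X(2)] and nYD = norm_onD[OF Y(2)]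
  have Gadd: "(w + w', u + u') \<in> G" if "(w, u) \<in> G" "(w', u') \<in> G" for w w' u u'
    using csubspaceD(2)[OF G(1) that] by simp
  have Gscale: "(a *\<^sub>C w, a *\<^sub>C u) \<in> G" if "(w, u) \<in> G" for w u a
    using csubspaceD(3)[OF G(1) that, of a] by (simp add: scaleC_prod_def)
  have Gdiff: "(w - w', u - u') \<in> G" if "(w, u) \<in> G" "(w', u') \<in> G" for w w' u u'
    using csubspaceD(4)[OF G(1) that] by simp
  \<comment> \<open>This is the closure of \<open>G\<close> in the product space. The bound passes
    to it, hence it is again the graph of a function, and density with completeness of
    \<open>Y\<close> makes that function total.\<close>
  define R where "R x y \<longleftrightarrow> x \<in> X \<and> y \<in> Y \<and> (\<forall>e>0. \<exists>w u. (w, u) \<in> G \<and> n (x - w) < e \<and> nY (y - u) < e)" for x y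
  have Rbd: "nY y \<le> c * n x" if R: "R x y" for x y
  proof (rule field_le_epsilon)
    fix e :: real assume e: "0 < e"
    define d where "d = e / (c + 1)"
    have d: "0 < d" using e c by (simp add: d_def)
    obtain w u where wu: "(w, u) \<in> G" "n (x - w) < d" "nY (y - u) < d" using R d unfolding R_def by blast
    have m: "x \<in> X" "y \<in> Y" "w \<in> X" "u \<in> Y" "nY u \<le> c * n w" using R G(2)[OF wu(1)] by (auto simp: R_def)
    have "nY y \<le> nY (y - u) + nY u" using nYD(3)[of "y - u" u] m by (simp add: YD)
    also have "\<dots> \<le> d + c * n w" using wu m by simp
    also have "n w \<le> n x + d" using nD(3)[of "w - x" x] m wu norm_on_commute[OF X(2) X(1), of w x] by (simp add: XD)
    then have "d + c * n w \<le> d + c * (n x + d)" using c by (simp add: mult_left_mono)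
    also have "\<dots> = c * n x + (c + 1) * d" by (simp add: algebra_simps)
    also have "(c + 1) * d = e" using c by (simp add: d_def)
    finally show "nY y \<le> c * n x + e" .
  qed
  have Radd: "R (x + x') (y + y')" if R: "R x y" "R x' y'" for x x' y y'
    unfolding R_def
  proof (intro conjI allI impI)
    show "x + x' \<in> X" "y + y' \<in> Y" using R by (auto simp: R_def XD YD)
    fix e :: real assume "0 < e"
    then obtain w u w' u' where wu: "(w, u) \<in> G" "n (x - w) < e/2" "nY (y - u) < e/2"
      "(w', u') \<in> G" "n (x' - w') < e/2" "nY (y' - u') < e/2"
      using R unfolding R_def by (meson half_gt_zero)
    have m: "x \<in> X" "y \<in> Y" "w \<in> X" "u \<in> Y" "x' \<in> X" "y' \<in> Y" "w' \<in> X" "u' \<in> Y"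
      using R G(2)[OF wu(1)] G(2)[OF wu(4)] by (auto simp: R_def)
    have "n ((x + x') - (w + w')) < e"
      using nD(3)[of "x - w" "x' - w'"] m wu by (simp add: XD add_diff_add)
    moreover have "nY ((y + y') - (u + u')) < e"
      using nYD(3)[of "y - u" "y' - u'"] m wu by (simp add: YD add_diff_add)
    ultimately show "\<exists>w u. (w, u) \<in> G \<and> n (x + x' - w) < e \<and> nY (y + y' - u) < e"
      using Gadd[OF wu(1,4)] by blast
  qed
  have Rscale: "R (a *\<^sub>C x) (a *\<^sub>C y)" if R: "R x y" for a x y
    unfolding R_def
  proof (intro conjI allI impI)
    show "a *\<^sub>C x \<in> X" "a *\<^sub>C y \<in> Y" using R by (auto simp: R_def XD YD)
    fix e :: real assume e: "0 < e"
    have e': "0 < e / (cmod a + 1)" using e by (simp add: add_nonneg_pos)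
    then obtain w u where wu: "(w, u) \<in> G" "n (x - w) < e / (cmod a + 1)" "nY (y - u) < e / (cmod a + 1)"
      using R unfolding R_def by blast
    have m: "x \<in> X" "y \<in> Y" "w \<in> X" "u \<in> Y" using R G(2)[OF wu(1)] by (auto simp: R_def)
    have small: "cmod a * r < e" if "r < e / (cmod a + 1)" "0 \<le> r" for r
    proof -
      have "cmod a * r \<le> (cmod a + 1) * r" using that by (simp add: mult_right_mono)
      also have "\<dots> < (cmod a + 1) * (e / (cmod a + 1))"
        using that by (intro mult_strict_left_mono) (simp_all add: add_nonneg_pos)
      also have "\<dots> = e" using norm_ge_zero[of a] by (simp add: add_nonneg_eq_0_iff)
      finally show ?thesis .
    qed
    have "n (a *\<^sub>C x - a *\<^sub>C w) < e"
      using small[OF wu(2)] nD(1)[of "x - w"] nD(4)[of "x - w" a] m by (simp add: XD scaleC_diff_right)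
    moreover have "nY (a *\<^sub>C y - a *\<^sub>C u) < e"
      using small[OF wu(3)] nYD(1)[of "y - u"] nYD(4)[of "y - u" a] m by (simp add: YD scaleC_diff_right)
    ultimately show "\<exists>w u. (w, u) \<in> G \<and> n (a *\<^sub>C x - w) < e \<and> nY (a *\<^sub>C y - u) < e"
      using Gscale[OF wu(1)] by blast
  qed
  have Runique: "y = y'" if R: "R x y" "R x y'" for x y y'
  proof -
    have "R (x + (-1) *\<^sub>C x) (y + (-1) *\<^sub>C y')" by (intro Radd Rscale R)
    then have "nY (y - y') \<le> c * n 0" using Rbd by (fastforce simp: scaleC_minus1)
    then have "nY (y - y') = 0" using norm_on_zero[OF X(2,1)] nYD(1)[of "y - y'"] R by (auto simp: R_def YD)
    then show ?thesis using nYD(2)[of "y - y'"] R by (auto simp: R_def YD)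
  qed
  have Rex: "\<exists>y. R x y" if x: "x \<in> X" for x
  proof -
    have "\<exists>w u. (w, u) \<in> G \<and> n (x - w) < 1 / real (Suc k)" for k
      using dense[OF x, of "1 / real (Suc k)"] by auto
    then obtain w u where wu: "\<And>k. (w k, u k) \<in> G" "\<And>k. n (x - w k) < 1 / real (Suc k)" by metis
    have m: "w k \<in> X" "u k \<in> Y" for k using G(2)[OF wu(1)] by auto
    obtain y where y: "y \<in> Y" "(\<lambda>k. nY (u k - y)) \<longlonglongrightarrow> 0"
    proof (rule ncompleteD[OF Y(3) m(2)])
      fix e :: real assume e: "0 < e"
      obtain N where N: "2 * (c + 1) / e < real N" using reals_Archimedean2 by blast
      show "\<exists>N. \<forall>i\<ge>N. \<forall>j\<ge>N. nY (u i - u j) < e"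
      proof (intro exI allI impI)
        fix i j assume ij: "N \<le> i" "N \<le> j"
        have N0: "0 < real N" using N c e by (meson add_nonneg_pos divide_pos_pos less_trans mult_pos_pos zero_less_numeral zero_less_one)
        have "1 / real (Suc i) \<le> 1 / real N" "1 / real (Suc j) \<le> 1 / real N"
          using ij N0 by (auto intro!: divide_left_mono mult_pos_pos)
        moreover have "n (w i - w j) \<le> n (x - w i) + n (x - w j)"
          using norm_on_diff_triangle[OF X(2,1) m(1)[of i] x m(1)[of j]] norm_on_commute[OF X(2,1) m(1)[of i] x] by simp
        ultimately have "n (w i - w j) \<le> 2 / real N" using wu(2)[of i] wu(2)[of j] by linarith
        then have "c * n (w i - w j) \<le> c * (2 / real N)" using c by (rule mult_left_mono)
        then have "nY (u i - u j) \<le> c * (2 / real N)" using G(2)[OF Gdiff[OF wu(1)[of i] wu(1)[of j]]] by linarith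
        also have "\<dots> < e"
        proof -
          have "2 * (c + 1) < real N * e" using N e by (simp add: divide_less_eq)
          then show ?thesis using N0 by (simp add: divide_less_eq algebra_simps)
        qed
        finally show "nY (u i - u j) < e" .
      qed
    qed auto
    have "R x y" unfolding R_def
    proof (intro conjI allI impI x y)
      fix e :: real assume e: "0 < e"
      have "\<forall>\<^sub>F k in sequentially. 1 / real (Suc k) < e"
        using order_tendstoD(2)[OF LIMSEQ_inverse_real_of_nat e] by (simp add: inverse_eq_divide)
      moreover have "\<forall>\<^sub>F k in sequentially. nY (u k - y) < e" using order_tendstoD(2)[OF y(2) e] .
      ultimately have "\<forall>\<^sub>F k in sequentially. n (x - w k) < e \<and> nY (y - u k) < e"
      proof eventually_elim
        case (elim k)
        then show ?case using wu(2)[of k] norm_on_commute[OF Y(2,1) m(2)[of k] y(1)] by simp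
      qed
      from eventually_happens'[OF sequentially_bot this] obtain k where "n (x - w k) < e \<and> nY (y - u k) < e" by blast
      then show "\<exists>w u. (w, u) \<in> G \<and> n (x - w) < e \<and> nY (y - u) < e" using wu(1) by blast
    qed
    then show ?thesis ..
  qed
  define T where "T x = (SOME y. R x y)" for x
  have T: "R x (T x)" if "x \<in> X" for x unfolding T_def using Rex[OF that] by (rule someI_ex)
  show ?thesis
  proof (rule that)
    show "T ` X \<subseteq> Y" using T by (auto simp: R_def)
    show "clinear_on X T" unfolding clinear_on_def
    proof (intro conjI ballI allI)
      show "T (x + y) = T x + T y" if "x \<in> X" "y \<in> X" for x y
        by (rule Runique[OF T Radd[OF T T]]) (use that in \<open>auto simp: XD\<close>)
      show "T (a *\<^sub>C x) = a *\<^sub>C T x" if "x \<in> X" for a x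
        by (rule Runique[OF T Rscale[OF T]]) (use that in \<open>auto simp: XD\<close>)
    qed
    show "nY (T x) \<le> c * n x" if "x \<in> X" for x using Rbd[OF T[OF that]] .
    show "T w = u" if wu: "(w, u) \<in> G" for w u
    proof (rule Runique[OF T])
      have "n (w - w) = 0" "nY (u - u) = 0" using norm_on_zero X Y by auto
      then show "R w u" unfolding R_def using G(2)[OF wu] wu by force
      show "w \<in> X" using G(2)[OF wu] by simp
    qed
  qed
qed

text \<open>Zabreiko's lemma; it replaces the closed graph theorem.\<close>

lemma countably_subadditive_seminorm_bounded:
  fixes p :: "'h::chilbert_space \<Rightarrow> real"
  assumes nonneg: "\<And>x. 0 \<le> p x"
    and add: "\<And>x y. p (x + y) \<le> p x + p y" and scale: "\<And>r x. p (r *\<^sub>R x) = \<bar>r\<bar> * p x"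
    and csub: "\<And>f x. f sums x \<Longrightarrow> summable (\<lambda>k. p (f k)) \<Longrightarrow> p x \<le> (\<Sum>k. p (f k))"
  obtains M where "\<And>x. p x \<le> M * norm x"
proof -
  define A where "A k = {x. p x \<le> real k}" for k
  have cover: "(\<Union>k. A k) = UNIV" unfolding A_def using real_arch_simple by (auto simp: set_eq_iff)
  have "\<exists>k. interior (closure (A k)) \<noteq> {}"
  proof (rule ccontr)
    assume "\<not> ?thesis"
    then have emp: "interior (closure (A k)) = {}" for k by blast
    have "Met_TC.mtopology interior_of \<Union>(range (\<lambda>k. closure (A k))) = {}"
      by (rule Met_TC.metric_Baire_category_alt) (use emp in \<open>auto simp: complete_UNIV\<close>)
    then have "interior (\<Union>k. closure (A k)) = {}" by simp
    moreover have "(\<Union>k. closure (A k)) = UNIV" using cover closure_subset by blast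
    ultimately show False by simp
  qed
  then obtain k x0 where "x0 \<in> interior (closure (A k))" by blast
  then obtain r where r: "0 < r" "ball x0 r \<subseteq> closure (A k)" by (auto simp: mem_interior)
  have neg: "p (- x) = p x" for x using scale[of "-1" x] by simp
  \<comment> \<open>The factor \<open>t = r / s\<close> scales \<open>x\<close> into the ball on
    which \<open>A k\<close> is dense. Subtracting an approximant of the centre \<open>x0\<close>
    from one of \<open>x0 + t x\<close> moves the ball to the origin; \<open>p\<close> of the
    difference is at most \<open>2 * k\<close>.\<close>
  have approx: "\<exists>y. norm (x - y) < e \<and> p y \<le> 2 * real k / r * s" if nx: "norm x < s" and e: "0 < e" for x :: 'h and e s
  proof -
    define t where "t = r / s"
    have s: "0 < s" using nx by (metis norm_ge_zero order.strict_trans1)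
    have t: "0 < t" using s r by (simp add: t_def)
    have b: "norm (t *\<^sub>R x) < r" using nx s r t mult_strict_left_mono[of "norm x" s t] by (simp add: t_def)
    have "x0 + t *\<^sub>R x \<in> closure (A k)" "x0 \<in> closure (A k)" using r b by (auto simp: subset_eq dist_norm)
    moreover have te: "0 < t * e / 2" using t e by simp
    ultimately obtain y1 y0 where y: "y1 \<in> A k" "dist y1 (x0 + t *\<^sub>R x) < t * e / 2" "y0 \<in> A k" "dist y0 x0 < t * e / 2"
      unfolding closure_approachable by blast
    define y where "y = (1 / t) *\<^sub>R (y1 - y0)"
    have "x - y = (1 / t) *\<^sub>R (((x0 + t *\<^sub>R x) - y1) + (y0 - x0))"
      using t by (simp add: y_def algebra_simps)
    then have "norm (x - y) = (1 / t) * norm (((x0 + t *\<^sub>R x) - y1) + (y0 - x0))" using t by simp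
    also have "\<dots> < (1 / t) * (t * e)"
    proof (rule mult_strict_left_mono)
      have "norm (((x0 + t *\<^sub>R x) - y1) + (y0 - x0)) \<le> norm ((x0 + t *\<^sub>R x) - y1) + norm (y0 - x0)" by (rule norm_triangle_ineq)
      also have "\<dots> < t * e / 2 + t * e / 2" using y by (intro add_strict_mono) (simp_all add: dist_norm norm_minus_commute)
      finally show "norm (((x0 + t *\<^sub>R x) - y1) + (y0 - x0)) < t * e" by (simp only: field_sum_of_halves)
    qed (use t in simp)
    also have "\<dots> = e" using t by simp
    finally have 1: "norm (x - y) < e" .
    have "p y = (1 / t) * p (y1 - y0)" unfolding y_def scale using t by simp
    also have "p (y1 - y0) \<le> 2 * real k" using add[of y1 "- y0"] neg[of y0] y by (simp add: A_def)
    then have "(1 / t) * p (y1 - y0) \<le> (1 / t) * (2 * real k)" using t by (intro mult_left_mono) auto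
    also have "\<dots> = 2 * real k / r * s" using s r by (simp add: t_def)
    finally show ?thesis using 1 by blast
  qed
  define K where "K = 2 * real k / r"
  have K0: "0 \<le> K" using r by (simp add: K_def)
  \<comment> \<open>Successive approximation: the bound on the residual is halved at every step, so
    \<open>x\<close> is the sum of a series whose values of \<open>p\<close> are dominated by a
    geometric series, and countable subadditivity applies.\<close>
  have main: "p x \<le> 4 * K * s" if x: "norm x < s" for x s
  proof -
    have s: "0 < s" using x by (metis norm_ge_zero order.strict_trans1)
    have ex: "\<exists>y. norm z < s / 2 ^ i \<longrightarrow> norm (z - y) < s / 2 ^ Suc i \<and> p y \<le> K * (s / 2 ^ i)" for z :: 'h and i :: nat
      using approx[of z "s / 2 ^ i" "s / 2 ^ Suc i"] s unfolding K_def by auto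
    define Y where "Y z i = (SOME y. norm z < s / 2 ^ i \<longrightarrow> norm (z - y) < s / 2 ^ Suc i \<and> p y \<le> K * (s / 2 ^ i))" for z :: 'h and i :: nat
    have Y: "\<And>z i. norm z < s / 2 ^ i \<Longrightarrow> norm (z - Y z i) < s / 2 ^ Suc i \<and> p (Y z i) \<le> K * (s / 2 ^ i)"
      using someI_ex[OF ex] unfolding Y_def by blast
    define z where "z = rec_nat x (\<lambda>i w. w - Y w i)"
    have z0: "z 0 = x" and zS: "\<And>i. z (Suc i) = z i - Y (z i) i" by (simp_all add: z_def)
    have zn: "norm (z i) < s / 2 ^ i" for i
      by (induction i) (use x Y in \<open>auto simp: z0 zS\<close>)
    define f where "f i = Y (z i) i" for i
    have ps: "p (f i) \<le> K * s * (1/2) ^ i" for i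
      using Y[OF zn[of i]] by (simp add: f_def power_divide)
    have part: "(\<Sum>i<m. f i) = x - z m" for m by (induction m) (simp_all add: z0 zS f_def)
    have "(\<lambda>m. s * (1/2) ^ m) \<longlonglongrightarrow> s * 0" by (intro tendsto_intros) auto
    then have "(\<lambda>m. s / 2 ^ m) \<longlonglongrightarrow> 0" by (simp add: power_divide)
    then have "z \<longlonglongrightarrow> 0"
      by (rule Lim_null_comparison[rotated]) (intro always_eventually allI less_imp_le zn)
    then have "(\<lambda>m. x - z m) \<longlonglongrightarrow> x - 0" by (intro tendsto_intros)
    then have sums: "f sums x" by (simp add: sums_def part)
    have sg: "summable (\<lambda>i. K * s * (1/2) ^ i)" by (intro summable_mult summable_geometric) simp
    have sp: "summable (\<lambda>i. p (f i))"
      by (rule summable_comparison_test'[OF sg, of 0]) (use nonneg ps in auto)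
    have "p x \<le> (\<Sum>i. p (f i))" using csub[OF sums sp] .
    also have "\<dots> \<le> (\<Sum>i. K * s * (1/2) ^ i)" by (rule suminf_le[OF ps sp sg])
    also have "\<dots> = K * s * 2" by (subst suminf_mult) (auto simp: suminf_geometric intro: summable_geometric)
    also have "\<dots> \<le> 4 * K * s" using K0 s by simp
    finally show ?thesis .
  qed
  show ?thesis
  proof (rule that)
    fix x
    show "p x \<le> 8 * K * norm x"
    proof (cases "x = 0")
      case True then show ?thesis using scale[of 0 0] by simp
    next
      case False
      then have "norm x < 2 * norm x" by simp
      from main[OF this] show ?thesis by (simp add: algebra_simps)
    qed
  qed
qed

subsection \<open>Estimates on unit intervals\<close>

lemma weighted_integral_cut:
  "weighted_integral \<omega> (cut I (abs_aefun f)) =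
    (\<integral>\<^sup>+ t. ennreal ((norm (exp (- \<omega> * t) *\<^sub>R f t))\<^sup>2) * indicator I t \<partial>lebesgue)"
  unfolding cut.abs_eq weighted_integral.abs_eq by (intro nn_integral_cong) (auto simp: indicator_def)

text \<open>The total weight that the time \<open>t\<close> collects from all slices
  \<open>[n, n+1)\<close> whose past \<open>t < n + 1\<close> contains it. The slices start at the
  integer part of \<open>t\<close>, so this is a geometric series; the factor \<open>exp d\<close>
  pays for replacing the integer part by \<open>t\<close>.\<close>

lemma nn_integral_exp_ge_floor:
  assumes "0 < d"
  shows "(\<integral>\<^sup>+ n. ennreal (exp (- d * real_of_int n)) * indicator {..<real_of_int n + 1} t \<partial>count_space UNIV)
    \<le> ennreal (exp d / (1 - exp (- d))) * ennreal (exp (- d * t))"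
proof -
  let ?m = "\<lfloor>t\<rfloor>"
  have e1: "exp (- d) < 1" using assms by simp
  have "(\<integral>\<^sup>+ n. ennreal (exp (- d * real_of_int n)) * indicator {..<real_of_int n + 1} t \<partial>count_space UNIV)
     = (\<integral>\<^sup>+ n. ennreal (exp (- d * real_of_int n)) * indicator {?m..} n \<partial>count_space UNIV)"
    by (intro nn_integral_cong) (auto simp: indicator_def floor_le_iff not_less le_floor_iff)
  also have "\<dots> = (\<integral>\<^sup>+ n. ennreal (exp (- d * real_of_int n)) \<partial>count_space {?m..})"
    by (subst nn_integral_count_space_indicator) auto
  also have "\<dots> = (\<integral>\<^sup>+ k. ennreal (exp (- d * real_of_int (?m + int k))) \<partial>count_space UNIV)"
  proof (rule nn_integral_bij_count_space[symmetric])
    show "bij_betw (\<lambda>k. ?m + int k) UNIV {?m..}"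
      by (rule bij_betwI[where g = "\<lambda>n. nat (n - ?m)"]) auto
  qed
  also have "\<dots> = (\<Sum>k. ennreal (exp (- d * real_of_int ?m) * exp (- d) ^ k))"
    unfolding nn_integral_count_space_nat
    by (simp add: exp_of_nat_mult[symmetric] exp_add[symmetric] algebra_simps)
  also have "\<dots> = ennreal (\<Sum>k. exp (- d * real_of_int ?m) * exp (- d) ^ k)"
    using e1 by (intro suminf_ennreal2 summable_mult summable_geometric) auto
  also have "(\<Sum>k. exp (- d * real_of_int ?m) * exp (- d) ^ k) = exp (- d * real_of_int ?m) / (1 - exp (- d))"
    using e1 by (subst suminf_mult) (auto simp: suminf_geometric intro: summable_geometric)
  also have "\<dots> \<le> exp d / (1 - exp (- d)) * exp (- d * t)"
  proof -
    have "exp (- d * real_of_int ?m) \<le> exp (d + - d * t)"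
      using assms real_of_int_floor_gt_diff_one[of t] mult_left_mono[of "t - 1" "real_of_int ?m" d]
      by (simp add: algebra_simps)
    then have "exp (- d * real_of_int ?m) / (1 - exp (- d)) \<le> (exp d * exp (- d * t)) / (1 - exp (- d))"
      unfolding exp_add using e1 by (intro divide_right_mono) auto
    then show ?thesis by simp
  qed
  then have "ennreal (exp (- d * real_of_int ?m) / (1 - exp (- d))) \<le> ennreal (exp d / (1 - exp (- d)) * exp (- d * t))"
    by (rule ennreal_leI)
  also have "\<dots> = ennreal (exp d / (1 - exp (- d))) * ennreal (exp (- d * t))"
    using e1 by (intro ennreal_mult) auto
  finally show ?thesis .
qed

text \<open>Turns a local causal estimate into a global one. The bound on slice \<open>n\<close>
  sees the whole past of \<open>u\<close> at the weight \<open>\<gamma>\<close>; after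
  multiplication by the weight \<open>\<beta>\<close> of the slice, the sum over \<open>n\<close>
  converges at each time because \<open>\<gamma> < \<beta>\<close>, and Tonelli exchanges sum and
  integral.\<close>

lemma weighted_integral_slices:
  fixes w :: "'a::real_normed_vector aefun" and u :: "'b::real_normed_vector aefun" and \<beta> \<gamma> C :: real
  assumes sw: "strongly_measurable w" and su: "strongly_measurable u" and "\<gamma> < \<beta>" and C: "0 \<le> C"
    and h: "\<And>n::int. weighted_integral 0 (cut {real_of_int n..<real_of_int n + 1} w)
        \<le> ennreal ((C * exp (\<gamma> * n))\<^sup>2) * weighted_integral \<gamma> (cut {..<real_of_int n + 1} u)"
  shows "weighted_integral \<beta> w \<le>
    ennreal ((exp \<bar>\<beta>\<bar> * C)\<^sup>2 * (exp (2 * (\<beta> - \<gamma>)) / (1 - exp (- (2 * (\<beta> - \<gamma>)))))) * weighted_integral \<beta> u"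
proof (cases w; cases u)
  fix f g assume w: "w = abs_aefun f" and u: "u = abs_aefun g"
  define d where "d = 2 * (\<beta> - \<gamma>)"
  have d: "0 < d" using assms(3) by (simp add: d_def)
  have e1: "exp (- d) < 1" using d by simp
  define \<phi> where "\<phi> t = ennreal ((norm (exp (- \<beta> * t) *\<^sub>R f t))\<^sup>2)" for t
  define \<psi> where "\<psi> t = ennreal ((norm (exp (- \<gamma> * t) *\<^sub>R g t))\<^sup>2)" for t
  have fm: "smeas f" "smeas g" using sw su by (simp_all add: w u strongly_measurable_abs)
  have [measurable]: "\<phi> \<in> borel_measurable lebesgue" "\<psi> \<in> borel_measurable lebesgue"
    unfolding \<phi>_def \<psi>_def by (intro smeas_norm2_exp fm)+
  have slice: "(\<integral>\<^sup>+ t. \<phi> t * indicator {real_of_int n..<real_of_int n + 1} t \<partial>lebesgue)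
      \<le> (\<integral>\<^sup>+ t. ennreal ((exp \<bar>\<beta>\<bar> * C)\<^sup>2) * (ennreal (exp (- d * real_of_int n)) * (\<psi> t * indicator {..<real_of_int n + 1} t)) \<partial>lebesgue)" for n :: int
  proof -
    let ?I = "{real_of_int n..<real_of_int n + 1}"
    have "(\<integral>\<^sup>+ t. \<phi> t * indicator ?I t \<partial>lebesgue) = weighted_integral \<beta> (cut ?I w)"
      unfolding w weighted_integral_cut \<phi>_def ..
    also have "\<dots> \<le> ennreal ((exp \<bar>\<beta>\<bar> * exp (- \<beta> * n))\<^sup>2) * weighted_integral 0 (cut ?I w)"
    proof (rule weighted_integral_mono)
      fix t :: real assume t: "t \<in> ?I"
      have "\<bar>\<beta> * (n - t)\<bar> \<le> \<bar>\<beta>\<bar> * 1"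
        using t unfolding abs_mult by (intro mult_left_mono) auto
      then have "- \<beta> * t \<le> \<bar>\<beta>\<bar> + - \<beta> * n" by (simp add: algebra_simps abs_le_iff)
      then show "exp (- \<beta> * t) \<le> exp \<bar>\<beta>\<bar> * exp (- \<beta> * n) * exp (- 0 * t)"
        by (simp add: exp_add[symmetric])
    qed (use sw in \<open>auto intro: strongly_measurable_cut\<close>)
    also have "\<dots> \<le> ennreal ((exp \<bar>\<beta>\<bar> * exp (- \<beta> * n))\<^sup>2) * (ennreal ((C * exp (\<gamma> * n))\<^sup>2) * weighted_integral \<gamma> (cut {..<real_of_int n + 1} u))"
      by (intro mult_left_mono h) auto
    also have "\<dots> = ennreal ((exp \<bar>\<beta>\<bar> * C)\<^sup>2 * exp (- d * n)) * weighted_integral \<gamma> (cut {..<real_of_int n + 1} u)"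
    proof -
      have "exp (- d * n) = (exp (- \<beta> * n) * exp (\<gamma> * n))\<^sup>2"
        unfolding exp_add[symmetric] exp_double[symmetric] by (simp add: d_def algebra_simps)
      then have "(exp \<bar>\<beta>\<bar> * exp (- \<beta> * n))\<^sup>2 * (C * exp (\<gamma> * n))\<^sup>2 = (exp \<bar>\<beta>\<bar> * C)\<^sup>2 * exp (- d * n)"
        by (simp add: power_mult_distrib mult_ac)
      then show ?thesis by (simp add: mult.assoc[symmetric] ennreal_mult[symmetric])
    qed
    also have "\<dots> = (\<integral>\<^sup>+ t. ennreal ((exp \<bar>\<beta>\<bar> * C)\<^sup>2) * (ennreal (exp (- d * real_of_int n)) * (\<psi> t * indicator {..<real_of_int n + 1} t)) \<partial>lebesgue)"
    proof -
      have m1: "(\<lambda>t. \<psi> t * indicator {..<real_of_int n + 1} t) \<in> borel_measurable lebesgue"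
        by (intro borel_measurable_times_ennreal borel_measurable_indicator) auto
      then have m2: "(\<lambda>t. ennreal (exp (- d * real_of_int n)) * (\<psi> t * indicator {..<real_of_int n + 1} t)) \<in> borel_measurable lebesgue"
        by (rule borel_measurable_times_ennreal[OF borel_measurable_const])
      show ?thesis
        unfolding u weighted_integral_cut \<psi>_def[symmetric] nn_integral_cmult[OF m2] nn_integral_cmult[OF m1]
        by (simp add: ennreal_mult mult.assoc)
    qed
    finally show ?thesis .
  qed
  have "weighted_integral \<beta> w = (\<integral>\<^sup>+ t. \<phi> t \<partial>lebesgue)" by (simp add: w weighted_integral.abs_eq \<phi>_def)
  also have "\<dots> = (\<integral>\<^sup>+ t. \<integral>\<^sup>+ n. \<phi> t * indicator {real_of_int n..<real_of_int n + 1} t \<partial>count_space UNIV \<partial>lebesgue)"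
  proof (rule nn_integral_cong)
    fix t :: real
    have "(\<integral>\<^sup>+ n. \<phi> t * indicator {real_of_int n..<real_of_int n + 1} t \<partial>count_space UNIV)
       = (\<integral>\<^sup>+ n. \<phi> t * indicator {\<lfloor>t\<rfloor>} n \<partial>count_space UNIV)"
      by (intro nn_integral_cong) (auto simp: indicator_def floor_eq_iff dest: floor_unique)
    also have "\<dots> = \<phi> t" by (subst nn_integral_cmult_indicator) auto
    finally show "\<phi> t = (\<integral>\<^sup>+ n. \<phi> t * indicator {real_of_int n..<real_of_int n + 1} t \<partial>count_space UNIV)" by simp
  qed
  also have "\<dots> = (\<integral>\<^sup>+ n. \<integral>\<^sup>+ t. \<phi> t * indicator {real_of_int n..<real_of_int n + 1} t \<partial>lebesgue \<partial>count_space (UNIV :: int set))"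
    by (intro nn_integral_count_space_nn_integral borel_measurable_times_ennreal borel_measurable_indicator) auto
  also have "\<dots> \<le> (\<integral>\<^sup>+ n. \<integral>\<^sup>+ t. ennreal ((exp \<bar>\<beta>\<bar> * C)\<^sup>2) * (ennreal (exp (- d * real_of_int n)) * (\<psi> t * indicator {..<real_of_int n + 1} t)) \<partial>lebesgue \<partial>count_space UNIV)"
    by (intro nn_integral_mono slice)
  also have "\<dots> = (\<integral>\<^sup>+ t. \<integral>\<^sup>+ n. ennreal ((exp \<bar>\<beta>\<bar> * C)\<^sup>2) * (ennreal (exp (- d * real_of_int n)) * (\<psi> t * indicator {..<real_of_int n + 1} t)) \<partial>count_space UNIV \<partial>lebesgue)"
    by (intro nn_integral_count_space_nn_integral[symmetric] borel_measurable_times_ennreal borel_measurable_indicator) auto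
  also have "\<dots> \<le> (\<integral>\<^sup>+ t. ennreal ((exp \<bar>\<beta>\<bar> * C)\<^sup>2) * (\<psi> t * (ennreal (exp d / (1 - exp (- d))) * ennreal (exp (- d * t)))) \<partial>lebesgue)"
  proof (rule nn_integral_mono)
    fix t :: real
    have "(\<integral>\<^sup>+ n. ennreal ((exp \<bar>\<beta>\<bar> * C)\<^sup>2) * (ennreal (exp (- d * real_of_int n)) * (\<psi> t * indicator {..<real_of_int n + 1} t)) \<partial>count_space UNIV)
      = (\<integral>\<^sup>+ n. (ennreal ((exp \<bar>\<beta>\<bar> * C)\<^sup>2) * \<psi> t) * (ennreal (exp (- d * real_of_int n)) * indicator {..<real_of_int n + 1} t) \<partial>count_space UNIV)"
      by (intro nn_integral_cong) (simp only: mult_ac)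
    also have "\<dots> = (ennreal ((exp \<bar>\<beta>\<bar> * C)\<^sup>2) * \<psi> t) * (\<integral>\<^sup>+ n. ennreal (exp (- d * real_of_int n)) * indicator {..<real_of_int n + 1} t \<partial>count_space UNIV)"
      by (rule nn_integral_cmult) simp
    also have "\<dots> = ennreal ((exp \<bar>\<beta>\<bar> * C)\<^sup>2) * (\<psi> t * (\<integral>\<^sup>+ n. ennreal (exp (- d * real_of_int n)) * indicator {..<real_of_int n + 1} t \<partial>count_space UNIV))"
      by (simp only: mult.assoc)
    also have "\<dots> \<le> ennreal ((exp \<bar>\<beta>\<bar> * C)\<^sup>2) * (\<psi> t * (ennreal (exp d / (1 - exp (- d))) * ennreal (exp (- d * t))))"
      by (intro mult_left_mono nn_integral_exp_ge_floor d) auto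
    finally show "(\<integral>\<^sup>+ n. ennreal ((exp \<bar>\<beta>\<bar> * C)\<^sup>2) * (ennreal (exp (- d * real_of_int n)) * (\<psi> t * indicator {..<real_of_int n + 1} t)) \<partial>count_space UNIV)
      \<le> ennreal ((exp \<bar>\<beta>\<bar> * C)\<^sup>2) * (\<psi> t * (ennreal (exp d / (1 - exp (- d))) * ennreal (exp (- d * t))))" .
  qed
  also have "\<dots> = (\<integral>\<^sup>+ t. ennreal ((exp \<bar>\<beta>\<bar> * C)\<^sup>2 * (exp d / (1 - exp (- d)))) * ennreal ((norm (exp (- \<beta> * t) *\<^sub>R g t))\<^sup>2) \<partial>lebesgue)"
  proof (rule nn_integral_cong)
    fix t :: real
    have "exp (- d * t) * (exp (- \<gamma> * t))\<^sup>2 = (exp (- \<beta> * t))\<^sup>2"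
      unfolding exp_double[symmetric] exp_add[symmetric] by (simp add: d_def algebra_simps)
    then have "(norm (exp (- \<gamma> * t) *\<^sub>R g t))\<^sup>2 * exp (- d * t) = (norm (exp (- \<beta> * t) *\<^sub>R g t))\<^sup>2"
      by (simp add: power_mult_distrib mult_ac)
    then have e: "\<psi> t * ennreal (exp (- d * t)) = ennreal ((norm (exp (- \<beta> * t) *\<^sub>R g t))\<^sup>2)"
      unfolding \<psi>_def by (simp add: ennreal_mult[symmetric])
    show "ennreal ((exp \<bar>\<beta>\<bar> * C)\<^sup>2) * (\<psi> t * (ennreal (exp d / (1 - exp (- d))) * ennreal (exp (- d * t))))
      = ennreal ((exp \<bar>\<beta>\<bar> * C)\<^sup>2 * (exp d / (1 - exp (- d)))) * ennreal ((norm (exp (- \<beta> * t) *\<^sub>R g t))\<^sup>2)"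
      unfolding e[symmetric] using e1 by (subst ennreal_mult) (auto simp: mult_ac)
  qed
  also have "\<dots> = ennreal ((exp \<bar>\<beta>\<bar> * C)\<^sup>2 * (exp d / (1 - exp (- d)))) * weighted_integral \<beta> u"
    unfolding u weighted_integral.abs_eq by (intro nn_integral_cmult smeas_norm2_exp fm)
  finally show "weighted_integral \<beta> w \<le>
    ennreal ((exp \<bar>\<beta>\<bar> * C)\<^sup>2 * (exp (2 * (\<beta> - \<gamma>)) / (1 - exp (- (2 * (\<beta> - \<gamma>)))))) * weighted_integral \<beta> u"
    by (simp add: d_def)
qed

lemma L2_left:
  assumes "f \<in> L2 \<beta>" "\<gamma> \<le> \<beta>" shows "cut {..<a} f \<in> L2 \<gamma>"
proof -
  have "exp (- \<gamma> * t) \<le> exp ((\<beta> - \<gamma>) * a) * exp (- \<beta> * t)" if "t < a" for t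
  proof -
    have "(\<beta> - \<gamma>) * t \<le> (\<beta> - \<gamma>) * a" using that assms by (intro mult_left_mono) auto
    then show ?thesis by (simp add: exp_add[symmetric] algebra_simps)
  qed
  then show ?thesis
    using L2_weight_mono(1)[of "{..<a}" "cut {..<a} f" \<gamma> "exp ((\<beta> - \<gamma>) * a)" \<beta>] assms
    by (simp add: L2_cut)
qed

text \<open>The square root of the constant in \<open>weighted_integral_slices\<close>, which
  concerns squared norms.\<close>

definition slice_const :: "real \<Rightarrow> real \<Rightarrow> real \<Rightarrow> real" where
  "slice_const \<gamma> \<beta> C = exp \<bar>\<beta>\<bar> * C * sqrt (exp (2 * (\<beta> - \<gamma>)) / (1 - exp (- (2 * (\<beta> - \<gamma>)))))"

lemma slice_const_nonneg: "\<gamma> < \<beta> \<Longrightarrow> 0 \<le> C \<Longrightarrow> 0 \<le> slice_const \<gamma> \<beta> C"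
  unfolding slice_const_def by (intro mult_nonneg_nonneg real_sqrt_ge_zero divide_nonneg_nonneg) auto

lemma L2_slices:
  fixes w :: "'a::real_normed_vector aefun" and u :: "'b::real_normed_vector aefun" and \<beta> \<gamma> C :: real
  assumes sw: "strongly_measurable w" and u: "u \<in> L2 \<beta>" and "\<gamma> < \<beta>" and C: "0 \<le> C"
    and h1: "\<And>n::int. cut {real_of_int n..<real_of_int n + 1} w \<in> L2 0"
    and h: "\<And>n::int. L2_norm 0 (cut {real_of_int n..<real_of_int n + 1} w)
        \<le> C * exp (\<gamma> * n) * L2_norm \<gamma> (cut {..<real_of_int n + 1} u)"
  shows "w \<in> L2 \<beta>" "L2_norm \<beta> w \<le> slice_const \<gamma> \<beta> C * L2_norm \<beta> u"
proof -
  let ?K = "(exp \<bar>\<beta>\<bar> * C)\<^sup>2 * (exp (2 * (\<beta> - \<gamma>)) / (1 - exp (- (2 * (\<beta> - \<gamma>)))))"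
  have K: "?K = (slice_const \<gamma> \<beta> C)\<^sup>2"
    using assms(3) unfolding slice_const_def power_mult_distrib by (subst real_sqrt_pow2) auto
  have "weighted_integral \<beta> w \<le> ennreal ?K * weighted_integral \<beta> u"
  proof (rule weighted_integral_slices[OF sw L2_sm[OF u] assms(3) C])
    fix n :: int
    have u': "cut {..<real_of_int n + 1} u \<in> L2 \<gamma>" using u assms(3) by (intro L2_left) auto
    have "ennreal ((L2_norm 0 (cut {real_of_int n..<real_of_int n + 1} w))\<^sup>2) \<le>
        ennreal ((C * exp (\<gamma> * n) * L2_norm \<gamma> (cut {..<real_of_int n + 1} u))\<^sup>2)"
      by (intro ennreal_leI power_mono h) auto
    then show "weighted_integral 0 (cut {real_of_int n..<real_of_int n + 1} w)
        \<le> ennreal ((C * exp (\<gamma> * n))\<^sup>2) * weighted_integral \<gamma> (cut {..<real_of_int n + 1} u)"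
      unfolding L2_norm_sq[OF h1] power_mult_distrib[of "C * exp _" "L2_norm _ _"]
      by (subst (asm) ennreal_mult) (simp_all add: L2_norm_sq[OF u'])
  qed
  then have *: "weighted_integral \<beta> w \<le> ennreal ((slice_const \<gamma> \<beta> C)\<^sup>2) * weighted_integral \<beta> u"
    unfolding K .
  then show "w \<in> L2 \<beta>" using u sw by (auto simp: L2_def ennreal_mult_less_top intro: order.strict_trans1)
  have "weighted_integral \<beta> w \<le> ennreal ((slice_const \<gamma> \<beta> C * L2_norm \<beta> u)\<^sup>2)"
    using * by (simp add: power_mult_distrib ennreal_mult L2_norm_sq[OF u])
  then show "L2_norm \<beta> w \<le> slice_const \<gamma> \<beta> C * L2_norm \<beta> u"
    by (rule L2_norm_leI) (use slice_const_nonneg[OF assms(3) C] in simp)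
qed

lemma L2_bounded_support:
  assumes "cut {a..<b} f = f" "f \<in> L2 \<beta>" shows "f \<in> L2 \<alpha>"
proof (rule L2_weight_mono(1)[OF assms(1) _ _ assms(2)])
  fix t assume t: "t \<in> {a..<b}"
  have "(\<beta> - \<alpha>) * t \<le> \<bar>\<beta> - \<alpha>\<bar> * (\<bar>a\<bar> + \<bar>b\<bar>)"
  proof -
    have "(\<beta> - \<alpha>) * t \<le> \<bar>\<beta> - \<alpha>\<bar> * \<bar>t\<bar>" by (metis abs_ge_self abs_mult)
    also have "\<dots> \<le> \<bar>\<beta> - \<alpha>\<bar> * (\<bar>a\<bar> + \<bar>b\<bar>)" using t by (intro mult_left_mono) auto
    finally show ?thesis .
  qed
  then show "exp (- \<alpha> * t) \<le> exp (\<bar>\<beta> - \<alpha>\<bar> * (\<bar>a\<bar> + \<bar>b\<bar>)) * exp (- \<beta> * t)"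
    by (simp add: exp_add[symmetric] algebra_simps)
qed simp

subsection \<open>Inner products with shifts and cuts\<close>

lemma L2_inner_shift: "L2_inner (shift a f) (shift a g) = L2_inner f g"
proof (cases f; cases g)
  fix f' g' assume "f = abs_aefun f'" "g = abs_aefun g'"
  then show ?thesis
    using lebesgue_integral_real_affine[of 1 "\<lambda>t. cinner (f' t) (g' t)" a]
    by (simp add: aefun_abs_simps)
qed

lemma L2_inner_cut: "L2_inner (cut I f) g = L2_inner f (cut I g)"
proof (cases f; cases g)
  fix f' g' assume "f = abs_aefun f'" "g = abs_aefun g'"
  then show ?thesis
    by (auto simp: aefun_abs_simps intro!: Bochner_Integration.integral_cong)
qed

lemma L2_inner_shift_left: "L2_inner (shift a f) g = L2_inner f (shift (- a) g)"
  using L2_inner_shift[of a f "shift (- a) g"] by simp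

subsection \<open>Exponential functions\<close>

lift_definition expf :: "real set \<Rightarrow> real \<Rightarrow> 'a::real_vector \<Rightarrow> 'a aefun" is
  "\<lambda>I \<sigma> u t. if t \<in> I then exp (\<sigma> * t) *\<^sub>R u else 0" .

lemma expf_def': "expf I \<sigma> u = abs_aefun (\<lambda>t. if t \<in> I then exp (\<sigma> * t) *\<^sub>R u else 0)"
  by (rule expf.abs_eq)

lemma cut_expf: "cut J (expf I \<sigma> u) = expf (J \<inter> I) \<sigma> u"
  by transfer (simp add: ae_eq_def)

lemma expf_empty [simp]: "expf {} \<sigma> u = 0"
  by transfer (simp add: ae_eq_def)

lemma shift_expf: "shift a (expf I \<sigma> u) = of_real (exp (\<sigma> * a)) *\<^sub>C expf {s. a + s \<in> I} \<sigma> (u::'a::chilbert_space)"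
  by transfer (auto simp: ae_eq_def scaleR_scaleC scaleC_scaleC exp_add distrib_left)

lemma expf_add: "expf I \<sigma> (u + v) = expf I \<sigma> u + expf I \<sigma> v"
  by transfer (simp add: ae_eq_def scaleR_add_right)

lemma expf_scaleC: "expf I \<sigma> (c *\<^sub>C u) = c *\<^sub>C expf I \<sigma> (u::'a::chilbert_space)"
  by transfer (simp add: ae_eq_def scaleR_scaleC scaleC_scaleC mult.commute)

lemma expf_diff_atLeast: "a \<le> b \<Longrightarrow> expf {a..} \<sigma> u - expf {b..} \<sigma> u = expf {a..<b} \<sigma> u"
  by transfer (auto simp: ae_eq_def)

lemma smeas_expf: "I \<in> sets lebesgue \<Longrightarrow> smeas (\<lambda>t. if t \<in> I then exp (\<sigma> * t) *\<^sub>R u else 0)"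
  by (intro smeas_If smeas_exp smeas_const)

lemma nn_integral_exp_atLeast:
  assumes "0 < k"
  shows "(\<integral>\<^sup>+ t. ennreal (exp (- k * t)) * indicator {a..} t \<partial>lebesgue) = ennreal (exp (- k * a) / k)"
proof -
  have "((\<lambda>t. - (exp (- k * t) / k)) \<longlongrightarrow> - (0 / k)) at_top"
  proof (intro tendsto_intros filterlim_compose[OF exp_at_bot])
    show "filterlim (\<lambda>t. - k * t) at_bot at_top"
      using assms by (simp add: filterlim_uminus_at_bot filterlim_tendsto_pos_mult_at_top[OF tendsto_const _ filterlim_ident])
  qed (use assms in auto)
  then have "(\<integral>\<^sup>+ t. ennreal (exp (- k * t)) * indicator {a..} t \<partial>lborel) = ennreal (0 - - (exp (- k * a) / k))"
    using assms by (intro nn_integral_FTC_atLeast) (auto intro!: derivative_eq_intros)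
  then show ?thesis by (simp add: nn_integral_completion)
qed

lemma nn_integral_exp_lessThan:
  assumes "0 < k"
  shows "(\<integral>\<^sup>+ t. ennreal (exp (k * t)) * indicator {..<a} t \<partial>lebesgue) = ennreal (exp (k * a) / k)"
proof -
  have "(\<lambda>t. ennreal (exp (k * t)) * indicator {..<a} t) \<in> borel_measurable lebesgue"
    by (rule measurable_completion) simp
  then have "(\<integral>\<^sup>+ t. ennreal (exp (k * t)) * indicator {..<a} t \<partial>lebesgue)
     = (\<integral>\<^sup>+ t. ennreal (exp (k * (- t))) * indicator {..<a} (- t) \<partial>lebesgue)"
    using nn_integral_real_affine_lebesgue[of "\<lambda>t. ennreal (exp (k * t)) * indicator {..<a} t" "-1" 0] by simp
  also have "\<dots> = (\<integral>\<^sup>+ t. ennreal (exp (- k * t)) * indicator {- a..} t \<partial>lebesgue)"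
  proof (rule nn_integral_cong_AE)
    have "AE t in lebesgue. t \<noteq> - a" by (rule AE_completion) (rule AE_lborel_singleton)
    then show "AE t in lebesgue. ennreal (exp (k * (- t))) * indicator {..<a} (- t) = ennreal (exp (- k * t)) * indicator {- a..} t"
      by eventually_elim (auto simp: indicator_def)
  qed
  also have "\<dots> = ennreal (exp (k * a) / k)" using nn_integral_exp_atLeast[OF assms, of "- a"] by simp
  finally show ?thesis .
qed

lemma weighted_integral_expf:
  assumes "I \<in> sets borel"
  shows "weighted_integral \<omega> (expf I \<sigma> u) =
    ennreal ((norm u)\<^sup>2) * (\<integral>\<^sup>+ t. ennreal (exp (2 * (\<sigma> - \<omega>) * t)) * indicator I t \<partial>lebesgue)"
proof -
  have e: "(norm (exp (- \<omega> * t) *\<^sub>R exp (\<sigma> * t) *\<^sub>R u))\<^sup>2 = (norm u)\<^sup>2 * exp (2 * (\<sigma> - \<omega>) * t)" for t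
  proof -
    have "exp (2 * (\<sigma> - \<omega>) * t) = (exp (- \<omega> * t) * exp (\<sigma> * t))\<^sup>2"
      unfolding exp_add[symmetric] exp_double[symmetric] by (simp add: algebra_simps)
    then show ?thesis by (simp add: power_mult_distrib mult_ac)
  qed
  have "weighted_integral \<omega> (expf I \<sigma> u) = (\<integral>\<^sup>+ t. ennreal ((norm u)\<^sup>2) * (ennreal (exp (2 * (\<sigma> - \<omega>) * t)) * indicator I t) \<partial>lebesgue)"
    unfolding expf_def' weighted_integral.abs_eq
  proof (rule nn_integral_cong)
    fix t :: real
    show "ennreal ((norm (exp (- \<omega> * t) *\<^sub>R (if t \<in> I then exp (\<sigma> * t) *\<^sub>R u else 0)))\<^sup>2)
       = ennreal ((norm u)\<^sup>2) * (ennreal (exp (2 * (\<sigma> - \<omega>) * t)) * indicator I t)"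
      using e[of t] by (cases "t \<in> I") (simp_all only: if_True if_False indicator_simps mult_1_right ennreal_mult[symmetric] zero_le_power2 exp_ge_zero, simp)
  qed
  also have "\<dots> = ennreal ((norm u)\<^sup>2) * (\<integral>\<^sup>+ t. ennreal (exp (2 * (\<sigma> - \<omega>) * t)) * indicator I t \<partial>lebesgue)"
    by (rule nn_integral_cmult, rule measurable_completion) (use assms in measurable)
  finally show ?thesis .
qed

lemma strongly_measurable_expf: "I \<in> sets borel \<Longrightarrow> strongly_measurable (expf I \<sigma> u)"
  unfolding expf_def' strongly_measurable_abs by (rule smeas_expf) auto

lemma expf_atLeast_L2:
  assumes "\<sigma> < \<omega>"
  shows "expf {a..} \<sigma> u \<in> L2 \<omega>"
    "L2_norm \<omega> (expf {a..} \<sigma> u) = norm u * exp (- (\<omega> - \<sigma>) * a) / sqrt (2 * (\<omega> - \<sigma>))"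
proof -
  have w: "weighted_integral \<omega> (expf {a..} \<sigma> u) = ennreal ((norm u)\<^sup>2 * (exp (- (2 * (\<omega> - \<sigma>)) * a) / (2 * (\<omega> - \<sigma>))))"
    using nn_integral_exp_atLeast[of "2 * (\<omega> - \<sigma>)" a] assms
    by (simp add: weighted_integral_expf ennreal_mult[symmetric])
  then show "expf {a..} \<sigma> u \<in> L2 \<omega>" by (simp add: L2_def strongly_measurable_expf)
  have "exp (- (2 * (\<omega> - \<sigma>)) * a) = (exp (- (\<omega> - \<sigma>) * a))\<^sup>2"
    unfolding exp_double[symmetric] by (simp add: algebra_simps)
  then show "L2_norm \<omega> (expf {a..} \<sigma> u) = norm u * exp (- (\<omega> - \<sigma>) * a) / sqrt (2 * (\<omega> - \<sigma>))"
    using assms unfolding L2_norm_def w by (simp add: real_sqrt_mult real_sqrt_divide)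
qed

lemma expf_lessThan_L2:
  assumes "\<omega> < \<sigma>"
  shows "expf {..<a} \<sigma> u \<in> L2 \<omega>"
    "L2_norm \<omega> (expf {..<a} \<sigma> u) = norm u * exp ((\<sigma> - \<omega>) * a) / sqrt (2 * (\<sigma> - \<omega>))"
proof -
  have w: "weighted_integral \<omega> (expf {..<a} \<sigma> u) = ennreal ((norm u)\<^sup>2 * (exp ((2 * (\<sigma> - \<omega>)) * a) / (2 * (\<sigma> - \<omega>))))"
    using nn_integral_exp_lessThan[of "2 * (\<sigma> - \<omega>)" a] assms
    by (simp add: weighted_integral_expf ennreal_mult[symmetric])
  then show "expf {..<a} \<sigma> u \<in> L2 \<omega>" by (simp add: L2_def strongly_measurable_expf)
  have "exp ((2 * (\<sigma> - \<omega>)) * a) = (exp ((\<sigma> - \<omega>) * a))\<^sup>2"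
    unfolding exp_double[symmetric] by (simp add: algebra_simps)
  then show "L2_norm \<omega> (expf {..<a} \<sigma> u) = norm u * exp ((\<sigma> - \<omega>) * a) / sqrt (2 * (\<sigma> - \<omega>))"
    using assms unfolding L2_norm_def w by (simp add: real_sqrt_mult real_sqrt_divide)
qed

lemma expf_interval_L2: "expf {a..<b} \<sigma> u \<in> L2 \<omega>"
proof -
  have "cut {..<b} (expf {a..} \<sigma> u) \<in> L2 (\<sigma> + 1)" by (intro L2_cut expf_atLeast_L2) auto
  moreover have "{..<b} \<inter> {a..} = {a..<b}" by auto
  ultimately have "expf {a..<b} \<sigma> u \<in> L2 (\<sigma> + 1)" by (simp add: cut_expf)
  then show ?thesis by (rule L2_bounded_support[of a b, rotated]) (simp add: cut_expf)
qed

lemma L2_inner_expf: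
  "L2_inner (expf I \<sigma> u) (abs_aefun v) = (LINT t|lebesgue. indicator I t *\<^sub>R (exp (\<sigma> * t) *\<^sub>R cinner u (v t)))"
  unfolding expf_def' L2_inner.abs_eq
  by (intro Bochner_Integration.integral_cong) (auto simp: indicator_def cinner_scaleR_left scaleR_conv_of_real)

text \<open>The dependence on \<open>max a b\<close> alone is the pattern that \<open>gram\<close>
  reproduces for the shifted eigenvectors.\<close>

lemma L2_inner_expf_expf:
  assumes "0 < \<sigma>"
  shows "L2_inner (expf {a..} (- \<sigma>) u) (expf {b..} (- \<sigma>) v) =
    of_real (exp (- (2 * \<sigma>) * max a b) / (2 * \<sigma>)) * cinner u v"
proof -
  have "L2_inner (expf {a..} (- \<sigma>) u) (expf {b..} (- \<sigma>) v) =
     (LINT t|lebesgue. of_real (exp (- (2 * \<sigma>) * t) * indicator {max a b..} t) * cinner u v)"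
    unfolding expf_def' L2_inner.abs_eq
  proof (intro Bochner_Integration.integral_cong refl)
    fix t :: real
    have "exp (- \<sigma> * t) * exp (- \<sigma> * t) = exp (- (2 * \<sigma>) * t)" unfolding exp_add[symmetric] by simp
    then show "cinner (if t \<in> {a..} then exp (- \<sigma> * t) *\<^sub>R u else 0) (if t \<in> {b..} then exp (- \<sigma> * t) *\<^sub>R v else 0)
       = complex_of_real (exp (- (2 * \<sigma>) * t) * indicator {max a b..} t) * cinner u v"
      by (auto simp: indicator_def cinner_scaleR_left cinner_scaleR_right simp flip: of_real_mult mult.assoc)
  qed
  also have "\<dots> = of_real (LINT t|lebesgue. exp (- (2 * \<sigma>) * t) * indicator {max a b..} t) * cinner u v"
    by (simp only: integral_mult_left_zero integral_complex_of_real)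
  also have "(LINT t|lebesgue. exp (- (2 * \<sigma>) * t) * indicator {max a b..} t) = exp (- (2 * \<sigma>) * max a b) / (2 * \<sigma>)"
  proof -
    have "(\<lambda>t::real. exp (- (2 * \<sigma>) * t) * indicator {max a b..} t) \<in> borel_measurable lebesgue"
      by (rule measurable_completion) simp
    then have "(LINT t|lebesgue. exp (- (2 * \<sigma>) * t) * indicator {max a b..} t)
       = enn2real (\<integral>\<^sup>+ t. ennreal (exp (- (2 * \<sigma>) * t) * indicator {max a b..} t) \<partial>lebesgue)"
      by (intro integral_eq_nn_integral) auto
    also have "(\<integral>\<^sup>+ t. ennreal (exp (- (2 * \<sigma>) * t) * indicator {max a b..} t) \<partial>lebesgue)
      = (\<integral>\<^sup>+ t. ennreal (exp (- (2 * \<sigma>) * t)) * indicator {max a b..} t \<partial>lebesgue)"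
      by (intro nn_integral_cong) (auto simp: indicator_def)
    also have "\<dots> = ennreal (exp (- (2 * \<sigma>) * max a b) / (2 * \<sigma>))"
      using assms by (intro nn_integral_exp_atLeast) simp
    finally show ?thesis using assms by simp
  qed
  finally show ?thesis .
qed

subsection \<open>Density\<close>

text \<open>Half-lines form an intersection-stable generator of the Borel sets, so all Borel sets
  have vanishing integrals. Passing to a Borel representative \<open>g\<close> first lets this
  argument run in \<open>lborel\<close>.\<close>

lemma AE_zero_if_integrals_zero:
  fixes \<psi> :: "real \<Rightarrow> real"
  assumes i: "integrable lebesgue \<psi>" and z: "\<And>a. (LINT t|lebesgue. indicator {..<a} t *\<^sub>R \<psi> t) = 0"
  shows "AE t in lebesgue. \<psi> t = 0"
proof -
  obtain g where g: "g \<in> borel_measurable lborel" "AE t in lborel. \<psi> t = g t"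
    using completion_ex_borel_measurable_real[of \<psi> lborel] i by auto
  have ae: "AE t in lebesgue. \<psi> t = g t" using g(2) by (rule AE_completion)
  have gm: "g \<in> borel_measurable lebesgue" using g(1) by (rule measurable_completion)
  have "integrable lebesgue g"
    using integrable_cong_AE_imp[OF i gm] ae by (auto elim: eventually_mono)
  then have gi: "integrable lborel g" using g(1) by (simp add: integrable_completion)
  have ind: "set_lebesgue_integral lborel {..<a} g = 0" for a
  proof -
    have gm': "(\<lambda>t. indicator {..<a} t *\<^sub>R g t) \<in> borel_measurable lborel" using g(1) by simp
    have "set_lebesgue_integral lborel {..<a} g = (LINT t|lebesgue. indicator {..<a} t *\<^sub>R g t)"
      unfolding set_lebesgue_integral_def by (rule integral_completion[OF gm', symmetric])
    also have "\<dots> = (LINT t|lebesgue. indicator {..<a} t *\<^sub>R \<psi> t)"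
    proof (rule integral_cong_AE)
      show "AE t in lebesgue. indicator {..<a} t *\<^sub>R g t = indicator {..<a} t *\<^sub>R \<psi> t"
        using ae by eventually_elim simp
      show "(\<lambda>t. indicator {..<a} t *\<^sub>R g t) \<in> borel_measurable lebesgue" using gm' by (rule measurable_completion)
      show "(\<lambda>t. indicator {..<a} t *\<^sub>R \<psi> t) \<in> borel_measurable lebesgue"
        using i by (intro borel_measurable_scaleR borel_measurable_indicator) auto
    qed
    finally show ?thesis using z by simp
  qed
  have si: "set_integrable lborel A g" if "A \<in> sets lborel" for A
    unfolding set_integrable_def using integrable_mult_indicator[OF that gi] .
  have UN: "set_lebesgue_integral lborel UNIV g = 0"
  proof -
    have "(\<lambda>n. set_lebesgue_integral lborel {..<real n} g) \<longlonglongrightarrow> set_lebesgue_integral lborel (\<Union>n. {..<real n}) g"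
      by (rule set_integral_cont_up) (auto intro!: si simp: incseq_def)
    moreover have "(\<Union>n. {..<real n}) = UNIV" using reals_Archimedean2 by auto
    ultimately show ?thesis by (simp add: ind LIMSEQ_const_iff)
  qed
  have all: "set_lebesgue_integral lborel A g = 0" if "A \<in> sets lborel" for A
  proof -
    have m: "A \<in> sigma_sets UNIV (range lessThan)"
      using that unfolding sets_lborel borel_Iio by (simp add: sets_measure_of)
    have IS: "Int_stable (range (lessThan :: real \<Rightarrow> real set))"
    proof (rule Int_stableI)
      fix a b :: "real set" assume "a \<in> range lessThan" "b \<in> range lessThan"
      then obtain x y where "a = {..<x}" "b = {..<y}" by auto
      then have "a \<inter> b = {..<min x y}" by auto
      then show "a \<inter> b \<in> range lessThan" by simp
    qed
    have PW: "range (lessThan :: real \<Rightarrow> real set) \<subseteq> Pow UNIV" by simp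
    show ?thesis using IS PW m
    proof (induction rule: sigma_sets_induct_disjoint)
    next
      case (compl A)
      then have A: "A \<in> sets lborel" unfolding sets_lborel borel_Iio by (simp add: sets_measure_of)
      have "set_lebesgue_integral lborel (A \<union> (UNIV - A)) g = set_lebesgue_integral lborel A g + set_lebesgue_integral lborel (UNIV - A) g"
        using A by (intro set_integral_Un si) auto
      then show ?case using UN compl by (simp add: Un_absorb1)
    next
      case (union A)
      then have A: "A i \<in> sets lborel" for i unfolding sets_lborel borel_Iio by (auto simp: sets_measure_of)
      have "set_lebesgue_integral lborel (\<Union>i. A i) g = (\<Sum>i. set_lebesgue_integral lborel (A i) g)"
        using A union(1) by (intro lebesgue_integral_countable_add si) (auto simp: disjoint_family_on_def)
      then show ?case using union by simp
    qed (use ind in \<open>auto simp: set_lebesgue_integral_def\<close>)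
  qed
  have "AE t in lborel. g t = 0"
    by (rule density_unique_real[OF gi]) (use all in \<open>auto simp: set_lebesgue_integral_def\<close>)
  with g(2) have "AE t in lborel. \<psi> t = 0" by eventually_elim simp
  then show ?thesis by (rule AE_completion)
qed

text \<open>Truncated exponentials are total in \<open>L2 0\<close> for every exponent
  \<open>\<sigma>\<close>. The free exponent allows density to be tested on those functions for
  which the later integrals are explicit.\<close>

lemma L2_orth_expf:
  fixes w :: "'a::chilbert_space aefun"
  assumes w: "w \<in> L2 0" and z: "\<And>a b u. L2_inner (expf {a..<b} \<sigma> u) w = 0"
  shows "w = 0"
proof (cases w)
  case (1 f)
  have fm: "smeas f" using w by (simp add: 1 L2_abs0)
  have re: "AE t in lebesgue. Re (cinner u (f t)) = 0" for u
  proof -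
    have "AE t in lebesgue. indicator {- real n..<real n} t *\<^sub>R (exp (\<sigma> * t) * Re (cinner u (f t))) = 0" for n
    proof (rule AE_zero_if_integrals_zero)
      have int: "integrable lebesgue (\<lambda>t. indicator {a..<b} t *\<^sub>R (exp (\<sigma> * t) *\<^sub>R cinner u (f t)))" for a b
      proof -
        have "integrable lebesgue (\<lambda>t. cinner (if t \<in> {a..<b} then exp (\<sigma> * t) *\<^sub>R u else 0) (f t))"
          using expf_interval_L2[of a b \<sigma> u 0] w unfolding expf_def' 1 by (rule L2_inner_integrable)
        then show ?thesis
          by (rule Bochner_Integration.integrable_cong[THEN iffD1, rotated 2])
             (auto simp: indicator_def cinner_scaleR_left scaleR_conv_of_real)
      qed
      then have int': "integrable lebesgue (\<lambda>t. indicator {a..<b} t *\<^sub>R (exp (\<sigma> * t) * Re (cinner u (f t))))" for a b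
        using integrable_Re[OF int[of a b]] by (simp add: mult.assoc)
      show "integrable lebesgue (\<lambda>t. indicator {- real n..<real n} t *\<^sub>R (exp (\<sigma> * t) * Re (cinner u (f t))))"
        by (rule int')
      fix a
      have "(LINT t|lebesgue. indicator {..<a} t *\<^sub>R indicator {- real n..<real n} t *\<^sub>R (exp (\<sigma> * t) * Re (cinner u (f t))))
        = (LINT t|lebesgue. Re (indicator {- real n..<min a (real n)} t *\<^sub>R (exp (\<sigma> * t) *\<^sub>R cinner u (f t))))"
        by (intro Bochner_Integration.integral_cong) (auto simp: indicator_def)
      also have "\<dots> = Re (L2_inner (expf {- real n..<min a (real n)} \<sigma> u) w)"
        unfolding 1 L2_inner_expf by (rule integral_Re[OF int])
      finally show "(LINT t|lebesgue. indicator {..<a} t *\<^sub>R indicator {- real n..<real n} t *\<^sub>R (exp (\<sigma> * t) * Re (cinner u (f t)))) = 0"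
        using z by simp
    qed
    then have "AE t in lebesgue. \<forall>n::nat. indicator {- real n..<real n} t *\<^sub>R (exp (\<sigma> * t) * Re (cinner u (f t))) = 0"
      unfolding AE_all_countable ..
    then show ?thesis
    proof eventually_elim
      case (elim t)
      obtain n :: nat where "\<bar>t\<bar> < real n" using reals_Archimedean2 by blast
      then have "t \<in> {- real n..<real n}" by auto
      with elim[rule_format, of n] show ?case by simp
    qed
  qed
  have "AE t in lebesgue. cinner u (f t) = 0" for u
    using re[of u] re[of "\<i> *\<^sub>C u"]
    by eventually_elim (simp add: cinner_scaleC_left complex_eq_iff)
  then have "AE t in lebesgue. f t = 0" by (rule smeas_AE_zeroI[OF fm])
  then show ?thesis by (simp add: 1 zero_aefun.abs_eq abs_aefun_eq_iff)
qed

section \<open>Closed subspaces and density by orthogonality\<close>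

lemma ncomplete_closed_subset:
  assumes X: "ncomplete X n" and S: "S \<subseteq> X"
    and cl: "\<And>f x. (\<And>k::nat. f k \<in> S) \<Longrightarrow> x \<in> X \<Longrightarrow> (\<lambda>k. n (f k - x)) \<longlonglongrightarrow> 0 \<Longrightarrow> x \<in> S"
  shows "ncomplete S n"
  unfolding ncomplete_def
proof (intro allI impI, elim conjE)
  fix f :: "nat \<Rightarrow> 'a" assume f: "\<forall>k. f k \<in> S" and c: "\<forall>e>0. \<exists>N. \<forall>i\<ge>N. \<forall>j\<ge>N. n (f i - f j) < e"
  obtain x where "x \<in> X" "(\<lambda>k. n (f k - x)) \<longlonglongrightarrow> 0"
    using ncompleteD[OF X, of f] f c S by blast
  then show "\<exists>x\<in>S. (\<lambda>k. n (f k - x)) \<longlonglongrightarrow> 0" using cl f by blast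
qed

lemma csubspace_L2_plus: "csubspace (L2_plus \<omega> :: 'a::chilbert_space aefun set)"
  by (auto simp: csubspace_def L2_plus_def L2_add L2_scaleC cut_add cut_scaleC)

lemma L2_plus_L2: "f \<in> L2_plus \<omega> \<Longrightarrow> f \<in> L2 \<omega>"
  by (simp add: L2_plus_def)

lemma L2_plus_fix: "f \<in> L2_plus \<omega> \<Longrightarrow> pi_plus f = f"
  by (simp add: L2_plus_def)

lemma norm_on_subset: "norm_on X n \<Longrightarrow> S \<subseteq> X \<Longrightarrow> norm_on S n"
  by (simp add: norm_on_def subset_eq)

lemma norm_on_L2_plus: "norm_on (L2_plus \<omega> :: 'a::chilbert_space aefun set) (L2_norm \<omega>)"
  by (rule norm_on_subset[OF norm_on_L2]) (auto simp: L2_plus_def)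

lemma limit_eq:
  assumes X: "csubspace X" "norm_on X n"
    and lim: "\<And>k::nat. f k \<in> X" "x \<in> X" "y \<in> X" "(\<lambda>k. n (f k - x)) \<longlonglongrightarrow> 0" "(\<lambda>k. n (f k - y)) \<longlonglongrightarrow> 0"
  shows "x = y"
proof -
  have "(\<lambda>k. n (f k - x) + n (f k - y)) \<longlonglongrightarrow> 0 + 0" by (intro tendsto_intros lim)
  moreover have "n (x - y) \<le> n (f k - x) + n (f k - y)" for k
    using norm_on_diff_triangle[OF X(2,1) lim(2) lim(1)[of k] lim(3)] norm_on_commute[OF X(2,1) lim(2) lim(1)[of k]] by simp
  ultimately have "n (x - y) \<le> 0" by (intro LIMSEQ_le_const[of _ 0]) auto
  then have "n (x - y) = 0" using norm_onD(1)[OF X(2), of "x - y"] lim X by (simp add: csubspace_diff)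
  then show ?thesis using norm_onD(2)[OF X(2), of "x - y"] lim X by (simp add: csubspace_diff)
qed

lemma L2_plus_complete: "ncomplete (L2_plus \<omega> :: 'a::chilbert_space aefun set) (L2_norm \<omega>)"
proof (rule ncomplete_closed_subset[OF L2_complete])
  fix f :: "nat \<Rightarrow> 'a aefun" and x
  assume f: "\<And>k. f k \<in> L2_plus \<omega>" and x: "x \<in> L2 \<omega>" and l: "(\<lambda>k. L2_norm \<omega> (f k - x)) \<longlonglongrightarrow> 0"
  have f': "f k \<in> L2 \<omega>" "pi_plus (f k) = f k" for k using f by (auto simp: L2_plus_def)
  have "(\<lambda>k. L2_norm \<omega> (f k - pi_plus x)) \<longlonglongrightarrow> 0"
  proof (rule Lim_null_comparison[OF _ l], intro always_eventually allI)
    fix k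
    have "f k - pi_plus x = pi_plus (f k - x)" by (simp add: cut_diff f')
    then show "norm (L2_norm \<omega> (f k - pi_plus x)) \<le> L2_norm \<omega> (f k - x)"
      using L2_norm_cut_le[of "f k - x" \<omega>] f' x by (simp add: L2_diff)
  qed
  then have "pi_plus x = x"
    using limit_eq[OF csubspace_L2 norm_on_L2 f'(1) _ x _ l] x by (simp add: L2_cut)
  then show "x \<in> L2_plus \<omega>" using x by (simp add: L2_plus_def)
qed (auto simp: L2_plus_def)

text \<open>The Riesz lemma on the closure \<open>S\<close> of \<open>G\<close> yields the
  projection \<open>a\<close> of \<open>x\<close>. The remainder \<open>x - a\<close> is orthogonal
  to \<open>G\<close>, hence zero, so \<open>x\<close> lies in \<open>S\<close>.\<close>

lemma dense_if_orthogonal_zero: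
  fixes X :: "'a::chilbert_space aefun set"
  assumes X: "csubspace X" "X \<subseteq> L2 0" "ncomplete X (L2_norm 0)" and G: "csubspace G" "G \<subseteq> X"
    and z: "\<And>w. w \<in> X \<Longrightarrow> (\<And>g. g \<in> G \<Longrightarrow> L2_inner g w = 0) \<Longrightarrow> w = 0"
    and x: "x \<in> X" and e: "0 < e"
  shows "\<exists>g\<in>G. L2_norm 0 (x - g) < e"
proof -
  define S where "S = {x\<in>X. \<forall>e>0. \<exists>g\<in>G. L2_norm 0 (x - g) < e}"
  have GS: "G \<subseteq> S"
  proof
    fix g assume g: "g \<in> G"
    have "L2_norm 0 (g - g) = 0" using norm_on_zero[OF norm_on_L2 csubspace_L2] by simp
    then show "g \<in> S" using g G by (auto simp: S_def intro!: bexI[of _ g])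
  qed
  have L: "g \<in> G \<Longrightarrow> g \<in> L2 0" "y \<in> X \<Longrightarrow> y \<in> L2 0" "y \<in> S \<Longrightarrow> y \<in> X" for g y using X G by (auto simp: S_def)
  have subS: "csubspace S" unfolding csubspace_def
  proof (intro conjI ballI allI)
    show "0 \<in> S" using GS csubspaceD(1)[OF G(1)] by auto
    fix y assume y: "y \<in> S"
    show "y + z \<in> S" if z: "z \<in> S" for z unfolding S_def
    proof (intro CollectI conjI allI impI)
      show "y + z \<in> X" using y z X(1) L by (simp add: csubspaceD)
      fix e :: real assume "0 < e"
      then have e2: "0 < e / 2" by simp
      obtain g where g: "g \<in> G" "L2_norm 0 (y - g) < e/2" using y e2 unfolding S_def by blast
      obtain h where h: "h \<in> G" "L2_norm 0 (z - h) < e/2" using z e2 unfolding S_def by blast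
      note gh = g(1) h(1) g(2) h(2)
      then have "L2_norm 0 ((y - g) + (z - h)) < e"
        using L2_norm_triangle[of "y - g" 0 "z - h"] y z by (simp add: L L2_diff)
      then show "\<exists>g\<in>G. L2_norm 0 (y + z - g) < e"
        using gh G(1) by (intro bexI[of _ "g + h"]) (auto simp: csubspaceD algebra_simps)
    qed
    show "a *\<^sub>C y \<in> S" for a unfolding S_def
    proof (intro CollectI conjI allI impI)
      show "a *\<^sub>C y \<in> X" using y X(1) L by (simp add: csubspaceD)
      fix e :: real assume e: "0 < e"
      then have "0 < e / (cmod a + 1)" by (simp add: add_nonneg_pos)
      then obtain g where g: "g \<in> G" "L2_norm 0 (y - g) < e / (cmod a + 1)" using y unfolding S_def by auto
      have "cmod a * L2_norm 0 (y - g) \<le> (cmod a + 1) * L2_norm 0 (y - g)" by (simp add: mult_right_mono)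
      also have "\<dots> < e" using g(2) by (simp add: less_divide_eq mult.commute add_nonneg_pos)
      finally have "L2_norm 0 (a *\<^sub>C (y - g)) < e" using g y by (simp add: L2_norm_scaleC L L2_diff)
      then show "\<exists>g\<in>G. L2_norm 0 (a *\<^sub>C y - g) < e"
        using g G(1) by (intro bexI[of _ "a *\<^sub>C g"]) (auto simp: csubspaceD scaleC_diff_right)
    qed
  qed
  have comS: "ncomplete S (L2_norm 0)"
  proof (rule ncomplete_closed_subset[OF X(3)])
    fix f y assume f: "\<And>k. f k \<in> S" and y: "y \<in> X" and l: "(\<lambda>k. L2_norm 0 (f k - y)) \<longlonglongrightarrow> 0"
    show "y \<in> S" unfolding S_def
    proof (intro CollectI conjI allI impI y)
      fix e :: real assume e: "0 < e"
      then obtain k where k: "L2_norm 0 (f k - y) < e/2"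
        using order_tendstoD(2)[OF l, of "e/2"] by (auto simp: eventually_sequentially)
      have e2: "0 < e / 2" using e by simp
      obtain g where g: "g \<in> G" "L2_norm 0 (f k - g) < e/2" using f[of k] e2 unfolding S_def by blast
      have "L2_norm 0 (y - g) \<le> L2_norm 0 (y - f k) + L2_norm 0 (f k - g)"
        using y f g L by (intro norm_on_diff_triangle[OF norm_on_L2 csubspace_L2]) auto
      also have "L2_norm 0 (y - f k) = L2_norm 0 (f k - y)"
        using y f L by (intro norm_on_commute[OF norm_on_L2 csubspace_L2]) auto
      finally show "\<exists>g\<in>G. L2_norm 0 (y - g) < e" using k g by (intro bexI[of _ g]) auto
    qed
  qed (auto simp: S_def)
  interpret coercive_form S "L2_norm 0" L2_inner 1 1
    by unfold_locales
       (auto simp: L L2_inner_add_right L2_inner_scaleC_right L2_inner_self L2_inner_bound comS subS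
         intro: norm_on_subset[OF norm_on_L2] csubspaceD[OF subS] L2_inner_commute)
  obtain a where a: "a \<in> S" "\<And>y. y \<in> S \<Longrightarrow> L2_inner a y = L2_inner x y"
    by (rule riesz[of "L2_inner x" "L2_norm 0 x"]) (use x in \<open>auto simp: L L2_inner_add_right L2_inner_scaleC_right L2_inner_bound\<close>)
  have "x - a = 0"
  proof (rule z)
    show "x - a \<in> X" using x a L X(1) by (simp add: csubspaceD)
    fix g assume g: "g \<in> G"
    then have "L2_inner (x - a) g = 0" using x a GS by (simp add: L L2_inner_diff_left subset_eq)
    then show "L2_inner g (x - a) = 0" using L2_inner_commute[of g "x - a"] by simp
  qed
  then show ?thesis using a(1) e by (auto simp: S_def)
qed

subsection \<open>Bounded maps between \<open>L\<^sup>2\<close> spaces\<close>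

lemma BL_D:
  assumes "T \<in> BL X n Y nY"
  shows "x \<in> X \<Longrightarrow> T x \<in> Y" "x \<in> X \<Longrightarrow> y \<in> X \<Longrightarrow> T (x + y) = T x + T y"
    "x \<in> X \<Longrightarrow> T (a *\<^sub>C x) = a *\<^sub>C T x"
  using assms unfolding BL_def clinear_on_def by auto

lemma BL_diff: "T \<in> BL X n Y nY \<Longrightarrow> csubspace X \<Longrightarrow> x \<in> X \<Longrightarrow> y \<in> X \<Longrightarrow> T (x - y) = T x - T y"
  using BL_D(2)[of T X n Y nY "x - y" y] by (simp add: csubspace_diff)

lemma BL_zero: "T \<in> BL X n Y nY \<Longrightarrow> csubspace X \<Longrightarrow> T 0 = 0"
  using BL_diff[of T X n Y nY 0 0] by (simp add: csubspaceD)

lemma BL_bound: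
  assumes "T \<in> BL X n Y nY" "norm_on X n"
  obtains M where "0 < M" "\<And>x. x \<in> X \<Longrightarrow> nY (T x) \<le> M * n x"
proof -
  from assms obtain M where M: "\<And>x. x \<in> X \<Longrightarrow> nY (T x) \<le> M * n x" unfolding BL_def by auto
  have "nY (T x) \<le> (\<bar>M\<bar> + 1) * n x" if "x \<in> X" for x
    using M[OF that] mult_right_mono[of M "\<bar>M\<bar> + 1" "n x"] norm_onD(1)[OF assms(2) that] by linarith
  then show ?thesis by (intro that[of "\<bar>M\<bar> + 1"]) auto
qed

lemma BL_I:
  assumes "\<And>x. x \<in> X \<Longrightarrow> T x \<in> Y" "\<And>x y. x \<in> X \<Longrightarrow> y \<in> X \<Longrightarrow> T (x + y) = T x + T y"
    "\<And>a x. x \<in> X \<Longrightarrow> T (a *\<^sub>C x) = a *\<^sub>C T x" "\<And>x. x \<in> X \<Longrightarrow> nY (T x) \<le> M * n x"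
  shows "T \<in> BL X n Y nY"
  using assms unfolding BL_def clinear_on_def by blast

lemma BL_comp:
  assumes S: "S \<in> BL Y nY Z nZ" and T: "T \<in> BL X n Y nY" and Y: "norm_on Y nY"
  shows "(\<lambda>x. S (T x)) \<in> BL X n Z nZ"
proof -
  obtain M where M: "0 < M" "\<And>y. y \<in> Y \<Longrightarrow> nZ (S y) \<le> M * nY y" using BL_bound[OF S Y] by blast
  obtain M' where M': "\<And>x. x \<in> X \<Longrightarrow> nY (T x) \<le> M' * n x" using T unfolding BL_def by auto
  show ?thesis
  proof (rule BL_I)
    fix x assume x: "x \<in> X"
    have "nZ (S (T x)) \<le> M * nY (T x)" using M BL_D[OF T] x by auto
    also have "\<dots> \<le> M * (M' * n x)" using M M' x by (intro mult_left_mono) auto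
    finally show "nZ (S (T x)) \<le> (M * M') * n x" by simp
  qed (use BL_D[OF S] BL_D[OF T] in auto)
qed

lemma BL_minus:
  assumes S: "S \<in> BL X n Y nY" and T: "T \<in> BL X n Y nY" and Y: "norm_on Y nY" "csubspace Y"
  shows "(\<lambda>x. S x - T x) \<in> BL X n Y nY"
proof -
  obtain M where M: "\<And>y. y \<in> X \<Longrightarrow> nY (S y) \<le> M * n y" using S unfolding BL_def by auto
  obtain M' where M': "\<And>x. x \<in> X \<Longrightarrow> nY (T x) \<le> M' * n x" using T unfolding BL_def by auto
  note SD = BL_D[OF S] and TD = BL_D[OF T]
  show ?thesis
  proof (rule BL_I)
    fix x assume x: "x \<in> X"
    have "nY (S x - T x) \<le> nY (S x) + nY (- T x)"
      using norm_onD(3)[OF Y(1), of "S x" "- T x"] x SD TD Y by (simp add: csubspaceD)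
    then show "nY (S x - T x) \<le> (M + M') * n x"
      using M[OF x] M'[OF x] norm_on_minus[OF Y(1), of "T x"] TD x by (simp add: algebra_simps)
  qed (use SD TD Y in \<open>auto simp: scaleC_diff_right csubspaceD\<close>)
qed

lemma BL_id: "(\<lambda>x. x) \<in> BL X n X n"
  by (rule BL_I[where M = 1]) auto

lemma BL_zero_map: "csubspace Y \<Longrightarrow> norm_on Y nY \<Longrightarrow> (\<lambda>x. 0) \<in> BL X n Y nY"
  by (rule BL_I[where M = 0]) (auto simp: csubspaceD norm_on_zero)

lemma BL_shift: "shift t \<in> BL (L2 \<omega> :: 'a::chilbert_space aefun set) (L2_norm \<omega>) (L2 \<omega>) (L2_norm \<omega>)"
  by (rule BL_I[where M = "exp (\<omega> * t)"]) (auto simp: L2_shift shift_add shift_scaleC L2_norm_shift)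

lemma BL_cut: "I \<in> sets lebesgue \<Longrightarrow> cut I \<in> BL (L2 \<omega> :: 'a::chilbert_space aefun set) (L2_norm \<omega>) (L2 \<omega>) (L2_norm \<omega>)"
  by (rule BL_I[where M = 1]) (auto simp: L2_cut cut_add cut_scaleC L2_norm_cut_le)

text \<open>Truncations to bounded intervals lie in every weighted space, so an identity between
  bounded maps can be checked where representatives at different weights agree.\<close>

lemma BL_L2_eqI:
  fixes T :: "'a::chilbert_space aefun \<Rightarrow> 'b::complex_vector"
  assumes T: "T \<in> BL (L2 \<beta>) (L2_norm \<beta>) Y nY" and T': "T' \<in> BL (L2 \<beta>) (L2_norm \<beta>) Y nY"
    and Y: "norm_on Y nY" "csubspace Y"
    and eq: "\<And>n::nat. T (cut {- real n..<real n} u) = T' (cut {- real n..<real n} u)"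
    and u: "u \<in> L2 \<beta>"
  shows "T u = T' u"
proof -
  have c: "cut {- real n..<real n} u \<in> L2 \<beta>" for n using u by (intro L2_cut) auto
  have conv: "(\<lambda>n. nY (S (cut {- real n..<real n} u) - S u)) \<longlonglongrightarrow> 0"
    if S: "S \<in> BL (L2 \<beta>) (L2_norm \<beta>) Y nY" for S
  proof -
    obtain M where M: "0 < M" "\<And>x. x \<in> L2 \<beta> \<Longrightarrow> nY (S x) \<le> M * L2_norm \<beta> x" using BL_bound[OF S norm_on_L2] by blast
    have ev: "\<forall>\<^sub>F n in sequentially. t \<in> {- real n..<real n}" for t
    proof -
      obtain N :: nat where "\<bar>t\<bar> < real N" using reals_Archimedean2 by blast
      then have "\<forall>n\<ge>N. t \<in> {- real n..<real n}" by auto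
      then show ?thesis by (auto simp: eventually_sequentially)
    qed
    have "(\<lambda>n. L2_norm \<beta> (u - cut {- real n..<real n} u)) \<longlonglongrightarrow> 0"
      by (rule L2_norm_cut_tendsto[OF u _ ev]) auto
    then have "(\<lambda>n. M * L2_norm \<beta> (u - cut {- real n..<real n} u)) \<longlonglongrightarrow> M * 0" by (intro tendsto_intros)
    then show ?thesis
    proof (rule Lim_null_comparison[rotated, OF tendsto_eq_rhs], simp, intro always_eventually allI)
      fix n
      have "S (cut {- real n..<real n} u) - S u = S (cut {- real n..<real n} u - u)"
        by (rule BL_diff[OF S csubspace_L2 c u, symmetric])
      then show "norm (nY (S (cut {- real n..<real n} u) - S u)) \<le> M * L2_norm \<beta> (u - cut {- real n..<real n} u)"
        using M(2)[of "cut {- real n..<real n} u - u"] norm_on_commute[OF norm_on_L2 csubspace_L2 c u]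
          norm_onD(1)[OF Y(1), of "S (cut {- real n..<real n} u - u)"] BL_D(1)[OF S] by (simp add: L2_diff c u)
    qed
  qed
  show ?thesis
    by (rule limit_eq[OF Y(2,1), of "\<lambda>n. T (cut {- real n..<real n} u)"])
       (use conv[OF T] conv[OF T'] BL_D(1)[OF T] BL_D(1)[OF T'] u c eq in auto)
qed

subsection \<open>Changing the weight of a time-invariant causal map\<close>

lemma TIC_D:
  assumes "D \<in> TIC \<omega>"
  shows "D \<in> BL (L2 \<omega>) (L2_norm \<omega>) (L2 \<omega>) (L2_norm \<omega>)"
    "u \<in> L2 \<omega> \<Longrightarrow> shift t (D u) = D (shift t u)"
    "u \<in> L2 \<omega> \<Longrightarrow> pi_minus (D (pi_plus u)) = 0"
    "u \<in> L2 \<omega> \<Longrightarrow> D u \<in> L2 \<omega>"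
  using assms by (auto simp: TIC_def dest: BL_D(1))

lemma TIC_diff: "D \<in> TIC \<omega> \<Longrightarrow> u \<in> L2 \<omega> \<Longrightarrow> v \<in> L2 \<omega> \<Longrightarrow> D (u - v) = D u - D v"
  by (rule BL_diff[OF TIC_D(1) csubspace_L2])

lemma TIC_add: "D \<in> TIC \<omega> \<Longrightarrow> u \<in> L2 \<omega> \<Longrightarrow> v \<in> L2 \<omega> \<Longrightarrow> D (u + v) = D u + D v"
  by (rule BL_D(2)[OF TIC_D(1)])

lemma TIC_plus:
  assumes D: "D \<in> TIC \<omega>" and u: "u \<in> L2 \<omega>" "pi_plus u = u"
  shows "pi_plus (D u) = D u"
  using TIC_D(3)[OF D u(1)] pi_split[of "D u"] u(2) by simp

lemma TIC_causal_ge: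
  assumes D: "D \<in> TIC \<omega>" and u: "u \<in> L2 \<omega>" "cut {a..} u = u"
  shows "cut {a..} (D u) = D u"
proof -
  have s: "shift a u \<in> L2 \<omega>" "pi_plus (shift a u) = shift a u"
    using arg_cong[OF u(2), of "shift a"] u(1) by (auto simp: L2_shift shift_cut atLeast_def)
  have "pi_plus (D (shift a u)) = D (shift a u)" by (rule TIC_plus[OF D s])
  then have "pi_plus (shift a (D u)) = shift a (D u)" using TIC_D(2)[OF D u(1)] by simp
  then have "shift (- a) (pi_plus (shift a (D u))) = D u" by simp
  then show ?thesis by (simp add: shift_cut atLeast_def)
qed

lemma lessThan_split: "cut {..<a} f + cut {a..} f = (f::'a::ab_group_add aefun)" for a :: real
proof -
  have "{..<a} \<union> {a..} = UNIV" "{..<a} \<inter> {a..} = {}" by auto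
  then show ?thesis using cut_split[of "{..<a}" "{a..}" f] by simp
qed

lemma TIC_causal:
  assumes D: "D \<in> TIC \<omega>" and u: "u \<in> L2 \<omega>"
  shows "cut {..<a} (D u) = cut {..<a} (D (cut {..<a} u))"
proof -
  have m: "cut {..<a} u \<in> L2 \<omega>" "cut {a..} u \<in> L2 \<omega>" using u by (auto intro: L2_cut)
  have "cut {a..} (D (cut {a..} u)) = D (cut {a..} u)" by (rule TIC_causal_ge[OF D m(2)]) simp
  then have "cut {..<a} (D (cut {a..} u)) = cut ({..<a} \<inter> {a..}) (D (cut {a..} u))" by (metis cut_cut)
  also have "{..<a} \<inter> {a..} = {}" by auto
  finally have z: "cut {..<a} (D (cut {a..} u)) = 0" by simp
  have "D u = D (cut {..<a} u) + D (cut {a..} u)" using TIC_add[OF D m] by (simp add: lessThan_split)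
  then show ?thesis using z by (simp add: cut_add)
qed

lemma TIC_causal_interval:
  assumes D: "D \<in> TIC \<omega>" and u: "u \<in> L2 \<omega>"
  shows "cut {b..<a} (D u) = cut {b..<a} (D (cut {..<a} u))"
  by (rule cut_eq_subset[OF TIC_causal[OF D u]]) auto

lemma L2_norm_unit_interval:
  assumes "f \<in> L2 \<omega>"
  shows "cut {real_of_int n..<real_of_int n + 1} f \<in> L2 0"
    "L2_norm 0 (cut {real_of_int n..<real_of_int n + 1} f) \<le> exp \<bar>\<omega>\<bar> * exp (\<omega> * n) * L2_norm \<omega> f"
proof -
  let ?I = "{real_of_int n..<real_of_int n + 1}"
  have "exp (- 0 * t) \<le> exp \<bar>\<omega>\<bar> * exp (\<omega> * n) * exp (- \<omega> * t)" if t: "t \<in> ?I" for t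
  proof -
    have "\<bar>\<omega> * (t - n)\<bar> \<le> \<bar>\<omega>\<bar> * 1" using t unfolding abs_mult by (intro mult_left_mono) auto
    then have "0 \<le> \<bar>\<omega>\<bar> + \<omega> * n + - \<omega> * t" by (simp add: algebra_simps abs_le_iff)
    then show ?thesis by (simp add: exp_add[symmetric])
  qed
  then have *: "cut ?I f \<in> L2 0" "L2_norm 0 (cut ?I f) \<le> exp \<bar>\<omega>\<bar> * exp (\<omega> * n) * L2_norm \<omega> (cut ?I f)"
    using L2_weight_mono[of ?I "cut ?I f" 0 "exp \<bar>\<omega>\<bar> * exp (\<omega> * n)" \<omega>] assms by (auto simp: L2_cut)
  then show "cut ?I f \<in> L2 0" by simp
  have "exp \<bar>\<omega>\<bar> * exp (\<omega> * n) * L2_norm \<omega> (cut ?I f) \<le> exp \<bar>\<omega>\<bar> * exp (\<omega> * n) * L2_norm \<omega> f"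
    by (intro mult_left_mono L2_norm_cut_le assms) auto
  then show "L2_norm 0 (cut ?I f) \<le> exp \<bar>\<omega>\<bar> * exp (\<omega> * n) * L2_norm \<omega> f" using * by linarith
qed

lemma sets_Icc [simp]: "{a..<b} \<in> sets (lebesgue :: real measure)" "{..<b} \<in> sets (lebesgue :: real measure)"
  "{a..} \<in> sets (lebesgue :: real measure)"
  by auto

lemma L2_cut_interval: "f \<in> L2 \<beta> \<Longrightarrow> cut {a..<b} f \<in> L2 \<alpha>"
  by (rule L2_bounded_support[of a b _ \<beta>]) (simp_all add: L2_cut)

lemma eventually_interval: "\<forall>\<^sub>F n in sequentially. t \<in> {- real n..<real n}"
proof -
  obtain N :: nat where "\<bar>t\<bar> < real N" using reals_Archimedean2 by blast
  then have "\<forall>n\<ge>N. t \<in> {- real n..<real n}" by auto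
  then show ?thesis by (auto simp: eventually_sequentially)
qed

lemma L2_norm_interval_tendsto:
  "f \<in> L2 \<beta> \<Longrightarrow> (\<lambda>n. L2_norm \<beta> (f - cut {- real n..<real n} f)) \<longlonglongrightarrow> 0"
  by (rule L2_norm_cut_tendsto) (auto intro: eventually_interval[simplified])

text \<open>By causality the output on \<open>[n, n+1)\<close> depends only on the input before
  \<open>n + 1\<close>, which lies in the smaller weight too; there the given bound applies and
  \<open>L2_slices\<close> adds the pieces. Truncated inputs are dense, and the identities of
  \<open>TIC\<close> pass to the extension through \<open>BL_L2_eqI\<close>.\<close>

lemma TIC_reweight:
  fixes D :: "'u::chilbert_space aefun \<Rightarrow> 'y::chilbert_space aefun"
  assumes D: "D \<in> TIC \<omega>" and "\<omega> < \<beta>"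
  obtains D' where "D' \<in> TIC \<beta>" "\<And>u. u \<in> L2 \<omega> \<Longrightarrow> u \<in> L2 \<beta> \<Longrightarrow> D' u = D u"
proof -
  obtain K where K: "0 < K" "\<And>u. u \<in> L2 \<omega> \<Longrightarrow> L2_norm \<omega> (D u) \<le> K * L2_norm \<omega> u"
    using BL_bound[OF TIC_D(1)[OF D] norm_on_L2] by blast
  have bd: "D u \<in> L2 \<beta> \<and> L2_norm \<beta> (D u) \<le> slice_const \<omega> \<beta> (exp \<bar>\<omega>\<bar> * K) * L2_norm \<beta> u"
    if u: "u \<in> L2 \<omega>" "u \<in> L2 \<beta>" for u
  proof -
    have c: "cut {real_of_int n..<real_of_int n + 1} (D u) \<in> L2 0 \<and>
        L2_norm 0 (cut {real_of_int n..<real_of_int n + 1} (D u)) \<le> exp \<bar>\<omega>\<bar> * K * exp (\<omega> * n) * L2_norm \<omega> (cut {..<real_of_int n + 1} u)" for n :: int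
    proof -
      let ?v = "D (cut {..<real_of_int n + 1} u)"
      have cu: "cut {..<real_of_int n + 1} u \<in> L2 \<omega>" using u by (simp add: L2_cut)
      then have v: "?v \<in> L2 \<omega>" by (rule TIC_D(4)[OF D])
      have le: "exp \<bar>\<omega>\<bar> * exp (\<omega> * n) * L2_norm \<omega> ?v \<le> exp \<bar>\<omega>\<bar> * exp (\<omega> * n) * (K * L2_norm \<omega> (cut {..<real_of_int n + 1} u))"
        by (intro mult_left_mono K cu) auto
      have eq: "exp \<bar>\<omega>\<bar> * exp (\<omega> * n) * (K * L2_norm \<omega> (cut {..<real_of_int n + 1} u)) = exp \<bar>\<omega>\<bar> * K * exp (\<omega> * n) * L2_norm \<omega> (cut {..<real_of_int n + 1} u)"
        by (simp only: mult_ac)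
      show ?thesis
        unfolding TIC_causal_interval[OF D u(1)]
        using L2_norm_unit_interval(1)[OF v, of n] order_trans[OF L2_norm_unit_interval(2)[OF v, of n] le, unfolded eq] by blast
    qed
    show ?thesis
      using L2_slices[OF L2_sm[OF TIC_D(4)[OF D u(1)]] u(2) assms(2), of "exp \<bar>\<omega>\<bar> * K"] c K(1) by auto
  qed
  let ?G = "{(u, D u) |u. u \<in> L2 \<omega> \<and> u \<in> L2 \<beta>}"
  have sG: "csubspace ?G"
    unfolding csubspace_def
  proof (intro conjI ballI allI)
    show "0 \<in> ?G" using BL_zero[OF TIC_D(1)[OF D] csubspace_L2] by (auto simp: zero_prod_def)
    fix x assume "x \<in> ?G"
    then obtain u where u: "x = (u, D u)" "u \<in> L2 \<omega>" "u \<in> L2 \<beta>" by blast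
    show "x + y \<in> ?G" if "y \<in> ?G" for y
    proof -
      from that obtain v where v: "y = (v, D v)" "v \<in> L2 \<omega>" "v \<in> L2 \<beta>" by blast
      show ?thesis using u v TIC_add[OF D u(2) v(2)] by (auto simp: L2_add)
    qed
    show "a *\<^sub>C x \<in> ?G" for a
      using u BL_D(3)[OF TIC_D(1)[OF D] u(2)] by (auto simp: L2_scaleC scaleC_prod_def)
  qed
  obtain D' where D': "D' ` L2 \<beta> \<subseteq> L2 \<beta>" "clinear_on (L2 \<beta>) D'"
    "\<And>x. x \<in> L2 \<beta> \<Longrightarrow> L2_norm \<beta> (D' x) \<le> slice_const \<omega> \<beta> (exp \<bar>\<omega>\<bar> * K) * L2_norm \<beta> x"
    "\<And>w u. (w, u) \<in> ?G \<Longrightarrow> D' w = u"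
  proof (rule extension_by_continuity[OF csubspace_L2 norm_on_L2 csubspace_L2 norm_on_L2 L2_complete sG])
    show "w \<in> L2 \<beta> \<and> u \<in> L2 \<beta> \<and> L2_norm \<beta> u \<le> slice_const \<omega> \<beta> (exp \<bar>\<omega>\<bar> * K) * L2_norm \<beta> w"
      if "(w, u) \<in> ?G" for w u using that bd by auto
    show "\<exists>(w, u)\<in>?G. L2_norm \<beta> (x - w) < e" if x: "x \<in> L2 \<beta>" and e: "0 < e" for x e
    proof -
      obtain n where n: "L2_norm \<beta> (x - cut {- real n..<real n} x) < e"
        using order_tendstoD(2)[OF L2_norm_interval_tendsto[OF x] e] by (auto simp: eventually_sequentially)
      then show ?thesis using L2_cut_interval[OF x] by (intro bexI[of _ "(cut {- real n..<real n} x, D (cut {- real n..<real n} x))"]) auto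
    qed
    show "0 \<le> slice_const \<omega> \<beta> (exp \<bar>\<omega>\<bar> * K)" using K assms(2) by (intro slice_const_nonneg) auto
  qed auto
  have agree: "D' u = D u" if "u \<in> L2 \<omega>" "u \<in> L2 \<beta>" for u using D'(4)[of u "D u"] that by blast
  have BLD: "D' \<in> BL (L2 \<beta>) (L2_norm \<beta>) (L2 \<beta>) (L2_norm \<beta>)"
    unfolding BL_def using D'(1-3) by blast
  have "D' \<in> TIC \<beta>"
    unfolding TIC_def
  proof (intro CollectI conjI allI ballI BLD)
    fix t and u :: "'u aefun" assume u: "u \<in> L2 \<beta>"
    show "shift t (D' u) = D' (shift t u)"
    proof (rule BL_L2_eqI[OF BL_comp[OF BL_shift BLD norm_on_L2] BL_comp[OF BLD BL_shift norm_on_L2] norm_on_L2 csubspace_L2 _ u])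
      fix n :: nat
      have c: "cut {- real n..<real n} u \<in> L2 \<alpha>" for \<alpha> using L2_cut_interval[OF u] .
      then show "shift t (D' (cut {- real n..<real n} u)) = D' (shift t (cut {- real n..<real n} u))"
        by (simp add: agree L2_shift TIC_D(2)[OF D])
    qed
  next
    fix u :: "'u aefun" assume u: "u \<in> L2 \<beta>"
    show "pi_minus (D' (pi_plus u)) = 0"
    proof (rule BL_L2_eqI[OF BL_comp[OF BL_cut BL_comp[OF BLD BL_cut norm_on_L2] norm_on_L2] BL_zero_map[OF csubspace_L2 norm_on_L2] norm_on_L2 csubspace_L2 _ u])
      fix n :: nat
      have c: "cut {- real n..<real n} u \<in> L2 \<alpha>" for \<alpha> using L2_cut_interval[OF u] .
      then have "D' (pi_plus (cut {- real n..<real n} u)) = D (pi_plus (cut {- real n..<real n} u))"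
        by (intro agree L2_cut[OF c]) simp_all
      then show "pi_minus (D' (pi_plus (cut {- real n..<real n} u))) = 0"
        using TIC_D(3)[OF D c] by simp
    qed auto
  qed
  then show ?thesis using agree by (rule that)
qed

subsection \<open>Well-posed linear systems\<close>

lemma wplsD:
  assumes "wpls \<omega> A B C D"
  shows "C0_semigroup A" "bdd_above ((\<lambda>t. exp (- \<omega> * t) * onorm (A t)) ` {0..})"
    "B \<in> BL (L2 \<omega>) (L2_norm \<omega>) UNIV norm"
    "0 \<le> t \<Longrightarrow> u \<in> L2 \<omega> \<Longrightarrow> A t (B u) = B (shift t (pi_minus u))"
    "C \<in> BL UNIV norm (L2 \<omega>) (L2_norm \<omega>)"
    "0 \<le> t \<Longrightarrow> C (A t x) = pi_plus (shift t (C x))"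
    "D \<in> TIC \<omega>"
    "u \<in> L2 \<omega> \<Longrightarrow> pi_plus (D (pi_minus u)) = C (B u)"
  using assms unfolding wpls_def by auto

lemma wpls_A0: "wpls \<omega> A B C D \<Longrightarrow> A 0 x = x"
proof -
  assume "wpls \<omega> A B C D"
  from wplsD(1)[OF this] show "A 0 x = x" by (simp add: C0_semigroup_def)
qed

lemma wpls_B_pi_minus: "wpls \<omega> A B C D \<Longrightarrow> u \<in> L2 \<omega> \<Longrightarrow> B (pi_minus u) = B u"
  using wplsD(4)[of \<omega> A B C D 0 u] by (simp add: wpls_A0)

lemma wpls_C_plus: "wpls \<omega> A B C D \<Longrightarrow> C x \<in> L2_plus \<omega>"
  using wplsD(6)[of \<omega> A B C D 0 x] BL_D(1)[OF wplsD(5), of \<omega> A B C D x] by (simp add: wpls_A0 L2_plus_def)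

text \<open>The input map sees only the past, where the larger weight gives the larger norm; this is
  why \<open>B'\<close> may be \<open>B\<close> applied to the past. The outputs of \<open>C\<close>
  live on the half-line, where the comparison is reversed.\<close>

lemma wpls_reweight:
  fixes A :: "real \<Rightarrow> 'h::chilbert_space \<Rightarrow> 'h" and B :: "'u::chilbert_space aefun \<Rightarrow> 'h"
    and C :: "'h \<Rightarrow> 'y::chilbert_space aefun"
  assumes w: "wpls \<omega> A B C D" and "\<omega> < \<beta>"
    and B': "\<And>u. u \<in> L2 \<beta> \<Longrightarrow> B' u = B (pi_minus u)"
    and D': "D' \<in> TIC \<beta>" "\<And>u. u \<in> L2 \<omega> \<Longrightarrow> u \<in> L2 \<beta> \<Longrightarrow> D' u = D u"
  shows "wpls \<beta> A B' C D'"
  unfolding wpls_def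
proof (intro conjI allI impI ballI)
  note W = wplsD[OF w]
  have m: "pi_minus u \<in> L2 \<omega>" "L2_norm \<omega> (pi_minus u) \<le> L2_norm \<beta> (pi_minus u)" "pi_minus u \<in> L2 \<beta>"
    if "u \<in> L2 \<beta>" for u :: "'u aefun"
    using L2_weight_minus[of "pi_minus u" \<omega> \<beta>] that assms(2) by (simp_all add: L2_cut)
  show "C0_semigroup A" by (rule W)
  obtain M where M: "\<And>t. 0 \<le> t \<Longrightarrow> exp (- \<omega> * t) * onorm (A t) \<le> M"
    using W(2) by (auto simp: bdd_above_def)
  have "exp (- \<beta> * t) * onorm (A t) \<le> \<bar>M\<bar>" if t: "0 \<le> t" for t
  proof -
    have "bounded_linear (A t)"
    proof -
      have A: "A t \<in> BL UNIV norm UNIV norm" using W(1) t by (simp add: C0_semigroup_def)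
      obtain K where K: "\<And>x. norm (A t x) \<le> K * norm x" using A by (auto simp: BL_def)
      show ?thesis
        by (rule bounded_linear_intro[of _ K]) (use BL_D[OF A] K in \<open>auto simp: scaleR_scaleC mult.commute\<close>)
    qed
    then have o: "0 \<le> onorm (A t)" by (rule onorm_pos_le)
    have "exp (- \<beta> * t) \<le> exp (- \<omega> * t)" using assms(2) t by (simp add: mult_right_mono)
    then have "exp (- \<beta> * t) * onorm (A t) \<le> exp (- \<omega> * t) * onorm (A t)" using o by (rule mult_right_mono)
    then show ?thesis using M[OF t] by linarith
  qed
  then show "bdd_above ((\<lambda>t. exp (- \<beta> * t) * onorm (A t)) ` {0..})" by (auto intro!: bdd_aboveI2)
  obtain K where K: "0 < K" "\<And>u. u \<in> L2 \<omega> \<Longrightarrow> norm (B u) \<le> K * L2_norm \<omega> u"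
    using BL_bound[OF W(3) norm_on_L2] by blast
  show "B' \<in> BL (L2 \<beta>) (L2_norm \<beta>) UNIV norm"
  proof (rule BL_I)
    show "norm (B' u) \<le> K * L2_norm \<beta> u" if u: "u \<in> L2 \<beta>" for u
    proof -
      have "norm (B' u) \<le> K * L2_norm \<omega> (pi_minus u)" using B'[OF u] K m u by simp
      also have "\<dots> \<le> K * L2_norm \<beta> u"
        using m(2)[OF u] L2_norm_cut_le[OF u, of "{..<0}"] K by (intro mult_left_mono) auto
      finally show ?thesis .
    qed
    show "B' (x + y) = B' x + B' y" if "x \<in> L2 \<beta>" "y \<in> L2 \<beta>" for x y
      using that m BL_D(2)[OF W(3)] by (simp add: B' L2_add cut_add)
    show "B' (a *\<^sub>C x) = a *\<^sub>C B' x" if "x \<in> L2 \<beta>" for a x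
      using that m BL_D(3)[OF W(3)] by (simp add: B' L2_scaleC cut_scaleC)
  qed simp
  show "A t (B' u) = B' (shift t (pi_minus u))" if t: "0 \<le> t" and u: "u \<in> L2 \<beta>" for t u
  proof -
    have s: "shift t (pi_minus u) \<in> L2 \<beta>" using m[OF u] by (simp add: L2_shift)
    have f: "pi_minus (shift t (pi_minus u)) = shift t (pi_minus u)"
    proof -
      have "{s. t + s \<in> {..<0}} \<subseteq> {..<0}" using t by auto
      then show ?thesis by (simp add: shift_cut inf.absorb2)
    qed
    show ?thesis using W(4)[OF t m(1)[OF u]] by (simp add: B'[OF u] B'[OF s] f)
  qed
  obtain M' where M': "0 < M'" "\<And>x. L2_norm \<omega> (C x) \<le> M' * norm x"
    by (rule BL_bound[OF W(5)]) (auto simp: norm_on_def norm_scaleC norm_triangle_ineq)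
  show "C \<in> BL UNIV norm (L2 \<beta>) (L2_norm \<beta>)"
  proof (rule BL_I[where M = M'])
    fix x
    have "L2_norm \<beta> (C x) \<le> L2_norm \<omega> (C x)" "C x \<in> L2 \<beta>"
      using L2_weight_plus[of "C x" \<omega> \<beta>] wpls_C_plus[OF w, of x] assms(2) by (simp_all add: L2_plus_def)
    then show "C x \<in> L2 \<beta>" "L2_norm \<beta> (C x) \<le> M' * norm x" using M'(2)[of x] by simp_all
  qed (use BL_D[OF W(5)] in auto)
  show "C (A t x) = pi_plus (shift t (C x))" if "0 \<le> t" for t x using W(6)[OF that] .
  show "D' \<in> TIC \<beta>" by (rule D')
  show "pi_plus (D' (pi_minus u)) = C (B' u)" if u: "u \<in> L2 \<beta>" for u
    using W(8)[OF m(1)[OF u]] m[OF u] by (simp add: D' B'[OF u])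
qed

subsection \<open>The causal extension\<close>

lemma aefun_eqI_cuts:
  fixes f g :: "'a::ab_group_add aefun"
  assumes "pi_plus f = f" "pi_plus g = g" "\<And>T. 0 < T \<Longrightarrow> cut {0..<T} f = cut {0..<T} g"
  shows "f = g"
proof (cases f; cases g)
  fix f' g' assume e: "f = abs_aefun f'" "g = abs_aefun g'"
  have 1: "AE t in lebesgue. (if t \<in> {0..} then f' t else 0) = f' t"
    "AE t in lebesgue. (if t \<in> {0..} then g' t else 0) = g' t"
    using assms(1,2) by (simp_all only: e cut.abs_eq abs_aefun_eq_iff)
  have "AE t in lebesgue. (if t \<in> {0..<real (Suc n)} then f' t else 0) = (if t \<in> {0..<real (Suc n)} then g' t else 0)" for n
    using assms(3)[of "real (Suc n)"] unfolding e cut.abs_eq abs_aefun_eq_iff by simp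
  then have "AE t in lebesgue. \<forall>n. (if t \<in> {0..<real (Suc n)} then f' t else 0) = (if t \<in> {0..<real (Suc n)} then g' t else 0)"
    unfolding AE_all_countable ..
  with 1 have "AE t in lebesgue. f' t = g' t"
  proof eventually_elim
    case (elim t)
    show ?case
    proof (cases "0 \<le> t")
      case True
      obtain n where "t < real n" using reals_Archimedean2 by blast
      then have "t < real (Suc n)" by simp
      then show ?thesis using elim(3)[rule_format, of n] True by simp
    next
      case False then show ?thesis using elim by simp
    qed
  qed
  then show ?thesis by (simp add: e abs_aefun_eq_iff)
qed

lemma causal_ext_eqI:
  fixes y :: "'y::ab_group_add aefun"
  assumes "pi_plus y = y" "\<And>T. 0 < T \<Longrightarrow> cut {0..<T} y = cut {0..<T} (D (cut {0..<T} u))"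
  shows "causal_ext D u = y"
  unfolding causal_ext_def
proof (rule the_equality)
  show "pi_plus y = y \<and> (\<forall>T>0. cut {0..<T} y = cut {0..<T} (D (cut {0..<T} u)))" using assms by blast
  show "z = y" if "pi_plus z = z \<and> (\<forall>T>0. cut {0..<T} z = cut {0..<T} (D (cut {0..<T} u)))" for z
  proof (rule aefun_eqI_cuts)
    show "pi_plus z = z" using that by blast
    show "cut {0..<T} z = cut {0..<T} y" if T: "0 < T" for T
      using \<open>pi_plus z = z \<and> _\<close> assms(2)[OF T] T by metis
  qed (rule assms(1))
qed

text \<open>Inputs truncated to \<open>[0, T)\<close> belong to both weighted spaces, so the causal
  extension of any representative is the reweighted map itself. Inside the proof every
  \<open>causal_ext\<close> is replaced in this way.\<close>

lemma causal_ext_TIC: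
  assumes D': "D' \<in> TIC \<beta>" and agree: "\<And>u. u \<in> L2 \<omega> \<Longrightarrow> u \<in> L2 \<beta> \<Longrightarrow> D' u = D u"
    and u: "u \<in> L2_plus \<beta>"
  shows "causal_ext D u = D' u"
proof (rule causal_ext_eqI)
  have u': "u \<in> L2 \<beta>" "pi_plus u = u" using u by (auto simp: L2_plus_def)
  show "pi_plus (D' u) = D' u" by (rule TIC_plus[OF D' u'])
  fix T :: real assume "0 < T"
  have e: "cut {..<T} u = cut {0..<T} u"
  proof -
    have "cut {..<T} (pi_plus u) = cut {0..<T} u" by (simp, rule arg_cong[where f = "\<lambda>I. cut I u"]) auto
    then show ?thesis using u'(2) by simp
  qed
  have "cut {0..<T} (D' u) = cut {0..<T} (D' (cut {0..<T} u))"
    using TIC_causal_interval[OF D' u'(1), of 0 T] by (simp add: e)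
  also have "D' (cut {0..<T} u) = D (cut {0..<T} u)"
    using L2_cut_interval[OF u'(1)] by (intro agree) auto
  finally show "cut {0..<T} (D' u) = cut {0..<T} (D (cut {0..<T} u))" .
qed

subsection \<open>Normed carriers as metric spaces\<close>

lemma norm_dist_metric:
  assumes "csubspace X" "norm_on X n"
  shows "Metric_space X (norm_dist X n)"
proof
  note XD = csubspaceD[OF assms(1)] and nD = norm_onD[OF assms(2)]
  show "0 \<le> norm_dist X n x y" for x y by (simp add: norm_dist_def XD nD)
  show "norm_dist X n x y = norm_dist X n y x" for x y
    using norm_on_commute[OF assms(2,1), of x y] by (simp add: norm_dist_def)
  show "norm_dist X n x y = 0 \<longleftrightarrow> x = y" if "x \<in> X" "y \<in> X" for x y
    using that by (simp add: norm_dist_def XD nD)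
  show "norm_dist X n x z \<le> norm_dist X n x y + norm_dist X n y z" if "x \<in> X" "y \<in> X" "z \<in> X" for x y z
    using that norm_on_diff_triangle[OF assms(2,1)] by (simp add: norm_dist_def)
qed

lemma limitin_norm_topology:
  assumes X: "csubspace X" "norm_on X n" and f: "\<And>k::nat. f k \<in> X" "x \<in> X" "(\<lambda>k. n (f k - x)) \<longlonglongrightarrow> 0"
  shows "limitin (norm_topology X n) f x sequentially"
proof -
  interpret Metric_space X "norm_dist X n" by (rule norm_dist_metric[OF X])
  show ?thesis
    unfolding norm_topology_def limit_metric_sequentially
  proof (intro conjI allI impI f)
    fix e :: real assume "0 < e"
    then obtain N where "\<And>k. k \<ge> N \<Longrightarrow> n (f k - x) < e"
      using order_tendstoD(2)[OF f(3)] by (auto simp: eventually_sequentially)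
    then show "\<exists>N. \<forall>k\<ge>N. f k \<in> X \<and> norm_dist X n (f k) x < e" using f by (auto simp: norm_dist_def)
  qed
qed

lemma banach_space_on_ncomplete:
  assumes "banach_space_on X n" shows "csubspace X" "norm_on X n" "ncomplete X n"
proof -
  show X: "csubspace X" "norm_on X n" using assms by (auto simp: banach_space_on_def)
  interpret Metric_space X "norm_dist X n" by (rule norm_dist_metric[OF X])
  have mc: mcomplete using assms by (simp add: banach_space_on_def)
  show "ncomplete X n" unfolding ncomplete_def
  proof (intro allI impI, elim conjE)
    fix f :: "nat \<Rightarrow> 'a" assume f: "\<forall>k. f k \<in> X" and c: "\<forall>e>0. \<exists>N. \<forall>i\<ge>N. \<forall>j\<ge>N. n (f i - f j) < e"
    have "MCauchy f" unfolding MCauchy_def using f c by (auto simp: norm_dist_def)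
    then obtain x where x: "limitin mtopology f x sequentially" using mc by (auto simp: mcomplete_def)
    then have xX: "x \<in> X" and lim: "\<forall>e>0. \<exists>N. \<forall>k\<ge>N. f k \<in> X \<and> norm_dist X n (f k) x < e"
      by (auto simp: limit_metric_sequentially)
    have "(\<lambda>k. n (f k - x)) \<longlonglongrightarrow> 0"
    proof (rule LIMSEQ_I)
      fix e :: real assume "0 < e"
      then obtain N where N: "\<forall>k\<ge>N. f k \<in> X \<and> norm_dist X n (f k) x < e" using lim by blast
      have "norm (n (f k - x) - 0) < e" if "N \<le> k" for k
        using N that xX f norm_onD(1)[OF X(2), of "f k - x"] by (auto simp: norm_dist_def csubspaceD[OF X(1)])
      then show "\<exists>N. \<forall>k\<ge>N. norm (n (f k - x) - 0) < e" by blast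
    qed
    with xX show "\<exists>x\<in>X. (\<lambda>k. n (f k - x)) \<longlonglongrightarrow> 0" by blast
  qed
qed

section \<open>Sums, series and limits in normed carriers\<close>

lemma csubspace_sum: "csubspace X \<Longrightarrow> (\<And>i. i \<in> I \<Longrightarrow> f i \<in> X) \<Longrightarrow> sum f I \<in> X"
  by (induction I rule: infinite_finite_induct) (auto simp: csubspaceD)

lemma norm_on_sum: "csubspace X \<Longrightarrow> norm_on X n \<Longrightarrow> (\<And>i. i \<in> I \<Longrightarrow> f i \<in> X) \<Longrightarrow> n (sum f I) \<le> (\<Sum>i\<in>I. n (f i))"
proof (induction I rule: infinite_finite_induct)
  case (insert i I)
  then have "n (f i + sum f I) \<le> n (f i) + n (sum f I)" by (intro norm_onD(3)) (auto intro: csubspace_sum)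
  then show ?case using insert by fastforce
qed (auto simp: norm_on_zero)

lemma norm_on_lim_le:
  assumes X: "csubspace X" "norm_on X n" and f: "\<And>k::nat. f k \<in> X" "x \<in> X" "(\<lambda>k. n (f k - x)) \<longlonglongrightarrow> 0"
    and le: "\<And>k. n (f k) \<le> c"
  shows "n x \<le> c"
proof -
  have "(\<lambda>k. c + n (f k - x)) \<longlonglongrightarrow> c + 0" by (intro tendsto_intros f)
  moreover have "n x \<le> c + n (f k - x)" for k
    using norm_onD(3)[OF X(2), of "f k" "x - f k"] f X le[of k] norm_on_commute[OF X(2,1), of x "f k"]
    by (simp add: csubspaceD)
  ultimately show ?thesis by (intro LIMSEQ_le_const[of _ c]) auto
qed

lemma summable_converges:
  assumes X: "csubspace X" "norm_on X n" "ncomplete X n" and g: "\<And>k::nat. g k \<in> X" "summable (\<lambda>k. n (g k))"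
  obtains l where "l \<in> X" "(\<lambda>m. n ((\<Sum>k<m. g k) - l)) \<longlonglongrightarrow> 0" "n l \<le> (\<Sum>k. n (g k))"
proof -
  have s: "(\<Sum>k<m. g k) \<in> X" for m using X g by (intro csubspace_sum) auto
  have nn: "0 \<le> n (g k)" for k using norm_onD(1)[OF X(2) g(1)] .
  have le: "n ((\<Sum>k<i. g k) - (\<Sum>k<j. g k)) \<le> (\<Sum>k\<in>{j..<i}. n (g k))" if "j \<le> i" for i j
  proof -
    have "(\<Sum>k<i. g k) - (\<Sum>k<j. g k) = (\<Sum>k\<in>{j..<i}. g k)"
      using that sum_diff_nat_ivl[of 0 j i g] by (simp add: atLeast0LessThan)
    then show ?thesis using norm_on_sum[OF X(1,2), of "{j..<i}" g] g by simp
  qed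
  obtain l where l: "l \<in> X" "(\<lambda>m. n ((\<Sum>k<m. g k) - l)) \<longlonglongrightarrow> 0"
  proof (rule ncompleteD[OF X(3) s])
    fix e :: real assume e: "0 < e"
    obtain N where N: "\<And>a b. N \<le> a \<Longrightarrow> norm (\<Sum>k\<in>{a..<b}. n (g k)) < e"
      using g(2) e unfolding summable_Cauchy by blast
    have "n ((\<Sum>k<i. g k) - (\<Sum>k<j. g k)) < e" if "N \<le> i" "N \<le> j" for i j
    proof (cases "j \<le> i")
      case True
      then show ?thesis using le[OF True] N[OF that(2), of i] by force
    next
      case False
      then have "i \<le> j" by simp
      then show ?thesis
        using le[OF \<open>i \<le> j\<close>] N[OF that(1), of j] norm_on_commute[OF X(2,1) s s, of i j] by force
    qed
    then show "\<exists>N. \<forall>i\<ge>N. \<forall>j\<ge>N. n ((\<Sum>k<i. g k) - (\<Sum>k<j. g k)) < e" by blast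
  qed auto
  moreover have "n l \<le> (\<Sum>k. n (g k))"
  proof (rule norm_on_lim_le[OF X(1,2) s l])
    show "n (\<Sum>k<m. g k) \<le> (\<Sum>k. n (g k))" for m
      using norm_on_sum[OF X(1,2), of "{..<m}" g] g sum_le_suminf[OF g(2), of "{..<m}"] nn by fastforce
  qed
  ultimately show ?thesis by (rule that)
qed

lemma BL_lim:
  assumes T: "T \<in> BL X n Y nY" and X: "csubspace X" "norm_on X n" and Y: "norm_on Y nY"
    and f: "\<And>k::nat. f k \<in> X" "x \<in> X" "(\<lambda>k. n (f k - x)) \<longlonglongrightarrow> 0"
  shows "(\<lambda>k. nY (T (f k) - T x)) \<longlonglongrightarrow> 0"
proof -
  obtain M where M: "0 < M" "\<And>x. x \<in> X \<Longrightarrow> nY (T x) \<le> M * n x" using BL_bound[OF T X(2)] by blast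
  have "(\<lambda>k. M * n (f k - x)) \<longlonglongrightarrow> M * 0" by (intro tendsto_intros f)
  then show ?thesis
  proof (rule Lim_null_comparison[rotated, OF tendsto_eq_rhs], simp, intro always_eventually allI)
    fix k
    have d: "f k - x \<in> X" using f X by (simp add: csubspaceD)
    then have "nY (T (f k - x)) \<le> M * n (f k - x)" "0 \<le> nY (T (f k - x))"
      using M norm_onD(1)[OF Y] BL_D(1)[OF T] by auto
    then show "norm (nY (T (f k) - T x)) \<le> M * n (f k - x)"
      using BL_diff[OF T X(1) f(1) f(2)] by simp
  qed
qed

lemma L2_norm_zero [simp]: "L2_norm \<omega> (0 :: 'a::chilbert_space aefun) = 0"
  by (rule norm_on_zero[OF norm_on_L2 csubspace_L2])

lemma csubspace_UNIV: "csubspace UNIV" by (simp add: csubspace_def)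

lemma norm_on_UNIV: "norm_on (UNIV :: 'a::chilbert_space set) norm"
  by (simp add: norm_on_def norm_scaleC norm_triangle_ineq)

subsection \<open>Pointwise application of a bounded operator\<close>

lemma L2_inner_bound_lim:
  fixes f g :: "nat \<Rightarrow> 'a::chilbert_space aefun"
  assumes "\<And>k. f k \<in> L2 0" "x \<in> L2 0" "y \<in> L2 0" "(\<lambda>k. L2_norm 0 (f k - x)) \<longlonglongrightarrow> 0"
  shows "(\<lambda>k. L2_inner y (f k)) \<longlonglongrightarrow> L2_inner y x"
proof -
  have "(\<lambda>k. L2_norm 0 y * L2_norm 0 (f k - x)) \<longlonglongrightarrow> L2_norm 0 y * 0" by (intro tendsto_intros assms)
  then have "(\<lambda>k. L2_inner y (f k) - L2_inner y x) \<longlonglongrightarrow> 0"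
  proof (rule Lim_null_comparison[rotated, OF tendsto_eq_rhs], simp, intro always_eventually allI)
    fix k
    show "norm (L2_inner y (f k) - L2_inner y x) \<le> L2_norm 0 y * L2_norm 0 (f k - x)"
      using L2_inner_bound[of y "f k - x"] assms by (simp add: L2_diff L2_inner_diff_right)
  qed
  then show ?thesis by (simp add: LIM_zero_iff)
qed

text \<open>Instantiated twice: with the cost operator \<open>J\<close> on the outputs and with the
  Gram operator \<open>\<Gamma>\<close> on the inputs.\<close>

locale bounded_symmetric =
  fixes J :: "'y::chilbert_space \<Rightarrow> 'y"
  assumes J: "J \<in> BL UNIV norm UNIV norm" and Jsym: "\<And>x y. cinner (J x) y = cinner x (J y)"
begin

abbreviation "MJ \<equiv> map_aefun J"

lemma J_add: "J (x + y) = J x + J y" and J_scale: "J (a *\<^sub>C x) = a *\<^sub>C J x" and J_0: "J 0 = 0"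
  using BL_D[OF J] BL_zero[OF J csubspace_UNIV] by auto

lemma bounded_linear_J: "bounded_linear J"
proof -
  obtain K where K: "\<And>x. norm (J x) \<le> K * norm x" using J by (auto simp: BL_def)
  show ?thesis
    by (rule bounded_linear_intro[of _ K]) (use K in \<open>auto simp: J_add J_scale scaleR_scaleC mult.commute\<close>)
qed

lemma MJ_add: "MJ (f + g) = MJ f + MJ g"
  by (cases f; cases g) (simp add: aefun_abs_simps J_add)

lemma MJ_scale: "MJ (a *\<^sub>C f) = a *\<^sub>C MJ f"
  by (cases f) (simp add: aefun_abs_simps J_scale)

lemma MJ_shift: "MJ (shift t f) = shift t (MJ f)"
  by transfer (simp add: ae_eq_def)

lemma MJ_cut: "MJ (cut I f) = cut I (MJ f)"
  by (cases f) (auto simp: aefun_abs_simps J_0 intro!: arg_cong[where f = abs_aefun])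

lemma MJ_0: "MJ 0 = 0"
  unfolding zero_aefun.abs_eq map_aefun.abs_eq J_0 ..

definition "CJ = (SOME K. 0 < K \<and> (\<forall>x. norm (J x) \<le> K * norm x))"

lemma CJ: "0 < CJ" "norm (J x) \<le> CJ * norm x"
proof -
  have "\<exists>K. 0 < K \<and> (\<forall>x. norm (J x) \<le> K * norm x)"
    using BL_bound[OF J norm_on_UNIV] by (metis UNIV_I)
  from someI_ex[OF this] show "0 < CJ" "norm (J x) \<le> CJ * norm x" unfolding CJ_def by auto
qed

lemma MJ_L2: assumes "f \<in> L2 0" shows "MJ f \<in> L2 0" "L2_norm 0 (MJ f) \<le> CJ * L2_norm 0 f"
proof -
  have s: "strongly_measurable (MJ f)"
    using assms smeas_bounded_linear[OF bounded_linear_J]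
    by (cases f) (auto simp: map_aefun.abs_eq L2_abs0 strongly_measurable_abs)
  have "weighted_integral 0 (MJ f) \<le> ennreal (CJ\<^sup>2) * weighted_integral 0 f"
  proof (cases f)
    case (1 g)
    then have g: "smeas g" using assms by (simp add: L2_abs0)
    have "weighted_integral 0 (MJ f) \<le> (\<integral>\<^sup>+ t. ennreal (CJ\<^sup>2) * ennreal ((norm (g t))\<^sup>2) \<partial>lebesgue)"
      unfolding 1 map_aefun.abs_eq weighted_integral.abs_eq
    proof (rule nn_integral_mono)
      fix t :: real
      have "(norm (J (g t)))\<^sup>2 \<le> (CJ * norm (g t))\<^sup>2" by (intro power_mono CJ) auto
      then show "ennreal ((norm (exp (- 0 * t) *\<^sub>R J (g t)))\<^sup>2) \<le> ennreal (CJ\<^sup>2) * ennreal ((norm (g t))\<^sup>2)"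
        by (simp add: ennreal_mult[symmetric] power_mult_distrib ennreal_leI)
    qed
    also have "\<dots> = ennreal (CJ\<^sup>2) * weighted_integral 0 f"
      using smeas_norm2[OF g] by (simp add: 1 weighted_integral.abs_eq nn_integral_cmult)
    finally show ?thesis .
  qed
  then have *: "weighted_integral 0 (MJ f) \<le> ennreal ((CJ * L2_norm 0 f)\<^sup>2)"
    by (simp add: power_mult_distrib ennreal_mult L2_norm_sq[OF assms])
  then show "MJ f \<in> L2 0" using s by (auto simp: L2_def intro: order.strict_trans1)
  show "L2_norm 0 (MJ f) \<le> CJ * L2_norm 0 f" using * CJ(1) by (intro L2_norm_leI) auto
qed

lemma L2_inner_MJ: "L2_inner (MJ f) g = L2_inner f (MJ g)"
  by (cases f; cases g) (simp add: map_aefun.abs_eq L2_inner.abs_eq Jsym)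

lemma BL_MJ: "MJ \<in> BL (L2 0) (L2_norm 0) (L2 0) (L2_norm 0)"
  by (rule BL_I[where M = CJ]) (auto simp: MJ_L2 MJ_add MJ_scale)

end

subsection \<open>The optimal control\<close>

text \<open>The output after time \<open>t\<close> is produced by the state reached at
  \<open>t\<close> and the remaining input. This is the system-theoretic content of every dynamic
  programming argument that follows.\<close>

lemma wpls_output_shift:
  assumes w: "wpls \<gamma> A B C D" and t: "0 \<le> t" and u: "u \<in> L2 \<gamma>"
  shows "pi_plus (shift t (C x + D u)) = C (A t x + B (shift t u)) + D (pi_plus (shift t u))"
proof -
  note W = wplsD[OF w]
  have s: "shift t u \<in> L2 \<gamma>" using u by (rule L2_shift)
  have m: "pi_minus (shift t u) \<in> L2 \<gamma>" "pi_plus (shift t u) \<in> L2 \<gamma>" using s by (auto intro: L2_cut)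
  have "pi_plus (shift t (D u)) = pi_plus (D (pi_minus (shift t u) + pi_plus (shift t u)))"
    using TIC_D(2)[OF W(7) u] by (simp add: pi_split)
  also have "\<dots> = C (B (shift t u)) + D (pi_plus (shift t u))"
    using W(8)[OF s] TIC_plus[OF W(7) m(2)] by (simp add: TIC_add[OF W(7) m] cut_add)
  finally show ?thesis
    using W(6)[OF t] BL_D(2)[OF W(5)] by (simp add: shift_add cut_add)
qed

lemma wpls_B_plus: "wpls \<gamma> A B C D \<Longrightarrow> u \<in> L2 \<gamma> \<Longrightarrow> pi_plus u = u \<Longrightarrow> B u = 0"
proof -
  assume w: "wpls \<gamma> A B C D" and u: "u \<in> L2 \<gamma>" "pi_plus u = u"
  have "{..<0} \<inter> {0..} = ({} :: real set)" by auto
  then have "pi_minus u = 0" using u(2) cut_cut[of "{..<0}" "{0..}" u] by simp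
  then show "B u = 0" using wpls_B_pi_minus[OF w u(1)] BL_zero[OF wplsD(3)[OF w] csubspace_L2] by simp
qed

text \<open>Everything is expressed at one weight \<open>\<gamma> > 0\<close> for both systems, so
  that \<open>L2_plus 0\<close> embeds in \<open>L2 \<gamma>\<close> and \<open>D\<close>,
  \<open>R\<close> act without causal extension. \<open>adm\<close> and \<open>nV\<close> are
  parameters fixed by equations, which allows the interpretation to insert \<open>U_star\<close> for
  \<open>adm\<close>.\<close>

locale optimal_control_problem = bounded_symmetric J
  for J :: "'y::chilbert_space \<Rightarrow> 'y" +
  fixes \<gamma> :: real and A :: "real \<Rightarrow> 'h::chilbert_space \<Rightarrow> 'h"
    and B :: "'u::chilbert_space aefun \<Rightarrow> 'h"
    and C :: "'h \<Rightarrow> 'y aefun" and D :: "'u aefun \<Rightarrow> 'y aefun"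
    and Q :: "'h \<Rightarrow> 'z::chilbert_space aefun" and R :: "'u aefun \<Rightarrow> 'z aefun"
    and Zu :: "'z aefun topology" and Zs :: "'z aefun set" and ns :: "'z aefun \<Rightarrow> real"
    and adm :: "'h \<Rightarrow> 'u aefun \<Rightarrow> bool" and nV :: "'u aefun \<Rightarrow> real" and \<epsilon> :: real
  assumes gpos: "0 < \<gamma>" and sysC: "wpls \<gamma> A B C D" and sysQ: "wpls \<gamma> A B Q R"
    and Zu: "topological_vector_space Zu"
    and Zs: "csubspace Zs" "norm_on Zs ns" "ncomplete Zs ns" "Zs \<subseteq> topspace Zu"
    and Zs_cont: "continuous_map (norm_topology Zs ns) Zu (\<lambda>z. z)"
    and Q_cont: "continuous_map euclidean Zu Q"
    and R_cont: "continuous_map (norm_topology (L2_plus 0) (L2_norm 0)) Zu R"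
    and Zs_shift: "\<And>z t. z \<in> topspace Zu \<Longrightarrow> 0 < t \<Longrightarrow> pi_plus (shift t z) \<in> Zs \<longleftrightarrow> z \<in> Zs"
    and adm_def: "\<And>x u. adm x u \<longleftrightarrow> u \<in> L2_plus 0 \<and> C x + D u \<in> L2 0 \<and> Q x + R u \<in> Zs"
    and nV_def: "\<And>u. nV u = Max {L2_norm 0 u, L2_norm 0 (D u), ns (R u)}"
    and eps: "0 < \<epsilon>"
    and coerc: "\<And>u. adm 0 u \<Longrightarrow> \<epsilon> * (nV u)\<^sup>2 \<le> Re (L2_inner (D u) (MJ (D u)))"
    and fcc: "\<And>x. \<exists>u. adm x u"
begin

lemmas WC = wplsD[OF sysC] and WQ = wplsD[OF sysQ]

lemma L2_plus_0_g: "u \<in> L2_plus 0 \<Longrightarrow> u \<in> L2_plus \<gamma>" "u \<in> L2_plus 0 \<Longrightarrow> L2_norm \<gamma> u \<le> L2_norm 0 u"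
  for u :: "'a::chilbert_space aefun"
  using L2_weight_plus[of u 0 \<gamma>] gpos by (auto simp: L2_plus_def)

lemma L2_0_g: "u \<in> L2_plus 0 \<Longrightarrow> u \<in> L2 \<gamma>" for u :: "'a::chilbert_space aefun"
  using L2_plus_0_g(1) by (auto simp: L2_plus_def)

lemma D_add: "u \<in> L2 \<gamma> \<Longrightarrow> v \<in> L2 \<gamma> \<Longrightarrow> D (u + v) = D u + D v"
  and D_diff: "u \<in> L2 \<gamma> \<Longrightarrow> v \<in> L2 \<gamma> \<Longrightarrow> D (u - v) = D u - D v"
  and D_scale: "u \<in> L2 \<gamma> \<Longrightarrow> D (a *\<^sub>C u) = a *\<^sub>C D u"
  and R_add: "u \<in> L2 \<gamma> \<Longrightarrow> v \<in> L2 \<gamma> \<Longrightarrow> R (u + v) = R u + R v"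
  and R_diff: "u \<in> L2 \<gamma> \<Longrightarrow> v \<in> L2 \<gamma> \<Longrightarrow> R (u - v) = R u - R v"
  and R_scale: "u \<in> L2 \<gamma> \<Longrightarrow> R (a *\<^sub>C u) = a *\<^sub>C R u"
  and B_add: "u \<in> L2 \<gamma> \<Longrightarrow> v \<in> L2 \<gamma> \<Longrightarrow> B (u + v) = B u + B v"
  and B_diff: "u \<in> L2 \<gamma> \<Longrightarrow> v \<in> L2 \<gamma> \<Longrightarrow> B (u - v) = B u - B v"
  and B_scale: "u \<in> L2 \<gamma> \<Longrightarrow> B (a *\<^sub>C u) = a *\<^sub>C B u"
  and C_add: "C (x + y) = C x + C y" and C_diff: "C (x - y) = C x - C y" and C_scale: "C (a *\<^sub>C x) = a *\<^sub>C C x"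
  and Q_add: "Q (x + y) = Q x + Q y" and Q_scale: "Q (a *\<^sub>C x) = a *\<^sub>C Q x"
  and C_0: "C 0 = 0" and Q_0: "Q 0 = 0" and D_0: "D 0 = 0" and R_0: "R 0 = 0" and B_0: "B 0 = 0"
  using BL_D[OF TIC_D(1)[OF WC(7)]] BL_D[OF TIC_D(1)[OF WQ(7)]] BL_D[OF WC(3)] BL_D[OF WC(5)] BL_D[OF WQ(5)]
    BL_diff[OF TIC_D(1)[OF WC(7)] csubspace_L2] BL_diff[OF TIC_D(1)[OF WQ(7)] csubspace_L2]
    BL_diff[OF WC(3) csubspace_L2] BL_diff[OF WC(5) csubspace_UNIV]
    BL_zero[OF WC(5) csubspace_UNIV] BL_zero[OF WQ(5) csubspace_UNIV] BL_zero[OF TIC_D(1)[OF WC(7)] csubspace_L2]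
    BL_zero[OF TIC_D(1)[OF WQ(7)] csubspace_L2] BL_zero[OF WC(3) csubspace_L2]
  by auto

lemma A_add: "0 \<le> t \<Longrightarrow> A t (x + y) = A t x + A t y" and A_scale: "0 \<le> t \<Longrightarrow> A t (a *\<^sub>C x) = a *\<^sub>C A t x"
proof -
  assume "0 \<le> t"
  then have "A t \<in> BL UNIV norm UNIV norm" using WC(1) by (simp add: C0_semigroup_def)
  from BL_D[OF this] show "A t (x + y) = A t x + A t y" "A t (a *\<^sub>C x) = a *\<^sub>C A t x" by auto
qed

lemma A_diff: "0 \<le> t \<Longrightarrow> A t (x - y) = A t x - A t y"
  using A_add[of t "x - y" y] by simp

lemma output_plus: "u \<in> L2 \<gamma> \<Longrightarrow> pi_plus u = u \<Longrightarrow> C x + D u \<in> L2_plus \<gamma>"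
  using wpls_C_plus[OF sysC, of x] TIC_plus[OF WC(7), of u] TIC_D(4)[OF WC(7), of u]
  by (simp add: L2_plus_def L2_add cut_add)

abbreviation "V \<equiv> Collect (adm 0)"

lemma V_iff: "u \<in> V \<longleftrightarrow> u \<in> L2_plus 0 \<and> D u \<in> L2 0 \<and> R u \<in> Zs"
  by (simp add: adm_def C_0 Q_0)

lemma adm_add: "adm x u \<Longrightarrow> adm y v \<Longrightarrow> adm (x + y) (u + v)"
proof -
  assume a: "adm x u" "adm y v"
  have g: "u \<in> L2 \<gamma>" "v \<in> L2 \<gamma>" using a by (auto simp: adm_def L2_0_g)
  have "C (x + y) + D (u + v) = (C x + D u) + (C y + D v)" "Q (x + y) + R (u + v) = (Q x + R u) + (Q y + R v)"
    by (simp_all add: C_add D_add[OF g] Q_add R_add[OF g])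
  then show ?thesis using a by (simp add: adm_def csubspaceD[OF csubspace_L2_plus] csubspaceD[OF Zs(1)] L2_add)
qed

lemma adm_scale: "adm x u \<Longrightarrow> adm (a *\<^sub>C x) (a *\<^sub>C u)"
proof -
  assume a: "adm x u"
  have g: "u \<in> L2 \<gamma>" using a by (auto simp: adm_def L2_0_g)
  have "C (a *\<^sub>C x) + D (a *\<^sub>C u) = a *\<^sub>C (C x + D u)" "Q (a *\<^sub>C x) + R (a *\<^sub>C u) = a *\<^sub>C (Q x + R u)"
    by (simp_all add: C_scale D_scale[OF g] Q_scale R_scale[OF g] scaleC_add_right)
  then show ?thesis using a by (simp add: adm_def csubspaceD[OF csubspace_L2_plus] csubspaceD[OF Zs(1)] L2_scaleC)
qed

lemma adm_diff: "adm x u \<Longrightarrow> adm y v \<Longrightarrow> adm (x - y) (u - v)"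
  using adm_add[of x u "(-1) *\<^sub>C y" "(-1) *\<^sub>C v"] adm_scale[of y v "-1"] by (simp add: scaleC_minus1)

lemma adm_0: "adm 0 0"
  by (simp add: adm_def C_0 Q_0 D_0 R_0 csubspaceD[OF csubspace_L2_plus] csubspaceD[OF Zs(1)])

lemma csubspace_V: "csubspace V"
  using adm_0 adm_add[of 0 _ 0] adm_scale[of 0] by (auto simp: csubspace_def)

text \<open>Here the Hausdorff property of \<open>Zu\<close> is used.\<close>

lemma QR_closed:
  assumes x: "xs \<longlonglongrightarrow> x" and u: "\<And>k. us k \<in> L2_plus 0" "u \<in> L2_plus 0" "(\<lambda>k. L2_norm 0 (us k - u)) \<longlonglongrightarrow> 0"
    and z: "\<And>k. Q (xs k) + R (us k) \<in> Zs" "z \<in> Zs" "(\<lambda>k. ns ((Q (xs k) + R (us k)) - z)) \<longlonglongrightarrow> 0"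
  shows "Q x + R u = z"
proof -
  have 1: "limitin Zu (\<lambda>k. Q (xs k)) (Q x) sequentially"
    using continuous_map_limit[OF Q_cont, of xs x sequentially] x by (simp add: comp_def)
  have 2: "limitin Zu (\<lambda>k. R (us k)) (R u) sequentially"
    using continuous_map_limit[OF R_cont limitin_norm_topology[OF csubspace_L2_plus norm_on_L2_plus u]]
    by (simp add: comp_def)
  have "limitin (prod_topology Zu Zu) (\<lambda>k. (Q (xs k), R (us k))) (Q x, R u) sequentially"
    using 1 2 by (simp add: limitin_pairwise comp_def)
  moreover have "continuous_map (prod_topology Zu Zu) Zu (\<lambda>(x, y). x + y)"
    using Zu by (simp add: topological_vector_space_def)
  ultimately have 3: "limitin Zu (\<lambda>k. Q (xs k) + R (us k)) (Q x + R u) sequentially"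
    by (auto dest: continuous_map_limit simp: comp_def)
  have 4: "limitin Zu (\<lambda>k. Q (xs k) + R (us k)) z sequentially"
    using continuous_map_limit[OF Zs_cont limitin_norm_topology[OF Zs(1,2) z]] by (simp add: comp_def)
  have "Hausdorff_space Zu" using Zu by (simp add: topological_vector_space_def)
  then show ?thesis using limitin_Hausdorff_unique[OF 3 4] by simp
qed

text \<open>Convergence at the weight zero implies convergence at the weight
  \<open>\<gamma>\<close>, where \<open>C\<close> and \<open>D\<close> are continuous, and
  uniqueness of limits there identifies \<open>y\<close>. The lemma gives both the completeness of
  \<open>V\<close> and the closed graph of the optimal control.\<close>

lemma adm_closed:
  assumes x: "xs \<longlonglongrightarrow> x" and a: "\<And>k. adm (xs k) (us k)"
    and u: "u \<in> L2_plus 0" "(\<lambda>k. L2_norm 0 (us k - u)) \<longlonglongrightarrow> 0"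
    and y: "y \<in> L2 0" "(\<lambda>k. L2_norm 0 ((C (xs k) + D (us k)) - y)) \<longlonglongrightarrow> 0"
    and z: "z \<in> Zs" "(\<lambda>k. ns ((Q (xs k) + R (us k)) - z)) \<longlonglongrightarrow> 0"
  shows "adm x u" "C x + D u = y" "Q x + R u = z"
proof -
  have us: "us k \<in> L2_plus 0" for k using a by (simp add: adm_def)
  have usg: "us k \<in> L2 \<gamma>" "u \<in> L2 \<gamma>" for k using us u by (simp_all add: L2_0_g)
  let ?Y = "\<lambda>k. C (xs k) + D (us k)"
  have Y: "?Y k \<in> L2_plus 0" for k
    using a[of k] output_plus[OF usg(1) L2_plus_fix[OF us], of "xs k"] by (simp add: adm_def L2_plus_def)
  \<comment> \<open>Comparing the weights zero and \<open>\<gamma>\<close> is possible only for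
    functions supported on the half-line, and of \<open>y\<close> only membership in
    \<open>L2 0\<close> is given.\<close>
  have yp: "y \<in> L2_plus 0"
  proof -
    have "(\<lambda>k. L2_norm 0 (pi_plus (?Y k) - pi_plus y)) \<longlonglongrightarrow> 0"
      by (rule BL_lim[OF BL_cut csubspace_L2 norm_on_L2 norm_on_L2]) (use Y y in \<open>auto simp: L2_plus_def\<close>)
    then have "(\<lambda>k. L2_norm 0 (?Y k - pi_plus y)) \<longlonglongrightarrow> 0" using L2_plus_fix[OF Y] by simp
    then have "pi_plus y = y"
      using limit_eq[OF csubspace_L2 norm_on_L2 L2_plus_L2[OF Y] _ y(1) _ y(2)] y(1) by (simp add: L2_cut)
    then show ?thesis using y by (simp add: L2_plus_def)
  qed
  have lu: "(\<lambda>k. L2_norm \<gamma> (us k - u)) \<longlonglongrightarrow> 0"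
    by (rule Lim_null_comparison[OF _ u(2)])
       (use L2_plus_0_g(2)[OF csubspaceD(4)[OF csubspace_L2_plus us u(1)]] in \<open>auto intro!: always_eventually\<close>)
  have lD: "(\<lambda>k. L2_norm \<gamma> (D (us k) - D u)) \<longlonglongrightarrow> 0"
    by (rule BL_lim[OF TIC_D(1)[OF WC(7)] csubspace_L2 norm_on_L2 norm_on_L2 usg lu])
  have lC: "(\<lambda>k. L2_norm \<gamma> (C (xs k) - C x)) \<longlonglongrightarrow> 0"
    by (rule BL_lim[OF WC(5) csubspace_UNIV norm_on_UNIV norm_on_L2])
       (use x in \<open>auto simp: tendsto_norm_zero_iff LIM_zero_iff\<close>)
  have m: "C (xs k) \<in> L2 \<gamma>" "C x \<in> L2 \<gamma>" "D (us k) \<in> L2 \<gamma>" "D u \<in> L2 \<gamma>" for k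
    using BL_D(1)[OF WC(5)] TIC_D(4)[OF WC(7)] usg by auto
  have lY: "(\<lambda>k. L2_norm \<gamma> (?Y k - (C x + D u))) \<longlonglongrightarrow> 0"
  proof (rule Lim_null_comparison)
    show "(\<lambda>k. L2_norm \<gamma> (C (xs k) - C x) + L2_norm \<gamma> (D (us k) - D u)) \<longlonglongrightarrow> 0"
      using tendsto_add[OF lC lD] by simp
    show "\<forall>\<^sub>F k in sequentially. norm (L2_norm \<gamma> (?Y k - (C x + D u))) \<le> L2_norm \<gamma> (C (xs k) - C x) + L2_norm \<gamma> (D (us k) - D u)"
      using L2_norm_triangle[OF L2_diff[OF m(1) m(2)] L2_diff[OF m(3) m(4)]] by (auto simp: add_diff_add)
  qed
  have ly: "(\<lambda>k. L2_norm \<gamma> (?Y k - y)) \<longlonglongrightarrow> 0"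
    by (rule Lim_null_comparison[OF _ y(2)])
       (use L2_plus_0_g(2)[OF csubspaceD(4)[OF csubspace_L2_plus Y yp]] in \<open>auto intro!: always_eventually\<close>)
  show 1: "C x + D u = y"
    by (rule limit_eq[OF csubspace_L2 norm_on_L2 _ _ _ lY ly]) (use m yp L2_0_g in \<open>auto simp: L2_add\<close>)
  show 2: "Q x + R u = z"
    by (rule QR_closed[OF x us u _ z]) (use a in \<open>auto simp: adm_def\<close>)
  show "adm x u" using 1 2 u y z by (simp add: adm_def)
qed

lemma nV_ge: "L2_norm 0 u \<le> nV u" "L2_norm 0 (D u) \<le> nV u" "ns (R u) \<le> nV u"
  by (simp_all add: nV_def)

lemma nV_le: "L2_norm 0 u \<le> c \<Longrightarrow> L2_norm 0 (D u) \<le> c \<Longrightarrow> ns (R u) \<le> c \<Longrightarrow> nV u \<le> c"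
  by (simp add: nV_def)

lemma V_g: "u \<in> V \<Longrightarrow> u \<in> L2 \<gamma>" by (simp add: adm_def L2_0_g)

lemma nV_norm: "norm_on V nV"
  unfolding norm_on_def
proof (intro conjI ballI allI)
  note nL = norm_onD[OF norm_on_L2] and nZ = norm_onD[OF Zs(2)]
  fix u assume u: "u \<in> V"
  then have u': "u \<in> L2 0" "D u \<in> L2 0" "R u \<in> Zs" "u \<in> L2 \<gamma>" by (auto simp: V_iff V_g L2_plus_L2 simp del: mem_Collect_eq)
  show "0 \<le> nV u" using nV_ge(1)[of u] L2_norm_nonneg[of 0 u] by linarith
  show "nV u = 0 \<longleftrightarrow> u = 0"
  proof
    assume "nV u = 0"
    then have "L2_norm 0 u = 0" using nV_ge(1)[of u] L2_norm_nonneg[of 0 u] by linarith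
    then show "u = 0" using u' L2_norm_eq_0_iff by blast
  next
    assume "u = 0" then show "nV u = 0"
      using norm_on_zero[OF Zs(2,1)] by (simp add: nV_def D_0 R_0)
  qed
  show "nV (a *\<^sub>C u) = cmod a * nV u" for a
  proof -
    have "nV (a *\<^sub>C u) = Max ((*) (cmod a) ` {L2_norm 0 u, L2_norm 0 (D u), ns (R u)})"
      using u' by (simp add: nV_def D_scale R_scale nL nZ)
    also have "\<dots> = cmod a * nV u"
      unfolding nV_def by (rule mono_Max_commute[symmetric]) (auto intro!: monoI mult_left_mono)
    finally show ?thesis .
  qed
  show "nV (u + v) \<le> nV u + nV v" if v: "v \<in> V" for v
  proof (rule nV_le)
    have v': "v \<in> L2 0" "D v \<in> L2 0" "R v \<in> Zs" "v \<in> L2 \<gamma>" using v by (auto simp: V_iff V_g L2_plus_L2 simp del: mem_Collect_eq)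
    show "L2_norm 0 (u + v) \<le> nV u + nV v" using nL(3)[OF u'(1) v'(1)] nV_ge(1)[of u] nV_ge(1)[of v] by linarith
    show "L2_norm 0 (D (u + v)) \<le> nV u + nV v"
      using nL(3)[OF u'(2) v'(2)] nV_ge(2)[of u] nV_ge(2)[of v] by (simp add: D_add u' v')
    show "ns (R (u + v)) \<le> nV u + nV v"
      using nZ(3)[OF u'(3) v'(3)] nV_ge(3)[of u] nV_ge(3)[of v] by (simp add: R_add u' v')
  qed
qed

lemma nV_complete: "ncomplete V nV"
  unfolding ncomplete_def
proof (intro allI impI, elim conjE)
  fix f :: "nat \<Rightarrow> 'u aefun" assume f: "\<forall>k. f k \<in> V" and c: "\<forall>e>0. \<exists>N. \<forall>i\<ge>N. \<forall>j\<ge>N. nV (f i - f j) < e"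
  have f': "f k \<in> L2_plus 0" "D (f k) \<in> L2 0" "R (f k) \<in> Zs" "f k \<in> L2 \<gamma>" "adm 0 (f k)" for k
    using f[rule_format, of k] V_iff[of "f k"] V_g[of "f k"] by auto
  obtain u where u: "u \<in> L2_plus 0" "(\<lambda>k. L2_norm 0 (f k - u)) \<longlonglongrightarrow> 0"
  proof (rule ncompleteD[OF L2_plus_complete f'(1)])
    show "\<exists>N. \<forall>i\<ge>N. \<forall>j\<ge>N. L2_norm 0 (f i - f j) < e" if "0 < e" for e
      using c that nV_ge(1)[of "f _ - f _"] by (meson order.strict_trans1)
  qed auto
  obtain y where y: "y \<in> L2 0" "(\<lambda>k. L2_norm 0 (D (f k) - y)) \<longlonglongrightarrow> 0"
  proof (rule ncompleteD[OF L2_complete f'(2)])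
    show "\<exists>N. \<forall>i\<ge>N. \<forall>j\<ge>N. L2_norm 0 (D (f i) - D (f j)) < e" if "0 < e" for e
      using c that nV_ge(2)[of "f _ - f _"] unfolding D_diff[OF f'(4) f'(4)] by (meson order.strict_trans1)
  qed auto
  obtain z where z: "z \<in> Zs" "(\<lambda>k. ns (R (f k) - z)) \<longlonglongrightarrow> 0"
  proof (rule ncompleteD[OF Zs(3) f'(3)])
    show "\<exists>N. \<forall>i\<ge>N. \<forall>j\<ge>N. ns (R (f i) - R (f j)) < e" if "0 < e" for e
      using c that nV_ge(3)[of "f _ - f _"] unfolding R_diff[OF f'(4) f'(4)] by (meson order.strict_trans1)
  qed auto
  have cl: "adm 0 u" "D u = y" "R u = z"
    using adm_closed[OF tendsto_const f'(5) u y(1) _ z(1)] y(2) z(2) by (simp_all add: C_0 Q_0)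
  have "(\<lambda>k. L2_norm 0 (f k - u) + L2_norm 0 (D (f k) - y) + ns (R (f k) - z)) \<longlonglongrightarrow> 0 + 0 + 0"
    by (intro tendsto_intros u y z)
  then have "(\<lambda>k. nV (f k - u)) \<longlonglongrightarrow> 0"
  proof (rule Lim_null_comparison[rotated, OF tendsto_eq_rhs], simp, intro always_eventually allI)
    fix k
    have "R (f k) - z \<in> Zs" using f' z by (simp add: csubspaceD[OF Zs(1)])
    then have nn: "0 \<le> ns (R (f k) - z)" using norm_onD(1)[OF Zs(2)] by blast
    have ug: "u \<in> L2 \<gamma>" using u by (simp add: L2_0_g)
    have "nV (f k - u) \<le> L2_norm 0 (f k - u) + L2_norm 0 (D (f k) - y) + ns (R (f k) - z)"
      using nn by (intro nV_le) (simp_all add: D_diff[OF f'(4) ug] R_diff[OF f'(4) ug] cl)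
    moreover have "0 \<le> nV (f k - u)" using nV_ge(1)[of "f k - u"] L2_norm_nonneg[of 0 "f k - u"] by linarith
    ultimately show "norm (nV (f k - u)) \<le> L2_norm 0 (f k - u) + L2_norm 0 (D (f k) - y) + ns (R (f k) - z)" by simp
  qed
  then show "\<exists>x\<in>V. (\<lambda>k. nV (f k - x)) \<longlonglongrightarrow> 0" using cl by blast
qed

definition b :: "'u aefun \<Rightarrow> 'u aefun \<Rightarrow> complex" where
  "b u v = L2_inner (D u) (MJ (D v))"

lemma V_D: "u \<in> V \<Longrightarrow> D u \<in> L2 0" using V_iff by blast

lemma b_bound: "u \<in> V \<Longrightarrow> v \<in> V \<Longrightarrow> cmod (b u v) \<le> CJ * L2_norm 0 (D u) * L2_norm 0 (D v)"
proof -
  assume "u \<in> V" "v \<in> V"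
  note d = V_D[OF this(1)] V_D[OF this(2)]
  have "cmod (b u v) \<le> L2_norm 0 (D u) * L2_norm 0 (MJ (D v))"
    unfolding b_def by (intro L2_inner_bound d MJ_L2)
  also have "\<dots> \<le> L2_norm 0 (D u) * (CJ * L2_norm 0 (D v))"
    by (intro mult_left_mono MJ_L2 d) simp
  finally show ?thesis by (simp add: mult_ac)
qed

sublocale b: coercive_form V nV b \<epsilon> CJ
proof
  show "b u (v + w) = b u v + b u w" if "u \<in> V" "v \<in> V" "w \<in> V" for u v w
    unfolding b_def using that V_D V_g by (simp add: D_add MJ_add L2_inner_add_right MJ_L2 del: mem_Collect_eq)
  show "b u (a *\<^sub>C v) = a * b u v" if "u \<in> V" "v \<in> V" for u v a
    unfolding b_def using that V_g[of v] by (simp add: D_scale MJ_scale L2_inner_scaleC_right del: mem_Collect_eq)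
  show "b u v = cnj (b v u)" if "u \<in> V" "v \<in> V" for u v
    unfolding b_def using L2_inner_commute[of "D u" "MJ (D v)"] by (simp add: L2_inner_MJ)
  show "\<epsilon> * (nV u)\<^sup>2 \<le> Re (b u u)" if "u \<in> V" for u
    using coerc that by (simp add: b_def)
  show "cmod (b u v) \<le> CJ * nV u * nV v" if "u \<in> V" "v \<in> V" for u v
  proof -
    have "CJ * L2_norm 0 (D u) * L2_norm 0 (D v) \<le> CJ * nV u * nV v"
      using nV_ge(2) CJ(1) norm_onD(1)[OF nV_norm that(1)]
      by (intro mult_mono mult_nonneg_nonneg) auto
    then show ?thesis using b_bound[OF that] by linarith
  qed
qed (use csubspace_V nV_norm nV_complete eps in auto)

text \<open>The orthogonality form of optimality, which is closed and linear in the pair. The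
  derivative form is recovered from it by \<open>cost_difference\<close>.\<close>

definition opt :: "'h \<Rightarrow> 'u aefun \<Rightarrow> bool" where
  "opt x u \<longleftrightarrow> adm x u \<and> (\<forall>\<eta>\<in>V. L2_inner (D \<eta>) (MJ (C x + D u)) = 0)"

lemma opt_unique: assumes "opt x u" "opt x v" shows "u = v"
proof -
  have V: "u - v \<in> V" using adm_diff[of x u x v] assms by (simp add: opt_def)
  have g: "u \<in> L2 \<gamma>" "v \<in> L2 \<gamma>" "C x + D u \<in> L2 0" "C x + D v \<in> L2 0"
    using assms by (auto simp: opt_def adm_def L2_0_g)
  have "b \<eta> (u - v) = 0" if \<eta>: "\<eta> \<in> V" for \<eta>
  proof -
    have "D (u - v) = (C x + D u) + (-1) *\<^sub>C (C x + D v)" by (simp add: D_diff[OF g(1,2)] scaleC_minus1)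
    then have "b \<eta> (u - v) = L2_inner (D \<eta>) (MJ (C x + D u)) - L2_inner (D \<eta>) (MJ (C x + D v))"
      unfolding b_def using V_D[OF \<eta>] g
      by (simp only: MJ_add MJ_scale) (simp add: L2_inner_add_right L2_inner_scaleC_right MJ_L2 L2_scaleC flip: MJ_add)
    then show ?thesis using assms \<eta> by (auto simp: opt_def)
  qed
  then have "b (u - v) \<eta> = 0" if "\<eta> \<in> V" for \<eta> using b.herm[OF V that] that by simp
  then have "u - v = 0" using b.form_zero[OF V] by blast
  then show ?thesis by simp
qed

text \<open>Any admissible \<open>u\<close> is corrected by the vector of \<open>V\<close> that
  represents its first-order residual with respect to \<open>b\<close>.\<close>

lemma opt_ex: "\<exists>u. opt x u"
proof -
  obtain u where u: "adm x u" using fcc by blast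
  then have y: "C x + D u \<in> L2 0" and ug: "u \<in> L2 \<gamma>" by (auto simp: adm_def L2_0_g)
  obtain a where a: "a \<in> V" "\<And>\<eta>. \<eta> \<in> V \<Longrightarrow> b a \<eta> = L2_inner (MJ (C x + D u)) (D \<eta>)"
  proof (rule b.riesz[of "\<lambda>\<eta>. L2_inner (MJ (C x + D u)) (D \<eta>)" "L2_norm 0 (MJ (C x + D u))"])
    show "L2_inner (MJ (C x + D u)) (D (\<eta> + \<zeta>)) = L2_inner (MJ (C x + D u)) (D \<eta>) + L2_inner (MJ (C x + D u)) (D \<zeta>)"
      if "\<eta> \<in> V" "\<zeta> \<in> V" for \<eta> \<zeta>
      using that y V_D V_g by (simp add: D_add L2_inner_add_right MJ_L2 del: mem_Collect_eq)
    show "L2_inner (MJ (C x + D u)) (D (c *\<^sub>C \<eta>)) = c * L2_inner (MJ (C x + D u)) (D \<eta>)" if "\<eta> \<in> V" for \<eta> c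
      using V_g[OF that] by (simp add: D_scale L2_inner_scaleC_right)
    show "cmod (L2_inner (MJ (C x + D u)) (D \<eta>)) \<le> L2_norm 0 (MJ (C x + D u)) * nV \<eta>" if "\<eta> \<in> V" for \<eta>
    proof -
      have "cmod (L2_inner (MJ (C x + D u)) (D \<eta>)) \<le> L2_norm 0 (MJ (C x + D u)) * L2_norm 0 (D \<eta>)"
        by (intro L2_inner_bound MJ_L2 y V_D that)
      also have "\<dots> \<le> L2_norm 0 (MJ (C x + D u)) * nV \<eta>" by (intro mult_left_mono nV_ge) simp
      finally show ?thesis .
    qed
  qed (blast intro: that)
  have "opt x (u - a)"
    unfolding opt_def
  proof (intro conjI ballI)
    show "adm x (u - a)" using adm_diff[OF u, of 0 a] a by simp
    fix \<eta> assume \<eta>: "\<eta> \<in> V"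
    have "C x + D (u - a) = (C x + D u) + (-1) *\<^sub>C D a" by (simp add: D_diff[OF ug V_g[OF a(1)]] scaleC_minus1)
    then have "L2_inner (D \<eta>) (MJ (C x + D (u - a))) = L2_inner (D \<eta>) (MJ (C x + D u)) - b \<eta> a"
      using V_D[OF \<eta>] V_D[OF a(1)] y
      by (simp only: MJ_add MJ_scale) (simp add: L2_inner_add_right L2_inner_scaleC_right MJ_L2 L2_scaleC b_def flip: MJ_add)
    also have "b \<eta> a = cnj (L2_inner (MJ (C x + D u)) (D \<eta>))"
      using a(2)[OF \<eta>] b.herm[OF \<eta> a(1)] by simp
    also have "\<dots> = L2_inner (D \<eta>) (MJ (C x + D u))" by (rule L2_inner_commute[symmetric])
    finally show "L2_inner (D \<eta>) (MJ (C x + D (u - a))) = 0" by simp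
  qed
  then show ?thesis ..
qed

definition Ko :: "'h \<Rightarrow> 'u aefun" where "Ko x = (THE u. opt x u)"

lemma opt_Ko: "opt x (Ko x)"
  unfolding Ko_def using opt_ex[of x] opt_unique by (metis theI)

lemma Ko_eqI: "opt x u \<Longrightarrow> Ko x = u"
  using opt_unique opt_Ko by blast

lemma opt_add: assumes "opt x u" "opt y v" shows "opt (x + y) (u + v)"
proof -
  have g: "u \<in> L2 \<gamma>" "v \<in> L2 \<gamma>" "C x + D u \<in> L2 0" "C y + D v \<in> L2 0"
    using assms by (auto simp: opt_def adm_def L2_0_g)
  have e: "C (x + y) + D (u + v) = (C x + D u) + (C y + D v)" by (simp add: C_add D_add[OF g(1,2)])
  have "L2_inner (D \<eta>) (MJ (C (x + y) + D (u + v))) = 0" if "\<eta> \<in> V" for \<eta>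
    unfolding e MJ_add[of "C x + D u"] using L2_inner_add_right[OF MJ_L2(1)[OF g(3)] MJ_L2(1)[OF g(4)] V_D[OF that]] assms that
    by (simp add: opt_def)
  then show ?thesis using assms adm_add by (auto simp: opt_def)
qed

lemma opt_scale: assumes "opt x u" shows "opt (a *\<^sub>C x) (a *\<^sub>C u)"
proof -
  have g: "u \<in> L2 \<gamma>" using assms by (auto simp: opt_def adm_def L2_0_g)
  have e: "C (a *\<^sub>C x) + D (a *\<^sub>C u) = a *\<^sub>C (C x + D u)" by (simp add: C_scale D_scale[OF g] scaleC_add_right)
  show ?thesis using assms adm_scale unfolding opt_def e MJ_scale L2_inner_scaleC_right by auto
qed

lemma Ko_add: "Ko (x + y) = Ko x + Ko y" and Ko_scale: "Ko (a *\<^sub>C x) = a *\<^sub>C Ko x"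
  by (auto intro!: Ko_eqI opt_add opt_scale opt_Ko)

lemma Ko_diff: "Ko (x - y) = Ko x - Ko y"
  using Ko_add[of "x - y" y] by simp

lemma Ko_0: "Ko 0 = 0" using Ko_diff[of 0 0] by simp

definition Co :: "'h \<Rightarrow> 'y aefun" where "Co x = C x + D (Ko x)"
definition Zo :: "'h \<Rightarrow> 'z aefun" where "Zo x = Q x + R (Ko x)"

lemma Ko_adm: "adm x (Ko x)" using opt_Ko by (simp add: opt_def)

lemma Ko_L2: "Ko x \<in> L2_plus 0" "Co x \<in> L2 0" "Zo x \<in> Zs" "Ko x \<in> L2 \<gamma>"
  using Ko_adm[of x] by (auto simp: adm_def Co_def Zo_def L2_0_g)

lemma Co_add: "Co (x + y) = Co x + Co y" and Co_scale: "Co (a *\<^sub>C x) = a *\<^sub>C Co x"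
  and Zo_add: "Zo (x + y) = Zo x + Zo y" and Zo_scale: "Zo (a *\<^sub>C x) = a *\<^sub>C Zo x"
  using Ko_L2(4) by (simp_all add: Co_def Zo_def C_add C_scale Q_add Q_scale Ko_add Ko_scale D_add R_add D_scale R_scale scaleC_add_right)

text \<open>The seminorm \<open>p\<close> is countably subadditive because the graph of
  \<open>Ko\<close> is closed: \<open>adm_closed\<close> keeps the sum admissible and continuity
  keeps it orthogonal. The summand \<open>ns (Zo x)\<close> is included because
  \<open>adm_closed\<close> asks for convergence of that component as well.\<close>

lemma Ko_bounded: obtains M where "0 < M" "\<And>x. L2_norm 0 (Ko x) \<le> M * norm x" "\<And>x. L2_norm 0 (Co x) \<le> M * norm x"
proof -
  define p where "p x = L2_norm 0 (Ko x) + L2_norm 0 (Co x) + ns (Zo x)" for x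
  have nZ: "0 \<le> ns (Zo x)" for x using norm_onD(1)[OF Zs(2) Ko_L2(3)] .
  have sK: "(\<Sum>k<m. Ko (f k)) = Ko (\<Sum>k<m. f k)" "(\<Sum>k<m. Co (f k)) = Co (\<Sum>k<m. f k)" "(\<Sum>k<m. Zo (f k)) = Zo (\<Sum>k<m. f k)" for f and m :: nat
  proof -
    have "Co 0 = 0" "Zo 0 = 0" by (simp_all add: Co_def Zo_def Ko_0 C_0 D_0 Q_0 R_0)
    then show "(\<Sum>k<m. Ko (f k)) = Ko (\<Sum>k<m. f k)" "(\<Sum>k<m. Co (f k)) = Co (\<Sum>k<m. f k)" "(\<Sum>k<m. Zo (f k)) = Zo (\<Sum>k<m. f k)"
      by (induction m) (simp_all add: Ko_0 Ko_add Co_add Zo_add)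
  qed
  obtain M where M: "\<And>x. p x \<le> M * norm x"
  proof (rule countably_subadditive_seminorm_bounded[of p])
    show "0 \<le> p x" for x using nZ[of x] by (simp add: p_def)
    show "p (x + y) \<le> p x + p y" for x y
      using L2_norm_triangle[OF L2_plus_L2[OF Ko_L2(1)] L2_plus_L2[OF Ko_L2(1)], of x y] L2_norm_triangle[OF Ko_L2(2) Ko_L2(2), of x y]
        norm_onD(3)[OF Zs(2) Ko_L2(3) Ko_L2(3), of x y]
      by (simp add: p_def Ko_add Co_add Zo_add)
    show "p (r *\<^sub>R x) = \<bar>r\<bar> * p x" for r x
      using L2_norm_scaleC[OF L2_plus_L2[OF Ko_L2(1)], of r x] L2_norm_scaleC[OF Ko_L2(2), of r x] norm_onD(4)[OF Zs(2) Ko_L2(3), of r x]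
      by (simp add: p_def scaleR_scaleC Ko_scale Co_scale Zo_scale distrib_left)
    fix f x assume fx: "f sums x" and sp: "summable (\<lambda>k. p (f k))"
    have s: "summable (\<lambda>k. L2_norm 0 (Ko (f k)))" "summable (\<lambda>k. L2_norm 0 (Co (f k)))" "summable (\<lambda>k. ns (Zo (f k)))"
      by (rule summable_comparison_test'[OF sp, of 0], use nZ in \<open>simp add: p_def\<close>)+
    obtain u where u: "u \<in> L2_plus 0" "(\<lambda>m. L2_norm 0 ((\<Sum>k<m. Ko (f k)) - u)) \<longlonglongrightarrow> 0" "L2_norm 0 u \<le> (\<Sum>k. L2_norm 0 (Ko (f k)))"
      using summable_converges[OF csubspace_L2_plus norm_on_L2_plus L2_plus_complete Ko_L2(1) s(1)] by blast
    obtain y where y: "y \<in> L2 0" "(\<lambda>m. L2_norm 0 ((\<Sum>k<m. Co (f k)) - y)) \<longlonglongrightarrow> 0" "L2_norm 0 y \<le> (\<Sum>k. L2_norm 0 (Co (f k)))"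
      using summable_converges[OF csubspace_L2 norm_on_L2 L2_complete Ko_L2(2) s(2)] by blast
    obtain z where z: "z \<in> Zs" "(\<lambda>m. ns ((\<Sum>k<m. Zo (f k)) - z)) \<longlonglongrightarrow> 0" "ns z \<le> (\<Sum>k. ns (Zo (f k)))"
      using summable_converges[OF Zs(1-3) Ko_L2(3) s(3)] by blast
    have X: "(\<lambda>m. \<Sum>k<m. f k) \<longlonglongrightarrow> x" using fx by (simp add: sums_def)
    have cl: "adm x u" "C x + D u = y" "Q x + R u = z"
      using adm_closed[OF X Ko_adm u(1) u(2)[unfolded sK] y(1) y(2)[unfolded sK, unfolded Co_def] z(1) z(2)[unfolded sK, unfolded Zo_def]] .
    have "opt x u" unfolding opt_def
    proof (intro conjI ballI cl)
      fix \<eta> assume \<eta>: "\<eta> \<in> V"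
      have "(\<lambda>m. L2_norm 0 (MJ (Co (\<Sum>k<m. f k)) - MJ y)) \<longlonglongrightarrow> 0"
        by (rule BL_lim[OF BL_MJ csubspace_L2 norm_on_L2 norm_on_L2 Ko_L2(2) y(1)]) (use y(2) in \<open>simp add: sK\<close>)
      then have "(\<lambda>m. L2_inner (D \<eta>) (MJ (Co (\<Sum>k<m. f k)))) \<longlonglongrightarrow> L2_inner (D \<eta>) (MJ y)"
        by (intro L2_inner_bound_lim MJ_L2 Ko_L2 y V_D \<eta>)
      moreover have "L2_inner (D \<eta>) (MJ (Co w)) = 0" for w using opt_Ko[of w] \<eta> by (simp add: opt_def Co_def)
      ultimately show "L2_inner (D \<eta>) (MJ (C x + D u)) = 0" by (simp add: cl LIMSEQ_const_iff)
    qed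
    then have K: "Ko x = u" by (rule Ko_eqI)
    then have "p x = L2_norm 0 u + L2_norm 0 y + ns z" by (simp add: p_def Co_def Zo_def cl)
    also have "\<dots> \<le> (\<Sum>k. L2_norm 0 (Ko (f k))) + (\<Sum>k. L2_norm 0 (Co (f k))) + (\<Sum>k. ns (Zo (f k)))"
      using u(3) y(3) z(3) by linarith
    also have "\<dots> = (\<Sum>k. p (f k))" unfolding p_def by (simp add: suminf_add s summable_add)
    finally show "p x \<le> (\<Sum>k. p (f k))" .
  qed auto
  show ?thesis
  proof (rule that[of "\<bar>M\<bar> + 1"])
    have le: "p x \<le> (\<bar>M\<bar> + 1) * norm x" for x
      using M[of x] mult_right_mono[of M "\<bar>M\<bar> + 1" "norm x"] by force
    show "L2_norm 0 (Ko x) \<le> (\<bar>M\<bar> + 1) * norm x" "L2_norm 0 (Co x) \<le> (\<bar>M\<bar> + 1) * norm x" for x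
      using le[of x] nZ[of x] L2_norm_nonneg[of 0 "Ko x"] L2_norm_nonneg[of 0 "Co x"] unfolding p_def by linarith+
  qed simp
qed

subsection \<open>Dynamic programming\<close>

lemma B_shift_plus: "u \<in> L2_plus \<gamma> \<Longrightarrow> B (shift 0 u) = 0"
  using wpls_B_plus[OF sysC, of u] by (simp add: L2_plus_def)

text \<open>On \<open>[0, t)\<close> the two weights are equivalent, so only the tail
  decides.\<close>

lemma L2_0_shift_iff:
  fixes y :: "'a::chilbert_space aefun"
  assumes y: "y \<in> L2_plus \<gamma>" and t: "0 \<le> t"
  shows "pi_plus (shift t y) \<in> L2 0 \<longleftrightarrow> y \<in> L2 0"
proof
  assume "pi_plus (shift t y) \<in> L2 0"
  then have "shift (- t) (pi_plus (shift t y)) \<in> L2 0" by (rule L2_shift)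
  then have 1: "cut {t..} y \<in> L2 0" by (simp add: shift_cut atLeast_def)
  have "cut {0..<t} y \<in> L2 0" using y by (intro L2_cut_interval) (auto simp: L2_plus_def)
  then have "cut {0..<t} y + cut {t..} y \<in> L2 0" using 1 by (rule L2_add)
  moreover have "{0..<t} \<inter> {t..} = {}" "{0..<t} \<union> {t..} = {0..}" using t by auto
  ultimately show "y \<in> L2 0" using cut_split[of "{0..<t}" "{t..}" y] L2_plus_fix[OF y] by simp
next
  assume "y \<in> L2 0" then show "pi_plus (shift t y) \<in> L2 0" by (intro L2_cut L2_shift) auto
qed

text \<open>The shift axiom for \<open>Zs\<close> enters here. It is assumed for positive times,
  hence the separate case \<open>t = 0\<close>.\<close>

lemma adm_shift_iff:
  assumes t: "0 \<le> t" and u: "u \<in> L2_plus 0"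
  shows "adm (A t x + B (shift t u)) (pi_plus (shift t u)) \<longleftrightarrow> adm x u"
proof (cases "t = 0")
  case True
  then show ?thesis
    using B_shift_plus[OF L2_plus_0_g(1)[OF u]] u by (simp add: wpls_A0[OF sysC] L2_plus_fix)
next
  case False
  then have t': "0 < t" using t by simp
  have ug: "u \<in> L2 \<gamma>" using u by (rule L2_0_g)
  have 1: "C (A t x + B (shift t u)) + D (pi_plus (shift t u)) = pi_plus (shift t (C x + D u))"
    by (rule wpls_output_shift[OF sysC t ug, symmetric])
  have 2: "Q (A t x + B (shift t u)) + R (pi_plus (shift t u)) = pi_plus (shift t (Q x + R u))"
    by (rule wpls_output_shift[OF sysQ t ug, symmetric])
  have "Q x \<in> topspace Zu" "R u \<in> topspace Zu"
  proof -
    show "Q x \<in> topspace Zu" using continuous_map_image_subset_topspace[OF Q_cont] by auto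
    have "u \<in> topspace (norm_topology (L2_plus 0) (L2_norm 0))"
    proof -
      interpret Metric_space "L2_plus 0 :: 'u aefun set" "norm_dist (L2_plus 0) (L2_norm 0)"
        by (rule norm_dist_metric[OF csubspace_L2_plus norm_on_L2_plus])
      show ?thesis using u by (simp add: norm_topology_def)
    qed
    then show "R u \<in> topspace Zu" using continuous_map_image_subset_topspace[OF R_cont] by auto
  qed
  then have 3: "Q x + R u \<in> topspace Zu"
    using Zu by (auto simp: topological_vector_space_def csubspace_def)
  have 4: "C x + D u \<in> L2_plus \<gamma>" by (rule output_plus[OF ug L2_plus_fix[OF u]])
  have 5: "pi_plus (shift t u) \<in> L2_plus 0" using u by (simp add: L2_plus_def L2_cut L2_shift)
  show ?thesis
    unfolding adm_def 1 2 using u 5 Zs_shift[OF 3 t'] L2_0_shift_iff[OF 4 t] by simp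
qed

text \<open>From the zero state, a control delayed by \<open>t\<close> is still at the zero state at
  time \<open>t\<close>, since \<open>B u = 0\<close> for \<open>u\<close> on the half-line.
  Admissibility is then read off from \<open>adm_shift_iff\<close>.\<close>

lemma shift_V:
  assumes t: "0 \<le> t" and u: "u \<in> V" shows "shift (- t) u \<in> V"
proof -
  have u0: "u \<in> L2_plus 0" using u V_iff by blast
  have s: "shift (- t) u \<in> L2_plus 0"
  proof -
    have "{0..} \<inter> {t..} = {t..}" using t by auto
    then have "pi_plus (shift (- t) (pi_plus u)) = shift (- t) (pi_plus u)" by (simp add: shift_cut atLeast_def[symmetric])
    then show ?thesis using u0 by (simp add: L2_plus_def L2_shift)
  qed
  have "B u = 0" by (rule wpls_B_plus[OF sysC L2_0_g[OF u0] L2_plus_fix[OF u0]])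
  then show ?thesis
    using adm_shift_iff[OF t s, of 0] u A_diff[OF t, of 0 0] L2_plus_fix[OF u0] by simp
qed

lemma D_shift: "u \<in> L2 \<gamma> \<Longrightarrow> D (shift t u) = shift t (D u)"
  using TIC_D(2)[OF WC(7)] by simp

text \<open>Bellman's principle: a variation \<open>\<eta>\<close> of the remaining control, delayed
  by \<open>t\<close>, is a variation of the original one by \<open>shift_V\<close>, and shifts
  preserve the inner product.\<close>

lemma opt_shift:
  assumes t: "0 \<le> t" and o: "opt x u"
  shows "opt (A t x + B (shift t u)) (pi_plus (shift t u))"
proof -
  have a: "adm x u" and u: "u \<in> L2_plus 0" "u \<in> L2 \<gamma>" "C x + D u \<in> L2 0" using o by (auto simp: opt_def adm_def L2_0_g)
  show ?thesis
    unfolding opt_def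
  proof (intro conjI ballI)
    show "adm (A t x + B (shift t u)) (pi_plus (shift t u))" using adm_shift_iff[OF t u(1)] a by blast
    fix \<eta> assume \<eta>: "\<eta> \<in> V"
    have "\<eta> \<in> L2_plus 0" using \<eta> V_iff by blast
    then have \<eta>p: "pi_plus (D \<eta>) = D \<eta>"
      using TIC_plus[OF WC(7) V_g[OF \<eta>]] by (simp add: L2_plus_fix)
    have "L2_inner (D \<eta>) (MJ (C (A t x + B (shift t u)) + D (pi_plus (shift t u))))
      = L2_inner (D \<eta>) (pi_plus (shift t (MJ (C x + D u))))"
      by (simp add: wpls_output_shift[OF sysC t u(2), symmetric] MJ_cut MJ_shift)
    also have "\<dots> = L2_inner (D \<eta>) (shift t (MJ (C x + D u)))"
      using L2_inner_cut[of "{0..}" "D \<eta>"] \<eta>p by simp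
    also have "\<dots> = L2_inner (D (shift (- t) \<eta>)) (MJ (C x + D u))"
      using L2_inner_shift_left[of "- t" "D \<eta>"] by (simp add: D_shift V_g[OF \<eta>])
    also have "\<dots> = 0" using o shift_V[OF t \<eta>] by (simp add: opt_def)
    finally show "L2_inner (D \<eta>) (MJ (C (A t x + B (shift t u)) + D (pi_plus (shift t u)))) = 0" .
  qed
qed

lemma Ko_shift: "0 \<le> t \<Longrightarrow> pi_plus (shift t (Ko x)) = Ko (A t x + B (shift t (Ko x)))"
  using Ko_eqI[OF opt_shift[OF _ opt_Ko]] by simp

end

subsection \<open>Laplace transforms\<close>

text \<open>The substitution \<open>x = exp (- \<delta> * t)\<close> turns the hypotheses into
  vanishing moments on the unit interval. Weierstrass extends them to continuous functions of
  \<open>x\<close>, dominated convergence to indicators of half-lines.\<close>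

lemma lerch_real:
  fixes \<phi> :: "real \<Rightarrow> real"
  assumes i: "integrable lebesgue \<phi>" and supp: "\<And>t. t < 0 \<Longrightarrow> \<phi> t = 0" and d: "0 < \<delta>"
    and z: "\<And>n::nat. (LINT t|lebesgue. exp (- \<delta> * t) ^ n * \<phi> t) = 0"
  shows "AE t in lebesgue. \<phi> t = 0"
proof -
  let ?x = "\<lambda>t. exp (- \<delta> * t)"
  have x01: "?x t \<in> {0..1}" if "0 \<le> t" for t using that d by simp
  have xm: "(\<lambda>t. h (?x t)) \<in> borel_measurable lebesgue" if "h \<in> borel_measurable borel" for h :: "real \<Rightarrow> real"
    by (rule measurable_completion) (use that in measurable)
  have bm: "(\<lambda>t. h (?x t) * \<phi> t) \<in> borel_measurable lebesgue" if "h \<in> borel_measurable borel" for h :: "real \<Rightarrow> real"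
    using xm[OF that] i by (intro borel_measurable_times) auto
  have bi: "integrable lebesgue (\<lambda>t. h (?x t) * \<phi> t)"
    if h: "h \<in> borel_measurable borel" "\<And>x. x \<in> {0..1} \<Longrightarrow> \<bar>h x\<bar> \<le> K" for h K
  proof (rule Bochner_Integration.integrable_bound[OF integrable_mult_right[OF i, of K] bm[OF h(1)]])
    show "AE t in lebesgue. norm (h (?x t) * \<phi> t) \<le> norm (K * \<phi> t)"
    proof (rule AE_I2)
      fix t
      show "norm (h (?x t) * \<phi> t) \<le> norm (K * \<phi> t)"
      proof (cases "0 \<le> t")
        case True
        then have "\<bar>h (?x t)\<bar> \<le> \<bar>K\<bar>" using h(2)[OF x01[OF True]] by linarith
        then show ?thesis by (simp add: abs_mult mult_right_mono)
      qed (simp add: supp)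
    qed
  qed
  have poly: "(LINT t|lebesgue. g (?x t) * \<phi> t) = 0" if g: "real_polynomial_function g" for g
  proof -
    obtain a n where g': "g = (\<lambda>x. \<Sum>i\<le>n. a i * x ^ i)"
      using g real_polynomial_function_iff_sum[of g] by blast
    have ii: "integrable lebesgue (\<lambda>t. ?x t ^ i * \<phi> t)" for i
      by (rule bi[of "\<lambda>x. x ^ i" 1]) (auto simp: power_le_one)
    have "(LINT t|lebesgue. g (?x t) * \<phi> t) = (LINT t|lebesgue. (\<Sum>i\<le>n. a i * (?x t ^ i * \<phi> t)))"
      unfolding g' by (simp add: sum_distrib_right mult.assoc)
    also have "\<dots> = (\<Sum>i\<le>n. LINT t|lebesgue. a i * (?x t ^ i * \<phi> t))"
      by (rule Bochner_Integration.integral_sum) (intro integrable_mult_right ii)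
    also have "\<dots> = 0" using z by simp
    finally show ?thesis .
  qed
  have cont: "(LINT t|lebesgue. h (?x t) * \<phi> t) = 0" if h: "continuous_on UNIV h" for h :: "real \<Rightarrow> real"
  proof -
    let ?N = "LINT t|lebesgue. \<bar>\<phi> t\<bar>"
    have hb: "h \<in> borel_measurable borel" using h by (rule borel_measurable_continuous_onI)
    have "\<bar>LINT t|lebesgue. h (?x t) * \<phi> t\<bar> \<le> e * ?N" if e: "0 < e" for e
    proof -
      obtain g where g: "real_polynomial_function g" "\<And>x. x \<in> {0..1} \<Longrightarrow> \<bar>h x - g x\<bar> < e"
        using Stone_Weierstrass_real_polynomial_function[OF compact_Icc continuous_on_subset[OF h subset_UNIV] e, of 0 1] by blast
      have gb: "g \<in> borel_measurable borel"
        by (intro borel_measurable_continuous_onI continuous_at_imp_continuous_on ballI continuous_real_polymonial_function g(1))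
      have cb: "\<exists>K. \<forall>x\<in>{0..1}. \<bar>f x\<bar> \<le> K" if "continuous_on UNIV f" for f :: "real \<Rightarrow> real"
        using compact_continuous_image[OF continuous_on_subset[OF that] compact_Icc[of 0 1]] compact_imp_bounded
        by (fastforce simp: bounded_iff)
      obtain K1 where K1: "\<And>x. x \<in> {0..1} \<Longrightarrow> \<bar>h x\<bar> \<le> K1" using cb[OF h] by blast
      have i1: "integrable lebesgue (\<lambda>t. h (?x t) * \<phi> t)" by (rule bi[OF hb K1])
      have i2: "integrable lebesgue (\<lambda>t. g (?x t) * \<phi> t)"
        by (rule bi[OF gb, of "K1 + e"]) (use K1 g(2) in fastforce)
      have "(LINT t|lebesgue. h (?x t) * \<phi> t) = (LINT t|lebesgue. h (?x t) * \<phi> t - g (?x t) * \<phi> t)"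
        unfolding Bochner_Integration.integral_diff[OF i1 i2] poly[OF g(1)] by simp
      also have "\<bar>\<dots>\<bar> \<le> (LINT t|lebesgue. \<bar>h (?x t) * \<phi> t - g (?x t) * \<phi> t\<bar>)"
        by (rule integral_abs_bound)
      also have "\<dots> \<le> (LINT t|lebesgue. e * \<bar>\<phi> t\<bar>)"
      proof (rule integral_mono)
        show "integrable lebesgue (\<lambda>t. \<bar>h (?x t) * \<phi> t - g (?x t) * \<phi> t\<bar>)" using i1 i2 by auto
        show "integrable lebesgue (\<lambda>t. e * \<bar>\<phi> t\<bar>)" using i by auto
        fix t
        show "\<bar>h (?x t) * \<phi> t - g (?x t) * \<phi> t\<bar> \<le> e * \<bar>\<phi> t\<bar>"
        proof (cases "0 \<le> t")
          case True
          then have "\<bar>h (?x t) - g (?x t)\<bar> \<le> e" using g(2)[OF x01[OF True]] by simp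
          then show ?thesis by (simp add: left_diff_distrib[symmetric] abs_mult mult_right_mono)
        qed (simp add: supp)
      qed
      finally show ?thesis by simp
    qed
    then have le: "\<bar>LINT t|lebesgue. h (?x t) * \<phi> t\<bar> \<le> e * ?N" if "0 < e" for e using that by blast
    have "\<bar>LINT t|lebesgue. h (?x t) * \<phi> t\<bar> \<le> 0"
    proof (rule field_le_epsilon)
      fix e :: real assume e: "0 < e"
      have N: "0 \<le> ?N" by simp
      then have N1: "0 < ?N + 1" by linarith
      have "\<bar>LINT t|lebesgue. h (?x t) * \<phi> t\<bar> \<le> e / (?N + 1) * ?N" by (intro le divide_pos_pos e N1)
      also have "\<dots> \<le> e / (?N + 1) * (?N + 1)" using divide_pos_pos[OF e N1] by (intro mult_left_mono) auto
      also have "\<dots> = e" using N1 by simp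
      finally show "\<bar>LINT t|lebesgue. h (?x t) * \<phi> t\<bar> \<le> 0 + e" by simp
    qed
    then show ?thesis by simp
  qed
  show ?thesis
  proof (rule AE_zero_if_integrals_zero[OF i])
    fix a :: real
    \<comment> \<open>Ramps that vanish up to the image of \<open>a\<close> and tend to one above
      it. Since \<open>x\<close> decreases in \<open>t\<close>, their limit is the indicator of
      \<open>t < a\<close>, with value zero at \<open>t = a\<close>.\<close>
    define h where "h n x = min 1 (max 0 (real n * (x - ?x a)))" for n and x :: real
    have hc: "continuous_on UNIV (h n)" for n unfolding h_def by (intro continuous_intros)
    have "(\<lambda>n. LINT t|lebesgue. h n (?x t) * \<phi> t) \<longlonglongrightarrow> (LINT t|lebesgue. indicator {..<a} t *\<^sub>R \<phi> t)"
    proof (rule integral_dominated_convergence[where w = "\<lambda>t. \<bar>\<phi> t\<bar>"])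
      show "(\<lambda>t. indicator {..<a} t *\<^sub>R \<phi> t) \<in> borel_measurable lebesgue"
        using i by (intro borel_measurable_scaleR borel_measurable_indicator) auto
      show "(\<lambda>t. h n (?x t) * \<phi> t) \<in> borel_measurable lebesgue" for n
        by (rule bm) (rule borel_measurable_continuous_onI[OF hc])
      show "integrable lebesgue (\<lambda>t. \<bar>\<phi> t\<bar>)" using i by auto
      show "AE t in lebesgue. norm (h n (?x t) * \<phi> t) \<le> \<bar>\<phi> t\<bar>" for n
      proof (rule AE_I2)
        fix t
        have "\<bar>h n (?x t)\<bar> \<le> 1" by (simp add: h_def)
        then show "norm (h n (?x t) * \<phi> t) \<le> \<bar>\<phi> t\<bar>"
          using mult_right_mono[of "\<bar>h n (?x t)\<bar>" 1 "\<bar>\<phi> t\<bar>"] by (simp add: abs_mult)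
      qed
      show "AE t in lebesgue. (\<lambda>n. h n (?x t) * \<phi> t) \<longlonglongrightarrow> indicator {..<a} t *\<^sub>R \<phi> t"
      proof (rule AE_I2)
        fix t
        have "(\<lambda>n. h n (?x t)) \<longlonglongrightarrow> indicator {..<a} t"
        proof (cases "t < a")
          case True
          then have p: "0 < ?x t - ?x a" using d by simp
          obtain N :: nat where N: "1 / (?x t - ?x a) < real N" using reals_Archimedean2 by blast
          have "h n (?x t) = 1" if "N \<le> n" for n
          proof -
            have "1 / (?x t - ?x a) \<le> real n" using N that by linarith
            then have "1 \<le> real n * (?x t - ?x a)" using p by (simp add: divide_le_eq)
            then show ?thesis by (simp add: h_def)
          qed
          then have "\<forall>\<^sub>F n in sequentially. h n (?x t) = indicator {..<a} t"
            using True by (auto simp: eventually_sequentially)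
          then show ?thesis by (rule tendsto_eventually)
        next
          case False
          then have "?x t - ?x a \<le> 0" using d by simp
          then have "real n * (?x t - ?x a) \<le> 0" for n by (intro mult_nonneg_nonpos) auto
          then have "h n (?x t) = 0" for n unfolding h_def by (subst max_absorb1) auto
          then show ?thesis using False by simp
        qed
        then show "(\<lambda>n. h n (?x t) * \<phi> t) \<longlonglongrightarrow> indicator {..<a} t *\<^sub>R \<phi> t"
          by (simp add: tendsto_mult_right)
      qed
    qed
    then show "(LINT t|lebesgue. indicator {..<a} t *\<^sub>R \<phi> t) = 0"
      unfolding cont[OF hc] by (simp add: LIMSEQ_const_iff)
  qed
qed

text \<open>The common factor \<open>exp (- \<sigma> * t)\<close> makes each scalar component
  integrable, and the steps of size \<open>\<delta>\<close> supply the moments for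
  \<open>lerch_real\<close>.\<close>

lemma lerch:
  fixes w :: "'a::chilbert_space aefun"
  assumes w: "w \<in> L2_plus 0" and s: "0 < \<sigma>" and d: "0 < \<delta>"
    and z: "\<And>n u. L2_inner (expf {0..} (- (\<sigma> + real n * \<delta>)) u) w = 0"
  shows "w = 0"
proof (cases w)
  case (1 f)
  have w0: "w \<in> L2 0" "pi_plus w = w" using w by (auto simp: L2_plus_def)
  have fm: "smeas f" using w0 by (simp add: 1 L2_abs0)
  have int: "integrable lebesgue (\<lambda>t. indicator {0..} t *\<^sub>R (exp (- s * t) *\<^sub>R cinner u (f t)))" if "0 < s" for s u
  proof -
    have "abs_aefun (\<lambda>t. if t \<in> {0..} then exp (- s * t) *\<^sub>R u else 0) \<in> L2 0"
      using expf_atLeast_L2(1)[of "- s" 0 0 u] that unfolding expf_def' by simp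
    from L2_inner_integrable[OF this w0(1)[unfolded 1]] show ?thesis
      by (rule Bochner_Integration.integrable_cong[THEN iffD1, rotated 2])
         (auto simp: indicator_def cinner_scaleR_left scaleR_conv_of_real)
  qed
  have re: "AE t in lebesgue. indicator {0..} t * (exp (- \<sigma> * t) * Re (cinner u (f t))) = 0" for u
  proof (rule lerch_real[OF _ _ d])
    show "integrable lebesgue (\<lambda>t. indicator {0..} t * (exp (- \<sigma> * t) * Re (cinner u (f t))))"
      using integrable_Re[OF int[OF s, of u]] by (simp add: mult.assoc)
    fix n :: nat
    have sn: "0 < \<sigma> + real n * \<delta>" using s d by (simp add: add_pos_nonneg)
    have e: "exp (- \<delta> * t) ^ n * (indicator {0..} t * (exp (- \<sigma> * t) * r)) = indicator {0..} t * (exp (- (\<sigma> + real n * \<delta>) * t) * r)" for t r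
      by (simp add: exp_of_nat_mult[symmetric] exp_add[symmetric] algebra_simps)
    have "(LINT t|lebesgue. exp (- \<delta> * t) ^ n * (indicator {0..} t * (exp (- \<sigma> * t) * Re (cinner u (f t)))))
      = (LINT t|lebesgue. Re (indicator {0..} t *\<^sub>R (exp (- (\<sigma> + real n * \<delta>) * t) *\<^sub>R cinner u (f t))))"
      unfolding e by (simp add: mult.assoc)
    also have "\<dots> = Re (L2_inner (expf {0..} (- (\<sigma> + real n * \<delta>)) u) w)"
      unfolding 1 L2_inner_expf by (rule integral_Re[OF int[OF sn]])
    finally show "(LINT t|lebesgue. exp (- \<delta> * t) ^ n * (indicator {0..} t * (exp (- \<sigma> * t) * Re (cinner u (f t))))) = 0"
      using z by simp
  qed auto
  have p: "AE t in lebesgue. (if t \<in> {0..} then f t else 0) = f t"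
    using w0(2) unfolding 1 cut.abs_eq abs_aefun_eq_iff .
  have "AE t in lebesgue. cinner u (f t) = 0" for u
    using re[of u] re[of "\<i> *\<^sub>C u"] p
  proof eventually_elim
    case (elim t)
    show ?case
    proof (cases "0 \<le> t")
      case True then show ?thesis using elim(1,2) by (simp add: cinner_scaleC_left complex_eq_iff)
    next
      case False then have "f t = 0" using elim(3) by simp
      then show ?thesis by simp
    qed
  qed
  then have "AE t in lebesgue. f t = 0" by (rule smeas_AE_zeroI[OF fm])
  then show ?thesis by (simp add: 1 zero_aefun.abs_eq abs_aefun_eq_iff)
qed

lemma expf_diff_lessThan: "a \<le> b \<Longrightarrow> expf {..<b} \<sigma> u - expf {..<a} \<sigma> u = expf {a..<b} \<sigma> u"
  by transfer (auto simp: ae_eq_def)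

lemma expf_interval_norm:
  assumes "a \<le> b" "\<omega> < \<sigma>"
  shows "L2_norm \<omega> (expf {a..<b} \<sigma> u) \<le> norm u * (exp ((\<sigma> - \<omega>) * b) * sqrt (b - a))"
proof (rule L2_norm_leI)
  have "(\<integral>\<^sup>+ t. ennreal (exp (2 * (\<sigma> - \<omega>) * t)) * indicator {a..<b} t \<partial>lebesgue)
     \<le> (\<integral>\<^sup>+ t. ennreal ((exp ((\<sigma> - \<omega>) * b))\<^sup>2) * indicator {a..<b} t \<partial>lebesgue)"
  proof (rule nn_integral_mono)
    fix t :: real
    show "ennreal (exp (2 * (\<sigma> - \<omega>) * t)) * indicator {a..<b} t \<le> ennreal ((exp ((\<sigma> - \<omega>) * b))\<^sup>2) * indicator {a..<b} t"
    proof (cases "t \<in> {a..<b}")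
      case True
      then have "(\<sigma> - \<omega>) * t \<le> (\<sigma> - \<omega>) * b" using assms(2) by (intro mult_left_mono) auto
      then have "2 * (\<sigma> - \<omega>) * t \<le> 2 * ((\<sigma> - \<omega>) * b)" unfolding mult.assoc[of 2] by simp
      then have "exp (2 * (\<sigma> - \<omega>) * t) \<le> (exp ((\<sigma> - \<omega>) * b))\<^sup>2" unfolding exp_double[symmetric] exp_le_cancel_iff .
      then show ?thesis by (intro mult_right_mono ennreal_leI) auto
    qed simp
  qed
  also have "\<dots> = ennreal ((exp ((\<sigma> - \<omega>) * b))\<^sup>2) * ennreal (b - a)"
    using assms(1) by (subst nn_integral_cmult_indicator) auto
  finally have "weighted_integral \<omega> (expf {a..<b} \<sigma> u) \<le> ennreal ((norm u)\<^sup>2) * (ennreal ((exp ((\<sigma> - \<omega>) * b))\<^sup>2) * ennreal (b - a))"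
    by (simp add: weighted_integral_expf mult_left_mono)
  also have "\<dots> = ennreal ((norm u * (exp ((\<sigma> - \<omega>) * b) * sqrt (b - a)))\<^sup>2)"
    using assms(1) by (simp add: ennreal_mult[symmetric] power_mult_distrib)
  finally show "weighted_integral \<omega> (expf {a..<b} \<sigma> u) \<le> ennreal ((norm u * (exp ((\<sigma> - \<omega>) * b) * sqrt (b - a)))\<^sup>2)" .
qed (use assms in auto)

lemma
  fixes k :: real
  shows integrable_exp_atLeast: "0 < k \<Longrightarrow> integrable lborel (\<lambda>t. indicator {0..} t * exp (- k * t))"
  and integral_exp_atLeast: "0 < k \<Longrightarrow> (LINT t|lborel. indicator {0..} t * exp (- k * t)) = 1 / k"
proof -
  assume k: "0 < k"
  have n: "(\<integral>\<^sup>+ t. ennreal (indicator {0..} t * exp (- k * t)) \<partial>lborel) = ennreal (1 / k)"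
  proof -
    have "(\<integral>\<^sup>+ t. ennreal (indicator {0..} t * exp (- k * t)) \<partial>lborel) = (\<integral>\<^sup>+ t. ennreal (exp (- k * t)) * indicator {0..} t \<partial>lebesgue)"
      unfolding nn_integral_completion by (intro nn_integral_cong) (auto simp: indicator_def)
    then show ?thesis using nn_integral_exp_atLeast[OF k, of 0] by simp
  qed
  show "integrable lborel (\<lambda>t. indicator {0..} t * exp (- k * t))"
    using n by (intro integrableI_nonneg) auto
  show "(LINT t|lborel. indicator {0..} t * exp (- k * t)) = 1 / k"
    using n k by (subst integral_eq_nn_integral) auto
qed

text \<open>Both sides of the identity are continuous in \<open>v\<close>, so it suffices to check it on truncated
  exponentials; this avoids Fubini for vector-valued functions.\<close>

lemma laplace_of_shifts:
  fixes F G :: "'a::chilbert_space aefun \<Rightarrow> complex"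
  assumes g: "0 < \<gamma>" "\<gamma> < s" and K: "0 < KF" "0 < KG"
    and Fadd: "\<And>f h. f \<in> L2 \<gamma> \<Longrightarrow> h \<in> L2 \<gamma> \<Longrightarrow> F (f + h) = F f + F h"
    and Fscale: "\<And>a f. f \<in> L2 \<gamma> \<Longrightarrow> F (a *\<^sub>C f) = a * F f"
    and Fbd: "\<And>f. f \<in> L2 \<gamma> \<Longrightarrow> cmod (F f) \<le> KF * L2_norm \<gamma> f"
    and Gadd: "\<And>f h. f \<in> L2_plus 0 \<Longrightarrow> h \<in> L2_plus 0 \<Longrightarrow> G (f + h) = G f + G h"
    and Gscale: "\<And>a f. f \<in> L2_plus 0 \<Longrightarrow> G (a *\<^sub>C f) = a * G f"
    and Gbd: "\<And>f. f \<in> L2_plus 0 \<Longrightarrow> cmod (G f) \<le> KG * L2_norm 0 f"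
    and gen: "\<And>c d w. 0 \<le> c \<Longrightarrow> c < d \<Longrightarrow>
        (LINT r|lborel. indicator {c<..d} r *\<^sub>R F (expf {..<r} s w)) = G (expf {c..<d} s w)"
    and v: "v \<in> L2_plus 0" and null: "\<And>a. 0 \<le> a \<Longrightarrow> F (shift a v) = 0"
  shows "G v = 0"
proof -
  \<comment> \<open>The integrand of the Laplace transform at \<open>s\<close> of the scalar
    function sending \<open>a\<close> to \<open>F (shift a v)\<close>. The integral of
    \<open>m v\<close> is to be \<open>G v\<close>, and \<open>null\<close> makes it zero.\<close>
  define m where "m v a = indicator {0..} a *\<^sub>R (exp (- s * a) *\<^sub>R F (shift a v))" for v a
  note LP = csubspaceD[OF csubspace_L2_plus]
  have Lg: "shift a v \<in> L2 \<gamma>" if "v \<in> L2_plus 0" for v :: "'a aefun" and a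
    using L2_weight_plus(1)[of v 0 \<gamma>] that g by (auto simp: L2_plus_def intro: L2_shift)
  have Ln: "L2_norm \<gamma> v \<le> L2_norm 0 v" if "v \<in> L2_plus 0" for v :: "'a aefun"
    using L2_weight_plus(2)[of v 0 \<gamma>] that g by (auto simp: L2_plus_def)
  have Fdiff: "F (f - h) = F f - F h" if "f \<in> L2 \<gamma>" "h \<in> L2 \<gamma>" for f h
    using Fadd[of "f - h" h] that by (simp add: L2_diff)
  have Gdiff: "G (f - h) = G f - G h" if "f \<in> L2_plus 0" "h \<in> L2_plus 0" for f h
    using Gadd[of "f - h" h] that by (simp add: LP)
  define E where "E a = indicator {0..} a * exp (- (s - \<gamma>) * a)" for a :: real
  have Ei: "integrable lborel E" "(LINT a|lborel. E a) = 1 / (s - \<gamma>)"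
    unfolding E_def using g integrable_exp_atLeast[of "s - \<gamma>"] integral_exp_atLeast[of "s - \<gamma>"] by auto
  have mbd: "cmod (m v a) \<le> KF * L2_norm 0 v * E a" if v: "v \<in> L2_plus 0" for v a
  proof (cases "0 \<le> a")
    case True
    have "cmod (F (shift a v)) \<le> KF * L2_norm \<gamma> (shift a v)" using Fbd Lg v by blast
    also have "L2_norm \<gamma> (shift a v) = exp (\<gamma> * a) * L2_norm \<gamma> v" using Lg[OF v, of 0] by (simp add: L2_norm_shift)
    also have "KF * \<dots> \<le> KF * (exp (\<gamma> * a) * L2_norm 0 v)" using Ln[OF v] K by (intro mult_left_mono) auto
    finally have "exp (- s * a) * cmod (F (shift a v)) \<le> exp (- s * a) * (KF * (exp (\<gamma> * a) * L2_norm 0 v))"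
      by (intro mult_left_mono) auto
    also have "\<dots> = KF * L2_norm 0 v * (exp (- s * a) * exp (\<gamma> * a))" by (simp only: mult_ac)
    also have "exp (- s * a) * exp (\<gamma> * a) = exp (- (s - \<gamma>) * a)" unfolding exp_add[symmetric] by (simp add: algebra_simps)
    finally show ?thesis using True by (simp add: m_def E_def)
  qed (simp add: m_def E_def)
  have mdiff: "m (f - h) a = m f a - m h a" if "f \<in> L2_plus 0" "h \<in> L2_plus 0" for f h a
    using Lg that by (simp add: m_def shift_diff Fdiff scaleR_diff_right)
  have mint: "integrable lborel (m v)" if v: "v \<in> L2_plus 0" and mm: "m v \<in> borel_measurable lborel" for v
  proof (rule Bochner_Integration.integrable_bound[OF integrable_mult_right[OF Ei(1), of "KF * L2_norm 0 v"] mm])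
    show "AE a in lborel. norm (m v a) \<le> norm (KF * L2_norm 0 v * E a)"
    proof (rule AE_I2)
      fix a
      show "norm (m v a) \<le> norm (KF * L2_norm 0 v * E a)"
        using mbd[OF v, of a] abs_ge_self[of "KF * L2_norm 0 v * E a"] unfolding real_norm_def by linarith
    qed
  qed
  have mnorm: "cmod (LINT a|lborel. m v a) \<le> KF * L2_norm 0 v / (s - \<gamma>)" if v: "v \<in> L2_plus 0" and mm: "m v \<in> borel_measurable lborel" for v
  proof -
    have "cmod (LINT a|lborel. m v a) \<le> (LINT a|lborel. cmod (m v a))" by (rule integral_norm_bound)
    also have "\<dots> \<le> (LINT a|lborel. KF * L2_norm 0 v * E a)"
      using mint[OF that] Ei(1) mbd[OF v] by (intro integral_mono) auto
    finally show ?thesis by (simp add: Ei)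
  qed
  \<comment> \<open>Measurability of \<open>m v\<close> is a membership condition, since
    \<open>F\<close> is an arbitrary functional. For the given \<open>v\<close> it is immediate
    because \<open>m v\<close> vanishes.\<close>
  define S where "S = {v \<in> L2_plus 0. m v \<in> borel_measurable lborel \<and> (LINT a|lborel. m v a) = G v}"
  have subS: "csubspace S" unfolding csubspace_def
  proof (intro conjI ballI allI)
    have "F 0 = 0" "G 0 = 0" using Fdiff[of 0 0] Gdiff[of 0 0] LP(1) by auto
    then show "0 \<in> S" by (simp add: S_def m_def[abs_def] LP)
    fix f assume f: "f \<in> S"
    show "f + h \<in> S" if h: "h \<in> S" for h
    proof -
      have fh: "f \<in> L2_plus 0" "h \<in> L2_plus 0" "m f \<in> borel_measurable lborel" "m h \<in> borel_measurable lborel" using f h by (auto simp: S_def)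
      have e: "m (f + h) = (\<lambda>a. m f a + m h a)"
        using Lg fh by (auto simp: m_def shift_add Fadd scaleR_add_right)
      show ?thesis using f h fh mint[OF fh(1,3)] mint[OF fh(2,4)] by (simp add: S_def e LP Gadd)
    qed
    show "c *\<^sub>C f \<in> S" for c
    proof -
      have ff: "f \<in> L2_plus 0" "m f \<in> borel_measurable lborel" using f by (auto simp: S_def)
      have e: "m (c *\<^sub>C f) = (\<lambda>a. c * m f a)"
        using Lg ff by (auto simp: m_def shift_scaleC Fscale)
      show ?thesis using f ff by (simp add: S_def e LP Gscale)
    qed
  qed
  have gens: "expf {c..<d} s w \<in> S" if cd: "0 \<le> c" "c < d" for c d w
  proof -
    let ?v = "expf {c..<d} s w"
    have vp: "?v \<in> L2_plus 0"
    proof -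
      have "{0..} \<inter> {c..<d} = {c..<d}" using cd by auto
      then show ?thesis by (simp add: L2_plus_def expf_interval_L2 cut_expf)
    qed
    define \<psi> where "\<psi> r = F (expf {..<r} s w)" for r
    have Eg: "expf {..<r} s w \<in> L2 \<gamma>" for r using g by (intro expf_lessThan_L2)
    have psub: "\<psi> b - \<psi> a = F (expf {a..<b} s w)" if "a \<le> b" for a b
      unfolding \<psi>_def using Fdiff[OF Eg Eg, of b a] that by (simp add: expf_diff_lessThan)
    \<comment> \<open>Supplies the measurability of \<open>\<psi>\<close>: the norm of an
      exponential on a short interval is at most a constant times the square root of its
      length.\<close>
    have cont: "continuous_on UNIV \<psi>"
    proof -
      have lip: "cmod (\<psi> b - \<psi> a) \<le> KF * (norm w * (exp ((s - \<gamma>) * M) * sqrt (b - a)))" if "a \<le> b" "b \<le> M" for a b M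
      proof -
        have "cmod (\<psi> b - \<psi> a) \<le> KF * L2_norm \<gamma> (expf {a..<b} s w)"
          unfolding psub[OF that(1)] by (intro Fbd expf_interval_L2)
        also have "\<dots> \<le> KF * (norm w * (exp ((s - \<gamma>) * b) * sqrt (b - a)))"
          using K g that by (intro mult_left_mono expf_interval_norm) auto
        also have "\<dots> \<le> KF * (norm w * (exp ((s - \<gamma>) * M) * sqrt (b - a)))"
          using K g that by (intro mult_left_mono mult_right_mono) auto
        finally show ?thesis .
      qed
      have "isCont \<psi> r" for r
        unfolding isCont_def
      proof (rule LIM_zero_cancel, rule Lim_null_comparison)
        have "((\<lambda>x. KF * (norm w * (exp ((s - \<gamma>) * (r + 1)) * sqrt \<bar>x - r\<bar>))) \<longlongrightarrow> KF * (norm w * (exp ((s - \<gamma>) * (r + 1)) * sqrt \<bar>r - r\<bar>))) (at r)"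
          by (intro tendsto_intros)
        then show "((\<lambda>x. KF * (norm w * (exp ((s - \<gamma>) * (r + 1)) * sqrt \<bar>x - r\<bar>))) \<longlongrightarrow> 0) (at r)" by simp
        have "\<forall>\<^sub>F x in at r. x < r + 1"
          using order_tendstoD(2)[OF tendsto_ident_at, of r "r + 1"] by simp
        then show "\<forall>\<^sub>F x in at r. norm (\<psi> x - \<psi> r) \<le> KF * (norm w * (exp ((s - \<gamma>) * (r + 1)) * sqrt \<bar>x - r\<bar>))"
        proof eventually_elim
          case (elim x)
          show ?case
          proof (cases "r \<le> x")
            case True then show ?thesis using lip[of r x "r + 1"] elim by simp
          next
            case False then show ?thesis using lip[of x r "r + 1"] by (simp add: norm_minus_commute abs_minus_commute)
          qed
        qed
      qed
      then show ?thesis by (simp add: continuous_at_imp_continuous_on)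
    qed
    have pm [measurable]: "\<psi> \<in> borel_measurable borel" using cont by (rule borel_measurable_continuous_onI)
    have pb: "cmod (\<psi> r) \<le> KF * (norm w / sqrt (2 * (s - \<gamma>))) * exp ((s - \<gamma>) * r)" for r
      using Fbd[OF Eg, of r] g expf_lessThan_L2(2)[OF g(2), of r w] by (simp add: \<psi>_def mult_ac)
    have hi: "integrable lborel (\<lambda>r. indicator {..e} r *\<^sub>R \<psi> r)" 
      and ht: "(LINT a|lborel. indicator {0..} a *\<^sub>R \<psi> (e - a)) = (LINT r|lborel. indicator {..e} r *\<^sub>R \<psi> r)"
      and hi': "integrable lborel (\<lambda>a. indicator {0..} a *\<^sub>R \<psi> (e - a))" for e
    proof -
      show hi': "integrable lborel (\<lambda>a. indicator {0..} a *\<^sub>R \<psi> (e - a))"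
      proof (rule Bochner_Integration.integrable_bound[OF integrable_mult_right[OF Ei(1), of "KF * (norm w / sqrt (2 * (s - \<gamma>))) * exp ((s - \<gamma>) * e)"]])
        show "AE a in lborel. norm (indicator {0..} a *\<^sub>R \<psi> (e - a)) \<le> norm (KF * (norm w / sqrt (2 * (s - \<gamma>))) * exp ((s - \<gamma>) * e) * E a)"
        proof (rule AE_I2)
          fix a
          have "exp ((s - \<gamma>) * (e - a)) = exp ((s - \<gamma>) * e) * exp (- (s - \<gamma>) * a)"
            unfolding exp_add[symmetric] by (simp add: algebra_simps)
          then have "cmod (\<psi> (e - a)) \<le> KF * (norm w / sqrt (2 * (s - \<gamma>))) * exp ((s - \<gamma>) * e) * exp (- (s - \<gamma>) * a)"
            using pb[of "e - a"] by (simp only: mult.assoc)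
          then show "norm (indicator {0..} a *\<^sub>R \<psi> (e - a)) \<le> norm (KF * (norm w / sqrt (2 * (s - \<gamma>))) * exp ((s - \<gamma>) * e) * E a)"
            using K g by (auto simp: E_def indicator_def abs_mult)
        qed
      qed measurable
      have sw: "(\<lambda>a. indicator {..e} (e + (-1) * a) *\<^sub>R \<psi> (e + (-1) * a)) = (\<lambda>a. indicator {0..} a *\<^sub>R \<psi> (e - a))"
        by (auto simp: indicator_def)
      show "integrable lborel (\<lambda>r. indicator {..e} r *\<^sub>R \<psi> r)"
        using lborel_integrable_real_affine_iff[of "-1" "\<lambda>r. indicator {..e} r *\<^sub>R \<psi> r" e] hi' unfolding sw by simp
      show "(LINT a|lborel. indicator {0..} a *\<^sub>R \<psi> (e - a)) = (LINT r|lborel. indicator {..e} r *\<^sub>R \<psi> r)"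
        using lborel_integral_real_affine[of "-1" "\<lambda>r. indicator {..e} r *\<^sub>R \<psi> r" e] unfolding sw by simp
    qed
    \<comment> \<open>The shift multiplies the exponential by \<open>exp (s * a)\<close>, which the
      Laplace kernel cancels. What is left is a difference of two translates of
      \<open>\<psi>\<close>; after reflection their integrals cancel up to the interval from
      \<open>c\<close> to \<open>d\<close>.\<close>
    have mv: "m ?v a = indicator {0..} a *\<^sub>R \<psi> (d - a) - indicator {0..} a *\<^sub>R \<psi> (c - a)" for a
    proof -
      have "{t. a + t \<in> {c..<d}} = {c - a..<d - a}" by auto
      then have "F (shift a ?v) = of_real (exp (s * a)) * F (expf {c - a..<d - a} s w)"
        by (simp add: shift_expf Fscale expf_interval_L2)
      also have "F (expf {c - a..<d - a} s w) = \<psi> (d - a) - \<psi> (c - a)" using psub[of "c - a" "d - a"] cd by simp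
      finally have "exp (- s * a) *\<^sub>R F (shift a ?v) = \<psi> (d - a) - \<psi> (c - a)"
        by (simp add: scaleR_conv_of_real exp_minus exp_of_real[symmetric] mult.assoc[symmetric])
      then show ?thesis by (simp add: m_def scaleR_diff_right)
    qed
    have "(LINT a|lborel. m ?v a) = (LINT r|lborel. indicator {..d} r *\<^sub>R \<psi> r) - (LINT r|lborel. indicator {..c} r *\<^sub>R \<psi> r)"
      unfolding mv ht[symmetric] by (rule Bochner_Integration.integral_diff[OF hi' hi'])
    also have "\<dots> = (LINT r|lborel. indicator {..d} r *\<^sub>R \<psi> r - indicator {..c} r *\<^sub>R \<psi> r)"
      by (rule Bochner_Integration.integral_diff[OF hi hi, symmetric])
    also have "\<dots> = (LINT r|lborel. indicator {c<..d} r *\<^sub>R \<psi> r)"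
      using cd by (intro Bochner_Integration.integral_cong) (auto simp: indicator_def)
    also have "\<dots> = G ?v" unfolding \<psi>_def by (rule gen[OF cd])
    finally have "(LINT a|lborel. m ?v a) = G ?v" .
    moreover have "m ?v \<in> borel_measurable lborel" unfolding mv[abs_def] by measurable
    ultimately show ?thesis using vp by (simp add: S_def)
  qed
  have "\<exists>g\<in>S. L2_norm 0 (v - g) < e" if e: "0 < e" for e
  proof (rule dense_if_orthogonal_zero[OF csubspace_L2_plus _ L2_plus_complete subS _ _ v e])
    show "L2_plus 0 \<subseteq> L2 0" "S \<subseteq> L2_plus 0" by (auto simp: L2_plus_def S_def)
    fix w :: "'a aefun" assume w: "w \<in> L2_plus 0" and z: "\<And>g. g \<in> S \<Longrightarrow> L2_inner g w = 0"
    show "w = 0"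
    proof (rule L2_orth_expf[where \<sigma> = s])
      show "w \<in> L2 0" using w by (simp add: L2_plus_def)
      fix a b u
      have "L2_inner (expf {a..<b} s u) w = L2_inner (expf {a..<b} s u) (pi_plus w)" using w by (simp add: L2_plus_fix)
      also have "\<dots> = L2_inner (expf ({0..} \<inter> {a..<b}) s u) w" by (simp add: L2_inner_cut[symmetric] cut_expf)
      also have "{0..} \<inter> {a..<b} = {max 0 a..<b}" by auto
      also have "L2_inner (expf {max 0 a..<b} s u) w = 0"
      proof (cases "max 0 a < b")
        case True then show ?thesis by (intro z gens) auto
      next
        case False
        then have e: "{max 0 a..<b} = {}" by auto
        show ?thesis unfolding e by simp
      qed
      finally show "L2_inner (expf {a..<b} s u) w = 0" .
    qed
  qed
  then have "\<exists>g\<in>S. L2_norm 0 (v - g) < 1 / real (Suc k)" for k by simp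
  then obtain h where h: "\<And>k. h k \<in> S" "\<And>k. L2_norm 0 (v - h k) < 1 / real (Suc k)" by metis
  have hS: "h k \<in> L2_plus 0" "m (h k) \<in> borel_measurable lborel" "(LINT a|lborel. m (h k) a) = G (h k)" for k
    using h(1)[of k] by (auto simp: S_def)
  have hl: "(\<lambda>k. L2_norm 0 (v - h k)) \<longlonglongrightarrow> 0"
    by (rule Lim_null_comparison[OF _ LIMSEQ_inverse_real_of_nat])
       (use h(2) in \<open>auto intro!: always_eventually less_imp_le simp: inverse_eq_divide\<close>)
  have m0: "m v = (\<lambda>a. 0)" using null by (auto simp: m_def indicator_def)
  \<comment> \<open>As \<open>m v\<close> is zero, the integral for \<open>v - h k\<close> is
    \<open>- G (h k)\<close>. Hence \<open>G v\<close> equals an expression that is continuous in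
    \<open>v - h k\<close>, which tends to zero.\<close>
  have "cmod (G v) \<le> (KG + KF / (s - \<gamma>)) * L2_norm 0 (v - h k)" for k
  proof -
    have d: "v - h k \<in> L2_plus 0" using v hS by (simp add: LP)
    have "m (v - h k) = (\<lambda>a. - m (h k) a)" using mdiff[OF v hS(1)] by (simp add: m0 fun_eq_iff)
    then have mm: "m (v - h k) \<in> borel_measurable lborel" "(LINT a|lborel. m (v - h k) a) = - G (h k)"
      using hS by simp_all
    have "G v = G (v - h k) - (LINT a|lborel. m (v - h k) a)" using Gdiff[OF v hS(1)] mm(2) by simp
    also have "cmod \<dots> \<le> KG * L2_norm 0 (v - h k) + KF * L2_norm 0 (v - h k) / (s - \<gamma>)"
      by (rule order_trans[OF norm_triangle_ineq4 add_mono[OF Gbd[OF d] mnorm[OF d mm(1)]]])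
    finally show ?thesis by (simp add: algebra_simps)
  qed
  moreover have "(\<lambda>k. (KG + KF / (s - \<gamma>)) * L2_norm 0 (v - h k)) \<longlonglongrightarrow> (KG + KF / (s - \<gamma>)) * 0"
    by (intro tendsto_intros hl)
  ultimately have "cmod (G v) \<le> (KG + KF / (s - \<gamma>)) * 0" by (intro LIMSEQ_le_const) auto
  then show ?thesis by simp
qed

section \<open>Pairings of exponentials on bounded intervals\<close>

lemma integral_exp_interval:
  fixes c d \<delta> :: real
  assumes "c \<le> d" "\<delta> \<noteq> 0"
  shows "(LINT t|lebesgue. indicator {c..<d} t * exp (\<delta> * t)) = (exp (\<delta> * d) - exp (\<delta> * c)) / \<delta>"
    "(LINT t|lborel. indicator {c<..d} t * exp (\<delta> * t)) = (exp (\<delta> * d) - exp (\<delta> * c)) / \<delta>"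
    "integrable lborel (\<lambda>t. indicator {c<..d} t * exp (\<delta> * t))"
proof -
  have 1: "has_bochner_integral lborel (\<lambda>t. exp (\<delta> * t) * indicator {c..d} t) (exp (\<delta> * d) / \<delta> - exp (\<delta> * c) / \<delta>)"
    using assms by (intro has_bochner_integral_FTC_Icc_real[where F = "\<lambda>t. exp (\<delta> * t) / \<delta>"])
      (auto intro!: derivative_eq_intros)
  have ae: "AE t in lborel. t \<noteq> c \<and> t \<noteq> d" using AE_lborel_singleton[of c] AE_lborel_singleton[of d] by eventually_elim auto
  have ae2: "AE t in lborel. exp (\<delta> * t) * indicator {c..d} t = indicator {c..<d} t * exp (\<delta> * t)"
    using ae by eventually_elim (auto simp: indicator_def)
  have 2: "has_bochner_integral lborel (\<lambda>t. indicator {c..<d} t * exp (\<delta> * t)) (exp (\<delta> * d) / \<delta> - exp (\<delta> * c) / \<delta>)"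
    by (rule has_bochner_integral_cong_AE[THEN iffD1, OF _ _ ae2 1]) simp_all
  have ae3: "AE t in lborel. exp (\<delta> * t) * indicator {c..d} t = indicator {c<..d} t * exp (\<delta> * t)"
    using ae by eventually_elim (auto simp: indicator_def)
  have 3: "has_bochner_integral lborel (\<lambda>t. indicator {c<..d} t * exp (\<delta> * t)) (exp (\<delta> * d) / \<delta> - exp (\<delta> * c) / \<delta>)"
    by (rule has_bochner_integral_cong_AE[THEN iffD1, OF _ _ ae3 1]) simp_all
  show "(LINT t|lebesgue. indicator {c..<d} t * exp (\<delta> * t)) = (exp (\<delta> * d) - exp (\<delta> * c)) / \<delta>"
    using has_bochner_integral_integral_eq[OF 2]
    by (subst integral_completion) (auto simp: diff_divide_distrib)
  show "(LINT t|lborel. indicator {c<..d} t * exp (\<delta> * t)) = (exp (\<delta> * d) - exp (\<delta> * c)) / \<delta>"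
    using has_bochner_integral_integral_eq[OF 3] by (simp add: diff_divide_distrib)
  show "integrable lborel (\<lambda>t. indicator {c<..d} t * exp (\<delta> * t))" using 3 by (rule integrable.intros)
qed

lemma L2_inner_expf_interval:
  assumes "0 \<le> c" "c \<le> d"
  shows "s \<noteq> \<sigma> \<Longrightarrow> L2_inner (expf {0..} (- \<sigma>) u) (expf {c..<d} s w) = of_real ((exp ((s - \<sigma>) * d) - exp ((s - \<sigma>) * c)) / (s - \<sigma>)) * cinner u w"
    and "L2_inner (expf {0..} (- s) u) (expf {c..<d} s w) = of_real (d - c) * cinner u w"
proof -
  have e: "L2_inner (expf {0..} (- \<sigma>) u) (expf {c..<d} s w) = of_real (LINT t|lebesgue. indicator {c..<d} t * exp ((s - \<sigma>) * t)) * cinner u w" for \<sigma>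
  proof -
    have "L2_inner (expf {0..} (- \<sigma>) u) (expf {c..<d} s w) = (LINT t|lebesgue. of_real (indicator {c..<d} t * exp ((s - \<sigma>) * t)) * cinner u w)"
      unfolding expf_def' L2_inner.abs_eq
    proof (intro Bochner_Integration.integral_cong refl)
      fix t :: real
      have "exp (- \<sigma> * t) * exp (s * t) = exp ((s - \<sigma>) * t)" "exp (s * t) * exp (- \<sigma> * t) = exp ((s - \<sigma>) * t)"
        unfolding exp_add[symmetric] by (simp_all add: algebra_simps)
      then show "cinner (if t \<in> {0..} then exp (- \<sigma> * t) *\<^sub>R u else 0) (if t \<in> {c..<d} then exp (s * t) *\<^sub>R w else 0)
         = complex_of_real (indicator {c..<d} t * exp ((s - \<sigma>) * t)) * cinner u w"
        using assms by (auto simp: indicator_def cinner_scaleR_left cinner_scaleR_right simp flip: of_real_mult mult.assoc)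
    qed
    then show ?thesis by (simp only: integral_mult_left_zero integral_complex_of_real)
  qed
  show "s \<noteq> \<sigma> \<Longrightarrow> L2_inner (expf {0..} (- \<sigma>) u) (expf {c..<d} s w) = of_real ((exp ((s - \<sigma>) * d) - exp ((s - \<sigma>) * c)) / (s - \<sigma>)) * cinner u w"
    unfolding e using integral_exp_interval(1)[OF assms(2), of "s - \<sigma>"] by simp
  have "(LINT t|lebesgue. indicator {c..<d} t * exp ((s - s) * t)) = d - c"
    using assms by (simp add: measure_completion)
  then show "L2_inner (expf {0..} (- s) u) (expf {c..<d} s w) = of_real (d - c) * cinner u w" unfolding e by simp
qed

lemma dense_closed_induct:
  assumes dense: "\<And>x e. x \<in> X \<Longrightarrow> 0 < e \<Longrightarrow> \<exists>g\<in>G. n (x - g) < e"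
    and X: "csubspace X" "norm_on X n" "G \<subseteq> X"
    and lim: "\<And>f x. (\<And>k::nat. f k \<in> G) \<Longrightarrow> x \<in> X \<Longrightarrow> (\<lambda>k. n (f k - x)) \<longlonglongrightarrow> 0 \<Longrightarrow> P x"
    and x: "x \<in> X"
  shows "P x"
proof -
  have "\<exists>g\<in>G. n (x - g) < 1 / real (Suc k)" for k using dense[OF x] by simp
  then obtain h where h: "\<And>k. h k \<in> G" "\<And>k. n (x - h k) < 1 / real (Suc k)" by metis
  have "n (h k - x) = n (x - h k)" "0 \<le> n (h k - x)" for k
    using h(1)[of k] X x by (auto intro: norm_on_commute norm_onD(1) simp: csubspaceD subset_eq)
  then have "(\<lambda>k. n (h k - x)) \<longlonglongrightarrow> 0"
    by (intro Lim_null_comparison[OF _ LIMSEQ_inverse_real_of_nat])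
       (use h(2) in \<open>auto intro!: always_eventually less_imp_le simp: inverse_eq_divide\<close>)
  then show ?thesis by (rule lim[OF h(1) x])
qed

lemma L2_inner_lim2:
  fixes f g :: "nat \<Rightarrow> 'a::chilbert_space aefun"
  assumes f: "\<And>k. f k \<in> L2 0" "x \<in> L2 0" "(\<lambda>k. L2_norm 0 (f k - x)) \<longlonglongrightarrow> 0"
    and g: "\<And>k. g k \<in> L2 0" "y \<in> L2 0" "(\<lambda>k. L2_norm 0 (g k - y)) \<longlonglongrightarrow> 0"
  shows "(\<lambda>k. L2_inner (f k) (g k)) \<longlonglongrightarrow> L2_inner x y"
proof -
  have "(\<lambda>k. L2_norm 0 (f k - x) * L2_norm 0 (g k - y) + L2_norm 0 (f k - x) * L2_norm 0 y + L2_norm 0 x * L2_norm 0 (g k - y)) \<longlonglongrightarrow> 0 * 0 + 0 * L2_norm 0 y + L2_norm 0 x * 0"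
    by (intro tendsto_intros f g)
  then have "(\<lambda>k. L2_inner (f k) (g k) - L2_inner x y) \<longlonglongrightarrow> 0"
  proof (rule Lim_null_comparison[rotated, OF tendsto_eq_rhs], simp, intro always_eventually allI)
    fix k
    have d: "f k - x \<in> L2 0" "g k - y \<in> L2 0" using f g by (auto intro: L2_diff)
    have "L2_inner (f k) (g k) - L2_inner x y = L2_inner (f k - x) (g k - y) + L2_inner (f k - x) y + L2_inner x (g k - y)"
      using f g by (simp add: L2_inner_diff_left L2_inner_diff_right L2_diff)
    then show "norm (L2_inner (f k) (g k) - L2_inner x y) \<le> L2_norm 0 (f k - x) * L2_norm 0 (g k - y) + L2_norm 0 (f k - x) * L2_norm 0 y + L2_norm 0 x * L2_norm 0 (g k - y)"
      using L2_inner_bound[OF d] L2_inner_bound[OF d(1) g(2)] L2_inner_bound[OF f(2) d(2)]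
      by (auto intro: order_trans[OF norm_triangle_ineq] order_trans[OF add_right_mono[OF norm_triangle_ineq]] add_mono)
  qed
  then show ?thesis by (simp add: LIM_zero_iff)
qed

lemma (in bounded_symmetric) MJ_lower:
  assumes c: "\<And>u. c * (norm u)\<^sup>2 \<le> Re (cinner u (J u))" and w: "w \<in> L2 0"
  shows "c * (L2_norm 0 w)\<^sup>2 \<le> Re (L2_inner w (MJ w))"
proof (cases w)
  case (1 f)
  have i1: "integrable lebesgue (\<lambda>t. cinner (f t) (f t))" using w 1 by (intro L2_inner_integrable) auto
  have i2: "integrable lebesgue (\<lambda>t. cinner (f t) (J (f t)))"
    using w MJ_L2(1)[OF w] 1 by (intro L2_inner_integrable) (auto simp: map_aefun.abs_eq)
  have "c * (L2_norm 0 w)\<^sup>2 = c * Re (L2_inner w w)" by (simp add: L2_inner_self[OF w] del: of_real_power)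
  also have "\<dots> = (LINT t|lebesgue. c * Re (cinner (f t) (f t)))"
    by (simp add: 1 L2_inner.abs_eq integral_Re[OF i1])
  also have "\<dots> \<le> (LINT t|lebesgue. Re (cinner (f t) (J (f t))))"
    using i1 i2 c by (intro integral_mono integrable_mult_right integrable_Re) (auto simp: cinner_self simp del: of_real_power)
  also have "\<dots> = Re (L2_inner w (MJ w))"
    by (simp add: 1 L2_inner.abs_eq map_aefun.abs_eq integral_Re[OF i2])
  finally show ?thesis .
qed

lemma cinner_form: "coercive_form (UNIV :: 'a::chilbert_space set) norm cinner 1 1"
proof
  show "ncomplete (UNIV :: 'a set) norm" unfolding ncomplete_def
  proof (intro allI impI, elim conjE)
    fix f :: "nat \<Rightarrow> 'a" assume "\<forall>e>0. \<exists>N. \<forall>i\<ge>N. \<forall>j\<ge>N. norm (f i - f j) < e"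
    then have "Cauchy f" by (auto simp: Cauchy_def dist_norm)
    then obtain x where "f \<longlonglongrightarrow> x" using Cauchy_convergent convergent_def by blast
    then show "\<exists>x\<in>UNIV. (\<lambda>k. norm (f k - x)) \<longlonglongrightarrow> 0" by (auto simp: tendsto_norm_zero_iff LIM_zero_iff)
  qed
qed (auto simp: csubspace_UNIV norm_on_UNIV cinner_add_right cinner_scaleC_right cinner_self norm_cinner_le intro: cinner_commute)

lemma cinner_eqI: "(\<And>u. cinner u x = cinner u y) \<Longrightarrow> x = y"
proof -
  assume "\<And>u. cinner u x = cinner u y"
  then have "cinner (x - y) (x - y) = 0" by (simp add: cinner_diff_right)
  then show "x = y" by (simp add: cinner_self)
qed

subsection \<open>The Laplace transform of an input\<close>

text \<open>Pairing with \<open>kern \<sigma> u\<close> evaluates the Laplace transform at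
  \<open>\<sigma>\<close> in the direction \<open>u\<close>.\<close>

definition kern :: "real \<Rightarrow> 'a::real_vector \<Rightarrow> 'a aefun" where
  "kern \<sigma> u = expf {0..} (- \<sigma>) u"

lemma kern_L2: "0 < \<sigma> \<Longrightarrow> kern \<sigma> u \<in> L2_plus 0"
  and kern_norm: "0 < \<sigma> \<Longrightarrow> L2_norm 0 (kern \<sigma> u) = norm u / sqrt (2 * \<sigma>)"
  using expf_atLeast_L2[of "- \<sigma>" 0 0 u] by (auto simp: kern_def L2_plus_def cut_expf)

lemma kern_L2': "0 < \<sigma> \<Longrightarrow> kern \<sigma> u \<in> L2 0"
  using kern_L2 L2_plus_L2 by blast

lemma kern_add: "kern \<sigma> (u + v) = kern \<sigma> u + kern \<sigma> v" and kern_scale: "kern \<sigma> (a *\<^sub>C u) = a *\<^sub>C kern \<sigma> (u::'a::chilbert_space)"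
  by (simp_all add: kern_def expf_add expf_scaleC)

lemma kern_inner_plus: "L2_inner (kern \<sigma> u) (pi_plus f) = L2_inner (kern \<sigma> u) f"
proof -
  have "pi_plus (kern \<sigma> u) = kern \<sigma> u" by (simp add: kern_def cut_expf)
  then show ?thesis using L2_inner_cut[of "{0..}" "kern \<sigma> u" f] by simp
qed

text \<open>The kernel is an eigenvector of the truncated left shifts. Its representative
  \<open>fe u\<close> in \<open>V\<close> inherits this property for the adjoint shifts
  \<open>T a\<close>.\<close>

lemma kern_shift: "0 \<le> t \<Longrightarrow> pi_plus (shift t (kern \<sigma> u)) = of_real (exp (- \<sigma> * t)) *\<^sub>C kern \<sigma> (u::'a::chilbert_space)"
proof -
  assume t: "0 \<le> t"
  have "{0..} \<inter> {s. t + s \<in> {0..}} = {0..}" using t by auto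
  then show ?thesis by (simp add: kern_def shift_expf cut_scaleC cut_expf)
qed

lemma kern_inner_shift:
  assumes t: "0 \<le> t" and f: "pi_plus f = f"
  shows "L2_inner (kern \<sigma> u) (shift (- t) f) = of_real (exp (- \<sigma> * t)) * L2_inner (kern \<sigma> u) f"
proof -
  have "L2_inner (kern \<sigma> u) (shift (- t) f) = L2_inner (shift t (kern \<sigma> u)) (pi_plus f)"
    using L2_inner_shift_left[of t "kern \<sigma> u" f] f by simp
  also have "\<dots> = L2_inner (pi_plus (shift t (kern \<sigma> u))) f" by (simp add: L2_inner_cut)
  finally show ?thesis by (simp add: kern_shift[OF t] L2_inner_scaleC_left)
qed

definition lap :: "real \<Rightarrow> 'a::chilbert_space aefun \<Rightarrow> 'a" where
  "lap \<sigma> v = (SOME a. \<forall>u. cinner u a = L2_inner (kern \<sigma> u) v)"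

lemma cinner_lap:
  assumes s: "0 < \<sigma>" and v: "v \<in> L2 0"
  shows "cinner u (lap \<sigma> v) = L2_inner (kern \<sigma> u) v"
proof -
  interpret U: coercive_form "UNIV :: 'a set" norm cinner 1 1 by (rule cinner_form)
  obtain a where a: "\<And>u. cinner a u = L2_inner v (kern \<sigma> u)"
  proof (rule U.riesz[of "\<lambda>u. L2_inner v (kern \<sigma> u)" "L2_norm 0 v / sqrt (2 * \<sigma>)"])
    show "cmod (L2_inner v (kern \<sigma> x)) \<le> L2_norm 0 v / sqrt (2 * \<sigma>) * norm x" for x
      using L2_inner_bound[OF v kern_L2'[OF s, of x]] by (simp add: kern_norm[OF s])
  qed (use v s in \<open>auto simp: kern_add kern_scale kern_L2' L2_inner_add_right L2_inner_scaleC_right\<close>)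
  have "\<exists>a. \<forall>u. cinner u a = L2_inner (kern \<sigma> u) v"
  proof (intro exI allI)
    show "cinner u a = L2_inner (kern \<sigma> u) v" for u
      using a[of u] cinner_commute[of u a] L2_inner_commute[of "kern \<sigma> u" v] by simp
  qed
  from someI_ex[OF this] show ?thesis unfolding lap_def by blast
qed

lemma lap_add: "0 < \<sigma> \<Longrightarrow> v \<in> L2 0 \<Longrightarrow> w \<in> L2 0 \<Longrightarrow> lap \<sigma> (v + w) = lap \<sigma> v + lap \<sigma> w"
  by (rule cinner_eqI) (simp add: cinner_lap cinner_add_right L2_add L2_inner_add_right kern_L2')

lemma lap_scale: "0 < \<sigma> \<Longrightarrow> v \<in> L2 0 \<Longrightarrow> lap \<sigma> (a *\<^sub>C v) = a *\<^sub>C lap \<sigma> v"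
  by (rule cinner_eqI) (simp add: cinner_lap cinner_scaleC_right L2_scaleC L2_inner_scaleC_right kern_L2')

lemma norm_lap: assumes "0 < \<sigma>" "v \<in> L2 0" shows "norm (lap \<sigma> v) \<le> L2_norm 0 v / sqrt (2 * \<sigma>)"
proof (cases "lap \<sigma> v = 0")
  case False
  have "(norm (lap \<sigma> v))\<^sup>2 = cmod (cinner (lap \<sigma> v) (lap \<sigma> v))" by (simp add: cinner_self norm_power)
  also have "\<dots> \<le> norm (lap \<sigma> v) / sqrt (2 * \<sigma>) * L2_norm 0 v"
    unfolding cinner_lap[OF assms] using L2_inner_bound[OF kern_L2'[OF assms(1)] assms(2), of "lap \<sigma> v"] by (simp add: kern_norm assms)
  finally have "norm (lap \<sigma> v) * norm (lap \<sigma> v) \<le> norm (lap \<sigma> v) * (L2_norm 0 v / sqrt (2 * \<sigma>))"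
    by (simp add: power2_eq_square)
  then show ?thesis by (rule mult_left_le_imp_le) (use False in simp)
qed (use assms in simp)

lemma kern_inner_wmul: "L2_inner (kern (\<sigma> - \<gamma>) u) (wmul (- \<gamma>) f) = L2_inner (kern \<sigma> u) (f :: 'a::chilbert_space aefun)"
proof (cases f)
  case (1 g)
  show ?thesis
    unfolding 1 wmul.abs_eq kern_def L2_inner_expf
  proof (intro Bochner_Integration.integral_cong refl)
    fix t :: real
    have "exp (- (\<sigma> - \<gamma>) * t) * exp (- \<gamma> * t) = exp (- \<sigma> * t)" unfolding exp_add[symmetric] by (simp add: algebra_simps)
    then show "indicator {0..} t *\<^sub>R exp (- (\<sigma> - \<gamma>) * t) *\<^sub>R cinner u (exp (- \<gamma> * t) *\<^sub>R g t) = indicator {0..} t *\<^sub>R exp (- \<sigma> * t) *\<^sub>R cinner u (g t)"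
      by (simp add: cinner_scaleR_right scaleR_conv_of_real mult.assoc[symmetric] flip: of_real_mult)
  qed
qed

context optimal_control_problem
begin

text \<open>The bounds for \<open>Ko\<close> and \<open>Co\<close>, \<open>B\<close> and
  \<open>D\<close> are chosen once, so that later constants such as \<open>\<delta>0\<close> and
  \<open>CN\<close> can be defined from them.\<close>

definition "MK = (SOME M. 0 < M \<and> (\<forall>x. L2_norm 0 (Ko x) \<le> M * norm x) \<and> (\<forall>x. L2_norm 0 (Co x) \<le> M * norm x))"

lemma MK: "0 < MK" "L2_norm 0 (Ko x) \<le> MK * norm x" "L2_norm 0 (Co x) \<le> MK * norm x"
proof -
  have "\<exists>M. 0 < M \<and> (\<forall>x. L2_norm 0 (Ko x) \<le> M * norm x) \<and> (\<forall>x. L2_norm 0 (Co x) \<le> M * norm x)"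
    by (rule Ko_bounded) blast
  from someI_ex[OF this] show "0 < MK" "L2_norm 0 (Ko x) \<le> MK * norm x" "L2_norm 0 (Co x) \<le> MK * norm x"
    unfolding MK_def by auto
qed

definition "KB = (SOME M. 0 < M \<and> (\<forall>u\<in>L2 \<gamma>. norm (B u) \<le> M * L2_norm \<gamma> u))"

lemma KB: "0 < KB" "u \<in> L2 \<gamma> \<Longrightarrow> norm (B u) \<le> KB * L2_norm \<gamma> u"
proof -
  have "\<exists>M. 0 < M \<and> (\<forall>u\<in>L2 \<gamma>. norm (B u) \<le> M * L2_norm \<gamma> u)"
    by (rule BL_bound[OF WC(3) norm_on_L2]) blast
  from someI_ex[OF this] show "0 < KB" "u \<in> L2 \<gamma> \<Longrightarrow> norm (B u) \<le> KB * L2_norm \<gamma> u"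
    unfolding KB_def by auto
qed

definition "KD = (SOME M. 0 < M \<and> (\<forall>u\<in>L2 \<gamma>. L2_norm \<gamma> (D u) \<le> M * L2_norm \<gamma> u))"

lemma KD: "0 < KD" "u \<in> L2 \<gamma> \<Longrightarrow> L2_norm \<gamma> (D u) \<le> KD * L2_norm \<gamma> u"
proof -
  have "\<exists>M. 0 < M \<and> (\<forall>u\<in>L2 \<gamma>. L2_norm \<gamma> (D u) \<le> M * L2_norm \<gamma> u)"
    by (rule BL_bound[OF TIC_D(1)[OF WC(7)] norm_on_L2]) blast
  from someI_ex[OF this] show "0 < KD" "u \<in> L2 \<gamma> \<Longrightarrow> L2_norm \<gamma> (D u) \<le> KD * L2_norm \<gamma> u"
    unfolding KD_def by auto
qed

subsection \<open>The adjoint of the right shift\<close>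

text \<open>The deviation of the remaining control from the optimal control for the state reached at
  time \<open>a\<close>. In particular \<open>T a v = 0\<close> says that \<open>v\<close> is
  optimal after time \<open>a\<close>.\<close>

definition T :: "real \<Rightarrow> 'u aefun \<Rightarrow> 'u aefun" where
  "T a v = pi_plus (shift a v) - Ko (B (shift a v))"

lemma V_plus: "v \<in> V \<Longrightarrow> v \<in> L2_plus 0" using V_iff by blast

lemma V_L2: "v \<in> V \<Longrightarrow> v \<in> L2 0" using V_plus L2_plus_L2 by blast

lemma A_0: "0 \<le> t \<Longrightarrow> A t 0 = 0" using A_diff[of t 0 0] by simp

lemma T_V: "0 \<le> a \<Longrightarrow> v \<in> V \<Longrightarrow> T a v \<in> V"
proof -
  assume a: "0 \<le> a" and v: "v \<in> V"
  have "adm (B (shift a v)) (pi_plus (shift a v))"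
    using adm_shift_iff[OF a V_plus[OF v], of 0] v by (simp add: A_0[OF a])
  from adm_diff[OF this Ko_adm[of "B (shift a v)"]] show "T a v \<in> V" by (simp add: T_def)
qed

lemma V_B: "v \<in> V \<Longrightarrow> B v = 0"
  using wpls_B_plus[OF sysC V_g L2_plus_fix[OF V_plus]] .

lemma T_0: "v \<in> V \<Longrightarrow> T 0 v = v"
  using V_B[of v] L2_plus_fix[OF V_plus[of v]] by (simp add: T_def Ko_0)

text \<open>The semigroup law is \<open>Ko_shift\<close>: subtracting the optimal control at
  \<open>c\<close> and then advancing it by \<open>a\<close> subtracts the optimal control for the
  state that it reaches, and these terms recombine by linearity of \<open>Ko\<close>.\<close>

lemma T_T:
  assumes a: "0 \<le> a" and c: "0 \<le> c" and v: "v \<in> V"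
  shows "T a (T c v) = T (a + c) v"
proof -
  let ?f = "shift c v" let ?x = "B ?f"
  have f: "?f \<in> L2 \<gamma>" using V_g[OF v] by (rule L2_shift)
  have m: "pi_minus ?f \<in> L2 \<gamma>" "pi_plus ?f \<in> L2 \<gamma>" using f by (auto intro: L2_cut)
  have K: "Ko ?x \<in> L2 \<gamma>" by (rule Ko_L2)
  have "{0..} \<inter> {s. a + s \<in> {0..}} = {0..}" using a by auto
  then have e1: "pi_plus (shift a (pi_plus ?f)) = pi_plus (shift (a + c) v)" by (simp add: shift_cut)
  have e2: "A a ?x + B (shift a (pi_plus ?f)) = B (shift (a + c) v)"
  proof -
    have "A a ?x + B (shift a (pi_plus ?f)) = B (shift a (pi_minus ?f) + shift a (pi_plus ?f))"
      using WC(4)[OF a f] m by (simp add: B_add L2_shift)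
    then show ?thesis by (simp add: shift_add[symmetric] pi_split)
  qed
  have e3: "B (shift a (T c v)) = B (shift a (pi_plus ?f)) - B (shift a (Ko ?x))"
    using m K by (simp add: T_def shift_diff B_diff L2_shift)
  have "pi_plus (shift a (T c v)) = pi_plus (shift (a + c) v) - Ko (A a ?x + B (shift a (Ko ?x)))"
    unfolding Ko_shift[OF a, symmetric] by (simp add: T_def shift_diff cut_diff e1)
  then show ?thesis
    unfolding T_def[of a] T_def[of "a + c"] e3 e2[symmetric] by (simp add: Ko_diff Ko_add algebra_simps)
qed

lemma D_plus: "v \<in> V \<Longrightarrow> pi_plus (D v) = D v"
  using TIC_plus[OF WC(7) V_g L2_plus_fix[OF V_plus]] .

lemma opt_Co: "\<eta> \<in> V \<Longrightarrow> L2_inner (D \<eta>) (MJ (Co x)) = 0"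
  using opt_Ko[of x] by (simp add: opt_def Co_def)

lemma output_T:
  assumes a: "0 \<le> a" and v: "v \<in> V"
  shows "pi_plus (shift a (D v)) = Co (B (shift a v)) + D (T a v)"
proof -
  have s: "pi_plus (shift a v) \<in> L2 \<gamma>" using V_g[OF v] by (intro L2_cut L2_shift) auto
  show ?thesis
    using wpls_output_shift[OF sysC a V_g[OF v], of 0] s Ko_L2(4)
    by (simp add: C_0 A_0[OF a] Co_def T_def D_diff)
qed

text \<open>After the shift is moved to the right factor, its output splits into that of
  \<open>T a v\<close> and an optimal output; the latter is annihilated by every
  \<open>D \<eta>\<close>.\<close>

lemma b_adj:
  assumes a: "0 \<le> a" and \<eta>: "\<eta> \<in> V" and v: "v \<in> V"
  shows "b (shift (- a) \<eta>) v = b \<eta> (T a v)"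
proof -
  have "b (shift (- a) \<eta>) v = L2_inner (shift (- a) (D \<eta>)) (MJ (D v))"
    by (simp add: b_def D_shift[OF V_g[OF \<eta>]])
  also have "\<dots> = L2_inner (pi_plus (D \<eta>)) (shift a (MJ (D v)))"
    using L2_inner_shift_left[of "- a"] D_plus[OF \<eta>] by simp
  also have "\<dots> = L2_inner (D \<eta>) (MJ (Co (B (shift a v)) + D (T a v)))"
    by (simp add: L2_inner_cut MJ_shift[symmetric] MJ_cut[symmetric] output_T[OF a v])
  also have "\<dots> = b \<eta> (T a v)"
    using V_D[OF \<eta>] V_D[OF T_V[OF a v]] opt_Co[OF \<eta>]
    by (simp add: MJ_add L2_inner_add_right MJ_L2 Ko_L2 b_def)
  finally show ?thesis .
qed

subsection \<open>Elements of \<open>V\<close> orthogonal to all eigenvectors of the adjoint shift vanish\<close>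

text \<open>For \<open>\<sigma> = 2 * \<gamma>\<close> this is the orthogonal complement, with respect to \<open>b\<close>, of the range of \<open>M\<close>
  constructed below; \<open>Vp_step\<close> moves \<open>\<sigma>\<close> by a fixed step, so that the Laplace transform of an element
  vanishes on an arithmetic progression.\<close>

definition Vp :: "real \<Rightarrow> 'u aefun set" where
  "Vp \<sigma> = {v \<in> V. \<forall>a\<ge>0. \<forall>u. L2_inner (kern \<sigma> u) (T a v) = 0}"

text \<open>The step size that turns the fixed-point relation in \<open>Vp_lap\<close> into a
  contraction with factor at most one half.\<close>

definition "\<delta>0 = \<gamma> / (MK * KB)"

lemma d0: "0 < \<delta>0" using gpos MK(1) KB(1) by (simp add: \<delta>0_def)

text \<open>The relation \<open>L2_inner (kern \<sigma> u) (T a v) = 0\<close> is Laplace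
  transformed in \<open>a\<close> at \<open>s = \<sigma> + \<delta>0\<close>. The shift term becomes
  the difference quotient of the transform of \<open>v\<close> between \<open>\<sigma>\<close> and
  \<open>s\<close>. In the feedback term the transform of the past of \<open>shift a v\<close> is
  the exponential \<open>E (lap s v)\<close>. The transform of \<open>v\<close> at
  \<open>\<sigma>\<close> vanishes by the case \<open>a = 0\<close>, so \<open>lap s v\<close> is
  \<open>- \<delta>0\<close> times a bounded operator applied to itself.\<close>

lemma Vp_lap:
  assumes s: "2 * \<gamma> \<le> \<sigma>" and v: "v \<in> Vp \<sigma>"
  shows "lap (\<sigma> + \<delta>0) v = 0"
proof -
  define s where "s = \<sigma> + \<delta>0"
  have sp: "0 < \<sigma>" "\<gamma> < \<sigma>" "0 < s" "\<gamma> < s" "s - \<sigma> = \<delta>0" "s \<noteq> \<sigma>" using assms gpos d0 by (auto simp: s_def)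
  have vV: "v \<in> V" and vT: "\<And>a u. 0 \<le> a \<Longrightarrow> L2_inner (kern \<sigma> u) (T a v) = 0" using v by (auto simp: Vp_def)
  define E where "E w = expf {..<0} s w" for w :: 'u
  have Eg: "E w \<in> L2 \<gamma>" "L2_norm \<gamma> (E w) = norm w / sqrt (2 * (s - \<gamma>))" for w
    using expf_lessThan_L2[OF sp(4), of 0 w] by (auto simp: E_def)
  have Elin: "E (w + w') = E w + E w'" "E (a *\<^sub>C w) = a *\<^sub>C E w" for w w' a by (simp_all add: E_def expf_add expf_scaleC)
  define l where "l u x = L2_inner (kern \<sigma> u) (Ko x)" for u x
  have l_add: "l u (x + y) = l u x + l u y" and l_scale: "l u (a *\<^sub>C x) = a * l u x" for u x y a
    using sp by (simp_all add: l_def Ko_add Ko_scale L2_inner_add_right L2_inner_scaleC_right kern_L2' L2_plus_L2 Ko_L2)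
  have l_bd: "cmod (l u x) \<le> norm u / sqrt (2 * \<sigma>) * (MK * norm x)" for u x
  proof -
    have "cmod (l u x) \<le> norm u / sqrt (2 * \<sigma>) * L2_norm 0 (Ko x)"
      unfolding l_def using L2_inner_bound[OF kern_L2'[OF sp(1)] L2_plus_L2[OF Ko_L2(1)], of u x] by (simp add: kern_norm sp)
    also have "\<dots> \<le> norm u / sqrt (2 * \<sigma>) * (MK * norm x)" using sp by (intro mult_left_mono MK) auto
    finally show ?thesis .
  qed
  have main: "L2_inner (kern s u) v = - of_real \<delta>0 * l u (B (E (lap s v)))" for u
  proof -
    \<comment> \<open>The weight is moved from \<open>f\<close> to the kernel, which extends the
      pairing to \<open>L2 \<gamma>\<close> because \<open>\<gamma> < \<sigma>\<close>. On
      \<open>shift a v\<close> the functional is the pairing of the kernel with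
      \<open>T a v\<close>.\<close>
    define F where "F f = L2_inner (kern (\<sigma> - \<gamma>) u) (wmul (- \<gamma>) f) - l u (B f)" for f
    define G where "G f = of_real (1 / \<delta>0) * (L2_inner (kern \<sigma> u) f - L2_inner (kern s u) f) - l u (B (E (lap s f)))" for f
    have wg: "wmul (- \<gamma>) f \<in> L2 0" "L2_norm 0 (wmul (- \<gamma>) f) = L2_norm \<gamma> f" if "f \<in> L2 \<gamma>" for f :: "'u aefun"
      using that by (simp_all add: L2_wmul_iff L2_norm_wmul)
    have kg: "kern (\<sigma> - \<gamma>) u \<in> L2 0" using sp by (intro kern_L2') simp
    define KF where "KF = L2_norm 0 (kern (\<sigma> - \<gamma>) u) + norm u / sqrt (2 * \<sigma>) * (MK * KB) + 1"
    define KG where "KG = 1 / \<delta>0 * (L2_norm 0 (kern \<sigma> u) + L2_norm 0 (kern s u)) + norm u / sqrt (2 * \<sigma>) * (MK * (KB * (1 / sqrt (2 * s) / sqrt (2 * (s - \<gamma>))))) + 1"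
    have pos: "0 \<le> norm u / sqrt (2 * \<sigma>) * (MK * KB)" "0 \<le> 1 / \<delta>0 * (L2_norm 0 (kern \<sigma> u) + L2_norm 0 (kern s u))"
      "0 \<le> norm u / sqrt (2 * \<sigma>) * (MK * (KB * (1 / sqrt (2 * s) / sqrt (2 * (s - \<gamma>)))))"
      using MK(1) KB(1) sp d0 by auto
    have "G v = 0"
    proof (rule laplace_of_shifts[where F = F and \<gamma> = \<gamma> and s = s and KF = KF and KG = KG])
      show "0 < \<gamma>" by (rule gpos)
      show "\<gamma> < s" by (rule sp)
      show "0 < KF" using pos L2_norm_nonneg[of 0 "kern (\<sigma> - \<gamma>) u"] unfolding KF_def by linarith
      show "0 < KG" using pos unfolding KG_def by linarith
      show "F (f + h) = F f + F h" if "f \<in> L2 \<gamma>" "h \<in> L2 \<gamma>" for f h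
        using that wg kg by (simp add: F_def wmul_add L2_inner_add_right B_add l_add)
      show "F (a *\<^sub>C f) = a * F f" if "f \<in> L2 \<gamma>" for f a
        using that by (simp add: F_def wmul_scaleC L2_inner_scaleC_right B_scale l_scale right_diff_distrib)
      show "cmod (F f) \<le> KF * L2_norm \<gamma> f" if f: "f \<in> L2 \<gamma>" for f
      proof -
        have "cmod (F f) \<le> L2_norm 0 (kern (\<sigma> - \<gamma>) u) * L2_norm \<gamma> f + norm u / sqrt (2 * \<sigma>) * (MK * norm (B f))"
          unfolding F_def using L2_inner_bound[OF kg wg(1)[OF f]] l_bd[of u "B f"] wg(2)[OF f]
          by (intro order_trans[OF norm_triangle_ineq4] add_mono) auto
        also have "\<dots> \<le> L2_norm 0 (kern (\<sigma> - \<gamma>) u) * L2_norm \<gamma> f + norm u / sqrt (2 * \<sigma>) * (MK * (KB * L2_norm \<gamma> f))"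
          using sp MK(1) KB(2)[OF f] by (intro add_left_mono mult_left_mono) auto
        also have "\<dots> = (KF - 1) * L2_norm \<gamma> f" by (simp add: KF_def algebra_simps)
        also have "\<dots> \<le> KF * L2_norm \<gamma> f" by (intro mult_right_mono) auto
        finally show ?thesis .
      qed
      show "G (f + h) = G f + G h" if "f \<in> L2_plus 0" "h \<in> L2_plus 0" for f h
        using that[THEN L2_plus_L2] sp
        by (simp add: G_def L2_inner_add_right kern_L2' lap_add Elin Eg B_add l_add algebra_simps)
      show "G (a *\<^sub>C f) = a * G f" if "f \<in> L2_plus 0" for f a
        using that[THEN L2_plus_L2] sp
        by (simp add: G_def L2_inner_scaleC_right lap_scale Elin Eg B_scale l_scale algebra_simps)
      show "cmod (G f) \<le> KG * L2_norm 0 f" if "f \<in> L2_plus 0" for f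
      proof -
        have f: "f \<in> L2 0" using that by (rule L2_plus_L2)
        have "norm (B (E (lap s f))) \<le> KB * (norm (lap s f) / sqrt (2 * (s - \<gamma>)))" using KB(2)[OF Eg(1)] Eg(2) by metis
        also have "\<dots> \<le> KB * (L2_norm 0 f / sqrt (2 * s) / sqrt (2 * (s - \<gamma>)))"
          using KB(1) sp by (intro mult_left_mono divide_right_mono norm_lap f) auto
        finally have 1: "norm (B (E (lap s f))) \<le> KB * (L2_norm 0 f / sqrt (2 * s) / sqrt (2 * (s - \<gamma>)))" .
        have "cmod (L2_inner (kern \<sigma> u) f - L2_inner (kern s u) f) \<le> L2_norm 0 (kern \<sigma> u) * L2_norm 0 f + L2_norm 0 (kern s u) * L2_norm 0 f"
          using sp by (intro order_trans[OF norm_triangle_ineq4] add_mono L2_inner_bound kern_L2' f)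
        then have 2: "cmod (of_real (1 / \<delta>0) * (L2_inner (kern \<sigma> u) f - L2_inner (kern s u) f)) \<le> 1 / \<delta>0 * (L2_norm 0 (kern \<sigma> u) * L2_norm 0 f + L2_norm 0 (kern s u) * L2_norm 0 f)"
          unfolding norm_mult using d0 by (intro mult_mono) (auto simp: norm_divide)
        have 3: "cmod (l u (B (E (lap s f)))) \<le> norm u / sqrt (2 * \<sigma>) * (MK * (KB * (L2_norm 0 f / sqrt (2 * s) / sqrt (2 * (s - \<gamma>)))))"
          using l_bd[of u "B (E (lap s f))"] sp MK(1) 1 by (elim order_trans) (intro mult_left_mono, auto)
        have "cmod (G f) \<le> 1 / \<delta>0 * (L2_norm 0 (kern \<sigma> u) * L2_norm 0 f + L2_norm 0 (kern s u) * L2_norm 0 f) + norm u / sqrt (2 * \<sigma>) * (MK * (KB * (L2_norm 0 f / sqrt (2 * s) / sqrt (2 * (s - \<gamma>)))))"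
          unfolding G_def using 2 3 by (intro order_trans[OF norm_triangle_ineq4] add_mono)
        also have "\<dots> = (KG - 1) * L2_norm 0 f" by (simp add: KG_def algebra_simps)
        also have "\<dots> \<le> KG * L2_norm 0 f" by (intro mult_right_mono) auto
        finally show ?thesis .
      qed
      show "v \<in> L2_plus 0" using vV by (rule V_plus)
      show "F (shift a v) = 0" if a: "0 \<le> a" for a
      proof -
        have p: "pi_plus (shift a v) \<in> L2 0" using V_L2[OF vV] by (intro L2_cut L2_shift) auto
        have "F (shift a v) = L2_inner (kern \<sigma> u) (pi_plus (shift a v)) - L2_inner (kern \<sigma> u) (Ko (B (shift a v)))"
          by (simp add: F_def l_def kern_inner_wmul kern_inner_plus)
        also have "\<dots> = L2_inner (kern \<sigma> u) (T a v)"
          using p sp by (simp add: T_def L2_inner_diff_right kern_L2' L2_plus_L2 Ko_L2)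
        finally show ?thesis using vT[OF a] by simp
      qed
      fix c d :: real and w assume cd: "0 \<le> c" "c < d"
      \<comment> \<open>Positive \<open>r\<close> is enough, since the integral below runs over
        \<open>c < r\<close> with \<open>0 \<le> c\<close>. The state \<open>B\<close> sees only the
        part before zero, which is the same for all such \<open>r\<close>.\<close>
      have vals: "F (expf {..<r} s w) = of_real ((exp (\<delta>0 * r) - 1) / \<delta>0) * cinner u w - l u (B (E w))" if r: "0 < r" for r
      proof -
        have "{0..} \<inter> {..<r} = {0..<r}" "{..<0} \<inter> {..<r} = {..<0}" using r by auto
        then have e: "pi_plus (expf {..<r} s w) = expf {0..<r} s w" "pi_minus (expf {..<r} s w) = E w" by (simp_all add: cut_expf E_def)
        have "B (expf {..<r} s w) = B (E w)"
          using wpls_B_pi_minus[OF sysC expf_lessThan_L2(1)[OF sp(4), of r w]] e by simp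
        moreover have "L2_inner (kern \<sigma> u) (expf {..<r} s w) = of_real ((exp (\<delta>0 * r) - 1) / \<delta>0) * cinner u w"
          using kern_inner_plus[of \<sigma> u "expf {..<r} s w"] L2_inner_expf_interval(1)[of 0 r s \<sigma> u w] r sp by (simp add: e kern_def)
        ultimately show ?thesis by (simp add: F_def kern_inner_wmul)
      qed
      have "(LINT r|lborel. indicator {c<..d} r *\<^sub>R F (expf {..<r} s w))
         = (LINT r|lborel. of_real (indicator {c<..d} r * exp (\<delta>0 * r)) * (cinner u w / of_real \<delta>0)
              - of_real (indicator {c<..d} r) * (cinner u w / of_real \<delta>0 + l u (B (E w))))"
      proof (intro Bochner_Integration.integral_cong refl)
        fix r :: real
        show "indicator {c<..d} r *\<^sub>R F (expf {..<r} s w) = of_real (indicator {c<..d} r * exp (\<delta>0 * r)) * (cinner u w / of_real \<delta>0)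
              - of_real (indicator {c<..d} r) * (cinner u w / of_real \<delta>0 + l u (B (E w)))"
          using vals[of r] cd d0 by (cases "r \<in> {c<..d}") (simp_all add: diff_divide_distrib left_diff_distrib)
      qed
      also have "\<dots> = (LINT r|lborel. of_real (indicator {c<..d} r * exp (\<delta>0 * r)) * (cinner u w / of_real \<delta>0))
          - (LINT r|lborel. of_real (indicator {c<..d} r) * (cinner u w / of_real \<delta>0 + l u (B (E w))))"
      proof (rule Bochner_Integration.integral_diff)
        have i1: "integrable lborel (\<lambda>r. complex_of_real (indicator {c<..d} r * exp (\<delta>0 * r)))"
          using integral_exp_interval(3)[of c d \<delta>0] cd d0 by (intro integrable_of_real) auto
        show "integrable lborel (\<lambda>r. of_real (indicator {c<..d} r * exp (\<delta>0 * r)) * (cinner u w / of_real \<delta>0))"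
          by (rule integrable_mult_left) (rule i1)
        have i2: "integrable lborel (\<lambda>r. complex_of_real (indicator {c<..d} r))"
          using cd by (intro integrable_of_real) (simp add: integrable_indicator_iff)
        show "integrable lborel (\<lambda>r. of_real (indicator {c<..d} r) * (cinner u w / of_real \<delta>0 + l u (B (E w))))"
          by (rule integrable_mult_left) (rule i2)
      qed
      also have "\<dots> = of_real ((exp (\<delta>0 * d) - exp (\<delta>0 * c)) / \<delta>0) * (cinner u w / of_real \<delta>0) - of_real (d - c) * (cinner u w / of_real \<delta>0 + l u (B (E w)))"
      proof -
        have "(LINT r|lborel. indicator {c<..d} r) = d - c" using cd by simp
        then show ?thesis
          unfolding integral_mult_left_zero integral_complex_of_real using integral_exp_interval(2)[of c d \<delta>0] cd d0 by simp
      qed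
      also have "\<dots> = G (expf {c..<d} s w)"
      proof -
        have lp: "lap s (expf {c..<d} s w) = of_real (d - c) *\<^sub>C w"
          by (rule cinner_eqI) (use cd sp in \<open>simp add: cinner_lap expf_interval_L2 kern_def L2_inner_expf_interval(2) cinner_scaleC_right\<close>)
        have le: "l u (B (E (lap s (expf {c..<d} s w)))) = of_real (d - c) * l u (B (E w))"
          unfolding lp Elin(2) B_scale[OF Eg(1)] l_scale ..
        have k1: "L2_inner (kern \<sigma> u) (expf {c..<d} s w) = of_real ((exp (\<delta>0 * d) - exp (\<delta>0 * c)) / \<delta>0) * cinner u w"
          using L2_inner_expf_interval(1)[of c d s \<sigma> u w] cd sp by (simp add: kern_def)
        have k2: "L2_inner (kern s u) (expf {c..<d} s w) = of_real (d - c) * cinner u w"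
          using L2_inner_expf_interval(2)[of c d s u w] cd by (simp add: kern_def)
        show ?thesis unfolding G_def le k1 k2 using d0 by (simp add: field_simps)
      qed
      finally show "(LINT r|lborel. indicator {c<..d} r *\<^sub>R F (expf {..<r} s w)) = G (expf {c..<d} s w)" .
    qed
    moreover have "L2_inner (kern \<sigma> u) v = 0" using vT[of 0 u] T_0[OF vV] by simp
    ultimately show ?thesis using d0 by (simp add: G_def field_simps minus_equation_iff eq_neg_iff_add_eq_0 add_eq_0_iff)
  qed
  let ?h = "lap s v"
  have "(norm ?h)\<^sup>2 = cmod (cinner ?h ?h)" by (simp add: cinner_self norm_power)
  also have "cinner ?h ?h = - of_real \<delta>0 * l ?h (B (E ?h))"
    unfolding cinner_lap[OF sp(3) V_L2[OF vV]] by (rule main)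
  also have "cmod (- of_real \<delta>0 * l ?h (B (E ?h))) = \<delta>0 * cmod (l ?h (B (E ?h)))" using d0 by (simp add: norm_mult)
  also have "\<dots> \<le> \<delta>0 * (norm ?h / sqrt (2 * \<sigma>) * (MK * (KB * (norm ?h / sqrt (2 * (s - \<gamma>))))))"
  proof -
    have "norm (B (E ?h)) \<le> KB * (norm ?h / sqrt (2 * (s - \<gamma>)))" using KB(2)[OF Eg(1)] Eg(2) by metis
    then have "norm ?h / sqrt (2 * \<sigma>) * (MK * norm (B (E ?h))) \<le> norm ?h / sqrt (2 * \<sigma>) * (MK * (KB * (norm ?h / sqrt (2 * (s - \<gamma>)))))"
      using MK(1) sp by (intro mult_left_mono) auto
    then show ?thesis using l_bd[of ?h "B (E ?h)"] d0 by (intro mult_left_mono) auto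
  qed
  also have "\<dots> = (norm ?h)\<^sup>2 * (\<gamma> / (sqrt (2 * \<sigma>) * sqrt (2 * (s - \<gamma>))))"
    using MK(1) KB(1) by (simp add: \<delta>0_def power2_eq_square)
  also have "\<dots> \<le> (norm ?h)\<^sup>2 * (1 / 2)"
  proof (rule mult_left_mono)
    \<comment> \<open>Each factor on the right is at least \<open>2 * \<gamma>\<close>: both
      \<open>\<sigma>\<close> and \<open>s\<close> are at least \<open>2 * \<gamma>\<close>. Here
      the lower bound on \<open>\<sigma>\<close> is used.\<close>
    have "(2 * \<gamma>)\<^sup>2 \<le> (2 * \<sigma>) * (2 * (s - \<gamma>))"
      using assms gpos d0 unfolding power2_eq_square s_def by (intro mult_mono) auto
    then have "2 * \<gamma> \<le> sqrt ((2 * \<sigma>) * (2 * (s - \<gamma>)))" by (rule real_le_rsqrt)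
    then show "\<gamma> / (sqrt (2 * \<sigma>) * sqrt (2 * (s - \<gamma>))) \<le> 1 / 2"
      using sp by (simp add: real_sqrt_mult[symmetric] divide_le_eq)
  qed simp
  finally have "(norm ?h)\<^sup>2 \<le> 0" by simp
  then show ?thesis by (simp add: s_def)
qed

text \<open>By the semigroup law \<open>Vp \<sigma>\<close> is invariant under every
  \<open>T a\<close>, so \<open>Vp_lap\<close> applies to \<open>T a v\<close> in place of
  \<open>v\<close>.\<close>

lemma Vp_step: assumes "2 * \<gamma> \<le> \<sigma>" "v \<in> Vp \<sigma>" shows "v \<in> Vp (\<sigma> + \<delta>0)"
proof -
  have v: "v \<in> V" using assms by (simp add: Vp_def)
  have "T a v \<in> Vp \<sigma>" if a: "0 \<le> a" for a
    using assms(2) T_V[OF a v] T_T[OF _ a v] a by (auto simp: Vp_def)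
  then have "lap (\<sigma> + \<delta>0) (T a v) = 0" if "0 \<le> a" for a using Vp_lap assms(1) that by blast
  moreover have "0 < \<sigma> + \<delta>0" using assms(1) gpos d0 by linarith
  ultimately have "L2_inner (kern (\<sigma> + \<delta>0) u) (T a v) = 0" if "0 \<le> a" for a u
    using cinner_lap[of "\<sigma> + \<delta>0" "T a v" u] V_L2[OF T_V[OF that v]] that by simp
  then show ?thesis using v by (simp add: Vp_def)
qed

lemma Vp_trivial: assumes "v \<in> Vp (2 * \<gamma>)" shows "v = 0"
proof -
  have v: "v \<in> V" using assms by (simp add: Vp_def)
  have n: "v \<in> Vp (2 * \<gamma> + real n * \<delta>0)" for n
  proof (induction n)
    case 0 then show ?case using assms by simp
  next
    case (Suc n)
    have "2 * \<gamma> \<le> 2 * \<gamma> + real n * \<delta>0" using d0 by simp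
    from Vp_step[OF this Suc] show ?case by (simp add: algebra_simps)
  qed
  show ?thesis
  proof (rule lerch[OF V_plus[OF v] _ d0])
    show "0 < 2 * \<gamma>" using gpos by simp
    fix n u
    have "L2_inner (kern (2 * \<gamma> + real n * \<delta>0) u) (T 0 v) = 0" using n[of n] by (simp add: Vp_def)
    then show "L2_inner (expf {0..} (- (2 * \<gamma> + real n * \<delta>0)) u) v = 0" using T_0[OF v] by (simp add: kern_def)
  qed
qed

end

section \<open>Right shifts and bounded intervals on the half-line\<close>

lemma L2_plus_right_shift: "u \<in> L2_plus \<omega> \<Longrightarrow> 0 \<le> t \<Longrightarrow> shift (- t) u \<in> L2_plus \<omega>"
proof -
  assume u: "u \<in> L2_plus \<omega>" and t: "0 \<le> t"
  have "{0..} \<inter> {t..} = {t..}" using t by auto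
  then have "pi_plus (shift (- t) (pi_plus u)) = shift (- t) (pi_plus u)" by (simp add: shift_cut atLeast_def[symmetric])
  then show "shift (- t) u \<in> L2_plus \<omega>" using u by (simp add: L2_plus_def L2_shift)
qed

lemma right_shift_support: "pi_plus u = u \<Longrightarrow> cut {t..} (shift (- t) u) = shift (- t) u"
proof -
  assume "pi_plus u = u"
  then have "shift (- t) u = shift (- t) (pi_plus u)" by simp
  also have "\<dots> = cut {t..} (shift (- t) u)" by (simp add: shift_cut atLeast_def[symmetric])
  finally show ?thesis by simp
qed

lemma cut_right_shift_zero:
  fixes u :: "'a::ab_group_add aefun"
  shows "pi_plus u = u \<Longrightarrow> cut {..<t} (shift (- t) u) = 0"
proof -
  assume "pi_plus u = u"
  then have "cut {..<t} (shift (- t) u) = cut {..<t} (cut {t..} (shift (- t) u))" by (simp add: right_shift_support del: cut_cut)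
  also have "\<dots> = cut ({..<t} \<inter> {t..}) (shift (- t) u)" by simp
  also have "{..<t} \<inter> {t..} = ({} :: real set)" by auto
  finally show ?thesis by simp
qed

lemma L2_norm_0_interval:
  assumes f: "f \<in> L2 \<gamma>" and g: "0 \<le> \<gamma>" and t: "0 \<le> t"
  shows "cut {0..<t} f \<in> L2 0" "L2_norm 0 (cut {0..<t} f) \<le> exp (\<gamma> * t) * L2_norm \<gamma> f"
proof -
  have "exp (- 0 * r) \<le> exp (\<gamma> * t) * exp (- \<gamma> * r)" if "r \<in> {0..<t}" for r
  proof -
    have "\<gamma> * r \<le> \<gamma> * t" using that g by (intro mult_left_mono) auto
    then show ?thesis by (simp add: exp_add[symmetric])
  qed
  then have *: "cut {0..<t} f \<in> L2 0" "L2_norm 0 (cut {0..<t} f) \<le> exp (\<gamma> * t) * L2_norm \<gamma> (cut {0..<t} f)"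
    using L2_weight_mono[of "{0..<t}" "cut {0..<t} f" 0 "exp (\<gamma> * t)" \<gamma>] f by (auto simp: L2_cut)
  then show "cut {0..<t} f \<in> L2 0" by simp
  have "exp (\<gamma> * t) * L2_norm \<gamma> (cut {0..<t} f) \<le> exp (\<gamma> * t) * L2_norm \<gamma> f"
    by (intro mult_left_mono L2_norm_cut_le f) auto
  then show "L2_norm 0 (cut {0..<t} f) \<le> exp (\<gamma> * t) * L2_norm \<gamma> f" using * by linarith
qed

lemma cut_interval_split:
  fixes f :: "'a::ab_group_add aefun"
  assumes "pi_plus f = f" "0 \<le> t"
  shows "f = cut {0..<t} f + shift (- t) (pi_plus (shift t f))"
proof -
  have "{0..<t} \<inter> {t..} = {}" "{0..<t} \<union> {t..} = {0..}" using assms by auto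
  then have "cut {0..<t} f + cut {t..} f = f" using cut_split[of "{0..<t}" "{t..}" f] assms by simp
  then show ?thesis by (simp add: shift_cut atLeast_def[symmetric])
qed

context optimal_control_problem
begin

subsection \<open>Optimal continuation\<close>

definition ext :: "real \<Rightarrow> 'u aefun \<Rightarrow> 'u aefun" where
  "ext t w = w + shift (- t) (Ko (B (shift t w)))"

text \<open>The last claim is the point of the construction: before \<open>t\<close> the output is
  bounded through \<open>D\<close>, after \<open>t\<close> through the state and the boundedness of
  \<open>Co\<close>. The norm of the whole output is thus controlled by \<open>w\<close>
  alone.\<close>

lemma ext_props:
  assumes t: "0 \<le> t" and w: "w \<in> L2_plus 0" "cut {0..<t} w = w"
  shows "ext t w \<in> V" "T t (ext t w) = 0" "cut {..<t} (ext t w) = w"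
    "L2_norm 0 (D (ext t w)) \<le> (KD + MK * KB) * exp (\<gamma> * t) * L2_norm \<gamma> w"
proof -
  let ?x = "B (shift t w)"
  have wg: "w \<in> L2 \<gamma>" using w by (simp add: L2_0_g)
  have K: "Ko ?x \<in> L2_plus 0" "pi_plus (Ko ?x) = Ko ?x" "Ko ?x \<in> L2 \<gamma>" using Ko_L2(1) L2_plus_fix[OF Ko_L2(1)] L2_0_g[OF Ko_L2(1)] by auto
  have sK: "shift (- t) (Ko ?x) \<in> L2_plus 0" using L2_plus_right_shift[OF K(1) t] .
  have e: "ext t w \<in> L2_plus 0" using w sK by (simp add: ext_def csubspaceD[OF csubspace_L2_plus])
  have eg: "ext t w \<in> L2 \<gamma>" by (rule L2_0_g[OF e])
  have cw: "cut {..<t} w = w"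
    by (rule cut_fix_subset[OF w(2)]) auto
  show c: "cut {..<t} (ext t w) = w"
    by (simp add: ext_def cut_add cw cut_right_shift_zero[OF K(2)])
  have "pi_plus (shift t w) = 0"
  proof -
    have "pi_plus (shift t (cut {0..<t} w)) = cut ({0..} \<inter> {s. t + s \<in> {0..<t}}) (shift t w)" by (simp add: shift_cut)
    also have "{0..} \<inter> {s. t + s \<in> {0..<t}} = {}" by auto
    finally show ?thesis using w(2) by simp
  qed
  then have p: "pi_plus (shift t (ext t w)) = Ko ?x"
    by (simp add: ext_def shift_add cut_add K)
  have "B (shift t (ext t w)) = ?x + B (Ko ?x)"
    using wg K by (simp add: ext_def shift_add B_add L2_shift)
  then have Be: "B (shift t (ext t w)) = ?x" using wpls_B_plus[OF sysC K(3,2)] by simp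
  show eV: "ext t w \<in> V"
    using adm_shift_iff[OF t e, of 0] Ko_adm[of ?x] by (simp add: A_0[OF t] Be p)
  show T0: "T t (ext t w) = 0" by (simp add: T_def Be p)
  have d: "D (ext t w) = cut {0..<t} (D w) + shift (- t) (Co ?x)"
  proof -
    have "cut {0..<t} (D (ext t w)) = cut {0..<t} (D w)"
      using TIC_causal_interval[OF WC(7) eg, of 0 t] by (simp add: c)
    moreover have "pi_plus (shift t (D (ext t w))) = Co ?x"
      using output_T[OF t eV] by (simp add: T0 Be D_0)
    ultimately show ?thesis using cut_interval_split[OF D_plus[OF eV] t] by simp
  qed
  have n1: "cut {0..<t} (D w) \<in> L2 0" "L2_norm 0 (cut {0..<t} (D w)) \<le> exp (\<gamma> * t) * (KD * L2_norm \<gamma> w)"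
  proof -
    have Dw: "D w \<in> L2 \<gamma>" using TIC_D(4)[OF WC(7) wg] .
    show "cut {0..<t} (D w) \<in> L2 0" using L2_norm_0_interval(1)[OF Dw _ t] gpos by simp
    have "exp (\<gamma> * t) * L2_norm \<gamma> (D w) \<le> exp (\<gamma> * t) * (KD * L2_norm \<gamma> w)" by (intro mult_left_mono KD wg) auto
    then show "L2_norm 0 (cut {0..<t} (D w)) \<le> exp (\<gamma> * t) * (KD * L2_norm \<gamma> w)"
      using L2_norm_0_interval(2)[OF Dw _ t] gpos by linarith
  qed
  have "norm ?x \<le> KB * (exp (\<gamma> * t) * L2_norm \<gamma> w)"
    using KB(2)[of "shift t w"] wg by (simp add: L2_shift L2_norm_shift)
  then have n2: "L2_norm 0 (Co ?x) \<le> MK * (KB * (exp (\<gamma> * t) * L2_norm \<gamma> w))"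
    by (rule order_trans[OF MK(3) mult_left_mono]) (use MK(1) in simp)
  have "L2_norm 0 (D (ext t w)) \<le> L2_norm 0 (cut {0..<t} (D w)) + L2_norm 0 (shift (- t) (Co ?x))"
    unfolding d by (intro L2_norm_triangle n1 L2_shift Ko_L2)
  also have "L2_norm 0 (shift (- t) (Co ?x)) = L2_norm 0 (Co ?x)" using Ko_L2(2) by (simp add: L2_norm_shift)
  finally show "L2_norm 0 (D (ext t w)) \<le> (KD + MK * KB) * exp (\<gamma> * t) * L2_norm \<gamma> w"
    using n1 n2 by (simp add: algebra_simps)
qed

subsection \<open>Eigenvectors of the adjoint shift\<close>

definition "\<sigma>0 = 2 * \<gamma>"

lemma s0: "0 < \<sigma>0" using gpos by (simp add: \<sigma>0_def)

definition fe :: "'u \<Rightarrow> 'u aefun" where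
  "fe u = (SOME f. f \<in> V \<and> (\<forall>v\<in>V. b f v = L2_inner (kern \<sigma>0 u) v))"

lemma fe: "fe u \<in> V" "v \<in> V \<Longrightarrow> b (fe u) v = L2_inner (kern \<sigma>0 u) v"
proof -
  have k: "kern \<sigma>0 u \<in> L2 0" using s0 by (rule kern_L2')
  obtain f where "f \<in> V" "\<And>v. v \<in> V \<Longrightarrow> b f v = L2_inner (kern \<sigma>0 u) v"
  proof (rule b.riesz[of "L2_inner (kern \<sigma>0 u)" "L2_norm 0 (kern \<sigma>0 u)"])
    show "L2_inner (kern \<sigma>0 u) (v + w) = L2_inner (kern \<sigma>0 u) v + L2_inner (kern \<sigma>0 u) w" if "v \<in> V" "w \<in> V" for v w
      using that[THEN V_L2] k by (rule L2_inner_add_right)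
    show "cmod (L2_inner (kern \<sigma>0 u) v) \<le> L2_norm 0 (kern \<sigma>0 u) * nV v" if "v \<in> V" for v
      using L2_inner_bound[OF k V_L2[OF that]] mult_left_mono[OF nV_ge(1)[of v] L2_norm_nonneg[of 0 "kern \<sigma>0 u"]] by linarith
  qed (auto simp: L2_inner_scaleC_right)
  then have "\<exists>f. f \<in> V \<and> (\<forall>v\<in>V. b f v = L2_inner (kern \<sigma>0 u) v)" by blast
  from someI_ex[OF this] show "fe u \<in> V" "v \<in> V \<Longrightarrow> b (fe u) v = L2_inner (kern \<sigma>0 u) v"
    unfolding fe_def by auto
qed

lemma fe_eqI: "f \<in> V \<Longrightarrow> (\<And>v. v \<in> V \<Longrightarrow> b f v = L2_inner (kern \<sigma>0 u) v) \<Longrightarrow> fe u = f"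
proof -
  assume f: "f \<in> V" "\<And>v. v \<in> V \<Longrightarrow> b f v = L2_inner (kern \<sigma>0 u) v"
  have d: "fe u + (-1) *\<^sub>C f \<in> V" using fe(1) f(1) by (intro b.subD)
  have "b (fe u + (-1) *\<^sub>C f) v = 0" if "v \<in> V" for v
    using b.add_left[OF fe(1) b.subD(3)[OF f(1)] that, of u "-1"] b.scale_left[OF f(1) that, of "-1"] fe(2)[OF that, of u] f(2)[OF that] by simp
  then have "fe u + (-1) *\<^sub>C f = 0" using b.form_zero[OF d] by blast
  then show "fe u = f" by (simp add: scaleC_minus1)
qed

lemma fe_add: "fe (u + v) = fe u + fe v"
proof (rule fe_eqI)
  show "fe u + fe v \<in> V" using fe(1) by (intro b.subD)
  fix w assume w: "w \<in> V"
  show "b (fe u + fe v) w = L2_inner (kern \<sigma>0 (u + v)) w"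
    using b.add_left[OF fe(1) fe(1) w] fe(2)[OF w] V_L2[OF w] s0 by (simp add: kern_add L2_inner_add_left kern_L2')
qed

lemma fe_scale: "fe (a *\<^sub>C u) = a *\<^sub>C fe u"
proof (rule fe_eqI)
  show "a *\<^sub>C fe u \<in> V" using fe(1) by (intro b.subD)
  fix w assume w: "w \<in> V"
  show "b (a *\<^sub>C fe u) w = L2_inner (kern \<sigma>0 (a *\<^sub>C u)) w"
    using b.scale_left[OF fe(1) w] fe(2)[OF w] by (simp add: kern_scale L2_inner_scaleC_left)
qed

lemma nV_nonneg: "0 \<le> nV u"
  using nV_ge(1)[of u] L2_norm_nonneg[of 0 u] by linarith

lemma nV_fe: "nV (fe u) \<le> norm u / sqrt (2 * \<sigma>0) / \<epsilon>"
proof -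
  have "\<epsilon> * (nV (fe u))\<^sup>2 \<le> Re (b (fe u) (fe u))" by (rule b.coercive[OF fe(1)])
  also have "\<dots> \<le> cmod (L2_inner (kern \<sigma>0 u) (fe u))" unfolding fe(2)[OF fe(1)] by (rule complex_Re_le_cmod)
  also have "\<dots> \<le> norm u / sqrt (2 * \<sigma>0) * L2_norm 0 (fe u)"
    using L2_inner_bound[OF kern_L2'[OF s0] V_L2[OF fe(1)], of u u] by (simp add: kern_norm s0)
  also have "\<dots> \<le> norm u / sqrt (2 * \<sigma>0) * nV (fe u)" using s0 by (intro mult_left_mono nV_ge) auto
  finally have *: "nV (fe u) * (\<epsilon> * nV (fe u)) \<le> nV (fe u) * (norm u / sqrt (2 * \<sigma>0))" by (simp add: power2_eq_square mult_ac)
  show ?thesis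
  proof (cases "nV (fe u) = 0")
    case True then show ?thesis using eps s0 by simp
  next
    case False
    then have "0 < nV (fe u)" using nV_nonneg[of "fe u"] by simp
    from mult_left_le_imp_le[OF * this] show ?thesis unfolding pos_le_divide_eq[OF eps] by (simp add: mult.commute)
  qed
qed

text \<open>By the representing property of \<open>fe\<close>, the transform of \<open>fe u\<close>
  at \<open>\<sigma>0\<close> is the Gram operator of the eigenvectors, as
  \<open>cinner_Gamma\<close> records.\<close>

definition \<Gamma> :: "'u \<Rightarrow> 'u" where "\<Gamma> u = lap \<sigma>0 (fe u)"

lemma cinner_Gamma: "cinner u (\<Gamma> v) = b (fe u) (fe v)"
  using cinner_lap[OF s0 V_L2[OF fe(1)]] fe(2)[OF fe(1)] by (simp add: \<Gamma>_def)

lemma Gamma_BL: "\<Gamma> \<in> BL UNIV norm UNIV norm"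
proof (rule BL_I[where M = "1 / sqrt (2 * \<sigma>0) / \<epsilon> / sqrt (2 * \<sigma>0)"])
  fix u v a
  show "\<Gamma> (u + v) = \<Gamma> u + \<Gamma> v" "\<Gamma> (a *\<^sub>C u) = a *\<^sub>C \<Gamma> u"
    using s0 V_L2[OF fe(1)] by (simp_all add: \<Gamma>_def fe_add fe_scale lap_add lap_scale)
  have "norm (\<Gamma> u) \<le> L2_norm 0 (fe u) / sqrt (2 * \<sigma>0)" unfolding \<Gamma>_def by (rule norm_lap[OF s0 V_L2[OF fe(1)]])
  also have "\<dots> \<le> norm u / sqrt (2 * \<sigma>0) / \<epsilon> / sqrt (2 * \<sigma>0)"
    using s0 order_trans[OF nV_ge(1) nV_fe] by (intro divide_right_mono) auto
  finally show "norm (\<Gamma> u) \<le> 1 / sqrt (2 * \<sigma>0) / \<epsilon> / sqrt (2 * \<sigma>0) * norm u" by simp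
qed simp

sublocale G: bounded_symmetric \<Gamma>
proof
  show "\<Gamma> \<in> BL UNIV norm UNIV norm" by (rule Gamma_BL)
  show "cinner (\<Gamma> x) y = cinner x (\<Gamma> y)" for x y
    using cinner_Gamma[of y x] cinner_Gamma[of x y] b.herm[OF fe(1) fe(1), of x y] cinner_commute[of "\<Gamma> x" y] by simp
qed

text \<open>The lower bound tests \<open>fe u\<close> against \<open>u\<close> times an exponential on the unit interval, continued
  optimally from a late time on.\<close>

lemma Gamma_lower: obtains c where "0 < c" "\<And>u. c * (norm u)\<^sup>2 \<le> Re (cinner u (\<Gamma> u))"
proof -
  \<comment> \<open>The optimal tail contributes at most \<open>exp (- \<gamma> * t) * C1\<close>
    times the square of \<open>norm u\<close>: the kernel decays like
    \<open>exp (- \<sigma>0 * t)\<close> while the state grows like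
    \<open>exp (\<gamma> * t)\<close>. The time \<open>t\<close> makes this at most one
    half.\<close>
  define C1 where "C1 = 1 / sqrt (2 * \<sigma>0) * (MK * (KB * exp (2 * \<gamma>)))"
  have C1: "0 < C1" using s0 MK(1) KB(1) by (simp add: C1_def)
  obtain t where t: "1 \<le> t" "exp (- \<gamma> * t) * C1 \<le> 1 / 2"
  proof -
    have "((\<lambda>t. exp (- \<gamma> * t) * C1) \<longlongrightarrow> 0 * C1) at_top"
    proof (intro tendsto_intros filterlim_compose[OF exp_at_bot])
      show "filterlim (\<lambda>t. - \<gamma> * t) at_bot at_top"
        using gpos by (simp add: filterlim_uminus_at_bot filterlim_tendsto_pos_mult_at_top[OF tendsto_const _ filterlim_ident])
    qed
    then have "\<forall>\<^sub>F t in at_top. exp (- \<gamma> * t) * C1 < 1 / 2" by (intro order_tendstoD(2)) auto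
    moreover have "\<forall>\<^sub>F t in at_top. (1::real) \<le> t" by (rule eventually_ge_at_top)
    ultimately have "\<forall>\<^sub>F t in at_top. 1 \<le> t \<and> exp (- \<gamma> * t) * C1 < 1 / 2" by eventually_elim simp
    then obtain t where "1 \<le> t \<and> exp (- \<gamma> * t) * C1 < 1 / 2"
      using eventually_happens'[OF trivial_limit_at_top_linorder] by blast
    then show ?thesis by (intro that[of t]) auto
  qed
  have t0: "0 \<le> t" using t by simp
  define C2 where "C2 = CJ * ((KD + MK * KB) * exp (\<gamma> * t) * exp (2 * \<gamma>))"
  have C2: "0 < C2" using CJ(1) KD(1) MK(1) KB(1) by (simp add: C2_def add_pos_pos)
  have main: "(norm u)\<^sup>2 / 2 \<le> nV (fe u) * (C2 * norm u)" for u
  proof -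
    \<comment> \<open>With the exponent \<open>3 * \<gamma>\<close>, the product with the kernel is
      \<open>exp (\<gamma> * r)\<close> on the unit interval, whose integral
      \<open>(exp \<gamma> - 1) / \<gamma>\<close> is at least one.\<close>
    define e where "e = expf {0..<1} (3 * \<gamma>) u"
    have e0: "e \<in> L2_plus 0" "cut {0..<t} e = e"
    proof -
      have "{0..} \<inter> {0..<1} = {0..<1::real}" "{0..<t} \<inter> {0..<1} = {0..<1}" using t by auto
      then show "e \<in> L2_plus 0" "cut {0..<t} e = e"
        by (simp_all add: e_def L2_plus_def cut_expf expf_interval_L2)
    qed
    have eg: "e \<in> L2 \<gamma>" by (rule L2_0_g[OF e0(1)])
    have en: "L2_norm \<gamma> e \<le> norm u * exp (2 * \<gamma>)"
      using expf_interval_norm[of 0 1 \<gamma> "3 * \<gamma>" u] gpos by (simp add: e_def)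
    note X = ext_props[OF t0 e0]
    let ?x = "B (shift t e)"
    have xn: "norm ?x \<le> KB * (exp (\<gamma> * t) * (norm u * exp (2 * \<gamma>)))"
    proof -
      have "norm ?x \<le> KB * (exp (\<gamma> * t) * L2_norm \<gamma> e)"
        using KB(2)[of "shift t e"] eg by (simp add: L2_shift L2_norm_shift)
      also have "\<dots> \<le> KB * (exp (\<gamma> * t) * (norm u * exp (2 * \<gamma>)))"
        using KB(1) en by (intro mult_left_mono) auto
      finally show ?thesis .
    qed
    have ke: "L2_inner (kern \<sigma>0 u) e = of_real ((exp \<gamma> - 1) / \<gamma> * (norm u)\<^sup>2)"
    proof -
      have d: "3 * \<gamma> - \<sigma>0 = \<gamma>" "3 * \<gamma> \<noteq> \<sigma>0" using gpos by (simp_all add: \<sigma>0_def)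
      have "L2_inner (kern \<sigma>0 u) e = of_real ((exp ((3 * \<gamma> - \<sigma>0) * 1) - exp ((3 * \<gamma> - \<sigma>0) * 0)) / (3 * \<gamma> - \<sigma>0)) * cinner u u"
        unfolding e_def kern_def by (rule L2_inner_expf_interval(1)) (use d in auto)
      then show ?thesis unfolding d cinner_self by simp
    qed
    have "(norm u)\<^sup>2 \<le> (exp \<gamma> - 1) / \<gamma> * (norm u)\<^sup>2"
    proof -
      have "1 \<le> (exp \<gamma> - 1) / \<gamma>" unfolding pos_le_divide_eq[OF gpos] using exp_ge_add_one_self[of \<gamma>] by linarith
      then show ?thesis using mult_right_mono[of 1 "(exp \<gamma> - 1) / \<gamma>" "(norm u)\<^sup>2"] by simp
    qed
    moreover have "cmod (L2_inner (kern \<sigma>0 u) (shift (- t) (Ko ?x))) \<le> (norm u)\<^sup>2 / 2"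
    proof -
      have "cmod (L2_inner (kern \<sigma>0 u) (shift (- t) (Ko ?x))) = exp (- \<sigma>0 * t) * cmod (L2_inner (kern \<sigma>0 u) (Ko ?x))"
        using kern_inner_shift[OF t0 L2_plus_fix[OF Ko_L2(1)], of \<sigma>0 u ?x] by (simp add: norm_mult)
      also have "\<dots> \<le> exp (- \<sigma>0 * t) * (norm u / sqrt (2 * \<sigma>0) * (MK * (KB * (exp (\<gamma> * t) * (norm u * exp (2 * \<gamma>))))))"
      proof (rule mult_left_mono)
        have "cmod (L2_inner (kern \<sigma>0 u) (Ko ?x)) \<le> norm u / sqrt (2 * \<sigma>0) * L2_norm 0 (Ko ?x)"
          using L2_inner_bound[OF kern_L2'[OF s0] L2_plus_L2[OF Ko_L2(1)], of u ?x] by (simp add: kern_norm s0)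
        also have "\<dots> \<le> norm u / sqrt (2 * \<sigma>0) * (MK * norm ?x)" using s0 by (intro mult_left_mono MK) auto
        also have "\<dots> \<le> norm u / sqrt (2 * \<sigma>0) * (MK * (KB * (exp (\<gamma> * t) * (norm u * exp (2 * \<gamma>)))))"
          using s0 MK(1) xn by (intro mult_left_mono) auto
        finally show "cmod (L2_inner (kern \<sigma>0 u) (Ko ?x)) \<le> norm u / sqrt (2 * \<sigma>0) * (MK * (KB * (exp (\<gamma> * t) * (norm u * exp (2 * \<gamma>)))))" .
      qed simp
      also have "\<dots> = (norm u)\<^sup>2 * ((exp (- \<sigma>0 * t) * exp (\<gamma> * t)) * C1)"
        by (simp add: C1_def power2_eq_square)
      also have "exp (- \<sigma>0 * t) * exp (\<gamma> * t) = exp (- \<gamma> * t)"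
        unfolding exp_add[symmetric] by (simp add: \<sigma>0_def algebra_simps)
      also have "(norm u)\<^sup>2 * (exp (- \<gamma> * t) * C1) \<le> (norm u)\<^sup>2 * (1 / 2)" using t(2) by (intro mult_left_mono) auto
      finally show ?thesis by simp
    qed
    moreover have "cmod (L2_inner (kern \<sigma>0 u) (ext t e)) = cmod (L2_inner (kern \<sigma>0 u) e + L2_inner (kern \<sigma>0 u) (shift (- t) (Ko ?x)))"
      unfolding ext_def by (intro arg_cong[where f = cmod] L2_inner_add_right kern_L2' s0 L2_plus_L2 e0 L2_shift Ko_L2)
    moreover have "(exp \<gamma> - 1) / \<gamma> * (norm u)\<^sup>2 \<le> cmod (L2_inner (kern \<sigma>0 u) e)" unfolding ke norm_of_real by (rule abs_ge_self)
    ultimately have "(norm u)\<^sup>2 / 2 \<le> cmod (L2_inner (kern \<sigma>0 u) (ext t e))"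
      using norm_diff_ineq[of "L2_inner (kern \<sigma>0 u) e" "L2_inner (kern \<sigma>0 u) (shift (- t) (Ko ?x))"] by linarith
    also have "\<dots> = cmod (b (fe u) (ext t e))" by (simp add: fe(2)[OF X(1)])
    also have "\<dots> \<le> CJ * L2_norm 0 (D (fe u)) * L2_norm 0 (D (ext t e))" by (rule b_bound[OF fe(1) X(1)])
    also have "\<dots> \<le> CJ * nV (fe u) * ((KD + MK * KB) * exp (\<gamma> * t) * (norm u * exp (2 * \<gamma>)))"
    proof (intro mult_mono)
      have "0 \<le> (KD + MK * KB) * exp (\<gamma> * t)" using KD(1) MK(1) KB(1) by simp
      then show "L2_norm 0 (D (ext t e)) \<le> (KD + MK * KB) * exp (\<gamma> * t) * (norm u * exp (2 * \<gamma>))"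
        using order_trans[OF X(4) mult_left_mono[OF en]] by blast
    qed (use CJ(1) nV_ge nV_nonneg in auto)
    finally show ?thesis by (simp add: C2_def mult_ac)
  qed
  show ?thesis
  proof (rule that)
    \<comment> \<open>Obtained by inserting \<open>norm u \<le> 2 * C2 * nV (fe u)\<close>, a
      consequence of \<open>main\<close>, into the coercivity of \<open>b\<close>.\<close>
    show "0 < \<epsilon> / (2 * C2)\<^sup>2" using eps C2 by simp
    fix u
    have "norm u \<le> 2 * C2 * nV (fe u)"
    proof (cases "u = 0")
      case False
      have "norm u * norm u \<le> norm u * (2 * C2 * nV (fe u))" using main[of u] by (simp add: power2_eq_square mult_ac)
      then show ?thesis by (rule mult_left_le_imp_le) (use False in simp)
    qed (use C2 nV_nonneg in simp)
    then have "(norm u)\<^sup>2 \<le> (2 * C2 * nV (fe u))\<^sup>2" by (intro power_mono) auto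
    then have "\<epsilon> * (norm u)\<^sup>2 \<le> (2 * C2)\<^sup>2 * (\<epsilon> * (nV (fe u))\<^sup>2)"
      using eps by (simp add: power_mult_distrib)
    also have "\<dots> \<le> (2 * C2)\<^sup>2 * Re (b (fe u) (fe u))" by (intro mult_left_mono b.coercive fe) auto
    finally show "\<epsilon> / (2 * C2)\<^sup>2 * (norm u)\<^sup>2 \<le> Re (cinner u (\<Gamma> u))"
      using C2 unfolding cinner_Gamma by (simp add: pos_divide_le_eq mult.commute)
  qed
qed

subsection \<open>The isomorphism from inputs to controls\<close>

text \<open>The linear relation generated by sending \<open>\<chi>\<^bsub>[a,\<infinity>)\<^esub> e\<^bsup>-\<sigma>0 t\<^esup> u\<close> to \<open>e\<^bsup>-\<sigma>0 a\<^esup>\<close> times the right shift of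
  \<open>fe u\<close> by \<open>a\<close>.  By \<open>GM_gram\<close> it is bounded from \<open>L\<^sup>2(\<real>\<^sub>+)\<close> to \<open>V\<close>, hence a function.\<close>

inductive GM :: "real set \<Rightarrow> 'u aefun \<Rightarrow> 'u aefun \<Rightarrow> bool" for I where
  zero: "GM I 0 0"
| step: "GM I w f \<Longrightarrow> a \<in> I \<Longrightarrow>
    GM I (w + expf {a..} (- \<sigma>0) u) (f + of_real (exp (- \<sigma>0 * a)) *\<^sub>C shift (- a) (fe u))"

lemma GM_gen: "a \<in> I \<Longrightarrow> GM I (expf {a..} (- \<sigma>0) u) (of_real (exp (- \<sigma>0 * a)) *\<^sub>C shift (- a) (fe u))"
  using GM.step[OF GM.zero, of a I u] by simp

lemma GM_add: "GM I w' f' \<Longrightarrow> GM I w f \<Longrightarrow> GM I (w + w') (f + f')"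
proof (induction rule: GM.induct)
  case (step w' f' a u)
  from GM.step[OF step.IH[OF step.prems] step.hyps(2), of u] show ?case by (simp add: add.assoc)
qed simp

lemma GM_scale: "GM I w f \<Longrightarrow> GM I (c *\<^sub>C w) (c *\<^sub>C f)"
proof (induction rule: GM.induct)
  case zero then show ?case by (simp add: GM.zero)
next
  case (step w f a u)
  from GM.step[OF step.IH step.hyps(2), of "c *\<^sub>C u"] show ?case
    by (simp add: scaleC_add_right expf_scaleC fe_scale shift_scaleC scaleC_scaleC mult.commute)
qed

lemma GM_diff: "GM I w f \<Longrightarrow> GM I w' f' \<Longrightarrow> GM I (w - w') (f - f')"
  using GM_add[OF GM_scale[of I w' f' "-1"], of w f] by (simp add: scaleC_minus1)

lemma GM_mono: "GM I w f \<Longrightarrow> I \<subseteq> I' \<Longrightarrow> GM I' w f"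
proof (induction rule: GM.induct)
  case (step w f a u)
  then show ?case by (intro GM.step) auto
qed (rule GM.zero)

lemma csubspace_GM: "csubspace {(w, f). GM I w f}"
  by (auto simp: csubspace_def zero_prod_def scaleC_prod_def intro: GM.zero GM_add GM_scale)

lemma GM_interval: "a \<in> I \<Longrightarrow> c \<in> I \<Longrightarrow> a \<le> c \<Longrightarrow> \<exists>f. GM I (expf {a..<c} (- \<sigma>0) u) f"
  using GM_diff[OF GM_gen GM_gen, of a I c u u] by (auto simp: expf_diff_atLeast)

lemma GM_L2: "GM I w f \<Longrightarrow> w \<in> L2 0"
proof (induction rule: GM.induct)
  case (step w f a u)
  have "expf {a..} (- \<sigma>0) u \<in> L2 0" using s0 by (intro expf_atLeast_L2) simp
  then show ?case using step.IH by (rule L2_add[rotated])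
qed simp

lemma GM_plus: "GM {0..} w f \<Longrightarrow> w \<in> L2_plus 0 \<and> f \<in> V"
proof (induction rule: GM.induct)
  case zero then show ?case using b.subD(1) csubspaceD(1)[OF csubspace_L2_plus] by auto
next
  case (step w f a u)
  then have a: "0 \<le> a" by simp
  have "{0..} \<inter> {a..} = {a..}" using a by auto
  then have "expf {a..} (- \<sigma>0) u \<in> L2_plus 0" using s0 by (simp add: L2_plus_def cut_expf expf_atLeast_L2)
  moreover have "of_real (exp (- \<sigma>0 * a)) *\<^sub>C shift (- a) (fe u) \<in> V" by (intro b.subD(3) shift_V a fe)
  ultimately show ?case using step.IH b.subD(2) csubspaceD(2)[OF csubspace_L2_plus] by blast
qed

text \<open>Shifting an exponential by \<open>t\<close> produces a factor
  \<open>exp (\<sigma>0 * t)\<close>. The coefficient \<open>exp (- \<sigma>0 * a)\<close> of the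
  generators compensates it, so the relation commutes with shifts.\<close>

lemma GM_shift: "GM I w f \<Longrightarrow> GM {a. a - t \<in> I} (shift (- t) w) (shift (- t) f)"
proof (induction rule: GM.induct)
  case zero then show ?case by (simp add: GM.zero)
next
  case (step w f a u)
  let ?c = "of_real (exp (\<sigma>0 * t)) :: complex"
  have "GM {a. a - t \<in> I} (shift (- t) w + ?c *\<^sub>C expf {a + t..} (- \<sigma>0) u)
     (shift (- t) f + ?c *\<^sub>C (of_real (exp (- \<sigma>0 * (a + t))) *\<^sub>C shift (- (a + t)) (fe u)))"
    using step by (intro GM_add[OF GM_scale[OF GM_gen] step.IH]) simp
  moreover have "shift (- t) (expf {a..} (- \<sigma>0) u) = ?c *\<^sub>C expf {a + t..} (- \<sigma>0) u"
  proof -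
    have "{s. - t + s \<in> {a..}} = {a + t..}" by auto
    then show ?thesis by (simp add: shift_expf)
  qed
  moreover have "?c *\<^sub>C (of_real (exp (- \<sigma>0 * (a + t))) *\<^sub>C shift (- (a + t)) (fe u)) = shift (- t) (of_real (exp (- \<sigma>0 * a)) *\<^sub>C shift (- a) (fe u))"
  proof -
    have "exp (\<sigma>0 * t) * exp (- \<sigma>0 * (a + t)) = exp (- \<sigma>0 * a)" unfolding exp_add[symmetric] by (simp add: algebra_simps)
    then have "?c * of_real (exp (- \<sigma>0 * (a + t))) = of_real (exp (- \<sigma>0 * a))" unfolding of_real_mult[symmetric] by simp
    then show ?thesis by (simp only: scaleC_scaleC shift_scaleC shift_shift) (simp add: add.commute)
  qed
  ultimately show ?case by (simp add: shift_add)
qed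

text \<open>Only finitely many generators occur in a derivation, so one right shift moves all of
  them to the half-line.\<close>

lemma GM_UNIV_plus: "GM UNIV w f \<Longrightarrow> \<exists>h\<ge>0. GM {0..} (shift (- h) w) (shift (- h) f)"
proof -
  assume *: "GM UNIV w f"
  have "\<exists>h\<ge>0. GM {- h..} w f"
    using * 
  proof (induction rule: GM.induct)
    case zero then show ?case using GM.zero by (intro exI[of _ 0]) auto
  next
    case (step w f a u)
    then obtain h where h: "0 \<le> h" "GM {- h..} w f" by blast
    have "GM {- (max h \<bar>a\<bar>)..} w f" by (rule GM_mono[OF h(2)]) auto
    then have "GM {- (max h \<bar>a\<bar>)..} (w + expf {a..} (- \<sigma>0) u) (f + of_real (exp (- \<sigma>0 * a)) *\<^sub>C shift (- a) (fe u))"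
      by (rule GM.step) auto
    then show ?case using h(1) by (intro exI[of _ "max h \<bar>a\<bar>"]) auto
  qed
  then obtain h where h: "0 \<le> h" "GM {- h..} w f" by blast
  have "{a. a - h \<in> {- h..}} = {0..}" by auto
  then show "\<exists>h\<ge>0. GM {0..} (shift (- h) w) (shift (- h) f)" using GM_shift[OF h(2), of h] h(1) by auto
qed

lemma V_b_shift: "f \<in> V \<Longrightarrow> g \<in> V \<Longrightarrow> 0 \<le> t \<Longrightarrow> b (shift (- t) f) (shift (- t) g) = b f g"
  unfolding b_def by (simp add: D_shift[OF V_g] MJ_shift L2_inner_shift del: mem_Collect_eq)

text \<open>Removing the common shift by \<open>a\<close> leaves the functional represented by
  \<open>fe u\<close>, evaluated at a right shift of \<open>fe v\<close>; the kernel turns that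
  shift into the exponential factor.\<close>

lemma gram_le:
  assumes "0 \<le> a" "a \<le> c"
  shows "b (shift (- a) (fe u)) (shift (- c) (fe v)) = of_real (exp (- \<sigma>0 * (c - a))) * cinner u (\<Gamma> v)"
proof -
  have sv: "shift (- (c - a)) (fe v) \<in> V" using assms by (intro shift_V fe) auto
  have "b (shift (- a) (fe u)) (shift (- a) (shift (- (c - a)) (fe v))) = b (fe u) (shift (- (c - a)) (fe v))"
    by (rule V_b_shift[OF fe(1) sv assms(1)])
  also have "\<dots> = of_real (exp (- \<sigma>0 * (c - a))) * L2_inner (kern \<sigma>0 u) (fe v)"
    unfolding fe(2)[OF sv] by (rule kern_inner_shift) (use assms L2_plus_fix[OF V_plus[OF fe(1)]] in auto)
  finally show ?thesis by (simp add: cinner_Gamma fe(2)[OF fe(1)])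
qed

text \<open>The coefficients complete the decay in the distance of \<open>a\<close> and
  \<open>c\<close> to \<open>exp (- 2 * \<sigma>0 * max a c)\<close>, which is the value of
  \<open>L2_inner_expf_expf\<close> up to the factor \<open>2 * \<sigma>0\<close>.\<close>

lemma gram:
  assumes "0 \<le> a" "0 \<le> c"
  shows "b (of_real (exp (- \<sigma>0 * a)) *\<^sub>C shift (- a) (fe u)) (of_real (exp (- \<sigma>0 * c)) *\<^sub>C shift (- c) (fe v))
    = of_real (2 * \<sigma>0) * L2_inner (expf {a..} (- \<sigma>0) u) (G.MJ (expf {c..} (- \<sigma>0) v))"
proof -
  have m: "G.MJ (expf {c..} (- \<sigma>0) v) = expf {c..} (- \<sigma>0) (\<Gamma> v)"
    unfolding expf_def' map_aefun.abs_eq by (auto simp: G.J_scale G.J_0 scaleR_scaleC intro!: arg_cong[where f = abs_aefun])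
  have V: "shift (- a) (fe u) \<in> V" "shift (- c) (fe v) \<in> V" by (rule shift_V[OF assms(1) fe(1)], rule shift_V[OF assms(2) fe(1)])
  have bb: "b (shift (- a) (fe u)) (shift (- c) (fe v)) = of_real (exp (- \<sigma>0 * \<bar>c - a\<bar>)) * cinner u (\<Gamma> v)"
  proof (cases "a \<le> c")
    case True then show ?thesis using gram_le[OF assms(1) True] by simp
  next
    case False
    then have "b (shift (- a) (fe u)) (shift (- c) (fe v)) = cnj (of_real (exp (- \<sigma>0 * (a - c))) * cinner v (\<Gamma> u))"
      using b.herm[OF V] gram_le[OF assms(2), of a v u] by simp
    also have "cnj (cinner v (\<Gamma> u)) = cinner u (\<Gamma> v)" using G.Jsym[of u v] cinner_commute[of "\<Gamma> u" v] by simp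
    then have "cnj (of_real (exp (- \<sigma>0 * (a - c))) * cinner v (\<Gamma> u)) = of_real (exp (- \<sigma>0 * (a - c))) * cinner u (\<Gamma> v)" by simp
    finally show ?thesis using False by (simp add: abs_if)
  qed
  have ee: "exp (- \<sigma>0 * a) * (exp (- \<sigma>0 * c) * exp (- \<sigma>0 * \<bar>c - a\<bar>)) = exp (- (2 * \<sigma>0) * max a c)"
    unfolding exp_add[symmetric] by (auto simp: abs_if max_def algebra_simps)
  have "b (of_real (exp (- \<sigma>0 * a)) *\<^sub>C shift (- a) (fe u)) (of_real (exp (- \<sigma>0 * c)) *\<^sub>C shift (- c) (fe v))
    = of_real (exp (- \<sigma>0 * a) * (exp (- \<sigma>0 * c) * exp (- \<sigma>0 * \<bar>c - a\<bar>))) * cinner u (\<Gamma> v)"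
    using b.scale_left[OF V(1) b.subD(3)[OF V(2)]] b.scale_right[OF V] by (simp add: bb)
  also have "\<dots> = of_real (2 * \<sigma>0) * L2_inner (expf {a..} (- \<sigma>0) u) (G.MJ (expf {c..} (- \<sigma>0) v))"
    unfolding ee m L2_inner_expf_expf[OF s0] using s0 by simp
  finally show ?thesis .
qed

text \<open>Pulled back along the relation, \<open>b\<close> is the \<open>L2\<close> inner product
  with the constant operator weight \<open>\<Gamma>\<close>. The upper and lower bounds for
  \<open>M\<close> are those of \<open>\<Gamma>\<close>.\<close>

lemma GM_gram:
  assumes "GM {0..} w f" "GM {0..} w' f'"
  shows "b f f' = of_real (2 * \<sigma>0) * L2_inner w (G.MJ w')"
  using assms
proof (induction arbitrary: w' f' rule: GM.induct)
  case zero
  have "b 0 f' = 0" unfolding b_def by (simp add: D_0)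
  then show ?case by simp
next
  case (step w f a u)
  let ?e = "expf {a..} (- \<sigma>0) u" and ?g = "of_real (exp (- \<sigma>0 * a)) *\<^sub>C shift (- a) (fe u)"
  have a: "0 \<le> a" using step.hyps by simp
  note gen = GM_gen[OF step.hyps(2), of u]
  have one: "b ?g f' = of_real (2 * \<sigma>0) * L2_inner ?e (G.MJ w')"
    using step.prems
  proof (induction rule: GM.induct)
    case zero
    have "b ?g 0 = 0" unfolding b_def by (simp add: D_0 MJ_0)
    then show ?case by (simp add: G.MJ_0)
  next
    case (step w' f' c v)
    have m: "G.MJ w' \<in> L2 0" "G.MJ (expf {c..} (- \<sigma>0) v) \<in> L2 0" "?e \<in> L2 0"
      using GM_L2[OF step.hyps(1)] s0 by (auto intro!: G.MJ_L2(1) expf_atLeast_L2)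
    have V: "?g \<in> V" "f' \<in> V" "of_real (exp (- \<sigma>0 * c)) *\<^sub>C shift (- c) (fe v) \<in> V"
      using GM_plus[OF gen] GM_plus[OF step.hyps(1)] GM_plus[OF GM_gen[OF step.hyps(2)]] by auto
    show ?case
      unfolding b.add_right[OF V] step.IH gram[OF a step.hyps(2)[unfolded atLeast_iff]] G.MJ_add L2_inner_add_right[OF m]
      by (simp add: distrib_left)
  qed
  have V: "f \<in> V" "?g \<in> V" "f' \<in> V" using GM_plus[OF step.hyps(1)] GM_plus[OF gen] GM_plus[OF step.prems] by auto
  have m: "w \<in> L2 0" "?e \<in> L2 0" "G.MJ w' \<in> L2 0"
    using GM_L2[OF step.hyps(1)] GM_L2[OF gen] GM_L2[OF step.prems] by (auto intro: G.MJ_L2)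
  show ?case
    unfolding b.add_left[OF V] step.IH[OF step.prems] one L2_inner_add_left[OF m] by (simp add: distrib_left)
qed

definition "C\<Gamma> = sqrt (2 * \<sigma>0 * G.CJ / \<epsilon>)"

lemma CG: "0 \<le> C\<Gamma>" using s0 G.CJ(1) eps by (simp add: C\<Gamma>_def)

lemma GM_bound: assumes "GM {0..} w f" shows "nV f \<le> C\<Gamma> * L2_norm 0 w"
proof -
  have fV: "f \<in> V" and w: "w \<in> L2 0" using GM_plus[OF assms] L2_plus_L2 by auto
  have "\<epsilon> * (nV f)\<^sup>2 \<le> Re (b f f)" by (rule b.coercive[OF fV])
  also have "\<dots> = 2 * \<sigma>0 * Re (L2_inner w (G.MJ w))" unfolding GM_gram[OF assms assms] by simp
  also have "\<dots> \<le> 2 * \<sigma>0 * (G.CJ * (L2_norm 0 w)\<^sup>2)"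
  proof (rule mult_left_mono)
    have "Re (L2_inner w (G.MJ w)) \<le> cmod (L2_inner w (G.MJ w))" by (rule complex_Re_le_cmod)
    also have "\<dots> \<le> L2_norm 0 w * L2_norm 0 (G.MJ w)" by (intro L2_inner_bound w G.MJ_L2)
    also have "\<dots> \<le> L2_norm 0 w * (G.CJ * L2_norm 0 w)" by (intro mult_left_mono G.MJ_L2 w) simp
    finally show "Re (L2_inner w (G.MJ w)) \<le> G.CJ * (L2_norm 0 w)\<^sup>2" by (simp add: power2_eq_square mult_ac)
  qed (use s0 in simp)
  finally have "(nV f)\<^sup>2 \<le> (2 * \<sigma>0 * G.CJ / \<epsilon>) * (L2_norm 0 w)\<^sup>2" using eps by (simp add: pos_le_divide_eq mult_ac)
  also have "\<dots> = (C\<Gamma> * L2_norm 0 w)\<^sup>2" using s0 G.CJ(1) eps by (simp add: C\<Gamma>_def power_mult_distrib)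
  finally show ?thesis by (rule power2_le_imp_le) (use CG in simp)
qed

text \<open>At the weight zero shifts are isometric, so the bound on the half-line carries over to
  the line with the same constant. \<open>V\<close> itself consists of controls on the half-line, so
  only its \<open>L2\<close> norm survives.\<close>

lemma GM_UNIV_bound: assumes "GM UNIV w f" shows "w \<in> L2 0 \<and> f \<in> L2 0 \<and> L2_norm 0 f \<le> C\<Gamma> * L2_norm 0 w"
proof -
  obtain h where h: "0 \<le> h" "GM {0..} (shift (- h) w) (shift (- h) f)" using GM_UNIV_plus[OF assms] by blast
  have w: "w \<in> L2 0" by (rule GM_L2[OF assms])
  have sf: "shift (- h) f \<in> L2 0" using GM_plus[OF h(2)] V_L2 by blast
  then have f: "f \<in> L2 0" using L2_shift[OF sf, of h] by simp
  have "L2_norm 0 (shift (- h) f) \<le> C\<Gamma> * L2_norm 0 (shift (- h) w)"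
    using GM_bound[OF h(2)] nV_ge(1) order_trans by blast
  then show ?thesis using w f by (simp add: L2_norm_shift)
qed

section \<open>Density of the generators and the map \<open>M\<close>\<close>

lemma GM_dense_UNIV:
  assumes "x \<in> L2 0" "0 < e" shows "\<exists>(w, f)\<in>{(w, f). GM UNIV w f}. L2_norm 0 (x - w) < e"
proof -
  have "\<exists>w\<in>{w. \<exists>f. GM UNIV w f}. L2_norm 0 (x - w) < e"
  proof (rule dense_if_orthogonal_zero[OF csubspace_L2 order_refl L2_complete _ _ _ assms])
    show "csubspace {w. \<exists>f. GM UNIV w f}" by (auto simp: csubspace_def intro: GM.zero GM_add GM_scale)
    show "{w. \<exists>f. GM UNIV w f} \<subseteq> L2 0" using GM_L2 by blast
    fix w assume w: "w \<in> L2 0" and z: "\<And>g. g \<in> {w. \<exists>f. GM UNIV w f} \<Longrightarrow> L2_inner g w = 0"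
    show "w = 0"
    proof (rule L2_orth_expf[OF w, where \<sigma> = "- \<sigma>0"])
      fix a c u
      show "L2_inner (expf {a..<c} (- \<sigma>0) u) w = 0"
      proof (cases "a \<le> c")
        case True
        show ?thesis by (rule z) (use GM_interval[OF _ _ True, of UNIV u] in auto)
      next
        case False
        then have e: "{a..<c} = {}" by auto
        show ?thesis unfolding e by simp
      qed
    qed
  qed
  then show ?thesis by blast
qed

lemma GM_dense_plus:
  assumes "x \<in> L2_plus 0" "0 < e" shows "\<exists>w\<in>{w. \<exists>f. GM {0..} w f}. L2_norm 0 (x - w) < e"
proof (rule dense_if_orthogonal_zero[OF csubspace_L2_plus _ L2_plus_complete _ _ _ assms])
  show "(L2_plus 0 :: 'u aefun set) \<subseteq> L2 0" by (auto simp: L2_plus_def)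
  show "csubspace {w. \<exists>f. GM {0..} w f}" by (auto simp: csubspace_def intro: GM.zero GM_add GM_scale)
  show "{w. \<exists>f. GM {0..} w f} \<subseteq> L2_plus 0" using GM_plus by blast
  fix w assume w: "w \<in> L2_plus 0" and z: "\<And>g. g \<in> {w. \<exists>f. GM {0..} w f} \<Longrightarrow> L2_inner g w = 0"
  show "w = 0"
  proof (rule L2_orth_expf[OF L2_plus_L2[OF w], where \<sigma> = "- \<sigma>0"])
    fix a c u
    have "L2_inner (expf {a..<c} (- \<sigma>0) u) w = L2_inner (expf {a..<c} (- \<sigma>0) u) (pi_plus w)" using w by (simp add: L2_plus_fix)
    also have "\<dots> = L2_inner (expf ({0..} \<inter> {a..<c}) (- \<sigma>0) u) w" by (simp add: L2_inner_cut[symmetric] cut_expf)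
    also have "{0..} \<inter> {a..<c} = {max 0 a..<c}" by auto
    also have "L2_inner (expf {max 0 a..<c} (- \<sigma>0) u) w = 0"
    proof (cases "max 0 a \<le> c")
      case True
      show ?thesis by (rule z) (use GM_interval[OF _ _ True, of "{0..}" u] True in auto)
    next
      case False
      then have e: "{max 0 a..<c} = {}" by auto
      show ?thesis unfolding e by simp
    qed
    finally show "L2_inner (expf {a..<c} (- \<sigma>0) u) w = 0" .
  qed
qed

lemma M_ex: "\<exists>M. M \<in> BL (L2 0) (L2_norm 0) (L2 0) (L2_norm 0) \<and> (\<forall>w f. GM UNIV w f \<longrightarrow> M w = f)"
proof -
  obtain M where M: "M ` L2 0 \<subseteq> L2 0" "clinear_on (L2 0) M" "\<And>x. x \<in> L2 0 \<Longrightarrow> L2_norm 0 (M x) \<le> C\<Gamma> * L2_norm 0 x"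
    "\<And>w u. (w, u) \<in> {(w, f). GM UNIV w f} \<Longrightarrow> M w = u"
    by (rule extension_by_continuity[OF csubspace_L2 norm_on_L2 csubspace_L2 norm_on_L2 L2_complete csubspace_GM _ GM_dense_UNIV CG])
       (use GM_UNIV_bound in auto)
  then show ?thesis by (intro exI[of _ M]) (auto simp: BL_def)
qed

definition "M = (SOME M. M \<in> BL (L2 0) (L2_norm 0) (L2 0) (L2_norm 0) \<and> (\<forall>w f. GM UNIV w f \<longrightarrow> M w = f))"

lemma M_BL: "M \<in> BL (L2 0) (L2_norm 0) (L2 0) (L2_norm 0)" and M_GM: "GM I w f \<Longrightarrow> M w = f"
proof -
  note * = someI_ex[OF M_ex, folded M_def]
  show "M \<in> BL (L2 0) (L2_norm 0) (L2 0) (L2_norm 0)" using * by blast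
  show "GM I w f \<Longrightarrow> M w = f" using * GM_mono[of I w f UNIV] by blast
qed

lemma M_lim: "(\<And>k. f k \<in> L2 0) \<Longrightarrow> x \<in> L2 0 \<Longrightarrow> (\<lambda>k. L2_norm 0 (f k - x)) \<longlonglongrightarrow> 0 \<Longrightarrow> (\<lambda>k. L2_norm 0 (M (f k) - M x)) \<longlonglongrightarrow> 0"
  by (rule BL_lim[OF M_BL csubspace_L2 norm_on_L2 norm_on_L2])

text \<open>On \<open>L\<^sup>2(\<real>\<^sub>+)\<close> the map is continuous into \<open>V\<close>, since \<open>V\<close> is complete.\<close>

lemma M_V_seq:
  assumes GMk: "\<And>k. GM {0..} (w k) (f k)" and x: "x \<in> L2_plus 0" and l: "(\<lambda>k. L2_norm 0 (w k - x)) \<longlonglongrightarrow> 0"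
  shows "M x \<in> V" "(\<lambda>k. nV (f k - M x)) \<longlonglongrightarrow> 0"
proof -
  have wk: "w k \<in> L2_plus 0" "f k \<in> V" "w k \<in> L2 0" for k using GM_plus[OF GMk, of k] L2_plus_L2 by auto
  obtain v where v: "v \<in> V" "(\<lambda>k. nV (f k - v)) \<longlonglongrightarrow> 0"
  proof (rule ncompleteD[OF nV_complete wk(2)])
    fix e :: real assume e: "0 < e"
    then have e': "0 < e / (2 * (C\<Gamma> + 1))" using CG by simp
    then obtain N where N: "\<And>k. k \<ge> N \<Longrightarrow> L2_norm 0 (w k - x) < e / (2 * (C\<Gamma> + 1))"
      using order_tendstoD(2)[OF l] by (auto simp: eventually_sequentially)
    have "nV (f i - f j) < e" if "N \<le> i" "N \<le> j" for i j
    proof -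
      have "L2_norm 0 (w i - w j) \<le> L2_norm 0 (w i - x) + L2_norm 0 (x - w j)"
        using wk x L2_plus_L2 by (intro norm_on_diff_triangle[OF norm_on_L2 csubspace_L2]) auto
      also have "L2_norm 0 (x - w j) = L2_norm 0 (w j - x)"
        using wk x L2_plus_L2 by (intro norm_on_commute[OF norm_on_L2 csubspace_L2]) auto
      finally have "L2_norm 0 (w i - w j) < 2 * (e / (2 * (C\<Gamma> + 1)))" using N[OF that(1)] N[OF that(2)] by linarith
      moreover have "2 * (e / (2 * (C\<Gamma> + 1))) = e / (C\<Gamma> + 1)" using CG by (simp add: field_simps)
      ultimately have "L2_norm 0 (w i - w j) < e / (C\<Gamma> + 1)" by (simp only:)
      then have "(C\<Gamma> + 1) * L2_norm 0 (w i - w j) < e" using CG by (simp add: pos_less_divide_eq mult.commute)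
      moreover have "C\<Gamma> * L2_norm 0 (w i - w j) \<le> (C\<Gamma> + 1) * L2_norm 0 (w i - w j)" by (intro mult_right_mono) auto
      ultimately show ?thesis using GM_bound[OF GM_diff[OF GMk[of i] GMk[of j]]] by linarith
    qed
    then show "\<exists>N. \<forall>i\<ge>N. \<forall>j\<ge>N. nV (f i - f j) < e" by blast
  qed auto
  have l1: "(\<lambda>k. L2_norm 0 (f k - v)) \<longlonglongrightarrow> 0"
    by (rule Lim_null_comparison[OF _ v(2)]) (use nV_ge(1) in \<open>auto intro!: always_eventually\<close>)
  have "(\<lambda>k. L2_norm 0 (M (w k) - M x)) \<longlonglongrightarrow> 0" by (rule M_lim[OF wk(3) L2_plus_L2[OF x] l])
  then have l2: "(\<lambda>k. L2_norm 0 (f k - M x)) \<longlonglongrightarrow> 0" using M_GM[OF GMk] by simp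
  have "M x = v"
    by (rule limit_eq[OF csubspace_L2 norm_on_L2 V_L2[OF wk(2)] BL_D(1)[OF M_BL L2_plus_L2[OF x]] V_L2[OF v(1)] l2 l1])
  then show "M x \<in> V" "(\<lambda>k. nV (f k - M x)) \<longlonglongrightarrow> 0" using v by simp_all
qed

lemma GM_plus_induct:
  assumes x: "x \<in> L2_plus 0"
    and P: "\<And>w f. (\<And>k. GM {0..} (w k) (f k)) \<Longrightarrow> (\<lambda>k. L2_norm 0 (w k - x)) \<longlonglongrightarrow> 0 \<Longrightarrow> P"
  shows P
proof -
  have "x = x \<longrightarrow> P"
  proof (rule dense_closed_induct[OF GM_dense_plus csubspace_L2_plus norm_on_L2_plus, where P = "\<lambda>y. y = x \<longrightarrow> P" and x = x])
    show "{w. \<exists>f. GM {0..} w f} \<subseteq> L2_plus 0" using GM_plus by blast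
    show "x \<in> L2_plus 0" by (rule x)
    fix h :: "nat \<Rightarrow> 'u aefun" and y
    assume "\<And>k. h k \<in> {w. \<exists>f. GM {0..} w f}" and l: "(\<lambda>k. L2_norm 0 (h k - y)) \<longlonglongrightarrow> 0"
    then have "\<forall>k. \<exists>f. GM {0..} (h k) f" by blast
    from choice[OF this] obtain f where "\<And>k. GM {0..} (h k) (f k)" by blast
    then show "y = x \<longrightarrow> P" using P[of h f] l by blast
  qed

  then show P using x by blast
qed

lemma M_V: "x \<in> L2_plus 0 \<Longrightarrow> M x \<in> V"
  by (rule GM_plus_induct, assumption, rule M_V_seq(1))

lemma M_plus: "x \<in> L2_plus 0 \<Longrightarrow> M x \<in> L2_plus 0"
  using M_V V_plus by blast

lemma M_nV: "x \<in> L2_plus 0 \<Longrightarrow> nV (M x) \<le> C\<Gamma> * L2_norm 0 x"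
proof -
  assume x: "x \<in> L2_plus 0"
  show ?thesis
  proof (rule GM_plus_induct[OF x])
    fix w f assume g: "\<And>k. GM {0..} (w k) (f k)" and l: "(\<lambda>k. L2_norm 0 (w k - x)) \<longlonglongrightarrow> 0"
    note X = M_V_seq[OF g x l]
    have wk: "w k \<in> L2_plus 0" "f k \<in> V" for k using GM_plus[OF g] by auto
    have "(\<lambda>k. nV (f k - M x) + C\<Gamma> * (L2_norm 0 (w k - x) + L2_norm 0 x)) \<longlonglongrightarrow> 0 + C\<Gamma> * (0 + L2_norm 0 x)"
      by (intro tendsto_intros X l)
    moreover have "nV (M x) \<le> nV (f k - M x) + C\<Gamma> * (L2_norm 0 (w k - x) + L2_norm 0 x)" for k
    proof -
      have "nV (M x) \<le> nV (M x - f k) + nV (f k)"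
        using b.nrmD(3)[OF b.subD(4)[OF X(1) wk(2)] wk(2)[of k], of k] by simp
      moreover have "nV (M x - f k) = nV (f k - M x)" by (rule norm_on_commute[OF nV_norm csubspace_V X(1) wk(2)])
      moreover have "nV (f k) \<le> C\<Gamma> * L2_norm 0 (w k)" by (rule GM_bound[OF g])
      moreover have "C\<Gamma> * L2_norm 0 (w k) \<le> C\<Gamma> * (L2_norm 0 (w k - x) + L2_norm 0 x)"
        using L2_norm_triangle[of "w k - x" 0 x] wk(1)[THEN L2_plus_L2] x L2_plus_L2 CG
        by (intro mult_left_mono) (auto simp: L2_diff)
      ultimately show ?thesis by linarith
    qed
    ultimately have "nV (M x) \<le> 0 + C\<Gamma> * (0 + L2_norm 0 x)" by (intro LIMSEQ_le_const) auto
    then show ?thesis by simp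
  qed
qed

definition "c\<Gamma> = (SOME c. 0 < c \<and> (\<forall>u. c * (norm u)\<^sup>2 \<le> Re (cinner u (\<Gamma> u))))"

lemma cG: "0 < c\<Gamma>" "c\<Gamma> * (norm u)\<^sup>2 \<le> Re (cinner u (\<Gamma> u))"
proof -
  have "\<exists>c. 0 < c \<and> (\<forall>u. c * (norm u)\<^sup>2 \<le> Re (cinner u (\<Gamma> u)))" by (rule Gamma_lower) blast
  from someI_ex[OF this] show "0 < c\<Gamma>" "c\<Gamma> * (norm u)\<^sup>2 \<le> Re (cinner u (\<Gamma> u))" unfolding c\<Gamma>_def by auto
qed

text \<open>The Gram identity passes to limits because the generators converge in the norm of
  \<open>V\<close>, hence their outputs in \<open>L2 0\<close>; the bound is then that of
  \<open>\<Gamma>\<close>.\<close>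

lemma M_lower:
  assumes x: "x \<in> L2_plus 0" shows "2 * \<sigma>0 * c\<Gamma> * (L2_norm 0 x)\<^sup>2 \<le> Re (b (M x) (M x))"
proof (rule GM_plus_induct[OF x])
  fix w f assume g: "\<And>k. GM {0..} (w k) (f k)" and l: "(\<lambda>k. L2_norm 0 (w k - x)) \<longlonglongrightarrow> 0"
  note X = M_V_seq[OF g x l]
  have wk: "w k \<in> L2 0" "f k \<in> V" "D (f k) \<in> L2 0" for k using GM_plus[OF g, of k] L2_plus_L2 V_D by auto
  have x0: "x \<in> L2 0" "D (M x) \<in> L2 0" using L2_plus_L2[OF x] V_D[OF X(1)] by auto
  have lD: "(\<lambda>k. L2_norm 0 (D (f k) - D (M x))) \<longlonglongrightarrow> 0"
  proof (rule Lim_null_comparison[OF _ X(2)], intro always_eventually allI)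
    show "norm (L2_norm 0 (D (f k) - D (M x))) \<le> nV (f k - M x)" for k
      using nV_ge(2)[of "f k - M x"] D_diff[OF V_g[OF wk(2)] V_g[OF X(1)]] by simp
  qed
  have 1: "(\<lambda>k. b (f k) (f k)) \<longlonglongrightarrow> b (M x) (M x)"
    unfolding b_def
    by (intro L2_inner_lim2 wk x0 lD MJ_L2 BL_lim[OF BL_MJ csubspace_L2 norm_on_L2 norm_on_L2])
  have 2: "(\<lambda>k. L2_inner (w k) (G.MJ (w k))) \<longlonglongrightarrow> L2_inner x (G.MJ x)"
    by (intro L2_inner_lim2 wk x0 l G.MJ_L2 BL_lim[OF G.BL_MJ csubspace_L2 norm_on_L2 norm_on_L2])
  have "(\<lambda>k. b (f k) (f k)) \<longlonglongrightarrow> of_real (2 * \<sigma>0) * L2_inner x (G.MJ x)"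
    unfolding GM_gram[OF g g] by (intro tendsto_intros 2)
  then have "b (M x) (M x) = of_real (2 * \<sigma>0) * L2_inner x (G.MJ x)" using 1 LIMSEQ_unique by blast
  then have "Re (b (M x) (M x)) = 2 * \<sigma>0 * Re (L2_inner x (G.MJ x))" by simp
  moreover have "c\<Gamma> * (L2_norm 0 x)\<^sup>2 \<le> Re (L2_inner x (G.MJ x))" by (rule G.MJ_lower[OF cG(2) x0(1)])
  ultimately show ?thesis using s0 by (simp add: mult.assoc)
qed

lemma M_add: "x \<in> L2 0 \<Longrightarrow> y \<in> L2 0 \<Longrightarrow> M (x + y) = M x + M y"
  and M_scale: "x \<in> L2 0 \<Longrightarrow> M (a *\<^sub>C x) = a *\<^sub>C M x"
  using BL_D[OF M_BL] by auto

text \<open>The lower bound makes the pulled-back form coercive, so \<open>riesz\<close> gives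
  \<open>M w\<close>, the projection of \<open>v\<close> onto the range with respect to
  \<open>b\<close>. The remainder is orthogonal to all shifts of all \<open>fe u\<close>; by
  \<open>b_adj\<close> it lies in \<open>Vp \<sigma>0\<close>, which is trivial.\<close>

lemma M_surj: assumes v: "v \<in> V" obtains w where "w \<in> L2_plus 0" "M w = v"
proof -
  interpret S: coercive_form "L2_plus 0" "L2_norm 0" "\<lambda>w w'. b (M w) (M w')" "2 * \<sigma>0 * c\<Gamma>" "CJ * C\<Gamma> * C\<Gamma>"
  proof
    show "b (M x) (M (y + z)) = b (M x) (M y) + b (M x) (M z)" if "x \<in> L2_plus 0" "y \<in> L2_plus 0" "z \<in> L2_plus 0" for x y z
      using M_V that by (simp add: M_add L2_plus_L2 b.add_right del: mem_Collect_eq)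
    show "b (M x) (M (a *\<^sub>C y)) = a * b (M x) (M y)" if "x \<in> L2_plus 0" "y \<in> L2_plus 0" for x y a
      using M_V that by (simp add: M_scale L2_plus_L2 b.scale_right del: mem_Collect_eq)
    show "b (M x) (M y) = cnj (b (M y) (M x))" if "x \<in> L2_plus 0" "y \<in> L2_plus 0" for x y
      by (rule b.herm[OF M_V[OF that(1)] M_V[OF that(2)]])
    show "2 * \<sigma>0 * c\<Gamma> * (L2_norm 0 x)\<^sup>2 \<le> Re (b (M x) (M x))" if "x \<in> L2_plus 0" for x by (rule M_lower[OF that])
    show "cmod (b (M x) (M y)) \<le> CJ * C\<Gamma> * C\<Gamma> * L2_norm 0 x * L2_norm 0 y" if "x \<in> L2_plus 0" "y \<in> L2_plus 0" for x y
    proof -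
      have "cmod (b (M x) (M y)) \<le> CJ * nV (M x) * nV (M y)" by (rule b.bound[OF M_V[OF that(1)] M_V[OF that(2)]])
      also have "\<dots> \<le> CJ * (C\<Gamma> * L2_norm 0 x) * (C\<Gamma> * L2_norm 0 y)"
        using CJ(1) CG nV_nonneg M_nV[OF that(1)] M_nV[OF that(2)] by (intro mult_mono) auto
      finally show ?thesis by (simp add: mult_ac)
    qed
  qed (use csubspace_L2_plus norm_on_L2_plus L2_plus_complete s0 cG(1) in auto)
  obtain w where w: "w \<in> L2_plus 0" "\<And>x. x \<in> L2_plus 0 \<Longrightarrow> b (M w) (M x) = b v (M x)"
  proof (rule S.riesz[of "\<lambda>x. b v (M x)" "CJ * nV v * C\<Gamma>"])
    show "b v (M (x + y)) = b v (M x) + b v (M y)" if "x \<in> L2_plus 0" "y \<in> L2_plus 0" for x y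
      using M_V that v by (simp add: M_add L2_plus_L2 b.add_right del: mem_Collect_eq)
    show "b v (M (a *\<^sub>C x)) = a * b v (M x)" if "x \<in> L2_plus 0" for x a
      using M_V that v by (simp add: M_scale L2_plus_L2 b.scale_right del: mem_Collect_eq)
    show "cmod (b v (M x)) \<le> CJ * nV v * C\<Gamma> * L2_norm 0 x" if "x \<in> L2_plus 0" for x
    proof -
      have "cmod (b v (M x)) \<le> CJ * nV v * nV (M x)" by (rule b.bound[OF v M_V[OF that]])
      also have "\<dots> \<le> CJ * nV v * (C\<Gamma> * L2_norm 0 x)"
        using CJ(1) nV_nonneg M_nV[OF that] by (intro mult_left_mono) auto
      finally show ?thesis by (simp add: mult_ac)
    qed
  qed (blast intro: that)
  let ?d = "v - M w"
  have Mw: "M w \<in> V" by (rule M_V[OF w(1)])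
  have dV: "?d \<in> V" by (rule b.subD(4)[OF v Mw])
  have orth: "b (M x) ?d = 0" if x: "x \<in> L2_plus 0" for x
  proof -
    have Mx: "M x \<in> V" by (rule M_V[OF x])
    have "b (M x) (v + (-1) *\<^sub>C M w) = b (M x) v - b (M x) (M w)"
      using b.add_right[OF Mx v b.subD(3)[OF Mw]] b.scale_right[OF Mx Mw] by simp
    also have "\<dots> = cnj (b v (M x)) - cnj (b (M w) (M x))" using b.herm[OF Mx v] b.herm[OF Mx Mw] by simp
    also have "\<dots> = 0" using w(2)[OF x] by simp
    finally show ?thesis by (simp add: scaleC_minus1)
  qed
  have "?d \<in> Vp \<sigma>0" unfolding Vp_def
  proof (rule CollectI, intro conjI allI impI)
    show "?d \<in> V" by (rule dV)
    fix a u assume a: "0 \<le> (a::real)"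
    have g: "GM {0..} (expf {a..} (- \<sigma>0) u) (of_real (exp (- \<sigma>0 * a)) *\<^sub>C shift (- a) (fe u))"
      using a by (intro GM_gen) simp
    have "0 = b (of_real (exp (- \<sigma>0 * a)) *\<^sub>C shift (- a) (fe u)) ?d"
      using orth[of "expf {a..} (- \<sigma>0) u"] GM_plus[OF g] M_GM[OF g] by simp
    also have "\<dots> = of_real (exp (- \<sigma>0 * a)) * b (fe u) (T a ?d)"
      using b.scale_left[OF shift_V[OF a fe(1)] dV] b_adj[OF a fe(1) dV] by simp
    also have "\<dots> = of_real (exp (- \<sigma>0 * a)) * L2_inner (kern \<sigma>0 u) (T a ?d)" by (simp add: fe(2)[OF T_V[OF a dV]])
    finally show "L2_inner (kern \<sigma>0 u) (T a ?d) = 0" by simp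
  qed
  then have "?d = 0" unfolding \<sigma>0_def by (rule Vp_trivial)
  then show ?thesis using w(1) by (intro that[of w]) auto
qed

lemma M_shift: assumes x: "x \<in> L2 0" shows "shift t (M x) = M (shift t x)"
proof (rule dense_closed_induct[where P = "\<lambda>x. shift t (M x) = M (shift t x)" and X = "L2 0" and n = "L2_norm 0" and G = "{w. \<exists>f. GM UNIV w f}"])
  show "\<exists>g\<in>{w. \<exists>f. GM UNIV w f}. L2_norm 0 (x - g) < e" if "x \<in> L2 0" "0 < e" for x e
    using GM_dense_UNIV[OF that] by auto
  show "{w. \<exists>f. GM UNIV w f} \<subseteq> L2 0" using GM_L2 by blast
  fix w x assume w: "\<And>k::nat. w k \<in> {w. \<exists>f. GM UNIV w f}" and x: "x \<in> L2 0" and l: "(\<lambda>k. L2_norm 0 (w k - x)) \<longlonglongrightarrow> 0"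
  have wk: "w k \<in> L2 0" for k using w GM_L2 by blast
  have eq: "shift t (M (w k)) = M (shift t (w k))" for k
  proof -
    obtain f where g: "GM UNIV (w k) f" using w by blast
    then have "GM UNIV (shift t (w k)) (shift t f)" using GM_shift[OF g, of "- t"] by (simp add: GM_mono)
    then show ?thesis using M_GM[OF g] M_GM by simp
  qed
  note B1 = BL_comp[OF BL_shift M_BL norm_on_L2, of t] and B2 = BL_comp[OF M_BL BL_shift norm_on_L2, of t]
  show "shift t (M x) = M (shift t x)"
  proof (rule limit_eq[OF csubspace_L2 norm_on_L2, of "\<lambda>k. M (shift t (w k))" 0])
    show "(\<lambda>k. L2_norm 0 (M (shift t (w k)) - shift t (M x))) \<longlonglongrightarrow> 0"
      using BL_lim[OF B1 csubspace_L2 norm_on_L2 norm_on_L2 wk x l] by (simp add: eq)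
    show "(\<lambda>k. L2_norm 0 (M (shift t (w k)) - M (shift t x))) \<longlonglongrightarrow> 0"
      by (rule BL_lim[OF B2 csubspace_L2 norm_on_L2 norm_on_L2 wk x l])
  qed (use BL_D(1)[OF B1] BL_D(1)[OF B2] wk x in auto)
qed (use csubspace_L2 norm_on_L2 x in auto)

lemma M_TIC: "M \<in> TIC 0"
  unfolding TIC_def
proof (intro CollectI conjI allI ballI M_BL M_shift)
  fix u :: "'u aefun" assume u: "u \<in> L2 0"
  have "pi_plus u \<in> L2_plus 0" using u by (simp add: L2_plus_def L2_cut)
  then have p: "pi_plus (M (pi_plus u)) = M (pi_plus u)" using M_plus L2_plus_fix by blast
  have "{..<0} \<inter> {0..} = ({} :: real set)" by auto
  then show "pi_minus (M (pi_plus u)) = 0" using cut_cut[of "{..<0}" "{0..}" "M (pi_plus u)"] p by simp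
qed

text \<open>The truncation of a generator at \<open>a < h\<close> is the difference of the
  generators at \<open>a\<close> and \<open>h\<close>. Paired with
  \<open>shift (- h) \<eta>\<close>, the generator at any time up to \<open>h\<close> gives the same
  value, so the difference is orthogonal to everything that starts after \<open>h\<close>.\<close>

lemma GM_cut:
  assumes h: "0 \<le> h" and g: "GM {0..} w f"
  shows "\<exists>f'. GM {0..} (cut {0..<h} w) f' \<and> (\<forall>\<eta>\<in>V. b (shift (- h) \<eta>) f' = 0)"
  using g
proof (induction rule: GM.induct)
  case zero
  then show ?case using GM.zero by (intro exI[of _ 0]) (auto simp: b_def D_0 MJ_0)
next
  case (step w f a u)
  then obtain f' where f': "GM {0..} (cut {0..<h} w) f'" "\<And>\<eta>. \<eta> \<in> V \<Longrightarrow> b (shift (- h) \<eta>) f' = 0" by blast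
  have a: "0 \<le> a" using step.hyps by simp
  show ?case
  proof (cases "a < h")
    case False
    then have "{0..<h} \<inter> {a..} = {}" by auto
    then show ?thesis using f' by (intro exI[of _ f']) (simp add: cut_add cut_expf)
  next
    case True
    let ?g = "\<lambda>c. of_real (exp (- \<sigma>0 * c)) *\<^sub>C shift (- c) (fe u)"
    have G1: "GM {0..} (expf {a..} (- \<sigma>0) u) (?g a)" "GM {0..} (expf {h..} (- \<sigma>0) u) (?g h)"
      by (rule GM_gen, use a in simp, rule GM_gen, use h in simp)
    have e: "{0..<h} \<inter> {a..} = {a..<h}" using a by auto
    have val: "b (shift (- h) \<eta>) (?g c) = of_real (exp (- \<sigma>0 * h)) * cnj (L2_inner (kern \<sigma>0 u) \<eta>)" if \<eta>: "\<eta> \<in> V" and c: "0 \<le> c" "c \<le> h" for \<eta> c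
    proof -
      have s1: "shift (- (h - c)) \<eta> \<in> V" using c by (intro shift_V \<eta>) auto
      have s2: "shift (- c) (fe u) \<in> V" by (intro shift_V fe c)
      have s3: "shift (- h) \<eta> \<in> V" by (intro shift_V h \<eta>)
      have "b (shift (- c) (shift (- (h - c)) \<eta>)) (shift (- c) (fe u)) = b (shift (- (h - c)) \<eta>) (fe u)"
        by (rule V_b_shift[OF s1 fe(1) c(1)])
      also have "\<dots> = cnj (L2_inner (kern \<sigma>0 u) (shift (- (h - c)) \<eta>))"
        using b.herm[OF s1 fe(1)] fe(2)[OF s1] by simp
      also have "\<dots> = of_real (exp (- \<sigma>0 * (h - c))) * cnj (L2_inner (kern \<sigma>0 u) \<eta>)"
        using kern_inner_shift[of "h - c" \<eta> \<sigma>0 u] c L2_plus_fix[OF V_plus[OF \<eta>]] by simp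
      finally have "b (shift (- h) \<eta>) (shift (- c) (fe u)) = of_real (exp (- \<sigma>0 * (h - c))) * cnj (L2_inner (kern \<sigma>0 u) \<eta>)" by simp
      then have "b (shift (- h) \<eta>) (?g c) = of_real (exp (- \<sigma>0 * c) * exp (- \<sigma>0 * (h - c))) * cnj (L2_inner (kern \<sigma>0 u) \<eta>)"
        using b.scale_right[OF s3 s2] by simp
      also have "exp (- \<sigma>0 * c) * exp (- \<sigma>0 * (h - c)) = exp (- \<sigma>0 * h)" unfolding exp_add[symmetric] by (simp add: algebra_simps)
      finally show ?thesis .
    qed
    have V: "?g a \<in> V" "?g h \<in> V" "f' \<in> V" using GM_plus G1 f' by auto
    show ?thesis
    proof (intro exI conjI ballI)
      have "GM {0..} (cut {0..<h} w + (expf {a..} (- \<sigma>0) u - expf {h..} (- \<sigma>0) u)) (f' + (?g a - ?g h))"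
        by (rule GM_add[OF GM_diff[OF G1] f'(1)])
      then show "GM {0..} (cut {0..<h} (w + expf {a..} (- \<sigma>0) u)) (f' + (?g a + (-1) *\<^sub>C ?g h))"
        using True by (simp add: cut_add cut_expf e expf_diff_atLeast scaleC_minus1)
      fix \<eta> assume \<eta>: "\<eta> \<in> V"
      have s3: "shift (- h) \<eta> \<in> V" by (intro shift_V h \<eta>)
      show "b (shift (- h) \<eta>) (f' + (?g a + (-1) *\<^sub>C ?g h)) = 0"
        using b.add_right[OF s3 V(3) b.subD(2)[OF V(1) b.subD(3)[OF V(2)]]] b.add_right[OF s3 V(1) b.subD(3)[OF V(2)]]
          b.scale_right[OF s3 V(2), of "-1"] f'(2)[OF \<eta>] val[OF \<eta> a] val[OF \<eta> h] True by simp
    qed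
  qed
qed

text \<open>The orthogonality in \<open>GM_cut\<close> says, through \<open>b_adj\<close>, that
  \<open>T h (M x)\<close> is orthogonal to \<open>V\<close>; being an element of \<open>V\<close>,
  it vanishes.\<close>

lemma M_opt:
  assumes h: "0 \<le> h" and x: "x \<in> L2_plus 0" "cut {0..<h} x = x"
  shows "T h (M x) = 0"
proof (rule GM_plus_induct[OF x(1)])
  fix w f assume g: "\<And>k. GM {0..} (w k) (f k)" and l: "(\<lambda>k. L2_norm 0 (w k - x)) \<longlonglongrightarrow> 0"
  have "\<forall>k. \<exists>f'. GM {0..} (cut {0..<h} (w k)) f' \<and> (\<forall>\<eta>\<in>V. b (shift (- h) \<eta>) f' = 0)" using GM_cut[OF h g] by blast
  then obtain f' where f': "\<And>k. GM {0..} (cut {0..<h} (w k)) (f' k)" "\<And>k \<eta>. \<eta> \<in> V \<Longrightarrow> b (shift (- h) \<eta>) (f' k) = 0" by metis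
  have wk: "w k \<in> L2 0" for k using GM_L2[OF g] .
  have x0: "x \<in> L2 0" using x L2_plus_L2 by blast
  have l': "(\<lambda>k. L2_norm 0 (cut {0..<h} (w k) - x)) \<longlonglongrightarrow> 0"
    using BL_lim[OF BL_cut csubspace_L2 norm_on_L2 norm_on_L2 wk x0 l, of "{0..<h}"] x(2) by simp
  note X = M_V_seq[OF f'(1) x(1) l']
  have fV: "f' k \<in> V" for k using GM_plus[OF f'(1)] by blast
  have TV: "T h (M x) \<in> V" by (rule T_V[OF h X(1)])
  have "b \<eta> (T h (M x)) = 0" if \<eta>: "\<eta> \<in> V" for \<eta>
  proof -
    have s: "shift (- h) \<eta> \<in> V" by (intro shift_V h \<eta>)
    have lD: "(\<lambda>k. L2_norm 0 (D (f' k) - D (M x))) \<longlonglongrightarrow> 0"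
    proof (rule Lim_null_comparison[OF _ X(2)], intro always_eventually allI)
      show "norm (L2_norm 0 (D (f' k) - D (M x))) \<le> nV (f' k - M x)" for k
        using nV_ge(2)[of "f' k - M x"] D_diff[OF V_g[OF fV] V_g[OF X(1)]] by simp
    qed
    have "(\<lambda>k. b (shift (- h) \<eta>) (f' k)) \<longlonglongrightarrow> b (shift (- h) \<eta>) (M x)"
      unfolding b_def
      by (intro L2_inner_bound_lim MJ_L2 V_D fV X(1) s lD BL_lim[OF BL_MJ csubspace_L2 norm_on_L2 norm_on_L2])
    then have "b (shift (- h) \<eta>) (M x) = 0" using f'(2)[OF \<eta>] by (simp add: LIMSEQ_const_iff)
    then show ?thesis using b_adj[OF h \<eta> X(1)] by simp
  qed
  then have "b (T h (M x)) \<eta> = 0" if "\<eta> \<in> V" for \<eta> using b.herm[OF TV that] that by simp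
  then show ?thesis using b.form_zero[OF TV] by blast
qed

end

subsection \<open>Pairs of outputs\<close>

lemma pair_aefun_L2:
  fixes f :: "'a::chilbert_space aefun" and g :: "'b::chilbert_space aefun"
  assumes "f \<in> L2 \<omega>" "g \<in> L2 \<omega>"
  shows "pair_aefun f g \<in> L2 \<omega>" "L2_norm \<omega> (pair_aefun f g) \<le> L2_norm \<omega> f + L2_norm \<omega> g"
proof -
  have "pair_aefun f g \<in> L2 \<omega> \<and> L2_norm \<omega> (pair_aefun f g) \<le> L2_norm \<omega> f + L2_norm \<omega> g"
  proof (cases f; cases g)
    fix f' g' assume e: "f = abs_aefun f'" "g = abs_aefun g'"
    have m: "smeas f'" "smeas g'" using assms unfolding e by (simp_all add: L2_abs)
    have "weighted_integral \<omega> (pair_aefun f g)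
        = (\<integral>\<^sup>+ t. ennreal ((norm (exp (- \<omega> * t) *\<^sub>R f' t))\<^sup>2) + ennreal ((norm (exp (- \<omega> * t) *\<^sub>R g' t))\<^sup>2) \<partial>lebesgue)"
      by (auto simp: e pair_aefun.abs_eq weighted_integral.abs_eq norm_prod_def power_mult_distrib distrib_left
        ennreal_plus[symmetric] simp del: ennreal_plus intro!: nn_integral_cong)
    also have "\<dots> = weighted_integral \<omega> f + weighted_integral \<omega> g"
      unfolding e weighted_integral.abs_eq by (intro nn_integral_add smeas_norm2_exp m)
    also have "\<dots> = ennreal ((L2_norm \<omega> f)\<^sup>2 + (L2_norm \<omega> g)\<^sup>2)" by (simp add: L2_norm_sq[symmetric] assms)
    finally have w: "weighted_integral \<omega> (pair_aefun f g) = ennreal ((L2_norm \<omega> f)\<^sup>2 + (L2_norm \<omega> g)\<^sup>2)" .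
    have "strongly_measurable (pair_aefun f g)"
      unfolding e pair_aefun.abs_eq strongly_measurable_abs by (rule smeas_Pair[OF m])
    moreover have "L2_norm \<omega> (pair_aefun f g) \<le> L2_norm \<omega> f + L2_norm \<omega> g"
      by (rule L2_norm_leI) (auto simp: w power2_sum intro!: ennreal_leI)
    ultimately show "pair_aefun f g \<in> L2 \<omega> \<and> L2_norm \<omega> (pair_aefun f g) \<le> L2_norm \<omega> f + L2_norm \<omega> g"
      by (simp add: L2_def w)
  qed
  then show "pair_aefun f g \<in> L2 \<omega>" "L2_norm \<omega> (pair_aefun f g) \<le> L2_norm \<omega> f + L2_norm \<omega> g" by auto
qed

lemma pair_aefun_add: "pair_aefun (f + g) (h + k) = pair_aefun f h + pair_aefun g k"
  by (cases f; cases g; cases h; cases k) (simp add: aefun_abs_simps)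

lemma pair_aefun_scaleC: "pair_aefun (a *\<^sub>C f) (a *\<^sub>C g) = a *\<^sub>C pair_aefun f g"
  by (cases f; cases g) (simp add: aefun_abs_simps scaleC_prod_def)

lemma pair_aefun_shift: "pair_aefun (shift t f) (shift t g) = shift t (pair_aefun f g)"
  by (cases f; cases g) (simp add: aefun_abs_simps)

lemma pair_aefun_cut: "pair_aefun (cut I f) (cut I g) = cut I (pair_aefun f g)"
  by (cases f; cases g) (auto simp: aefun_abs_simps zero_prod_def intro!: arg_cong[where f = abs_aefun])

lemma pair_aefun_0: "pair_aefun 0 0 = 0"
  by (simp add: zero_aefun.abs_eq pair_aefun.abs_eq zero_prod_def)

lemma BL_pair:
  fixes S :: "'x::complex_vector \<Rightarrow> 'a::chilbert_space aefun" and T :: "'x \<Rightarrow> 'b::chilbert_space aefun"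
  assumes S: "S \<in> BL X n (L2 \<omega>) (L2_norm \<omega>)" and T: "T \<in> BL X n (L2 \<omega>) (L2_norm \<omega>)" and X: "norm_on X n"
  shows "(\<lambda>x. pair_aefun (S x) (T x)) \<in> BL X n (L2 \<omega>) (L2_norm \<omega>)"
proof -
  obtain K where K: "\<And>x. x \<in> X \<Longrightarrow> L2_norm \<omega> (S x) \<le> K * n x" using BL_bound[OF S X] by blast
  obtain L where L: "\<And>x. x \<in> X \<Longrightarrow> L2_norm \<omega> (T x) \<le> L * n x" using BL_bound[OF T X] by blast
  show ?thesis
  proof (rule BL_I[where M = "K + L"])
    fix x assume x: "x \<in> X"
    note P = pair_aefun_L2[OF BL_D(1)[OF S x] BL_D(1)[OF T x]]
    show "pair_aefun (S x) (T x) \<in> L2 \<omega>" by (rule P)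
    show "L2_norm \<omega> (pair_aefun (S x) (T x)) \<le> (K + L) * n x"
      using P(2) K[OF x] L[OF x] by (simp add: distrib_right)
    show "pair_aefun (S (a *\<^sub>C x)) (T (a *\<^sub>C x)) = a *\<^sub>C pair_aefun (S x) (T x)" for a
      by (simp add: BL_D(3)[OF S x] BL_D(3)[OF T x] pair_aefun_scaleC)
    show "pair_aefun (S (x + y)) (T (x + y)) = pair_aefun (S x) (T x) + pair_aefun (S y) (T y)" if "y \<in> X" for y
      by (simp add: BL_D(2)[OF S x that] BL_D(2)[OF T x that] pair_aefun_add)
  qed
qed

lemma wpls_pair:
  assumes W: "wpls \<omega> A B C D" and W': "wpls \<omega> A B K F"
  shows "wpls \<omega> A B (\<lambda>x. pair_aefun (C x) (K x)) (\<lambda>u. pair_aefun (D u) (F u))"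
proof -
  note WD = wplsD[OF W] and WF = wplsD[OF W']
  have t: "(\<lambda>u. pair_aefun (D u) (F u)) \<in> TIC \<omega>"
    unfolding TIC_def
    using BL_pair[OF TIC_D(1)[OF WD(7)] TIC_D(1)[OF WF(7)] norm_on_L2] TIC_D(2,3)[OF WD(7)] TIC_D(2,3)[OF WF(7)]
    by (auto simp: pair_aefun_shift[symmetric] pair_aefun_cut[symmetric] pair_aefun_0)
  show ?thesis
    unfolding wpls_def
    using WD(1-4) t BL_pair[OF WD(5) WF(5) norm_on_UNIV] WD(6,8) WF(6,8)
    by (auto simp: pair_aefun_shift[symmetric] pair_aefun_cut[symmetric])
qed

subsection \<open>Truncation and causality\<close>

lemma cut_lessThan_plus: "pi_plus f = f \<Longrightarrow> cut {..<t} f = cut {0..<t} f"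
proof -
  assume "pi_plus f = f"
  moreover have "{..<t} \<inter> {0..} = {0..<t}" by auto
  ultimately show ?thesis using cut_cut[of "{..<t}" "{0..}" f] by simp
qed

lemma TIC_causal_plus:
  assumes "D \<in> TIC \<omega>" "u \<in> L2 \<omega>" "pi_plus u = u"
  shows "cut {0..<t} (D u) = cut {0..<t} (D (cut {0..<t} u))"
  using TIC_causal_interval[OF assms(1,2), of 0 t] by (simp add: cut_lessThan_plus[OF assms(3)])

lemma cut_interval_L2_plus: "u \<in> L2 \<beta> \<Longrightarrow> cut {0..<t} u \<in> L2_plus \<alpha>"
proof -
  have "{0..} \<inter> {0..<t} = {0..<t}" by auto
  then show "u \<in> L2 \<beta> \<Longrightarrow> cut {0..<t} u \<in> L2_plus \<alpha>" by (simp add: L2_plus_def L2_cut_interval)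
qed

lemma pi_plus_L2_plus: "u \<in> L2 \<beta> \<Longrightarrow> pi_plus u \<in> L2_plus \<beta>"
  by (simp add: L2_plus_def L2_cut)

lemma TIC_pi_minus: "D \<in> TIC \<omega> \<Longrightarrow> u \<in> L2 \<omega> \<Longrightarrow> pi_minus (D (pi_minus u)) = pi_minus (D u)"
  using TIC_causal[of D \<omega> u 0] by simp

context optimal_control_problem
begin

subsection \<open>Inversion on a weighted space\<close>

text \<open>The gap above \<open>\<gamma>\<close> serves \<open>L2_slices\<close> and is the rate at
  which optimal tails decay in \<open>N_surj_bounded_support\<close>.\<close>

definition "\<beta> = \<gamma> + 1"

lemma b0: "0 < \<beta>" "\<gamma> < \<beta>" "0 \<le> \<beta>" using gpos by (simp_all add: \<beta>_def)

lemma L2_plus_0_b: "u \<in> L2_plus 0 \<Longrightarrow> u \<in> L2 \<beta>" for u :: "'a::chilbert_space aefun"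
  using L2_weight_plus(1)[of u 0 \<beta>] b0 by (simp add: L2_plus_def)

text \<open>This will be the closed loop map \<open>(I - F)\<^sup>-\<^sup>1\<close>.\<close>

definition "N = (SOME N. N \<in> TIC \<beta> \<and> (\<forall>u\<in>L2 0 \<inter> L2 \<beta>. N u = M u))"

lemma N_TIC: "N \<in> TIC \<beta>" and N_M': "u \<in> L2 0 \<Longrightarrow> u \<in> L2 \<beta> \<Longrightarrow> N u = M u"
proof -
  have "\<exists>N. N \<in> TIC \<beta> \<and> (\<forall>u\<in>L2 0 \<inter> L2 \<beta>. N u = M u)" by (rule TIC_reweight[OF M_TIC b0(1)]) blast
  from someI_ex[OF this] show "N \<in> TIC \<beta>" "u \<in> L2 0 \<Longrightarrow> u \<in> L2 \<beta> \<Longrightarrow> N u = M u"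
    unfolding N_def by auto
qed

lemma N_M: "u \<in> L2_plus 0 \<Longrightarrow> N u = M u"
  by (rule N_M'[OF L2_plus_L2 L2_plus_0_b])

lemmas N_D = TIC_D[OF N_TIC] and N_add = TIC_add[OF N_TIC] and N_diff = TIC_diff[OF N_TIC]

lemma B_interval:
  assumes "pi_plus f = f" "f \<in> L2 \<gamma>"
  shows "B (shift t (cut {0..<t} f)) = B (shift t f)"
proof -
  have "pi_minus (shift t f) = pi_minus (shift t (pi_plus f))" using assms by simp
  also have "\<dots> = cut ({..<0} \<inter> {s. t + s \<in> {0..}}) (shift t f)" by (simp add: shift_cut)
  also have "{..<0} \<inter> {s. t + s \<in> {0..}} = {..<0} \<inter> {s. t + s \<in> {0..<t}}" by auto
  also have "cut \<dots> (shift t f) = pi_minus (shift t (cut {0..<t} f))" by (simp add: shift_cut)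
  finally have e: "pi_minus (shift t f) = pi_minus (shift t (cut {0..<t} f))" .
  show ?thesis
    using wpls_B_pi_minus[OF sysC, of "shift t f"] wpls_B_pi_minus[OF sysC, of "shift t (cut {0..<t} f)"] assms(2)
    by (simp add: e L2_shift L2_cut)
qed

text \<open>The image of an input on \<open>[0, h)\<close> is optimal after \<open>h\<close> and
  therefore determined by its own restriction to \<open>[0, h)\<close>.\<close>

lemma M_ext:
  assumes h: "0 \<le> h" and x: "x \<in> L2_plus 0" "cut {0..<h} x = x"
  shows "M x = ext h (cut {0..<h} (M x))"
proof -
  have p: "pi_plus (M x) = M x" "M x \<in> L2 \<gamma>"
    using L2_plus_fix[OF M_plus[OF x(1)]] V_g[OF M_V[OF x(1)]] by auto
  have "pi_plus (shift h (M x)) = Ko (B (shift h (M x)))" using M_opt[OF h x] by (simp add: T_def)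
  then show ?thesis
    using cut_interval_split[OF p(1) h] by (simp add: ext_def B_interval[OF p])
qed

definition "CN = sqrt (CJ / (2 * \<sigma>0 * c\<Gamma>)) * (KD + MK * KB)"

lemma CN: "0 \<le> CN" using CJ(1) s0 cG(1) KD(1) MK(1) KB(1) by (simp add: CN_def)

text \<open>The lower bound of \<open>M\<close> gives the output of \<open>M ?x\<close>, which by
  \<open>M_ext\<close> is the output of an optimal continuation. \<open>ext_props\<close> bounds it
  by the restriction of \<open>M ?x\<close> to \<open>[0, h)\<close>, and causality identifies that
  with the restriction of \<open>N w\<close>.\<close>

lemma N_lower_interval:
  assumes h: "0 \<le> h" and w: "w \<in> L2_plus \<beta>"
  shows "L2_norm 0 (cut {0..<h} w) \<le> CN * exp (\<gamma> * h) * L2_norm \<gamma> (cut {0..<h} (N w))"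
proof -
  let ?x = "cut {0..<h} w"
  let ?S = "KD + MK * KB" and ?n = "L2_norm \<gamma> (cut {0..<h} (N w))"
  have wb: "w \<in> L2 \<beta>" "pi_plus w = w" using w by (auto simp: L2_plus_def)
  have x: "?x \<in> L2_plus 0" "cut {0..<h} ?x = ?x" using cut_interval_L2_plus[OF wb(1)] by auto
  have c: "cut {0..<h} (M ?x) = cut {0..<h} (N w)"
    using TIC_causal_plus[OF N_TIC wb, of h] by (simp add: N_M[OF x(1)])
  have v: "cut {0..<h} (N w) \<in> L2_plus 0" by (rule cut_interval_L2_plus[OF N_D(4)[OF wb(1)]])
  have "L2_norm 0 (D (M ?x)) \<le> ?S * exp (\<gamma> * h) * ?n"
    using ext_props(4)[OF h v] M_ext[OF h x] by (simp add: c)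
  then have d: "(L2_norm 0 (D (M ?x)))\<^sup>2 \<le> (?S * exp (\<gamma> * h) * ?n)\<^sup>2" by (intro power_mono) auto
  have MV: "M ?x \<in> V" by (rule M_V[OF x(1)])
  have "2 * \<sigma>0 * c\<Gamma> * (L2_norm 0 ?x)\<^sup>2 \<le> Re (b (M ?x) (M ?x))" by (rule M_lower[OF x(1)])
  also have "\<dots> \<le> cmod (b (M ?x) (M ?x))" by (rule complex_Re_le_cmod)
  also have "\<dots> \<le> CJ * (L2_norm 0 (D (M ?x)))\<^sup>2" using b_bound[OF MV MV] by (simp add: power2_eq_square mult.assoc)
  also have "\<dots> \<le> CJ * (?S * exp (\<gamma> * h) * ?n)\<^sup>2" using d CJ(1) by (intro mult_left_mono) auto
  finally have "(L2_norm 0 ?x)\<^sup>2 \<le> CJ / (2 * \<sigma>0 * c\<Gamma>) * (?S * exp (\<gamma> * h) * ?n)\<^sup>2"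
    using s0 cG(1) by (simp add: field_simps)
  also have "\<dots> = (CN * exp (\<gamma> * h) * ?n)\<^sup>2"
    using CJ(1) s0 cG(1) by (simp add: CN_def power_mult_distrib)
  finally show ?thesis by (rule power2_le_imp_le) (use CN in simp)
qed

definition "KE = slice_const \<gamma> \<beta> (CN * exp \<gamma>)"

lemma KE: "0 \<le> KE" unfolding KE_def using b0 CN by (intro slice_const_nonneg) auto

text \<open>The factor \<open>exp (\<gamma> * h)\<close> of the interval estimate is of the form
  that \<open>L2_slices\<close> absorbs. Slice \<open>n\<close> uses \<open>h = n + 1\<close>,
  whence the factor \<open>exp \<gamma>\<close> in the constant.\<close>

lemma N_lower_plus:
  assumes w: "w \<in> L2_plus \<beta>" shows "L2_norm \<beta> w \<le> KE * L2_norm \<beta> (N w)"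
  unfolding KE_def
proof (rule L2_slices(2)[OF L2_sm[OF L2_plus_L2[OF w]] N_D(4)[OF L2_plus_L2[OF w]] b0(2)])
  have wb: "w \<in> L2 \<beta>" "pi_plus w = w" using w by (auto simp: L2_plus_def)
  have Np: "pi_plus (N w) = N w" by (rule TIC_plus[OF N_TIC wb])
  show "0 \<le> CN * exp \<gamma>" using CN by simp
  fix n :: int
  show c0: "cut {real_of_int n..<real_of_int n + 1} w \<in> L2 0" using wb by (intro L2_cut_interval)
  show "L2_norm 0 (cut {real_of_int n..<real_of_int n + 1} w)
      \<le> CN * exp \<gamma> * exp (\<gamma> * real_of_int n) * L2_norm \<gamma> (cut {..<real_of_int n + 1} (N w))"
  proof (cases "0 \<le> n")
    case True
    let ?h = "real_of_int n + 1"
    have h: "0 \<le> ?h" using True by simp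
    have "{real_of_int n..<?h} \<inter> {0..<?h} = {real_of_int n..<?h}" using True by auto
    then have "L2_norm 0 (cut {real_of_int n..<?h} w) \<le> L2_norm 0 (cut {0..<?h} w)"
      using L2_norm_cut_le[OF L2_cut_interval[OF wb(1)], of 0 "{real_of_int n..<?h}" 0 ?h] by simp
    also have "\<dots> \<le> CN * exp (\<gamma> * ?h) * L2_norm \<gamma> (cut {0..<?h} (N w))" by (rule N_lower_interval[OF h w])
    finally show ?thesis by (simp add: cut_lessThan_plus[OF Np] exp_add distrib_left mult_ac)
  next
    case False
    then have "{real_of_int n..<real_of_int n + 1} \<inter> {0..} = {}" by auto
    then have "cut {real_of_int n..<real_of_int n + 1} (pi_plus w) = 0" by simp
    then show ?thesis using wb(2) CN by (simp add: L2_norm_zero)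
  qed
qed

text \<open>A truncation to \<open>[- n, n)\<close> becomes an input on the half-line after a right
  shift. Shifts scale both sides by the same factor, and truncations approximate
  \<open>u\<close>.\<close>

lemma N_lower: assumes u: "u \<in> L2 \<beta>" shows "L2_norm \<beta> u \<le> KE * L2_norm \<beta> (N u)"
proof -
  let ?c = "\<lambda>n::nat. cut {- real n..<real n} u"
  have c: "?c n \<in> L2 \<beta>" for n using u by (rule L2_cut_interval)
  have l: "(\<lambda>n. L2_norm \<beta> (?c n - u)) \<longlonglongrightarrow> 0"
    using L2_norm_interval_tendsto[OF u] by (simp add: norm_on_commute[OF norm_on_L2 csubspace_L2 c u])
  note lN = BL_lim[OF N_D(1) csubspace_L2 norm_on_L2 norm_on_L2 c u l]
  have "(\<lambda>n. L2_norm \<beta> (?c n - u) + KE * (L2_norm \<beta> (N (?c n) - N u) + L2_norm \<beta> (N u))) \<longlonglongrightarrow> 0 + KE * (0 + L2_norm \<beta> (N u))"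
    by (intro tendsto_intros l lN)
  moreover have "L2_norm \<beta> u \<le> L2_norm \<beta> (?c n - u) + KE * (L2_norm \<beta> (N (?c n) - N u) + L2_norm \<beta> (N u))" for n
  proof -
    have s: "shift (- real n) (?c n) \<in> L2_plus \<beta>"
    proof -
      have "shift (- real n) (?c n) = cut {0..<2 * real n} (shift (- real n) u)"
        unfolding shift_cut by (rule arg_cong[where f = "\<lambda>I. cut I _"]) auto
      then show ?thesis using cut_interval_L2_plus[OF L2_shift[OF u]] by simp
    qed
    have "exp (- \<beta> * real n) * L2_norm \<beta> (?c n) \<le> exp (- \<beta> * real n) * (KE * L2_norm \<beta> (N (?c n)))"
      using N_lower_plus[OF s] c N_D(4)[OF c] by (simp add: N_D(2)[symmetric] L2_norm_shift mult_ac)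
    then have 1: "L2_norm \<beta> (?c n) \<le> KE * L2_norm \<beta> (N (?c n))" by simp
    have 2: "L2_norm \<beta> (N (?c n)) \<le> L2_norm \<beta> (N (?c n) - N u) + L2_norm \<beta> (N u)"
      using L2_norm_triangle[OF L2_diff[OF N_D(4)[OF c] N_D(4)[OF u]] N_D(4)[OF u]] by simp
    have "L2_norm \<beta> u \<le> L2_norm \<beta> (u - ?c n) + L2_norm \<beta> (?c n)"
      using L2_norm_triangle[OF L2_diff[OF u c[of n]] c[of n]] by simp
    then show ?thesis
      using 1 mult_left_mono[OF 2 KE] norm_on_commute[OF norm_on_L2 csubspace_L2 c u, of n] by linarith
  qed
  ultimately have "L2_norm \<beta> u \<le> 0 + KE * (0 + L2_norm \<beta> (N u))" by (intro LIMSEQ_le_const) auto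
  then show ?thesis by simp
qed

section \<open>Injectivity, closed range and surjectivity of \<open>N\<close>\<close>

lemma N_inj: assumes "u \<in> L2 \<beta>" "v \<in> L2 \<beta>" "N u = N v" shows "u = v"
proof -
  have d: "u - v \<in> L2 \<beta>" using assms by (intro L2_diff)
  have "L2_norm \<beta> (u - v) \<le> 0" using N_lower[OF d] assms by (simp add: N_diff L2_norm_zero)
  then show ?thesis using L2_norm_eq_0_iff[OF d] L2_norm_nonneg[of \<beta> "u - v"] by simp
qed

text \<open>A map bounded below has closed range. The domain \<open>X\<close> is left free because
  surjectivity is needed on the half-line as well as on the line.\<close>

lemma N_closed_range:
  assumes X: "csubspace X" "X \<subseteq> L2 \<beta>" "ncomplete X (L2_norm \<beta>)"
    and w: "\<And>k::nat. w k \<in> X" and u: "u \<in> L2 \<beta>" and l: "(\<lambda>k. L2_norm \<beta> (N (w k) - u)) \<longlonglongrightarrow> 0"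
  shows "\<exists>v\<in>X. N v = u"
proof -
  have wb: "w k \<in> L2 \<beta>" for k using w X(2) by blast
  obtain v where v: "v \<in> X" "(\<lambda>k. L2_norm \<beta> (w k - v)) \<longlonglongrightarrow> 0"
  proof (rule ncompleteD[OF X(3) w])
    fix e :: real assume e: "0 < e"
    then have e': "0 < e / (2 * (KE + 1))" using KE by simp
    then obtain n where n: "\<And>k. k \<ge> n \<Longrightarrow> L2_norm \<beta> (N (w k) - u) < e / (2 * (KE + 1))"
      using order_tendstoD(2)[OF l] by (auto simp: eventually_sequentially)
    have "L2_norm \<beta> (w i - w j) < e" if "n \<le> i" "n \<le> j" for i j
    proof -
      have "L2_norm \<beta> (N (w i) - N (w j)) \<le> L2_norm \<beta> (N (w i) - u) + L2_norm \<beta> (u - N (w j))"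
        by (rule norm_on_diff_triangle[OF norm_on_L2 csubspace_L2 N_D(4)[OF wb] u N_D(4)[OF wb]])
      also have "L2_norm \<beta> (u - N (w j)) = L2_norm \<beta> (N (w j) - u)"
        by (rule norm_on_commute[OF norm_on_L2 csubspace_L2 u N_D(4)[OF wb]])
      finally have "L2_norm \<beta> (N (w i) - N (w j)) \<le> 2 * (e / (2 * (KE + 1)))" using n[OF that(1)] n[OF that(2)] by linarith
      moreover have "L2_norm \<beta> (w i - w j) \<le> KE * L2_norm \<beta> (N (w i) - N (w j))"
        using N_lower[OF L2_diff[OF wb wb]] by (simp add: N_diff[OF wb wb])
      ultimately have "L2_norm \<beta> (w i - w j) \<le> KE * (2 * (e / (2 * (KE + 1))))"
        using mult_left_mono[OF _ KE] by (meson order_trans)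
      also have "\<dots> = KE * e / (KE + 1)" using KE by (simp add: field_simps)
      also have "\<dots> < e" using KE e by (simp add: pos_divide_less_eq)
      finally show ?thesis .
    qed
    then show "\<exists>n. \<forall>i\<ge>n. \<forall>j\<ge>n. L2_norm \<beta> (w i - w j) < e" by blast
  qed auto
  have vb: "v \<in> L2 \<beta>" using v X(2) by blast
  have "N v = u"
    by (rule limit_eq[OF csubspace_L2 norm_on_L2 N_D(4)[OF wb] N_D(4)[OF vb] u
      BL_lim[OF N_D(1) csubspace_L2 norm_on_L2 norm_on_L2 wb vb v(2)] l])
  then show ?thesis using v(1) by blast
qed

text \<open>A control \<open>u\<close> on \<open>[0, h)\<close> need not belong to \<open>V\<close>,
  but its optimal continuations from the times \<open>h + k\<close> do and hence are values of
  \<open>M\<close>. They differ from \<open>u\<close> by tails whose size grows like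
  \<open>exp (\<gamma> * t)\<close> while the weight decays like \<open>exp (- \<beta> * t)\<close>,
  so \<open>u\<close> lies in the closed range.\<close>

lemma N_surj_bounded_support:
  assumes u: "u \<in> L2 \<beta>" "cut {0..<h} u = u" and h: "0 \<le> h"
  shows "\<exists>v\<in>L2_plus \<beta>. N v = u"
proof -
  have u0: "u \<in> L2_plus 0" using cut_interval_L2_plus[OF u(1), of h] u(2) by simp
  have ug: "u \<in> L2 \<gamma>" by (rule L2_0_g[OF u0])
  let ?t = "\<lambda>k::nat. h + real k"
  have k: "0 \<le> ?t k" "cut {0..<?t k} u = u" for k
    using h by (auto intro: cut_fix_subset[OF u(2)])
  have eV: "ext (?t k) u \<in> V" for k by (rule ext_props(1)[OF k(1) u0 k(2)])
  have "\<exists>w. w \<in> L2_plus 0 \<and> M w = ext (?t k) u" for k using M_surj[OF eV] by blast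
  then obtain w where w: "\<And>k. w k \<in> L2_plus 0" "\<And>k. M (w k) = ext (?t k) u" by metis
  have wb: "w k \<in> L2_plus \<beta>" for k using L2_plus_0_b[OF w(1)] L2_plus_fix[OF w(1)] by (simp add: L2_plus_def)
  let ?c = "MK * KB * L2_norm \<gamma> u"
  have n: "L2_norm \<beta> (N (w k) - u) \<le> ?c * exp (- h) * exp (- 1) ^ k" for k
  proof -
    let ?x = "B (shift (?t k) u)"
    have "N (w k) - u = shift (- ?t k) (Ko ?x)" by (simp add: N_M w ext_def)
    then have "L2_norm \<beta> (N (w k) - u) = exp (- \<beta> * ?t k) * L2_norm \<beta> (Ko ?x)"
      unfolding minus_mult_commute by (simp only: L2_norm_shift[OF L2_plus_0_b[OF Ko_L2(1)]])
    also have "\<dots> \<le> exp (- \<beta> * ?t k) * (MK * (KB * (exp (\<gamma> * ?t k) * L2_norm \<gamma> u)))"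
    proof (rule mult_left_mono)
      have "L2_norm \<beta> (Ko ?x) \<le> L2_norm 0 (Ko ?x)"
        using L2_weight_plus(2)[of "Ko ?x" 0 \<beta>] L2_plus_fix[OF Ko_L2(1)] L2_plus_L2[OF Ko_L2(1)] b0 by simp
      also have "\<dots> \<le> MK * norm ?x" by (rule MK)
      also have "\<dots> \<le> MK * (KB * (exp (\<gamma> * ?t k) * L2_norm \<gamma> u))"
        using KB(2)[OF L2_shift[OF ug]] MK(1) by (intro mult_left_mono) (auto simp: L2_norm_shift[OF ug])
      finally show "L2_norm \<beta> (Ko ?x) \<le> MK * (KB * (exp (\<gamma> * ?t k) * L2_norm \<gamma> u))" .
    qed simp
    also have "\<dots> = ?c * (exp (- \<beta> * ?t k) * exp (\<gamma> * ?t k))" by simp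
    also have "exp (- \<beta> * ?t k) * exp (\<gamma> * ?t k) = exp (- h) * exp (- 1) ^ k"
      unfolding exp_add[symmetric] exp_of_nat_mult[symmetric] by (simp add: \<beta>_def algebra_simps)
    finally show ?thesis by (simp add: mult.assoc)
  qed
  have "(\<lambda>k. ?c * exp (- h) * exp (- 1) ^ k) \<longlonglongrightarrow> ?c * exp (- h) * 0"
    by (intro tendsto_intros LIMSEQ_realpow_zero) auto
  then have "(\<lambda>k. L2_norm \<beta> (N (w k) - u)) \<longlonglongrightarrow> 0"
    by (intro Lim_null_comparison[of "\<lambda>k. L2_norm \<beta> (N (w k) - u)"]) (use n in \<open>auto intro!: always_eventually\<close>)
  from N_closed_range[OF csubspace_L2_plus _ L2_plus_complete wb u(1) this] show ?thesis
    by (auto simp: L2_plus_def)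
qed

lemma N_surj_closure:
  assumes X: "csubspace X" "X \<subseteq> L2 \<beta>" "ncomplete X (L2_norm \<beta>)" and u: "u \<in> L2 \<beta>"
    and r: "\<And>n::nat. \<exists>v\<in>X. N v = cut {- real n..<real n} u"
  shows "\<exists>v\<in>X. N v = u"
proof -
  from r obtain w where w: "\<And>n. w n \<in> X" "\<And>n. N (w n) = cut {- real n..<real n} u" by metis
  have c: "cut {- real n..<real n} u \<in> L2 \<beta>" for n using u by (rule L2_cut_interval)
  show ?thesis
    by (rule N_closed_range[OF X w(1) u])
       (use L2_norm_interval_tendsto[OF u] in \<open>simp add: w norm_on_commute[OF norm_on_L2 csubspace_L2 c u]\<close>)
qed

lemma N_surj_plus: assumes u: "u \<in> L2_plus \<beta>" shows "\<exists>v\<in>L2_plus \<beta>. N v = u"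
proof (rule N_surj_closure[OF csubspace_L2_plus _ L2_plus_complete])
  have ub: "u \<in> L2 \<beta>" "pi_plus u = u" using u by (auto simp: L2_plus_def)
  show "(L2_plus \<beta> :: 'u aefun set) \<subseteq> L2 \<beta>" by (auto simp: L2_plus_def)
  show "u \<in> L2 \<beta>" by (rule ub)
  fix n :: nat
  have "{- real n..<real n} \<inter> {0..} = {0..<real n}" by auto
  then have "cut {- real n..<real n} u = cut {0..<real n} u" using cut_cut[of "{- real n..<real n}" "{0..}" u] ub(2) by simp
  then show "\<exists>v\<in>L2_plus \<beta>. N v = cut {- real n..<real n} u"
    using N_surj_bounded_support[OF L2_cut_interval[OF ub(1)], of "real n" 0 "real n"] by simp
qed

lemma N_surj: assumes u: "u \<in> L2 \<beta>" shows "\<exists>v\<in>L2 \<beta>. N v = u"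
proof (rule N_surj_closure[OF csubspace_L2 order_refl L2_complete u])
  fix n :: nat
  let ?s = "shift (- real n) (cut {- real n..<real n} u)"
  have "?s = cut {0..<2 * real n} (shift (- real n) u)"
    unfolding shift_cut by (rule arg_cong[where f = "\<lambda>I. cut I _"]) auto
  then have "?s \<in> L2_plus \<beta>" using cut_interval_L2_plus[OF L2_shift[OF u]] by simp
  then obtain v where v: "v \<in> L2 \<beta>" "N v = ?s" using N_surj_plus L2_plus_L2 by metis
  then have "N (shift (real n) v) = cut {- real n..<real n} u" using N_D(2)[OF v(1), of "real n"] by simp
  then show "\<exists>v\<in>L2 \<beta>. N v = cut {- real n..<real n} u" using L2_shift[OF v(1)] by blast
qed

section \<open>The inverse of \<open>N\<close>\<close>

definition "E = inv_into (L2 \<beta>) N"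

lemma N_E: "u \<in> L2 \<beta> \<Longrightarrow> N (E u) = u" and E_L2: "u \<in> L2 \<beta> \<Longrightarrow> E u \<in> L2 \<beta>"
proof -
  assume u: "u \<in> L2 \<beta>"
  have "u \<in> N ` L2 \<beta>" using N_surj[OF u] by blast
  then show "N (E u) = u" "E u \<in> L2 \<beta>" unfolding E_def by (rule f_inv_into_f, rule inv_into_into)
qed

lemma E_eqI: "v \<in> L2 \<beta> \<Longrightarrow> N v = u \<Longrightarrow> E u = v"
  using N_inj[OF E_L2 _ N_E] N_D(4) by blast

lemma E_N: "v \<in> L2 \<beta> \<Longrightarrow> E (N v) = v" by (rule E_eqI) auto

text \<open>Causality of the inverse. A causal bijection can have an anticausal inverse, as a right
  shift does; surjectivity of \<open>N\<close> on the half-line excludes this.\<close>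

lemma E_plus: "u \<in> L2_plus \<beta> \<Longrightarrow> E u \<in> L2_plus \<beta>"
  using N_surj_plus E_eqI L2_plus_L2 by metis

lemma E_TIC: "E \<in> TIC \<beta>"
  unfolding TIC_def
proof (intro CollectI conjI allI ballI BL_I[where M = KE])
  fix u v :: "'u aefun" assume u: "u \<in> L2 \<beta>"
  note Eu = E_L2[OF u] N_E[OF u]
  show "E u \<in> L2 \<beta>" by (rule Eu)
  show "E (u + v) = E u + E v" if v: "v \<in> L2 \<beta>"
    by (rule E_eqI) (use Eu E_L2[OF v] N_E[OF v] in \<open>simp_all add: L2_add N_add\<close>)
  show "E (a *\<^sub>C u) = a *\<^sub>C E u" for a
    by (rule E_eqI) (use Eu BL_D(3)[OF N_D(1)] in \<open>simp_all add: L2_scaleC\<close>)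
  show "L2_norm \<beta> (E u) \<le> KE * L2_norm \<beta> u" using N_lower[OF Eu(1)] Eu(2) by simp
  show "shift t (E u) = E (shift t u)" for t
    by (rule E_eqI[symmetric]) (use Eu N_D(2)[OF Eu(1), of t] in \<open>simp_all add: L2_shift\<close>)
  have "pi_plus (E (pi_plus u)) = E (pi_plus u)" by (rule L2_plus_fix[OF E_plus[OF pi_plus_L2_plus[OF u]]])
  moreover have "{..<0} \<inter> {0..} = ({} :: real set)" by auto
  ultimately show "pi_minus (E (pi_plus u)) = 0" using cut_cut[of "{..<0}" "{0..}" "E (pi_plus u)"] by simp
qed

end

text \<open>The larger weight controls the past and the smaller one the future.\<close>

lemma L2_intermediate:
  fixes u :: "'a::chilbert_space aefun"
  assumes "u \<in> L2 \<omega>" "u \<in> L2 \<beta>" "\<omega> \<le> \<gamma>" "\<gamma> \<le> \<beta>" shows "u \<in> L2 \<gamma>"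
proof -
  have "pi_minus u \<in> L2 \<gamma>" using L2_weight_minus(1)[of "pi_minus u" \<gamma> \<beta>] assms by (simp add: L2_cut)
  moreover have "pi_plus u \<in> L2 \<gamma>" using L2_weight_plus(1)[of "pi_plus u" \<omega> \<gamma>] assms by (simp add: L2_cut)
  ultimately show ?thesis using L2_add[of "pi_minus u" \<gamma> "pi_plus u"] by (simp add: pi_split)
qed

context optimal_control_problem
begin

subsection \<open>The feedback pair\<close>

lemma pi_minus_g: "u \<in> L2 \<beta> \<Longrightarrow> pi_minus u \<in> L2 \<gamma> \<and> L2_norm \<gamma> (pi_minus u) \<le> L2_norm \<beta> u"
  for u :: "'a::chilbert_space aefun"
  using L2_weight_minus[of "pi_minus u" \<gamma> \<beta>] L2_norm_cut_le[of u \<beta> "{..<0}"] b0 by (simp add: L2_cut)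

lemma B_pi_minus_BL: "(\<lambda>u. B (pi_minus u)) \<in> BL (L2 \<beta>) (L2_norm \<beta>) UNIV norm"
proof (rule BL_I[where M = KB])
  fix u v :: "'u aefun" and a assume u: "u \<in> L2 \<beta>"
  note m = pi_minus_g[OF u, THEN conjunct1]
  show "B (pi_minus (u + v)) = B (pi_minus u) + B (pi_minus v)" if v: "v \<in> L2 \<beta>"
    using m pi_minus_g[OF v] by (simp add: cut_add B_add)
  show "B (pi_minus (a *\<^sub>C u)) = a *\<^sub>C B (pi_minus u)" using m by (simp add: cut_scaleC B_scale)
  show "norm (B (pi_minus u)) \<le> KB * L2_norm \<beta> u"
    using KB(2)[OF m] mult_left_mono[OF pi_minus_g[OF u, THEN conjunct2], of KB] KB(1) by linarith
qed simp

lemma Ko_BL: "Ko \<in> BL UNIV norm (L2 \<beta>) (L2_norm \<beta>)"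
proof (rule BL_I[where M = MK])
  fix x
  show "Ko x \<in> L2 \<beta>" by (rule L2_plus_0_b[OF Ko_L2(1)])
  show "L2_norm \<beta> (Ko x) \<le> MK * norm x"
    using L2_weight_plus(2)[of "Ko x" 0 \<beta>] L2_plus_fix[OF Ko_L2(1)] L2_plus_L2[OF Ko_L2(1)] b0 MK(2)[of x] by simp
qed (simp_all add: Ko_add Ko_scale)

lemma Ko_b: "Ko x \<in> L2_plus \<beta>"
  using L2_plus_0_b[OF Ko_L2(1)] L2_plus_fix[OF Ko_L2(1)] by (simp add: L2_plus_def)

text \<open>After the input to \<open>N\<close> has ended, its output is the optimal control for the state reached.\<close>

lemma N_past:
  assumes w: "w \<in> L2 \<beta>" shows "pi_plus (N (pi_minus w)) = Ko (B (pi_minus (N (pi_minus w))))"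
proof -
  have 1: "(\<lambda>w. N (pi_minus w)) \<in> BL (L2 \<beta>) (L2_norm \<beta>) (L2 \<beta>) (L2_norm \<beta>)"
    by (rule BL_comp[OF N_D(1) BL_cut norm_on_L2]) simp
  have 2: "(\<lambda>w. pi_plus (N (pi_minus w))) \<in> BL (L2 \<beta>) (L2_norm \<beta>) (L2 \<beta>) (L2_norm \<beta>)"
    by (rule BL_comp[OF BL_cut 1 norm_on_L2]) simp
  have 3: "(\<lambda>w. Ko (B (pi_minus (N (pi_minus w))))) \<in> BL (L2 \<beta>) (L2_norm \<beta>) (L2 \<beta>) (L2_norm \<beta>)"
    by (rule BL_comp[OF Ko_BL BL_comp[OF B_pi_minus_BL 1 norm_on_L2] norm_on_UNIV])
  show ?thesis
  proof (rule BL_L2_eqI[OF 2 3 norm_on_L2 csubspace_L2 _ w])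
    fix n :: nat
    \<comment> \<open>An input on \<open>[- n, 0)\<close> moved to \<open>[0, n)\<close>, where
      \<open>M_opt\<close> applies with \<open>h = n\<close>.\<close>
    let ?w = "pi_minus (cut {- real n..<real n} w)"
    let ?x = "shift (- real n) ?w"
    have "?x = cut {0..<real n} (shift (- real n) w)"
      by (simp add: shift_cut) (rule arg_cong[where f = "\<lambda>I. cut I _"], auto)
    then have x: "?x \<in> L2_plus 0" "cut {0..<real n} ?x = ?x"
      using cut_interval_L2_plus[OF L2_shift[OF w]] by simp_all
    have s: "shift (real n) (M ?x) = N ?w"
      using N_D(2)[OF L2_plus_0_b[OF x(1)], of "real n", unfolded N_M[OF x(1)]] by simp
    have "N ?w \<in> L2 \<gamma>" unfolding s[symmetric] by (rule L2_shift[OF V_g[OF M_V[OF x(1)]]])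
    then have B: "B (N ?w) = B (pi_minus (N ?w))" using wpls_B_pi_minus[OF sysC] by simp
    have "T (real n) (M ?x) = 0" by (rule M_opt[OF _ x]) simp
    then show "pi_plus (N ?w) = Ko (B (pi_minus (N ?w)))" unfolding T_def s B by simp
  qed
qed

lemma N_split:
  assumes w: "w \<in> L2 \<beta>" shows "pi_plus (N w) = Ko (B (pi_minus (N w))) + N (pi_plus w)"
proof -
  have m: "pi_minus w \<in> L2 \<beta>" "pi_plus w \<in> L2 \<beta>" using w by (simp_all add: L2_cut)
  have "pi_plus (N w) = pi_plus (N (pi_minus w)) + pi_plus (N (pi_plus w))"
    using N_add[OF m] by (simp add: pi_split cut_add[symmetric])
  also have "pi_plus (N (pi_plus w)) = N (pi_plus w)" by (rule TIC_plus[OF N_TIC m(2)]) simp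
  finally show ?thesis using N_past[OF w] TIC_pi_minus[OF N_TIC w] by simp
qed

definition K :: "'h \<Rightarrow> 'u aefun" where "K x = E (Ko x)"
definition F :: "'u aefun \<Rightarrow> 'u aefun" where "F u = u - E u"

lemma E_minus: "u \<in> L2 \<beta> \<Longrightarrow> E (- u) = - E u"
  using TIC_diff[OF E_TIC L2_0_zero, of u] BL_zero[OF TIC_D(1)[OF E_TIC] csubspace_L2] by simp

lemma F_TIC: "F \<in> TIC \<beta>"
proof -
  have "{..<0} \<inter> {0..} = ({} :: real set)" by auto
  then show ?thesis
    unfolding TIC_def F_def
    using BL_minus[OF BL_id TIC_D(1)[OF E_TIC] norm_on_L2 csubspace_L2] TIC_D(2,3)[OF E_TIC]
    by (auto simp: shift_diff cut_diff)
qed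

text \<open>The two axioms for \<open>K\<close> and \<open>F\<close> are checked after applying the
  injective map \<open>N\<close>. Both are instances of \<open>N_split\<close>: for
  \<open>shift t (K x)\<close> it gives the intertwining of \<open>K\<close> with the semigroup, for
  \<open>E (pi_minus u)\<close> the relation between \<open>F\<close> and \<open>K\<close>.\<close>

lemma wpls_feedback: "wpls \<beta> A (\<lambda>u. B (pi_minus u)) K F"
proof -
  obtain D' where D': "D' \<in> TIC \<beta>" "\<And>u. u \<in> L2 \<gamma> \<Longrightarrow> u \<in> L2 \<beta> \<Longrightarrow> D' u = D u"
    using TIC_reweight[OF WC(7) b0(2)] by blast
  have W: "wpls \<beta> A (\<lambda>u. B (pi_minus u)) C D'" by (rule wpls_reweight[OF sysC b0(2) refl D'])
  note WD = wplsD[OF W]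
  have KA: "K (A t x) = pi_plus (shift t (K x))" if t: "0 \<le> t" for t x
  proof -
    have Kx: "K x \<in> L2 \<beta>" "N (K x) = Ko x" unfolding K_def using E_L2 N_E L2_plus_0_b[OF Ko_L2(1)] by auto
    have s: "shift t (K x) \<in> L2 \<beta>" by (rule L2_shift[OF Kx(1)])
    have Ns: "N (shift t (K x)) = shift t (Ko x)" using N_D(2)[OF Kx(1), of t] Kx(2) by simp
    have "B (pi_minus (shift t (Ko x))) = B (shift t (Ko x))"
      by (rule wpls_B_pi_minus[OF sysC L2_shift[OF Ko_L2(4)]])
    then have "Ko (A t x) + Ko (B (shift t (Ko x))) = Ko (B (shift t (Ko x))) + N (pi_plus (shift t (K x)))"
      using N_split[OF s] Ko_shift[OF t, of x] by (simp add: Ns Ko_add)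
    then have "N (pi_plus (shift t (K x))) = Ko (A t x)" by simp
    then show ?thesis unfolding K_def by (intro E_eqI) (use s in \<open>simp_all add: L2_cut K_def\<close>)
  qed
  have KB: "pi_plus (F (pi_minus u)) = K (B (pi_minus u))" if u: "u \<in> L2 \<beta>" for u
  proof -
    let ?m = "pi_minus u"
    have m: "?m \<in> L2 \<beta>" using u by (simp add: L2_cut)
    have i: "{0..} \<inter> {..<0} = ({} :: real set)" by auto
    then have z: "pi_plus ?m = 0" by simp
    have e: "E ?m \<in> L2 \<beta>" "N (E ?m) = ?m" using E_L2[OF m] N_E[OF m] by auto
    \<comment> \<open>The left-hand side is the future part of \<open>N (E ?m) = ?m\<close>, which
      is supported in the past.\<close>
    have "0 = Ko (B ?m) + N (pi_plus (E ?m))" using N_split[OF e(1)] by (simp add: e(2) i)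
    then have "N (pi_plus (E ?m)) = - Ko (B ?m)" by (simp add: eq_neg_iff_add_eq_0 add.commute)
    then have "E (- Ko (B ?m)) = pi_plus (E ?m)" using e(1) by (intro E_eqI) (simp_all add: L2_cut)
    then have "pi_plus (E ?m) = - K (B ?m)" by (simp add: E_minus K_def L2_plus_0_b[OF Ko_L2(1)])
    then show ?thesis by (simp add: F_def cut_diff i)
  qed
  have "K \<in> BL UNIV norm (L2 \<beta>) (L2_norm \<beta>)"
    unfolding K_def by (rule BL_comp[OF TIC_D(1)[OF E_TIC] Ko_BL norm_on_L2])
  then show ?thesis unfolding wpls_def using WD(1-4) KA KB F_TIC by auto
qed

section \<open>The closed loop and the cost\<close>

lemma TIC_inverse_feedback: "TIC_inverse \<beta> (\<lambda>u. u - F u) \<beta> N"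
  unfolding TIC_inverse_def identified_def F_def
  using N_TIC E_TIC E_N N_E by (auto intro!: bexI[of _ E])

text \<open>The definition selects some inverse \<open>G\<close> at some weight, about which nothing
  else is known. It is compared with \<open>N\<close> on truncated inputs: there \<open>E\<close>
  and its representative \<open>E'\<close> agree, and causality transfers the equality to each
  interval \<open>[0, t)\<close>.\<close>

lemma closed_loop: "closed_loop_control \<beta> K F x = Ko x"
proof -
  define G where "G = (SOME G. \<exists>\<gamma>. TIC_inverse \<beta> (\<lambda>u. u - F u) \<gamma> G)"
  have "\<exists>\<gamma>. TIC_inverse \<beta> (\<lambda>u. u - F u) \<gamma> G"
    unfolding G_def using TIC_inverse_feedback by (rule someI2[where P = "\<lambda>G. \<exists>\<gamma>. TIC_inverse \<beta> (\<lambda>u. u - F u) \<gamma> G", OF exI])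
  then obtain \<gamma>' E' where G: "G \<in> TIC \<gamma>'" "E' \<in> TIC \<gamma>'" "\<And>u. u \<in> L2 \<beta> \<Longrightarrow> u \<in> L2 \<gamma>' \<Longrightarrow> E u = E' u"
    "\<And>u. u \<in> L2 \<gamma>' \<Longrightarrow> E' (G u) = u"
    unfolding TIC_inverse_def identified_def F_def by auto
  have Kx: "K x \<in> L2 \<beta>" "pi_plus (K x) = K x" "N (K x) = Ko x"
    using E_plus[OF Ko_b] N_E[OF L2_plus_L2[OF Ko_b]] by (simp_all add: K_def L2_plus_def)
  show ?thesis unfolding closed_loop_control_def G_def[symmetric]
  proof (rule causal_ext_eqI)
    show "pi_plus (Ko x) = Ko x" by (rule L2_plus_fix[OF Ko_L2(1)])
    fix t :: real
    let ?k = "cut {0..<t} (K x)"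
    let ?g = "cut {0..<t} (G ?k)"
    have k: "?k \<in> L2_plus \<gamma>'" "?k \<in> L2 \<beta>" using cut_interval_L2_plus[OF Kx(1)] L2_cut_interval[OF Kx(1)] by auto
    have kg: "?k \<in> L2 \<gamma>'" "pi_plus ?k = ?k" using k(1) by (simp_all add: L2_plus_def)
    have g: "G ?k \<in> L2 \<gamma>'" "pi_plus (G ?k) = G ?k" using TIC_D(4)[OF G(1) kg(1)] TIC_plus[OF G(1) kg] by auto
    \<comment> \<open>The output of \<open>G\<close> is truncated again, since only then does it lie
      in both weighted spaces, where \<open>E\<close> and \<open>E'\<close> coincide.\<close>
    have gb: "?g \<in> L2_plus \<beta>" "?g \<in> L2 \<gamma>'" using cut_interval_L2_plus[OF g(1)] L2_cut_interval[OF g(1)] by auto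
    have gb': "?g \<in> L2 \<beta>" by (rule L2_plus_L2[OF gb(1)])
    have Eg: "E ?g \<in> L2 \<beta>" "pi_plus (E ?g) = E ?g" using E_plus[OF gb(1)] by (simp_all add: L2_plus_def)
    have "cut {0..<t} (E ?g) = cut {0..<t} (E' (G ?k))"
      using TIC_causal_plus[OF G(2) g, of t] G(3)[OF gb' gb(2)] by simp
    then have e: "cut {0..<t} (E ?g) = ?k" using G(4)[OF kg(1)] by simp
    have "cut {0..<t} (Ko x) = cut {0..<t} (N ?k)" using TIC_causal_plus[OF N_TIC Kx(1,2), of t] Kx(3) by simp
    also have "\<dots> = cut {0..<t} (N (E ?g))" using TIC_causal_plus[OF N_TIC Eg, of t] e by simp
    also have "\<dots> = ?g" using N_E[OF gb'] by simp
    finally show "cut {0..<t} (Ko x) = cut {0..<t} (G ?k)" .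
  qed
qed

text \<open>The first-order terms vanish by optimality and symmetry of \<open>J\<close>, so the
  difference is \<open>Re (b \<eta> \<eta>)\<close>. This is quadratic in the norm, which gives a
  vanishing derivative.\<close>

lemma cost_difference:
  assumes \<eta>: "\<eta> \<in> V"
  shows "\<bar>Re (L2_inner (C x + D (Ko x + \<eta>)) (MJ (C x + D (Ko x + \<eta>)))) - Re (L2_inner (C x + D (Ko x)) (MJ (C x + D (Ko x))))\<bar>
    \<le> CJ * (nV \<eta>)\<^sup>2"
proof -
  let ?y = "Co x" and ?d = "D \<eta>"
  have d: "?d \<in> L2 0" "?y \<in> L2 0" "?y + ?d \<in> L2 0" using V_D[OF \<eta>] Ko_L2(2) by (auto intro: L2_add)
  have e: "C x + D (Ko x + \<eta>) = ?y + ?d" by (simp add: Co_def D_add[OF Ko_L2(4) V_g[OF \<eta>]] add.assoc)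
  have z: "L2_inner ?d (MJ ?y) = 0" by (rule opt_Co[OF \<eta>])
  then have z': "L2_inner ?y (MJ ?d) = 0" using L2_inner_commute[of "MJ ?y" ?d] by (simp add: L2_inner_MJ)
  have "L2_inner (?y + ?d) (MJ (?y + ?d)) = L2_inner ?y (MJ ?y) + b \<eta> \<eta>"
    unfolding MJ_add b_def using d by (simp add: L2_inner_add_left L2_inner_add_right MJ_L2 L2_add z z')
  then have "\<bar>Re (L2_inner (?y + ?d) (MJ (?y + ?d))) - Re (L2_inner ?y (MJ ?y))\<bar> \<le> cmod (b \<eta> \<eta>)"
    by (simp add: abs_Re_le_cmod)
  also have "\<dots> \<le> CJ * (nV \<eta>)\<^sup>2" using b.bound[OF \<eta> \<eta>] by (simp add: power2_eq_square mult.assoc)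
  finally show ?thesis unfolding e by (simp add: Co_def)
qed

end

section \<open>Passage to a common weight and back\<close>

theorem theorem5p1:
  fixes \<theta> \<omega> :: real
    and A :: "real \<Rightarrow> 'h::chilbert_space \<Rightarrow> 'h"
    and B :: "'u::chilbert_space aefun \<Rightarrow> 'h"
    and C :: "'h \<Rightarrow> 'y::chilbert_space aefun"
    and D :: "'u aefun \<Rightarrow> 'y aefun"
    and Q :: "'h \<Rightarrow> 'z::chilbert_space aefun"
    and R :: "'u aefun \<Rightarrow> 'z aefun"
    and Zu :: "'z aefun topology"
    and Zs :: "'z aefun set"
    and ns :: "'z aefun \<Rightarrow> real"
    and J :: "'y \<Rightarrow> 'y"
  assumes "wpls \<omega> A B C D"
    and "J \<in> BL UNIV norm UNIV norm"
    and "\<forall>x y. cinner (J x) y = cinner x (J y)"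
    and "optimization_data \<omega> A B Q R Zu Zs ns"
    and "\<theta> = 0"
    and "\<exists>\<epsilon>>0. \<forall>u \<in> U_star \<theta> C D Q R Zs 0.
           Re (popov_form D J u u) \<ge> \<epsilon> * (U_star_norm \<theta> D R ns u)\<^sup>2"
  shows "(\<forall>x. U_star \<theta> C D Q R Zs x \<noteq> {}) \<longleftrightarrow>
    (\<exists>\<beta> K F. J_optimal_feedback \<theta> \<omega> A B C D Q R Zs ns J \<beta> K F)"
proof
  assume "\<exists>\<beta> K F. J_optimal_feedback \<theta> \<omega> A B C D Q R Zs ns J \<beta> K F"
  then show "\<forall>x. U_star \<theta> C D Q R Zs x \<noteq> {}"
    by (auto simp: J_optimal_feedback_def J_optimal_def)
next
  assume fcc: "\<forall>x. U_star \<theta> C D Q R Zs x \<noteq> {}"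
  note O = assms(4)[unfolded optimization_data_def]
  from O obtain \<alpha> B' where B': "identified \<omega> \<alpha> B B'" and W': "wpls \<alpha> A B' Q R" by blast
  obtain \<epsilon> where \<epsilon>: "0 < \<epsilon>" "\<And>u. u \<in> U_star 0 C D Q R Zs 0 \<Longrightarrow> \<epsilon> * (U_star_norm 0 D R ns u)\<^sup>2 \<le> Re (popov_form D J u u)"
    using assms(5,6) by blast
  \<comment> \<open>Strictly above zero and above the weights of both systems, as the reweighting
    lemmas require.\<close>
  define \<gamma> where "\<gamma> = max 0 (max \<omega> \<alpha>) + 1"
  have g: "0 < \<gamma>" "\<omega> < \<gamma>" "\<alpha> < \<gamma>" by (auto simp: \<gamma>_def)
  obtain D1 where D1: "D1 \<in> TIC \<gamma>" "\<And>u. u \<in> L2 \<omega> \<Longrightarrow> u \<in> L2 \<gamma> \<Longrightarrow> D1 u = D u"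
    using TIC_reweight[OF wplsD(7)[OF assms(1)] g(2)] by blast
  obtain R1 where R1: "R1 \<in> TIC \<gamma>" "\<And>u. u \<in> L2 \<alpha> \<Longrightarrow> u \<in> L2 \<gamma> \<Longrightarrow> R1 u = R u"
    using TIC_reweight[OF wplsD(7)[OF W'] g(3)] by blast
  \<comment> \<open>One input map for both systems: \<open>B\<close> and \<open>B'\<close> are
    identified on the common domain of their weights, which contains the past of every
    \<open>u\<close> in \<open>L2 \<gamma>\<close>.\<close>
  define B1 where "B1 u = B (pi_minus u)" for u
  have B1': "B1 u = B' (pi_minus u)" if u: "u \<in> L2 \<gamma>" for u
  proof -
    have "pi_minus u \<in> L2 \<omega>" "pi_minus u \<in> L2 \<alpha>"
      using L2_weight_minus(1)[of "pi_minus u" _ \<gamma>] g u by (auto simp: L2_cut)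
    then show ?thesis using B' by (simp add: B1_def identified_def)
  qed
  have sysC: "wpls \<gamma> A B1 C D1" by (rule wpls_reweight[OF assms(1) g(2) B1_def D1])
  have sysQ: "wpls \<gamma> A B1 Q R1" by (rule wpls_reweight[OF W' g(3) B1' R1])
  have plus_g: "u \<in> L2_plus \<gamma>" if "u \<in> L2_plus 0" for u :: "'u aefun"
    using that L2_weight_plus(1)[of u 0 \<gamma>] g by (simp add: L2_plus_def)
  have cD: "causal_ext D u = D1 u" if "u \<in> L2_plus 0" for u by (rule causal_ext_TIC[OF D1 plus_g[OF that]])
  have cR: "causal_ext R u = R1 u" if "u \<in> L2_plus 0" for u by (rule causal_ext_TIC[OF R1 plus_g[OF that]])
  have U0: "u \<in> L2_plus 0" if "u \<in> U_star 0 C D Q R Zs x" for u x using that by (simp add: U_star_def)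
  define nV where "nV u = Max {L2_norm 0 u, L2_norm 0 (D1 u), ns (R1 u)}" for u
  have nV: "U_star_norm 0 D R ns u = nV u" if "u \<in> L2_plus 0" for u
    using cD[OF that] cR[OF that] by (simp add: U_star_norm_def nV_def)
  interpret P: optimal_control_problem J \<gamma> A B1 C D1 Q R1 Zu Zs ns "\<lambda>x u. u \<in> U_star 0 C D Q R Zs x" nV \<epsilon>
  proof
    show "J \<in> BL UNIV norm UNIV norm" "cinner (J x) y = cinner x (J y)" for x y using assms(2,3) by auto
    show "topological_vector_space Zu" "Zs \<subseteq> topspace Zu" "continuous_map (norm_topology Zs ns) Zu (\<lambda>z. z)"
      "continuous_map euclidean Zu Q" using O by auto
    show "csubspace Zs" "norm_on Zs ns" "ncomplete Zs ns" using O banach_space_on_ncomplete[of Zs ns] by auto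
    show "continuous_map (norm_topology (L2_plus 0) (L2_norm 0)) Zu R1"
    proof (rule continuous_map_eq)
      show "continuous_map (norm_topology (L2_plus 0) (L2_norm 0)) Zu (causal_ext R)" using O by blast
      interpret Metric_space "L2_plus 0 :: 'u aefun set" "norm_dist (L2_plus 0) (L2_norm 0)"
        by (rule norm_dist_metric[OF csubspace_L2_plus norm_on_L2_plus])
      show "causal_ext R u = R1 u" if "u \<in> topspace (norm_topology (L2_plus 0) (L2_norm 0))" for u
        using that cR by (simp add: norm_topology_def)
    qed
    show "pi_plus (shift t z) \<in> Zs \<longleftrightarrow> z \<in> Zs" if "z \<in> topspace Zu" "0 < t" for z t using O that by blast
    show "u \<in> U_star 0 C D Q R Zs x \<longleftrightarrow> u \<in> L2_plus 0 \<and> C x + D1 u \<in> L2 0 \<and> Q x + R1 u \<in> Zs" for x u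
      unfolding U_star_def using cD[of u] cR[of u] by auto
    show "\<epsilon> * (nV u)\<^sup>2 \<le> Re (L2_inner (D1 u) (map_aefun J (D1 u)))" if u: "u \<in> U_star 0 C D Q R Zs 0" for u
      using \<epsilon>(2)[OF u] nV[OF U0[OF u]] cD[OF U0[OF u]] by (simp add: popov_form_def)
    show "\<exists>u. u \<in> U_star 0 C D Q R Zs x" for x using fcc assms(5) by blast
  qed (use g \<epsilon> sysC sysQ nV_def in auto)
  obtain D2 where D2: "D2 \<in> TIC P.\<beta>" "\<And>u. u \<in> L2 \<gamma> \<Longrightarrow> u \<in> L2 P.\<beta> \<Longrightarrow> D2 u = D1 u"
    using TIC_reweight[OF D1(1) P.b0(2)] by blast
  have "wpls P.\<beta> A (\<lambda>u. B1 (pi_minus u)) (\<lambda>x. pair_aefun (C x) (P.K x)) (\<lambda>u. pair_aefun (D2 u) (P.F u))"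
    by (rule wpls_pair[OF wpls_reweight[OF sysC P.b0(2) refl D2] P.wpls_feedback])
  moreover have "identified \<omega> P.\<beta> B (\<lambda>u. B1 (pi_minus u))"
    by (simp add: identified_def B1_def wpls_B_pi_minus[OF assms(1)])
  moreover have "identified \<omega> P.\<beta> D D2"
    unfolding identified_def
  proof (intro ballI, elim IntE)
    fix u :: "'u aefun" assume u: "u \<in> L2 \<omega>" "u \<in> L2 P.\<beta>"
    \<comment> \<open>\<open>D2\<close> is linked to \<open>D\<close> only through
      \<open>D1\<close>, so the agreement must pass through the intermediate weight.\<close>
    have "u \<in> L2 \<gamma>" using L2_intermediate[OF u] g P.b0 by simp
    then show "D u = D2 u" using D1(2) D2(2) u by simp
  qed
  ultimately have "admissible_feedback \<omega> A B C D P.\<beta> P.K P.F"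
    unfolding admissible_feedback_def using P.TIC_inverse_feedback by blast
  moreover have "J_optimal 0 C D Q R Zs ns J x (P.Ko x)" for x
    unfolding J_optimal_def
  proof (intro conjI allI impI)
    show "P.Ko x \<in> U_star 0 C D Q R Zs x" by (rule P.Ko_adm)
    fix e :: real assume e: "0 < e"
    show "\<exists>d>0. \<forall>\<eta>\<in>U_star 0 C D Q R Zs 0. U_star_norm 0 D R ns \<eta> < d \<longrightarrow>
        \<bar>cost C D J x (P.Ko x + \<eta>) - cost C D J x (P.Ko x)\<bar> \<le> e * U_star_norm 0 D R ns \<eta>"
    \<comment> \<open>The radius at which the quadratic bound of \<open>cost_difference\<close>
      falls below the required linear one.\<close>
    proof (intro exI[of _ "e / P.CJ"] conjI ballI impI)
      show "0 < e / P.CJ" using e P.CJ(1) by simp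
      fix \<eta> assume \<eta>: "\<eta> \<in> U_star 0 C D Q R Zs 0" and d: "U_star_norm 0 D R ns \<eta> < e / P.CJ"
      have \<eta>0: "\<eta> \<in> L2_plus 0" "P.Ko x + \<eta> \<in> L2_plus 0"
        using U0[OF \<eta>] P.Ko_L2(1) by (auto intro: csubspaceD(2)[OF csubspace_L2_plus])
      have "\<bar>cost C D J x (P.Ko x + \<eta>) - cost C D J x (P.Ko x)\<bar> \<le> P.CJ * (nV \<eta>)\<^sup>2"
        using P.cost_difference[of \<eta> x] \<eta> by (simp add: cost_def cD[OF \<eta>0(2)] cD[OF P.Ko_L2(1)])
      also have "\<dots> = nV \<eta> * P.CJ * nV \<eta>" by (simp add: power2_eq_square mult_ac)
      also have "\<dots> \<le> e * nV \<eta>"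
      proof (rule mult_right_mono)
        show "nV \<eta> * P.CJ \<le> e" using d P.CJ(1) by (simp add: nV[OF \<eta>0(1)] pos_less_divide_eq)
        show "0 \<le> nV \<eta>" by (rule P.nV_nonneg)
      qed
      finally show "\<bar>cost C D J x (P.Ko x + \<eta>) - cost C D J x (P.Ko x)\<bar> \<le> e * U_star_norm 0 D R ns \<eta>"
        by (simp add: nV[OF \<eta>0(1)])
    qed
  qed
  ultimately have "J_optimal_feedback 0 \<omega> A B C D Q R Zs ns J P.\<beta> P.K P.F"
    unfolding J_optimal_feedback_def by (simp add: P.closed_loop)
  then show "\<exists>\<beta> K F. J_optimal_feedback \<theta> \<omega> A B C D Q R Zs ns J \<beta> K F" using assms(5) by blast
qed

end
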